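(* Let $Q(x,y)=ax^2+bxy+cy^2$ be a real positive definite binary quadratic form with discriminant $d=b^2-4ac$, and let $Q^{-1}(x,y)=cx^2-bxy+ay^2$. Let $\phi_1(s)=\sum_{n\ge1}a_1(n)\lambda_n^{-s}$ and $\phi_2(s)=\sum_{n\ge1}a_2(n)\lambda_n'^{-s}$ be two Dirichlet series belonging to the class $\mathcal B$ with the same parity $\delta\in\{0,1\}$ (see context), with dual series $\psi_1(s)=\sum_{n\ge1}b_1(n)\mu_n^{-s}$ and $\psi_2(s)=\sum_{n\ge1}b_2(n)\mu_n'^{-s}$. Then the non-diagonal Epstein zeta function $\mathcal Z_2(s;Q;a_1,a_2;\lambda,\lambda')$ can be continued to the entire complex plane as: 1. a meromorphic function with a simple pole located at $s=1$ with residue $\frac{2\pi\rho_1\rho_2}{\sqrt{|d|}}$, if $a_1(n)$ and $a_2(n)$ are even arithmetical functions ($\delta=0$) and $\rho_1,\rho_2$ respectively denote the residues of $\phi_1,\phi_2$ at $s=1$; in particular, if at least one of the Dirichlet series $\phi_i$ is entire, then $\mathcal Z_2$ is entire; 2. an entire function, if $a_1(n)$ and $a_2(n)$ are odd arithmetical functions ($\delta=1$). Thus $\mathcal Z_2(s;Q;a_1,a_2;\lambda,\lambda')$ is a Dirichlet series belonging to the class $\mathcal A$ and satisfying Hecke's functional equation $$\left(\frac{2}{\sqrt{|d|}}\right)^{-s}\Gamma(s)\,\mathcal Z_2(s;Q;a_1,a_2;\lambda,\lambda')=(-1)^\delta\left(\frac{2}{\sqrt{|d|}}\right)^{s-1}\Gamma(1-s)\,\mathcal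 Z_2(1-s;Q^{-1};b_1,b_2;\mu,\mu').$$
   Context: Pairs with gamma factor $\Delta$ and parameter $r>0$: $(\lambda_n)_{n\ge1}$, $(\mu_n)_{n\ge1}$ are sequences of positive numbers strictly increasing to $\infty$; $(a(n))_{n\ge1}$, $(b(n))_{n\ge1}$ are complex sequences, not identically zero; $\phi(s)=\sum_{n\ge1}a(n)\lambda_n^{-s}$ and $\psi(s)=\sum_{n\ge1}b(n)\mu_n^{-s}$ have finite abscissas of absolute convergence $\sigma_a$, $\sigma_b$; and there is a meromorphic function $\chi$ on $\mathbb C$ such that (1) $\chi(s)=\Delta(s)\phi(s)$ for $\mathrm{Re}(s)>\sigma_a$ and $\chi(s)=\Delta(r-s)\psi(r-s)$ for $\mathrm{Re}(s)<r-\sigma_b$; (2) $\lim_{|\mathrm{Im}(s)|\to\infty}\chi(s)=0$ uniformly in every strip $\sigma_1\le\mathrm{Re}(s)\le\sigma_2$; (3) the singularities of $\chi$ are at most poles and are confined to some compact set. With $\Delta(s)=\Gamma(s)$ this is a Hecke pair with parameter $r$; with $\Delta(s)=\Gamma\left(\frac{s+\delta}2\right)$, $\delta\in\{0,1\}$, and $r=1$ it is a Bochner pair of parity $\delta$. Class $\mathcal A$: $\phi$ belongs to $\mathcal A$ if $(\phi,\psi)$ is a Hecke pair with some parameter $r$; $\phi$ and $\psi$ continue analytically to $\mathbb C$ except for possible simple poles at $s=r$; and the coefficients are extended to $n=0$ by $a(0):=-\phi(0)$, $b(0):=-\psi(0)$. Class $\mathcal B$: $\phi$ belongs to $\mathcal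 B$ (with parity $\delta$ and dual series $\psi$) if $(\phi,\psi)$ is a Bochner pair of parity $\delta$ and: for $\delta=0$, $\phi$ and $\psi$ continue analytically to $\mathbb C$ except for possible simple poles at $s=1$ with residues $\rho$ and $\rho^\star$ respectively (residue $0$ if there is no pole); for $\delta=1$, $\phi$ and $\psi$ continue to entire functions. The sequences are extended to $\mathbb Z$ by $a(0):=-2\phi(-\delta)$, $b(0):=-2\psi(-\delta)$, $a(-n)=(-1)^\delta a(n)$, $b(-n)=(-1)^\delta b(n)$, $\lambda_0=\mu_0=0$, $\lambda_{-n}=-\lambda_n$, $\mu_{-n}=-\mu_n$. Non-diagonal Epstein zeta function: for $\mathrm{Re}(s)>\max\{\sigma_{a_1},\sigma_{a_2}\}$ (abscissas of absolute convergence of $\phi_1,\phi_2$), $$\mathcal Z_2(s;Q;a_1,a_2;\lambda,\lambda')=\sum_{(m,n)\in\mathbb Z^2\setminus\{(0,0)\}}\frac{a_1(m)a_2(n)}{(a\lambda_m^2+b\lambda_m\lambda_n'+c\lambda_n'^2)^s};$$ $\mathcal Z_2(s;Q^{-1};b_1,b_2;\mu,\mu')$ is defined in the same way from $Q^{-1}$, $b_1,b_2$, $\mu,\mu'$. It is regarded as a single Dirichlet series by grouping terms with equal value of the quadratic form.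
   Formalization: Membership of Z_2 in class A is asserted only when its grouped coefficients are not all zero; for odd coefficients and b=0 the terms (m,n) and (-m,n) cancel, so Z_2 is identically 0, which the definition of a Hecke pair excludes. *)

theory Defs
  imports "HOL-Complex_Analysis.Complex_Analysis"
begin

text \<open>
  A Dirichlet series $\sum_{n \ge 1} a(n) \lambda_n^{-s}$ is given by \<open>lam :: nat \<Rightarrow> real\<close> and
  \<open>a :: nat \<Rightarrow> complex\<close>; only the values at indices \<open>n \<ge> 1\<close> are used.
\<close>

definition frequencies :: "(nat \<Rightarrow> real) \<Rightarrow> bool" where
  "frequencies lam \<longleftrightarrow>
     (\<forall>n\<ge>1. 0 < lam n) \<and> strict_mono_on {1..} lam \<and> filterlim lam at_top sequentially"

definition dirichlet_series :: "(nat \<Rightarrow> real) \<Rightarrow> (nat \<Rightarrow> complex) \<Rightarrow> complex \<Rightarrow> complex" where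
  "dirichlet_series lam a s = (\<Sum>n. a (Suc n) * of_real (lam (Suc n)) powr (- s))"

text \<open>Abscissa of absolute convergence.\<close>

definition abs_abscissa :: "(nat \<Rightarrow> real) \<Rightarrow> (nat \<Rightarrow> complex) \<Rightarrow> ereal" where
  "abs_abscissa lam a =
     Inf {ereal \<sigma> | \<sigma>. summable (\<lambda>n. norm (a (Suc n)) * lam (Suc n) powr (- \<sigma>))}"

definition dirichlet_data :: "(nat \<Rightarrow> real) \<Rightarrow> (nat \<Rightarrow> complex) \<Rightarrow> bool" where
  "dirichlet_data lam a \<longleftrightarrow>
     frequencies lam \<and> (\<exists>n\<ge>1. a n \<noteq> 0) \<and> \<bar>abs_abscissa lam a\<bar> \<noteq> \<infinity>"

text \<open>
  Pairs with gamma factor \<open>\<Delta>\<close> and parameter \<open>r\<close>. Holomorphy of \<open>chi\<close> off a compact set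
  confines its singularities, and \<open>meromorphic_on\<close> says that they are at most poles.
\<close>

definition gamma_pair ::
  "(complex \<Rightarrow> complex) \<Rightarrow> real \<Rightarrow> (nat \<Rightarrow> real) \<Rightarrow> (nat \<Rightarrow> complex) \<Rightarrow>
    (nat \<Rightarrow> real) \<Rightarrow> (nat \<Rightarrow> complex) \<Rightarrow> bool" where
  "gamma_pair \<Delta> r lam a mu b \<longleftrightarrow>
     0 < r \<and> dirichlet_data lam a \<and> dirichlet_data mu b \<and>
     (\<exists>chi. chi meromorphic_on UNIV \<and>
        (\<forall>s. ereal (Re s) > abs_abscissa lam a \<longrightarrow>
              chi s = \<Delta> s * dirichlet_series lam a s) \<and>
        (\<forall>s. ereal (Re s) < ereal r - abs_abscissa mu b \<longrightarrow>
              chi s = \<Delta> (of_real r - s) * dirichlet_series mu b (of_real r - s)) \<and>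
        (\<forall>\<sigma>1 \<sigma>2. \<forall>\<epsilon>>0. \<exists>T. \<forall>s. \<sigma>1 \<le> Re s \<and> Re s \<le> \<sigma>2 \<and> T \<le> \<bar>Im s\<bar> \<longrightarrow> norm (chi s) < \<epsilon>) \<and>
        (\<exists>K. compact K \<and> chi holomorphic_on (- K)))"

definition hecke_pair ::
  "real \<Rightarrow> (nat \<Rightarrow> real) \<Rightarrow> (nat \<Rightarrow> complex) \<Rightarrow> (nat \<Rightarrow> real) \<Rightarrow> (nat \<Rightarrow> complex) \<Rightarrow> bool" where
  "hecke_pair r lam a mu b \<longleftrightarrow> gamma_pair Gamma r lam a mu b"

definition bochner_pair ::
  "nat \<Rightarrow> (nat \<Rightarrow> real) \<Rightarrow> (nat \<Rightarrow> complex) \<Rightarrow> (nat \<Rightarrow> real) \<Rightarrow> (nat \<Rightarrow> complex) \<Rightarrow> bool" where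
  "bochner_pair \<delta> lam a mu b \<longleftrightarrow>
     \<delta> \<in> {0, 1} \<and> gamma_pair (\<lambda>s. Gamma ((s + of_nat \<delta>) / 2)) 1 lam a mu b"

definition continues_to ::
  "(nat \<Rightarrow> real) \<Rightarrow> (nat \<Rightarrow> complex) \<Rightarrow> complex set \<Rightarrow> (complex \<Rightarrow> complex) \<Rightarrow> bool" where
  "continues_to lam a S \<Phi> \<longleftrightarrow>
     \<Phi> holomorphic_on S \<and>
     (\<forall>s\<in>S. ereal (Re s) > abs_abscissa lam a \<longrightarrow> \<Phi> s = dirichlet_series lam a s)"

definition continues_except_simple_pole ::
  "(nat \<Rightarrow> real) \<Rightarrow> (nat \<Rightarrow> complex) \<Rightarrow> complex \<Rightarrow> (complex \<Rightarrow> complex) \<Rightarrow> bool" where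
  "continues_except_simple_pole lam a p \<Phi> \<longleftrightarrow>
     continues_to lam a (- {p}) \<Phi> \<and> not_essential \<Phi> p \<and> (is_pole \<Phi> p \<longrightarrow> zorder \<Phi> p = - 1)"

definition class_A :: "(nat \<Rightarrow> real) \<Rightarrow> (nat \<Rightarrow> complex) \<Rightarrow> bool" where
  "class_A lam a \<longleftrightarrow>
     (\<exists>r mu b \<Phi> \<Psi>. hecke_pair r lam a mu b \<and>
        continues_except_simple_pole lam a (of_real r) \<Phi> \<and>
        continues_except_simple_pole mu b (of_real r) \<Psi>)"

text \<open>
  The continuations \<open>\<Phi>\<close>, \<open>\<Psi>\<close> of the series and of its dual are parameters of the predicate; they
  are unique, except for the irrelevant value at \<open>1\<close> when \<open>\<delta> = 0\<close>. The residues are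
  \<open>residue \<Phi> 1\<close> and \<open>residue \<Psi> 1\<close>, which vanish if there is no pole.
\<close>

definition class_B ::
  "nat \<Rightarrow> (nat \<Rightarrow> real) \<Rightarrow> (nat \<Rightarrow> complex) \<Rightarrow> (nat \<Rightarrow> real) \<Rightarrow> (nat \<Rightarrow> complex) \<Rightarrow>
    (complex \<Rightarrow> complex) \<Rightarrow> (complex \<Rightarrow> complex) \<Rightarrow> bool" where
  "class_B \<delta> lam a mu b \<Phi> \<Psi> \<longleftrightarrow>
     bochner_pair \<delta> lam a mu b \<and>
     (\<delta> = 0 \<longrightarrow> continues_except_simple_pole lam a 1 \<Phi> \<and> continues_except_simple_pole mu b 1 \<Psi>) \<and>
     (\<delta> = 1 \<longrightarrow> continues_to lam a UNIV \<Phi> \<and> continues_to mu b UNIV \<Psi>)"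

text \<open>Extensions to all integer indices of the sequences of a series in the class \<open>\<B>\<close>.\<close>

definition ext_freq :: "(nat \<Rightarrow> real) \<Rightarrow> int \<Rightarrow> real" where
  "ext_freq lam n =
     (if n > 0 then lam (nat n) else if n < 0 then - lam (nat (- n)) else 0)"

definition ext_coeff :: "nat \<Rightarrow> (complex \<Rightarrow> complex) \<Rightarrow> (nat \<Rightarrow> complex) \<Rightarrow> int \<Rightarrow> complex" where
  "ext_coeff \<delta> \<Phi> a n =
     (if n > 0 then a (nat n)
      else if n < 0 then (- 1) ^ \<delta> * a (nat (- n))
      else - 2 * \<Phi> (- of_nat \<delta>))"

definition qform :: "real \<Rightarrow> real \<Rightarrow> real \<Rightarrow> real \<Rightarrow> real \<Rightarrow> real" where
  "qform a b c x y = a * x\<^sup>2 + b * x * y + c * y\<^sup>2"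

text \<open>
  In the following, \<open>A1\<close>, \<open>A2\<close>, \<open>L1\<close>, \<open>L2\<close> are the extended coefficients and frequencies.
\<close>

definition epstein_term ::
  "real \<Rightarrow> real \<Rightarrow> real \<Rightarrow> (int \<Rightarrow> complex) \<Rightarrow> (int \<Rightarrow> complex) \<Rightarrow> (int \<Rightarrow> real) \<Rightarrow> (int \<Rightarrow> real) \<Rightarrow>
    complex \<Rightarrow> int \<times> int \<Rightarrow> complex" where
  "epstein_term a b c A1 A2 L1 L2 s =
     (\<lambda>(m, n). A1 m * A2 n / of_real (qform a b c (L1 m) (L2 n)) powr s)"

definition epstein_zeta ::
  "real \<Rightarrow> real \<Rightarrow> real \<Rightarrow> (int \<Rightarrow> complex) \<Rightarrow> (int \<Rightarrow> complex) \<Rightarrow> (int \<Rightarrow> real) \<Rightarrow> (int \<Rightarrow> real) \<Rightarrow>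
    complex \<Rightarrow> complex" where
  "epstein_zeta a b c A1 A2 L1 L2 s =
     infsum (epstein_term a b c A1 A2 L1 L2 s) (UNIV - {(0, 0)})"

text \<open>
  Grouping the terms with equal value of the quadratic form: the frequencies of the resulting
  Dirichlet series are the values, and each coefficient is a sum over a fibre (which is finite for
  a positive definite form and frequencies tending to infinity).
  These coefficients may vanish identically, for instance for odd coefficient sequences and
  \<open>b = 0\<close>, and then the series is not part of a Hecke pair.
\<close>

definition epstein_values ::
  "real \<Rightarrow> real \<Rightarrow> real \<Rightarrow> (int \<Rightarrow> real) \<Rightarrow> (int \<Rightarrow> real) \<Rightarrow> real set" where
  "epstein_values a b c L1 L2 =
     (\<lambda>(m, n). qform a b c (L1 m) (L2 n)) ` (UNIV - {(0, 0)})"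

definition epstein_coeff ::
  "real \<Rightarrow> real \<Rightarrow> real \<Rightarrow> (int \<Rightarrow> complex) \<Rightarrow> (int \<Rightarrow> complex) \<Rightarrow> (int \<Rightarrow> real) \<Rightarrow> (int \<Rightarrow> real) \<Rightarrow>
    real \<Rightarrow> complex" where
  "epstein_coeff a b c A1 A2 L1 L2 v =
     (\<Sum>(m, n) | (m, n) \<noteq> (0, 0) \<and> qform a b c (L1 m) (L2 n) = v. A1 m * A2 n)"

text \<open>
  \<open>Z\<close> is the continuation to the complex plane, holomorphic except possibly at \<open>1\<close>, of the
  Epstein zeta function, whose double series converges absolutely to the right of \<open>\<sigma>\<close>.
\<close>

definition epstein_continuation ::
  "real \<Rightarrow> real \<Rightarrow> real \<Rightarrow> (int \<Rightarrow> complex) \<Rightarrow> (int \<Rightarrow> complex) \<Rightarrow> (int \<Rightarrow> real) \<Rightarrow> (int \<Rightarrow> real) \<Rightarrow>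
    ereal \<Rightarrow> (complex \<Rightarrow> complex) \<Rightarrow> bool" where
  "epstein_continuation a b c A1 A2 L1 L2 \<sigma> Z \<longleftrightarrow>
     Z meromorphic_on UNIV \<and> Z holomorphic_on (- {1}) \<and>
     (\<forall>s. ereal (Re s) > \<sigma> \<longrightarrow>
        (\<lambda>p. norm (epstein_term a b c A1 A2 L1 L2 s p)) summable_on (UNIV - {(0, 0)}) \<and>
        Z s = epstein_zeta a b c A1 A2 L1 L2 s)"

end

theory Submission
  imports Defs "HOL-Probability.Sinc_Integral" "HOL-Real_Asymp.Real_Asymp"
begin

text \<open>
  Shifting the inverse Mellin integral of $\chi$ across its poles turns the functional equation of a
  Bochner pair into a one-dimensional theta relation. Differentiating it in the scale parameter gives
  all the derivatives at $\beta = 0$ of a Poisson formula for $e^{-\alpha\lambda^2 + \beta\lambda}$.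
  Completing the square in the quadratic form and applying this formula first in the one index and
  then in the other, the mixed term $b\lambda_m\lambda'_n$ being absorbed by the complex parameter
  $\beta$, yields a theta relation of weight one between $Q$ and $Q^{-1}$. Hecke's Mellin transform
  argument then gives the continuation, the pole and the functional equation. Absolute convergence of
  the double series to the right of both abscissas $\sigma_{a_1}$, $\sigma_{a_2}$ uses that these are at
  least $1/2$, and finiteness of the abscissa of the grouped series is shown in the same way: if the
  coefficients of one series grew more slowly, then the dual theta function would decay along vertical
  lines, which is impossible for an almost periodic function unless its coefficients vanish.
\<close>

subsection \<open>Vertical line integrals and the Gamma function\<close>

text \<open>Condition (2) on a pair gives decay of \<chi> in strips without any rate, and nothing is
  known about the growth of the series between the two half-planes of absolute convergence. So the
  inverse Mellin integral is formed on two lines of absolute convergence only, and it yields a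
  relation in one real scale parameter. The linear term that the mixed product requires is recovered
  from it: differentiation in \<alpha> acts as minus the second derivative in \<beta>, the
  derivatives of the other parity vanish by antisymmetry, and both sides are power series in \<beta>
  with infinite radius of convergence. The pole originates in index 0. Up to sign, the constants
  a(0) and b(0) of a theta function are the residues of the completed series at 0 and 1, and those
  of the double theta function are products of them. For even parity b(0) is sqrt(pi) times the
  residue of \<phi> at 1, which explains the residue of the Epstein zeta function. For odd parity
  the constants vanish, because the completed series stays holomorphic at the pole -1 of its Gamma
  factor.\<close>

lemma norm_Gamma_le:
  assumes "Re z > 0"
  shows "norm (Gamma z) \<le> Gamma (Re z)"
proof -
  have A: "((\<lambda>t. of_real t powr (z - 1) / of_real (exp t)) has_integral Gamma z) {0..}"
    by (rule Gamma_integral_complex) fact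
  have B: "((\<lambda>t. t powr (Re z - 1) / exp t) has_integral Gamma (Re z)) {0..}"
    by (rule Gamma_integral_real) fact
  have "norm (integral {0..} (\<lambda>t. of_real t powr (z - 1) / of_real (exp t) :: complex))
          \<le> integral {0..} (\<lambda>t. t powr (Re z - 1) / exp t)"
    by (rule integral_norm_bound_integral)
       (use A B in \<open>auto simp: has_integral_iff norm_divide norm_powr_real_powr simp flip: exp_of_real\<close>)
  then show ?thesis
    using A B by (simp add: has_integral_iff)
qed

text \<open>\<open>N\<close> steps of the recurrence move \<open>z\<close> into the right
  half-plane, where \<open>Gamma\<close> is bounded on vertical strips by its values on the real
  axis. Each step gains a factor of modulus at least \<open>\<bar>Im z\<bar> \<ge> 1\<close>, so two
  of them already give a decay that is integrable over vertical lines.\<close>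

lemma Gamma_strip_bound:
  "\<exists>C. \<forall>z. \<sigma>1 \<le> Re z \<and> Re z \<le> \<sigma>2 \<and> 1 \<le> \<bar>Im z\<bar> \<longrightarrow> norm (Gamma z) \<le> C / (Im z)\<^sup>2"
proof -
  \<comment> \<open>At least 2 for the quadratic decay, and large enough to move the strip to the
    right of 0.\<close>
  obtain N :: nat where N: "real N \<ge> 2 + \<bar>\<sigma>1\<bar>"
    using real_arch_simple by blast
  have "compact (Gamma ` {\<sigma>1 + real N..\<sigma>2 + real N})"
    using N by (intro compact_continuous_image continuous_intros) (auto elim!: nonpos_Ints_cases)
  then obtain C where "\<forall>x\<in>{\<sigma>1 + real N..\<sigma>2 + real N}. \<bar>Gamma x\<bar> \<le> C"
    by (auto dest!: compact_imp_bounded simp: bounded_iff)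
  then have C: "\<And>x. x \<in> {\<sigma>1 + real N..\<sigma>2 + real N} \<Longrightarrow> \<bar>Gamma x\<bar> \<le> C" by blast
  show ?thesis
  proof (intro exI[of _ C] allI impI)
    fix z :: complex assume z: "\<sigma>1 \<le> Re z \<and> Re z \<le> \<sigma>2 \<and> 1 \<le> \<bar>Im z\<bar>"
    have nz: "z \<notin> \<int>\<^sub>\<le>\<^sub>0"
      using z by (auto elim!: nonpos_Ints_cases)
    have "pochhammer z N = Gamma (z + of_nat N) / Gamma z"
      by (rule pochhammer_Gamma) fact
    moreover have "Gamma z \<noteq> 0"
      using nz by (simp add: Gamma_eq_zero_iff)
    ultimately have eq: "norm (Gamma z) * norm (pochhammer z N) = norm (Gamma (z + of_nat N))"
      by (simp add: norm_divide)
    have "\<bar>Im z\<bar> ^ 2 \<le> \<bar>Im z\<bar> ^ N"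
      using z N by (intro power_increasing) auto
    also have "\<dots> = (\<Prod>j<N. \<bar>Im z\<bar>)" by simp
    also have "\<dots> \<le> (\<Prod>j<N. norm (z + of_nat j))"
      by (intro prod_mono) (use abs_Im_le_cmod[of "z + of_nat _"] in auto)
    also have "\<dots> = norm (pochhammer z N)"
      by (simp add: pochhammer_prod prod_norm atLeast0LessThan)
    finally have "norm (Gamma z) * (Im z)\<^sup>2 \<le> norm (Gamma (z + of_nat N))"
      unfolding eq[symmetric] by (intro mult_left_mono) auto
    also have "\<dots> \<le> Gamma (Re (z + of_nat N))"
      using z N by (intro norm_Gamma_le) auto
    also have "\<dots> \<le> C"
      using C[of "Re z + real N"] z by auto
    finally show "norm (Gamma z) \<le> C / (Im z)\<^sup>2"
      using z by (subst pos_le_divide_eq) auto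
  qed
qed

lemma integrable_inverse_square_decay:
  fixes f :: "real \<Rightarrow> complex"
  assumes cont: "continuous_on UNIV f" and bd: "\<And>t. 1 \<le> \<bar>t\<bar> \<Longrightarrow> norm (f t) \<le> C / t\<^sup>2"
  shows "integrable lborel f"
proof -
  have "compact (f ` {-1..1})"
    by (intro compact_continuous_image continuous_on_subset[OF cont]) auto
  then obtain D where "\<forall>t\<in>{-1..1}. norm (f t) \<le> D"
    by (auto dest!: compact_imp_bounded simp: bounded_iff)
  then have D: "\<And>t. t \<in> {-1..1} \<Longrightarrow> norm (f t) \<le> D" by blast
  have D0: "D \<ge> 0" using order_trans[OF norm_ge_zero D[of 0]] by simp
  have C0: "C \<ge> 0" using order_trans[OF norm_ge_zero bd[of 1]] by simp
  have int: "integrable lborel (\<lambda>x::real. 2 * (C + D) * inverse (1 + x\<^sup>2))"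
    using integrable_inverse_1_plus_square by (simp add: set_integrable_def)
  show ?thesis
  proof (rule Bochner_Integration.integrable_bound[OF int])
    show "f \<in> borel_measurable lborel"
      using cont by (simp add: borel_measurable_continuous_onI)
    have "norm (f t) \<le> 2 * (C + D) * inverse (1 + t\<^sup>2)" for t
    proof (cases "1 \<le> \<bar>t\<bar>")
      case True
      then have t: "1 \<le> t\<^sup>2" using power_mono[of 1 "\<bar>t\<bar>" 2] by simp
      have "norm (f t) \<le> C / t\<^sup>2" by (rule bd) fact
      also have "\<dots> \<le> 2 * (C + D) / (1 + t\<^sup>2)"
        using frac_le[of "2 * (C + D)" "2 * C" "1 + t\<^sup>2" "2 * t\<^sup>2"] t C0 D0 by simp
      finally show ?thesis by (simp add: divide_inverse)
    next
      case False
      then have t: "t\<^sup>2 \<le> 1" by (simp add: abs_square_le_1)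
      have "norm (f t) \<le> D" using False by (intro D) (auto simp: not_le abs_less_iff)
      also have "\<dots> \<le> 2 * (C + D) * inverse (1 + t\<^sup>2)"
      proof -
        have "D * (1 + t\<^sup>2) \<le> D * 2" using t D0 by (intro mult_left_mono) auto
        then have "D * (1 + t\<^sup>2) \<le> 2 * (C + D)" by (rule order_trans) (use C0 in simp)
        moreover have "1 + t\<^sup>2 > 0" by (simp add: add_pos_nonneg)
        ultimately show ?thesis by (simp add: field_simps)
      qed
      finally show ?thesis .
    qed
    then show "AE x in lborel. norm (f x) \<le> norm (2 * (C + D) * inverse (1 + x\<^sup>2))"
      by (intro always_eventually allI) (metis abs_ge_self order_trans real_norm_def)
  qed
qed

section \<open>Moving vertical lines of integration\<close>

lemma tendsto_integral_symmetric:
  fixes g :: "real \<Rightarrow> complex"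
  assumes "integrable lborel g"
  shows "(\<lambda>n. integral {- real n..real n} g) \<longlonglongrightarrow> (LINT t|lborel. g t)"
proof -
  have eq: "integral {- real n..real n} g = (LINT t|lborel. indicator {- real n..real n} t *\<^sub>R g t)" for n
  proof -
    have "set_integrable lborel {- real n..real n} g"
      unfolding set_integrable_def by (intro integrable_mult_indicator assms) auto
    from set_borel_integral_eq_integral(2)[OF this] show ?thesis
      by (simp add: set_lebesgue_integral_def)
  qed
  show ?thesis unfolding eq
  proof (rule integral_dominated_convergence[where w = "\<lambda>t. norm (g t)"])
    show "AE x in lborel. (\<lambda>n. indicator {- real n..real n} x *\<^sub>R g x) \<longlonglongrightarrow> g x"
    proof (intro always_eventually allI)
      fix x :: real
      obtain N :: nat where "real N \<ge> \<bar>x\<bar>" using real_arch_simple by blast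
      then have "\<forall>n\<ge>N. indicator {- real n..real n} x *\<^sub>R g x = g x"
        by (auto simp: indicator_def)
      then show "(\<lambda>n. indicator {- real n..real n} x *\<^sub>R g x) \<longlonglongrightarrow> g x"
        by (intro tendsto_eventually) (auto simp: eventually_at_top_linorder)
    qed
  qed (use assms in \<open>auto simp: indicator_def\<close>)
qed

text \<open>The residue theorem for rectangles with horizontal sides at height
  \<open>\<plusminus> n\<close>. These sides keep the length \<open>c2 - c1\<close>, so uniform
  decay without a rate removes them, while the vertical sides converge by integrability. The region
  \<open>U\<close> allows a function with infinitely many poles, such as \<open>Gamma\<close>, to be
  treated through the finitely many poles in the strip.\<close>

lemma vertical_shift:
  assumes c: "c1 < c2" and S: "finite S" "S \<subseteq> {s. c1 < Re s \<and> Re s < c2}"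
    and U: "open U" "connected U" "{s. c1 \<le> Re s \<and> Re s \<le> c2} \<subseteq> U"
    and hol: "f holomorphic_on U - S"
    and decay: "\<And>e. e > 0 \<Longrightarrow> \<exists>T. \<forall>s. c1 \<le> Re s \<and> Re s \<le> c2 \<and> T \<le> \<bar>Im s\<bar> \<longrightarrow> norm (f s) < e"
    and int: "integrable lborel (\<lambda>t. f (Complex c1 t))" "integrable lborel (\<lambda>t. f (Complex c2 t))"
  shows "(LINT t|lborel. f (Complex c2 t)) - (LINT t|lborel. f (Complex c1 t))
           = 2 * pi * (\<Sum>p\<in>S. residue f p)"
proof -
  define R where "R = (\<Sum>p\<in>S. residue f p)"
  define I where "I c n = integral {- real n..real n} (\<lambda>t. f (Complex c t))" for c n
  have "bounded (Im ` S)" using S by (intro finite_imp_bounded) auto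
  then obtain B0 where "\<And>p. p \<in> S \<Longrightarrow> \<bar>Im p\<bar> \<le> B0"
    unfolding bounded_iff by auto
  then have B: "\<bar>Im p\<bar> < B0 + 1" if "p \<in> S" for p
    using that by fastforce
  define B where "B = B0 + 1"
  note B = B[folded B_def]
  have key: "norm (I c2 n - I c1 n - 2 * pi * R) \<le> 2 * e * (c2 - c1)"
    if n: "real n > max 0 (max B T)" and e: "e > 0"
      and T: "\<forall>s. c1 \<le> Re s \<and> Re s \<le> c2 \<and> T \<le> \<bar>Im s\<bar> \<longrightarrow> norm (f s) < e" for n e T
  proof -
    define a1 a2 a3 a4 where a: "a1 = Complex c1 (- real n)" "a2 = Complex c2 (- real n)"
      "a3 = Complex c2 (real n)" "a4 = Complex c1 (real n)"
    have n0: "real n > 0" and nB: "real n > B" and nT: "real n > T" using n by auto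
    have rp: "rectpath a1 a3 = linepath a1 a2 +++ linepath a2 a3 +++ linepath a3 a4 +++ linepath a4 a1"
      by (simp add: rectpath_def Let_def a)
    have pi_sub: "path_image (rectpath a1 a3) \<subseteq> U - S"
    proof
      fix z assume "z \<in> path_image (rectpath a1 a3)"
      then have z: "z \<in> cbox a1 a3 - box a1 a3"
        using c n0 by (subst (asm) path_image_rectpath_cbox_minus_box) (auto simp: a)
      have "z \<notin> S"
      proof
        assume "z \<in> S"
        with B[of z] nB S have "z \<in> box a1 a3" by (auto simp: in_box_complex_iff a)
        with z show False by auto
      qed
      with z U show "z \<in> U - S" by (auto simp: in_cbox_complex_iff a)
    qed
    have "contour_integral (rectpath a1 a3) f
            = 2 * pi * \<i> * (\<Sum>p\<in>S. winding_number (rectpath a1 a3) p * residue f p)"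
    proof (rule Residue_theorem[OF U(1,2) S(1) hol])
      show "\<forall>z. z \<notin> U \<longrightarrow> winding_number (rectpath a1 a3) z = 0"
      proof (intro allI impI)
        fix z assume "z \<notin> U"
        then have "z \<notin> cbox a1 a3" using U by (auto simp: in_cbox_complex_iff a)
        then show "winding_number (rectpath a1 a3) z = 0"
          using c n0 by (intro winding_number_rectpath_outside) (auto simp: a)
      qed
    qed (use pi_sub in auto)
    also have "(\<Sum>p\<in>S. winding_number (rectpath a1 a3) p * residue f p) = R"
      unfolding R_def
    proof (intro sum.cong refl)
      fix p assume "p \<in> S"
      with B[of p] nB S have "p \<in> box a1 a3" by (auto simp: in_box_complex_iff a)
      then have "winding_number (rectpath a1 a3) p = 1" by (rule winding_number_rectpath)
      then show "winding_number (rectpath a1 a3) p * residue f p = residue f p" by simp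
    qed
    finally have tot: "contour_integral (rectpath a1 a3) f = 2 * pi * \<i> * R" .
    have pim: "path_image (rectpath a1 a3) =
        closed_segment a1 a2 \<union> closed_segment a2 a3 \<union> closed_segment a3 a4 \<union> closed_segment a4 a1"
      unfolding rp by (simp add: path_image_join Un_assoc)
    have contf: "continuous_on (U - S) f" using hol by (rule holomorphic_on_imp_continuous_on)
    have cs: "continuous_on (closed_segment a1 a2) f" "continuous_on (closed_segment a2 a3) f"
      "continuous_on (closed_segment a3 a4) f" "continuous_on (closed_segment a4 a1) f"
      using pi_sub unfolding pim by (auto intro: continuous_on_subset[OF contf])
    note ci = cs[THEN contour_integrable_continuous_linepath]
    have split: "contour_integral (rectpath a1 a3) f = contour_integral (linepath a1 a2) f
        + contour_integral (linepath a2 a3) f + contour_integral (linepath a3 a4) f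
        + contour_integral (linepath a4 a1) f"
      unfolding rp using ci by (simp add: contour_integrable_join)
    have v1: "contour_integral (linepath a2 a3) f = \<i> * I c2 n"
      unfolding I_def using n0 by (intro contour_integral_linepath_same_Re) (auto simp: a)
    have "contour_integral (linepath a4 a1) f = - contour_integral (linepath a1 a4) f"
      using cs(4) by (intro contour_integral_reverse_linepath) (simp add: closed_segment_commute)
    also have "contour_integral (linepath a1 a4) f = \<i> * I c1 n"
      unfolding I_def using n0 by (intro contour_integral_linepath_same_Re) (auto simp: a)
    finally have v2: "contour_integral (linepath a4 a1) f = - (\<i> * I c1 n)" .
    have seg: "norm (f z) \<le> e" if "z \<in> closed_segment a1 a2 \<union> closed_segment a3 a4" for z
    proof -
      have "Im z = - real n \<or> Im z = real n"
        using that by (auto simp: closed_segment_def a) (simp_all add: algebra_simps)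
      then have "\<bar>Im z\<bar> = real n" by auto
      moreover have "z \<in> cbox a1 a3"
        using that c n0 pim path_image_rectpath_subset_cbox[of a1 a3] by (auto simp: a)
      ultimately show ?thesis using T nT by (intro less_imp_le) (auto simp: in_cbox_complex_iff a)
    qed
    have h1: "norm (contour_integral (linepath a1 a2) f) \<le> e * norm (a2 - a1)"
      using seg e by (intro contour_integral_bound_linepath ci) auto
    have h2: "norm (contour_integral (linepath a3 a4) f) \<le> e * norm (a4 - a3)"
      using seg e by (intro contour_integral_bound_linepath ci) auto
    have nn: "norm (a2 - a1) = c2 - c1" "norm (a4 - a3) = c2 - c1"
      using c by (auto simp: a cmod_def)
    have "I c2 n - I c1 n - 2 * pi * R
        = \<i> * (contour_integral (linepath a1 a2) f + contour_integral (linepath a3 a4) f)"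
    proof -
      have *: "X = \<i> * Y" if "\<i> * X = - Y" for X Y :: complex
        using that by (auto simp: complex_eq_iff)
      show ?thesis
        by (rule *) (use tot in \<open>simp add: split v1 v2 algebra_simps\<close>)
    qed
    also have "norm \<dots> \<le> e * (c2 - c1) + e * (c2 - c1)"
      unfolding norm_mult using norm_triangle_ineq[of "contour_integral (linepath a1 a2) f" "contour_integral (linepath a3 a4) f"]
        h1 h2 nn by simp
    finally show ?thesis by simp
  qed
  have "(\<lambda>n. I c2 n - I c1 n) \<longlonglongrightarrow> 2 * pi * R"
  proof (rule LIMSEQ_I)
    fix r :: real assume r: "r > 0"
    define e where "e = r / (4 * (c2 - c1))"
    have e: "e > 0" using r c by (simp add: e_def)
    have e2: "2 * e * (c2 - c1) < r" using r c by (simp add: e_def field_simps)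
    obtain T where T: "\<forall>s. c1 \<le> Re s \<and> Re s \<le> c2 \<and> T \<le> \<bar>Im s\<bar> \<longrightarrow> norm (f s) < e"
      using decay[OF e] by blast
    obtain N :: nat where N: "real N > max 0 (max B T)" using reals_Archimedean2 by blast
    show "\<exists>no. \<forall>n\<ge>no. norm (I c2 n - I c1 n - 2 * pi * R) < r"
    proof (intro exI[of _ N] allI impI)
      fix n assume "n \<ge> N"
      then have "real n > max 0 (max B T)" using N by (meson less_le_trans of_nat_mono)
      from key[OF this e T] e2 show "norm (I c2 n - I c1 n - 2 * pi * R) < r" by simp
    qed
  qed
  moreover have "(\<lambda>n. I c2 n - I c1 n) \<longlonglongrightarrow> (LINT t|lborel. f (Complex c2 t)) - (LINT t|lborel. f (Complex c1 t))"
    unfolding I_def by (intro tendsto_diff tendsto_integral_symmetric int)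
  ultimately show ?thesis unfolding R_def by (rule LIMSEQ_unique[rotated])
qed

lemma continuous_on_Complex [continuous_intros]:
  assumes "continuous_on A f" "continuous_on A g"
  shows "continuous_on A (\<lambda>x. Complex (f x) (g x))"
  unfolding Complex_eq using assms by (intro continuous_intros)

section \<open>The Cahen-Mellin integral of the exponential function\<close>

lemma norm_powr_pos_real: "x > 0 \<Longrightarrow> norm (complex_of_real x powr z) = x powr Re z"
  by (simp add: norm_powr_real_powr)

lemma integrable_Gamma_powr:
  assumes c: "\<And>n::nat. c \<noteq> - real n" and x: "x > 0"
  shows "integrable lborel (\<lambda>t. Gamma (Complex c t) * complex_of_real x powr (- Complex c t))"
proof -
  obtain C where C: "\<forall>z. c \<le> Re z \<and> Re z \<le> c \<and> 1 \<le> \<bar>Im z\<bar> \<longrightarrow> norm (Gamma z) \<le> C / (Im z)\<^sup>2"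
    using Gamma_strip_bound by blast
  have nz: "Complex c t \<notin> \<int>\<^sub>\<le>\<^sub>0" for t
    using c by (auto elim!: nonpos_Ints_cases' simp: complex_eq_iff)
  show ?thesis
  proof (rule integrable_inverse_square_decay)
    show "continuous_on UNIV (\<lambda>t. Gamma (Complex c t) * complex_of_real x powr (- Complex c t))"
    proof (intro continuous_intros)
      show "continuous_on UNIV (\<lambda>t. Gamma (Complex c t))"
        by (rule continuous_on_compose2[of "- \<int>\<^sub>\<le>\<^sub>0" Gamma]) (use nz in \<open>auto intro!: continuous_intros\<close>)
    qed (use x in auto)
    fix t :: real assume t: "1 \<le> \<bar>t\<bar>"
    have "norm (Gamma (Complex c t)) \<le> C / t\<^sup>2"
      using C[rule_format, of "Complex c t"] t by simp
    then show "norm (Gamma (Complex c t) * complex_of_real x powr (- Complex c t)) \<le> (C * x powr (-c)) / t\<^sup>2"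
      unfolding norm_mult using x by (simp add: norm_powr_pos_real mult_right_mono flip: times_divide_eq_left)
  qed
qed

lemma Gamma_powr_strip_decay:
  assumes x: "x > 0" and e: "e > 0"
  shows "\<exists>T. \<forall>s. \<sigma>1 \<le> Re s \<and> Re s \<le> \<sigma>2 \<and> T \<le> \<bar>Im s\<bar> \<longrightarrow> norm (Gamma s * complex_of_real x powr (- s)) < e"
proof -
  obtain C where C: "\<forall>z. \<sigma>1 \<le> Re z \<and> Re z \<le> \<sigma>2 \<and> 1 \<le> \<bar>Im z\<bar> \<longrightarrow> norm (Gamma z) \<le> C / (Im z)\<^sup>2"
    using Gamma_strip_bound by blast
  \<comment> \<open>The power is monotone in the exponent, in a direction that depends on whether
    \<open>x \<ge> 1\<close>; the sum of its values at both ends of the strip is a bound in either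
    case.\<close>
  define D where "D = x powr (-\<sigma>1) + x powr (-\<sigma>2)"
  have D: "x powr (- \<sigma>) \<le> D" if "\<sigma>1 \<le> \<sigma>" "\<sigma> \<le> \<sigma>2" for \<sigma>
  proof (cases "x \<ge> 1")
    case True
    then have "x powr (- \<sigma>) \<le> x powr (-\<sigma>1)" using that by (intro powr_mono) auto
    then show ?thesis by (simp add: D_def add_increasing2)
  next
    case False
    then have "x powr (- \<sigma>) \<le> x powr (-\<sigma>2)" using that x by (intro powr_mono') auto
    then show ?thesis by (simp add: D_def add_increasing)
  qed
  define E where "E = \<bar>C\<bar> * D + 1"
  have E: "E > 0" "\<bar>C\<bar> * D < E" unfolding E_def D_def by (auto intro!: add_nonneg_pos mult_nonneg_nonneg)
  show ?thesis
  proof (intro exI[of _ "max 1 (E / e)"] allI impI)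
    fix s assume s: "\<sigma>1 \<le> Re s \<and> Re s \<le> \<sigma>2 \<and> max 1 (E / e) \<le> \<bar>Im s\<bar>"
    have "norm (Gamma s * complex_of_real x powr (- s)) = norm (Gamma s) * x powr (- Re s)"
      using x by (simp add: norm_mult norm_powr_pos_real)
    also have "\<dots> \<le> (\<bar>C\<bar> / (Im s)\<^sup>2) * D"
    proof (intro mult_mono D)
      have "norm (Gamma s) \<le> C / (Im s)\<^sup>2" using C s by auto
      also have "\<dots> \<le> \<bar>C\<bar> / (Im s)\<^sup>2" by (intro divide_right_mono) auto
      finally show "norm (Gamma s) \<le> \<bar>C\<bar> / (Im s)\<^sup>2" .
    qed (use s in auto)
    also have "\<dots> < E / (Im s)\<^sup>2"
    proof -
      have "(Im s)\<^sup>2 > 0" using s by auto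
      then show ?thesis using E(2) by (simp add: divide_strict_right_mono)
    qed
    also have "\<dots> \<le> E / \<bar>Im s\<bar>"
    proof (rule divide_left_mono)
      show "\<bar>Im s\<bar> \<le> (Im s)\<^sup>2" using s mult_left_mono[of 1 "\<bar>Im s\<bar>" "\<bar>Im s\<bar>"] by (simp add: power2_eq_square)
    qed (use s E in auto)
    also have "\<dots> \<le> e" using s e by (subst pos_divide_le_eq) (auto simp: field_simps)
    finally show "norm (Gamma s * complex_of_real x powr (- s)) < e" .
  qed
qed

text \<open>The Cahen-Mellin integral over the line of abscissa \<open>c\<close>, parametrised by
  the imaginary part and without the usual factor \<open>1 / (2 * pi)\<close>.\<close>

definition Gamma_line :: "real \<Rightarrow> real \<Rightarrow> complex" where
  "Gamma_line x c = (LINT t|lborel. Gamma (Complex c t) * complex_of_real x powr (- Complex c t))"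

lemma Gamma_line_shift:
  assumes x: "x > 0" and c: "c1 < c2" "\<And>n::nat. c1 \<noteq> - real n" "\<And>n::nat. c2 \<noteq> - real n"
    and S: "finite S" "\<And>n::nat. n \<in> S \<longleftrightarrow> c1 < - real n \<and> - real n < c2"
  shows "Gamma_line x c2 - Gamma_line x c1 = complex_of_real (2 * pi * (\<Sum>n\<in>S. (-x) ^ n / fact n))"
proof -
  let ?f = "\<lambda>s. Gamma s * complex_of_real x powr (- s)"
  let ?S = "(\<lambda>n. - of_nat n :: complex) ` S"
  \<comment> \<open>The poles of \<open>Gamma\<close> outside the strip are cut out. The complement
    of a countable closed set is still open and connected.\<close>
  define U where "U = - (\<int>\<^sub>\<le>\<^sub>0 - ?S)"
  have clo: "open U" unfolding U_def by (intro open_Compl closed_subset_Ints) (auto simp: nonpos_Ints_def)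
  have "countable (\<int>\<^sub>\<le>\<^sub>0 - ?S)"
    by (rule countable_subset[of _ "range of_int"]) (auto elim!: nonpos_Ints_cases)
  then have con: "connected U"
    using connected_open_diff_countable[of UNIV "\<int>\<^sub>\<le>\<^sub>0 - ?S"] connected_UNIV by (simp add: U_def Compl_eq_Diff_UNIV)
  have "Gamma_line x c2 - Gamma_line x c1 = 2 * pi * (\<Sum>p\<in>?S. residue ?f p)"
    unfolding Gamma_line_def
  proof (rule vertical_shift[OF c(1)])
    show "{s. c1 \<le> Re s \<and> Re s \<le> c2} \<subseteq> U"
    proof (safe, unfold U_def, safe)
      fix s :: complex assume s: "c1 \<le> Re s" "Re s \<le> c2" "s \<in> \<int>\<^sub>\<le>\<^sub>0" "s \<notin> ?S"
      then obtain n where n: "s = - of_nat n" by (auto elim!: nonpos_Ints_cases')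
      with s c(2,3)[of n] have "n \<in> S" unfolding S(2) by auto
      with n s show False by auto
    qed
    show "?f holomorphic_on U - ?S"
      using x by (intro holomorphic_intros) (auto simp: U_def)
  qed (use S c x clo con in \<open>auto intro: Gamma_powr_strip_decay integrable_Gamma_powr\<close>)
  also have "(\<Sum>p\<in>?S. residue ?f p) = (\<Sum>n\<in>S. residue ?f (- of_nat n))"
    by (subst sum.reindex) (auto simp: inj_on_def)
  also have "\<dots> = (\<Sum>n\<in>S. complex_of_real ((-x) ^ n / fact n))"
  proof (intro sum.cong refl)
    fix n assume "n \<in> S"
    let ?V = "- (\<int>\<^sub>\<le>\<^sub>0 - {- of_nat n :: complex})"
    show "residue ?f (- of_nat n) = complex_of_real ((-x) ^ n / fact n)"
    proof (rule residue_simple')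
      show "open ?V" by (intro open_Compl closed_subset_Ints) (auto simp: nonpos_Ints_def)
      show "?f holomorphic_on ?V - {- of_nat n}"
        using x by (intro holomorphic_intros) auto
      have "((\<lambda>w. (Gamma w * (w + of_nat n)) * complex_of_real x powr (- w))
              \<longlongrightarrow> (-1) ^ n / fact n * complex_of_real x powr (- (- of_nat n))) (at (- of_nat n))"
        using x by (intro tendsto_intros Gamma_residues) auto
      also have "(-1) ^ n / fact n * complex_of_real x powr (- (- of_nat n)) = complex_of_real ((-x) ^ n / fact n)"
        using x by (simp add: powr_nat' power_minus[of x])
      finally show "((\<lambda>w. ?f w * (w - - of_nat n)) \<longlongrightarrow> complex_of_real ((-x) ^ n / fact n)) (at (- of_nat n))"
        by (simp add: mult_ac)
    qed auto
  qed
  finally show ?thesis by (simp add: of_real_sum)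
qed

text \<open>The line runs midway between the poles \<open>- k\<close> and \<open>- (k + 1)\<close>.
  The recurrence leads in \<open>k + 1\<close> steps to the fixed abscissa 1/2, and the product of
  the factors has modulus at least \<open>fact k / 2\<close>: the j-th factor is at least
  \<open>k - j\<close> for \<open>j < k\<close>, the last one at least 1/2.\<close>

lemma Gamma_line_left:
  assumes x: "x > 0"
  shows "norm (Gamma_line x (1/2 - real (Suc k)))
     \<le> 2 * x powr (- 1/2) * (LINT t|lborel. norm (Gamma (Complex (1/2) t))) * (x ^ Suc k / fact k)"
proof -
  let ?c = "1/2 - real (Suc k)"
  have half: "(1/2 :: real) \<noteq> - real n" for n by (metis add_sign_intros(2) of_nat_0_le_iff half_gt_zero_iff neg_0_le_iff_le le_minus_iff less_le_not_le minus_minus zero_less_one)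
  have cn: "?c \<noteq> - real n" for n
  proof
    assume "?c = - real n"
    then have "1 = 2 * (real (Suc k) - real n)" by simp
    then have "(1::real) = of_int (2 * (int (Suc k) - int n))" by simp
    then have "1 = 2 * (int (Suc k) - int n)" by linarith
    then show False by presburger
  qed
  have intc: "integrable lborel (\<lambda>t. norm (Gamma (Complex ?c t) * complex_of_real x powr (- Complex ?c t)))"
    using cn x by (intro integrable_norm integrable_Gamma_powr) auto
  have inth: "integrable lborel (\<lambda>t. norm (Gamma (Complex (1/2) t)))"
    using integrable_Gamma_powr[of "1/2" 1] half by (intro integrable_norm) auto
  have pt: "norm (Gamma (Complex ?c t) * complex_of_real x powr (- Complex ?c t))
     \<le> 2 * x powr (- 1/2) * (x ^ Suc k / fact k) * norm (Gamma (Complex (1/2) t))" for t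
  proof -
    have nz: "Complex ?c t \<notin> \<int>\<^sub>\<le>\<^sub>0"
      using cn by (auto elim!: nonpos_Ints_cases' simp: complex_eq_iff)
    have "pochhammer (Complex ?c t) (Suc k) = Gamma (Complex ?c t + of_nat (Suc k)) / Gamma (Complex ?c t)"
      by (rule pochhammer_Gamma) fact
    moreover have "Complex ?c t + of_nat (Suc k) = Complex (1/2) t" by (simp add: complex_eq_iff)
    moreover have "Gamma (Complex ?c t) \<noteq> 0" using nz by (simp add: Gamma_eq_zero_iff)
    ultimately have eq: "norm (Gamma (Complex ?c t)) * norm (pochhammer (Complex ?c t) (Suc k)) = norm (Gamma (Complex (1/2) t))"
      by (simp add: norm_divide)
    have "fact k / 2 = (\<Prod>j<k. real (k - j)) * (1/2)"
      by (simp add: fact_prod_rev atLeast0LessThan)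
    also have "\<dots> \<le> (\<Prod>j<k. norm (Complex ?c t + of_nat j)) * norm (Complex ?c t + of_nat k)"
    proof (intro mult_mono prod_mono prod_nonneg)
      fix j assume j: "j \<in> {..<k}"
      then have "real (k - j) = real k - real j" by (simp add: of_nat_diff)
      moreover have "real k - real j \<le> \<bar>Re (Complex ?c t + of_nat j)\<bar>" using j by simp
      ultimately have "real (k - j) \<le> norm (Complex ?c t + of_nat j)"
        using abs_Re_le_cmod[of "Complex ?c t + of_nat j"] by linarith
      then show "0 \<le> real (k - j) \<and> real (k - j) \<le> norm (Complex ?c t + of_nat j)" by simp
    next
      show "1/2 \<le> norm (Complex ?c t + of_nat k)"
        using abs_Re_le_cmod[of "Complex ?c t + of_nat k"] by simp
    qed auto
    also have "\<dots> = norm (pochhammer (Complex ?c t) (Suc k))"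
      by (simp add: pochhammer_prod prod_norm atLeast0LessThan norm_mult prod.lessThan_Suc lessThan_Suc_atMost[symmetric] del: prod.lessThan_Suc)
         (simp add: prod.lessThan_Suc norm_mult prod_norm)
    finally have "norm (Gamma (Complex ?c t)) * (fact k / 2) \<le> norm (Gamma (Complex (1/2) t))"
      unfolding eq[symmetric] by (intro mult_left_mono) auto
    then have g: "norm (Gamma (Complex ?c t)) \<le> 2 / fact k * norm (Gamma (Complex (1/2) t))"
      by (simp add: field_simps)
    have "x powr (- ?c) = x powr (-1/2) * x powr (real (Suc k))"
      by (simp add: add.commute flip: powr_add)
    then have "norm (complex_of_real x powr (- Complex ?c t)) = x powr (-1/2) * x ^ Suc k"
      using x by (simp add: norm_powr_pos_real powr_realpow del: of_nat_Suc power_Suc)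
    then have "norm (Gamma (Complex ?c t) * complex_of_real x powr (- Complex ?c t))
       = norm (Gamma (Complex ?c t)) * (x powr (-1/2) * x ^ Suc k)"
      by (simp add: norm_mult)
    also have "\<dots> \<le> 2 / fact k * norm (Gamma (Complex (1/2) t)) * (x powr (-1/2) * x ^ Suc k)"
      using x by (intro mult_right_mono g) auto
    finally show ?thesis by (simp add: field_simps)
  qed
  have "norm (Gamma_line x ?c) \<le> (LINT t|lborel. norm (Gamma (Complex ?c t) * complex_of_real x powr (- Complex ?c t)))"
    unfolding Gamma_line_def by (rule integral_norm_bound)
  also have "\<dots> \<le> (LINT t|lborel. 2 * x powr (- 1/2) * (x ^ Suc k / fact k) * norm (Gamma (Complex (1/2) t)))"
    using pt intc inth by (intro integral_mono) auto
  also have "\<dots> = 2 * x powr (- 1/2) * (LINT t|lborel. norm (Gamma (Complex (1/2) t))) * (x ^ Suc k / fact k)"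
    by simp
  finally show ?thesis .
qed

text \<open>Moving the line to the left without bound picks up the residues of \<open>Gamma\<close>,
  which are the terms of the series of \<open>exp (- x)\<close>, and the remaining integral tends to
  0 like \<open>x ^ k / fact k\<close>.\<close>

lemma Gamma_line_eq:
  assumes x: "x > 0" and c: "c > 0"
  shows "Gamma_line x c = complex_of_real (2 * pi * exp (- x))"
proof -
  have sh: "Gamma_line x c = complex_of_real (2 * pi * (\<Sum>n<Suc k. (-x) ^ n / fact n)) + Gamma_line x (1/2 - real (Suc k))" for k
  proof -
    have "Gamma_line x c - Gamma_line x (1/2 - real (Suc k)) = complex_of_real (2 * pi * (\<Sum>n\<in>{..<Suc k}. (-x) ^ n / fact n))"
    proof (rule Gamma_line_shift[OF x])
      show "1/2 - real (Suc k) \<noteq> - real n" for n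
      proof
        assume "1/2 - real (Suc k) = - real n"
        then have "1 = 2 * (real (Suc k) - real n)" by simp
        then have "(1::real) = of_int (2 * (int (Suc k) - int n))" by simp
        then have "1 = 2 * (int (Suc k) - int n)" by linarith
        then show False by presburger
      qed
      show "n \<in> {..<Suc k} \<longleftrightarrow> 1/2 - real (Suc k) < - real n \<and> - real n < c" for n
        using c by (auto simp: less_Suc_eq_le)
    qed (use c in auto)
    then show ?thesis by (simp add: algebra_simps)
  qed
  have "(\<lambda>k. complex_of_real (2 * pi * (\<Sum>n<Suc k. (-x) ^ n / fact n)) + Gamma_line x (1/2 - real (Suc k)))
      \<longlonglongrightarrow> complex_of_real (2 * pi * exp (- x)) + 0"
  proof (intro tendsto_intros)
    have "(\<lambda>n. (- x) ^ n / fact n) sums exp (- x)"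
      using exp_converges[of "- x"] by (simp add: divide_inverse mult_ac)
    then have "(\<lambda>k. \<Sum>n<k. (- x) ^ n / fact n) \<longlonglongrightarrow> exp (- x)"
      by (simp add: sums_def)
    from LIMSEQ_Suc[OF this]
    show "(\<lambda>k. \<Sum>n<Suc k. (-x) ^ n / fact n) \<longlonglongrightarrow> exp (- x)" .
    define K where "K = 2 * x powr (- 1/2) * (LINT t|lborel. norm (Gamma (Complex (1/2) t)))"
    have "(\<lambda>k. K * x * (x ^ k / fact k)) \<longlonglongrightarrow> K * x * 0"
      using summable_LIMSEQ_zero[OF summable_exp[of x]] by (intro tendsto_intros) (simp add: divide_inverse mult_ac)
    then have "(\<lambda>k. K * (x ^ Suc k / fact k)) \<longlonglongrightarrow> 0" by (simp add: mult_ac)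
    then show "(\<lambda>k. Gamma_line x (1/2 - real (Suc k))) \<longlonglongrightarrow> 0"
      by (rule Lim_null_comparison[rotated]) (use Gamma_line_left[OF x] in \<open>auto simp: K_def\<close>)
  qed
  then have "(\<lambda>k::nat. Gamma_line x c) \<longlonglongrightarrow> complex_of_real (2 * pi * exp (- x)) + 0"
    unfolding sh[symmetric] .
  then show ?thesis by (simp add: LIMSEQ_const_iff)
qed

subsection \<open>Dirichlet series\<close>

lemma frequencies_pos: "frequencies lam \<Longrightarrow> 0 < lam (Suc n)"
  by (simp add: frequencies_def)

lemma frequencies_ge_first:
  assumes "frequencies lam"
  shows "lam (Suc 0) \<le> lam (Suc n)"
proof -
  have "mono_on {1..} lam"
    using assms by (auto simp: frequencies_def intro: strict_mono_on_imp_mono_on)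
  then show ?thesis by (auto simp: mono_on_def)
qed

lemma frequencies_filterlim_Suc:
  "frequencies lam \<Longrightarrow> filterlim (\<lambda>n. lam (Suc n)) at_top sequentially"
  by (simp add: frequencies_def filterlim_sequentially_Suc)

text \<open>Frequencies below 1 are allowed, so a single term may grow with \<sigma>. The comparison
  therefore carries a power of the smallest frequency as a factor.\<close>

lemma summable_dirichlet_mono:
  assumes "frequencies lam" "summable (\<lambda>n. norm (a (Suc n)) * lam (Suc n) powr (- \<sigma>))" "\<sigma> \<le> \<sigma>'"
  shows "summable (\<lambda>n. norm (a (Suc n)) * lam (Suc n) powr (- \<sigma>'))"
proof (rule summable_comparison_test')
  show "summable (\<lambda>n. norm (a (Suc n)) * lam (Suc n) powr (- \<sigma>) * lam (Suc 0) powr (- (\<sigma>' - \<sigma>)))"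
    by (intro summable_mult2 assms)
  fix n
  have "lam (Suc n) powr (- \<sigma>') = lam (Suc n) powr (- \<sigma>) * lam (Suc n) powr (- (\<sigma>' - \<sigma>))"
    by (simp flip: powr_add)
  also have "\<dots> \<le> lam (Suc n) powr (- \<sigma>) * lam (Suc 0) powr (- (\<sigma>' - \<sigma>))"
    using assms frequencies_pos[of lam] frequencies_ge_first[of lam n]
    by (intro mult_left_mono powr_mono2') auto
  finally show "norm (norm (a (Suc n)) * lam (Suc n) powr (- \<sigma>'))
      \<le> norm (a (Suc n)) * lam (Suc n) powr (- \<sigma>) * lam (Suc 0) powr (- (\<sigma>' - \<sigma>))"
    by (simp add: mult_left_mono mult.assoc)
qed

lemma abs_abscissa_le:
  "summable (\<lambda>n. norm (a (Suc n)) * lam (Suc n) powr (- \<sigma>)) \<Longrightarrow> abs_abscissa lam a \<le> ereal \<sigma>"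
  unfolding abs_abscissa_def by (intro Inf_lower) auto

lemma summable_of_abs_abscissa_less:
  assumes "frequencies lam" "abs_abscissa lam a < ereal \<sigma>"
  shows "summable (\<lambda>n. norm (a (Suc n)) * lam (Suc n) powr (- \<sigma>))"
proof -
  from assms(2) obtain \<tau> where \<tau>: "summable (\<lambda>n. norm (a (Suc n)) * lam (Suc n) powr (- \<tau>))" "\<tau> < \<sigma>"
    unfolding abs_abscissa_def Inf_less_iff by auto
  show ?thesis by (rule summable_dirichlet_mono[OF assms(1) \<tau>(1)]) (use \<tau> in simp)
qed

lemma abs_abscissa_less_half_plane:
  "open {s. A < ereal (Re s)}" "convex {s. A < ereal (Re s)}"
proof -
  have "open {s. A < ereal (Re s)} \<and> convex {s. A < ereal (Re s)}"
    by (cases A) (auto simp: open_halfspace_Re_gt convex_halfspace_Re_gt)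
  then show "open {s. A < ereal (Re s)}" "convex {s. A < ereal (Re s)}" by auto
qed

lemma norm_dirichlet_term_le:
  assumes "frequencies lam" "\<sigma> \<le> Re s" "Re s \<le> \<tau>"
  shows "norm (a (Suc n) * complex_of_real (lam (Suc n)) powr (- s))
     \<le> norm (a (Suc n)) * lam (Suc n) powr (- \<sigma>) * max 1 (lam (Suc 0) powr (- (\<tau> - \<sigma>)))"
proof -
  have pos: "lam (Suc n) > 0" "lam (Suc 0) > 0" using frequencies_pos[OF assms(1)] by auto
  have "norm (a (Suc n) * complex_of_real (lam (Suc n)) powr (- s)) = norm (a (Suc n)) * lam (Suc n) powr (- Re s)"
    using pos by (simp add: norm_mult norm_powr_real_powr)
  also have "lam (Suc n) powr (- Re s) = lam (Suc n) powr (- \<sigma>) * lam (Suc n) powr (- (Re s - \<sigma>))"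
    by (simp flip: powr_add)
  also have "lam (Suc n) powr (- (Re s - \<sigma>)) \<le> lam (Suc 0) powr (- (Re s - \<sigma>))"
    using assms pos frequencies_ge_first[of lam n] by (intro powr_mono2') auto
  also have "lam (Suc 0) powr (- (Re s - \<sigma>)) \<le> max 1 (lam (Suc 0) powr (- (\<tau> - \<sigma>)))"
  proof (cases "lam (Suc 0) \<ge> 1")
    case True
    then have "lam (Suc 0) powr (- (Re s - \<sigma>)) \<le> lam (Suc 0) powr 0"
      using assms by (intro powr_mono) auto
    then show ?thesis using pos by simp
  next
    case False
    then have "lam (Suc 0) powr (- (Re s - \<sigma>)) \<le> lam (Suc 0) powr (- (\<tau> - \<sigma>))"
      using assms pos by (intro powr_mono') auto
    then show ?thesis by simp
  qed
  finally show ?thesis by (simp add: mult_left_mono mult.assoc)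
qed

lemma summable_dirichlet_series:
  assumes "frequencies lam" "summable (\<lambda>n. norm (a (Suc n)) * lam (Suc n) powr (- \<sigma>))" "\<sigma> \<le> Re s"
  shows "summable (\<lambda>n. norm (a (Suc n) * complex_of_real (lam (Suc n)) powr (- s)))"
  by (rule summable_comparison_test'[OF summable_mult2[OF assms(2)]])
     (use norm_dirichlet_term_le[OF assms(1,3) order_refl] in auto)

lemma holomorphic_dirichlet_series:
  assumes "frequencies lam"
  shows "dirichlet_series lam a holomorphic_on {s. abs_abscissa lam a < ereal (Re s)}"
proof (rule holomorphic_uniform_sequence)
  let ?f = "\<lambda>n s. \<Sum>i<n. a (Suc i) * complex_of_real (lam (Suc i)) powr (- s)"
  show "open {s. abs_abscissa lam a < ereal (Re s)}" by (rule abs_abscissa_less_half_plane)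
  show "?f n holomorphic_on {s. abs_abscissa lam a < ereal (Re s)}" for n
    by (intro holomorphic_intros)
  fix x assume x: "x \<in> {s. abs_abscissa lam a < ereal (Re s)}"
  then obtain \<sigma> where "abs_abscissa lam a < ereal \<sigma>" "ereal \<sigma> < ereal (Re x)"
    using ereal_dense2[of "abs_abscissa lam a" "ereal (Re x)"] by blast
  then have sig: "abs_abscissa lam a < ereal \<sigma>" "\<sigma> < Re x" by auto
  define d where "d = Re x - \<sigma>"
  have ball: "\<sigma> \<le> Re s \<and> Re s \<le> Re x + d" if "s \<in> cball x d" for s
    using that abs_Re_le_cmod[of "x - s"] by (auto simp: d_def dist_norm)
  have "cball x d \<subseteq> {s. abs_abscissa lam a < ereal (Re s)}"
    using ball sig by (auto intro: less_le_trans)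
  moreover have "uniform_limit (cball x d) ?f (dirichlet_series lam a) sequentially"
    unfolding dirichlet_series_def
  proof (rule Weierstrass_m_test)
    show "summable (\<lambda>n. norm (a (Suc n)) * lam (Suc n) powr (- \<sigma>) * max 1 (lam (Suc 0) powr (- (Re x + d - \<sigma>))))"
      using sig assms by (intro summable_mult2 summable_of_abs_abscissa_less)
    show "norm (a (Suc n) * complex_of_real (lam (Suc n)) powr (- s))
       \<le> norm (a (Suc n)) * lam (Suc n) powr (- \<sigma>) * max 1 (lam (Suc 0) powr (- (Re x + d - \<sigma>)))"
      if "s \<in> cball x d" for n s
      using ball[OF that] assms by (intro norm_dirichlet_term_le) auto
  qed
  ultimately show "\<exists>d>0. cball x d \<subseteq> {s. abs_abscissa lam a < ereal (Re s)}
      \<and> uniform_limit (cball x d) ?f (dirichlet_series lam a) sequentially"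
    using sig by (intro exI[of _ d]) (auto simp: d_def)
qed

text \<open>Absolute convergence at one exponent is the only growth information about the
  coefficients. It is passed on to every weight that eventually lies below that power, in particular
  to Gaussian and exponential ones.\<close>

lemma summable_dirichlet_weight:
  assumes "frequencies lam" "summable (\<lambda>n. norm (a (Suc n)) * lam (Suc n) powr (- \<sigma>))"
    and h: "eventually (\<lambda>x. norm (h x) \<le> x powr (- \<sigma>)) at_top"
  shows "summable (\<lambda>n. norm (a (Suc n)) * h (lam (Suc n)) :: real)"
proof (rule summable_comparison_test_ev[OF _ assms(2)])
  have "eventually (\<lambda>n. norm (h (lam (Suc n))) \<le> lam (Suc n) powr (- \<sigma>)) sequentially"
    using h frequencies_filterlim_Suc[OF assms(1)] by (rule eventually_compose_filterlim)
  then show "eventually (\<lambda>n. norm (norm (a (Suc n)) * h (lam (Suc n))) \<le> norm (a (Suc n)) * lam (Suc n) powr (- \<sigma>)) sequentially"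
    by eventually_elim (auto simp: abs_mult intro!: mult_left_mono)
qed

lemma summable_dirichlet_gauss:
  assumes "frequencies lam" "summable (\<lambda>n. norm (a (Suc n)) * lam (Suc n) powr (- \<sigma>))" "\<epsilon> > 0"
  shows "summable (\<lambda>n. norm (a (Suc n)) * exp (K * lam (Suc n) - \<epsilon> * (lam (Suc n))\<^sup>2))"
proof (rule summable_dirichlet_weight[OF assms(1,2)])
  have "eventually (\<lambda>x::real. exp (K * x - \<epsilon> * x\<^sup>2) \<le> x powr (- \<sigma>)) at_top"
    using assms(3) by real_asymp
  then show "eventually (\<lambda>x::real. norm (exp (K * x - \<epsilon> * x\<^sup>2)) \<le> x powr (- \<sigma>)) at_top"
    by simp
qed

lemma summable_dirichlet_exp:
  assumes "frequencies lam" "summable (\<lambda>n. norm (a (Suc n)) * lam (Suc n) powr (- \<sigma>))" "\<epsilon> > 0"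
  shows "summable (\<lambda>n. norm (a (Suc n)) * exp (- \<epsilon> * lam (Suc n)))"
    and "summable (\<lambda>n. norm (a (Suc n)) * (lam (Suc n) * exp (- \<epsilon> * lam (Suc n))))"
proof -
  show "summable (\<lambda>n. norm (a (Suc n)) * exp (- \<epsilon> * lam (Suc n)))"
  proof (rule summable_dirichlet_weight[OF assms(1,2)])
    have "eventually (\<lambda>x::real. exp (- \<epsilon> * x) \<le> x powr (- \<sigma>)) at_top"
      using assms(3) by real_asymp
    then show "eventually (\<lambda>x::real. norm (exp (- \<epsilon> * x)) \<le> x powr (- \<sigma>)) at_top"
      by simp
  qed
  show "summable (\<lambda>n. norm (a (Suc n)) * (lam (Suc n) * exp (- \<epsilon> * lam (Suc n))))"
  proof (rule summable_dirichlet_weight[OF assms(1,2)])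
    have "eventually (\<lambda>x::real. x * exp (- \<epsilon> * x) \<le> x powr (- \<sigma>)) at_top"
      using assms(3) by real_asymp
    then show "eventually (\<lambda>x::real. norm (x * exp (- \<epsilon> * x)) \<le> x powr (- \<sigma>)) at_top"
      using eventually_gt_at_top[of 0] by eventually_elim (simp add: abs_mult)
  qed
qed

section \<open>Symmetry between a series and its dual\<close>

lemma gamma_pair_sym:
  assumes "gamma_pair \<Delta> r lam a mu b"
  shows "gamma_pair \<Delta> r mu b lam a"
proof -
  from assms obtain chi where r: "0 < r" and d: "dirichlet_data lam a" "dirichlet_data mu b"
    and mero: "chi meromorphic_on UNIV"
    and e1: "\<forall>s. ereal (Re s) > abs_abscissa lam a \<longrightarrow> chi s = \<Delta> s * dirichlet_series lam a s"
    and e2: "\<forall>s. ereal (Re s) < ereal r - abs_abscissa mu b \<longrightarrow>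
              chi s = \<Delta> (of_real r - s) * dirichlet_series mu b (of_real r - s)"
    and decay: "\<forall>\<sigma>1 \<sigma>2. \<forall>\<epsilon>>0. \<exists>T. \<forall>s. \<sigma>1 \<le> Re s \<and> Re s \<le> \<sigma>2 \<and> T \<le> \<bar>Im s\<bar> \<longrightarrow> norm (chi s) < \<epsilon>"
    and K: "\<exists>K. compact K \<and> chi holomorphic_on (- K)"
    unfolding gamma_pair_def by blast
  obtain A B where AB: "abs_abscissa lam a = ereal A" "abs_abscissa mu b = ereal B"
    using d unfolding dirichlet_data_def by (cases "abs_abscissa lam a"; cases "abs_abscissa mu b") auto
  define chi' where "chi' s = chi (of_real r - s)" for s
  have "chi' meromorphic_on UNIV"
    unfolding chi'_def by (rule meromorphic_on_compose[OF mero]) (auto intro!: analytic_intros)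
  moreover have "\<forall>s. ereal (Re s) > abs_abscissa mu b \<longrightarrow> chi' s = \<Delta> s * dirichlet_series mu b s"
    using e2 by (auto simp: AB chi'_def)
  moreover have "\<forall>s. ereal (Re s) < ereal r - abs_abscissa lam a \<longrightarrow>
              chi' s = \<Delta> (of_real r - s) * dirichlet_series lam a (of_real r - s)"
    using e1 by (auto simp: AB chi'_def)
  moreover have "\<forall>\<sigma>1 \<sigma>2. \<forall>\<epsilon>>0. \<exists>T. \<forall>s. \<sigma>1 \<le> Re s \<and> Re s \<le> \<sigma>2 \<and> T \<le> \<bar>Im s\<bar> \<longrightarrow> norm (chi' s) < \<epsilon>"
  proof (intro allI impI)
    fix \<sigma>1 \<sigma>2 \<epsilon> :: real assume "\<epsilon> > 0"
    then obtain T where T: "\<forall>s. r - \<sigma>2 \<le> Re s \<and> Re s \<le> r - \<sigma>1 \<and> T \<le> \<bar>Im s\<bar> \<longrightarrow> norm (chi s) < \<epsilon>"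
      using decay by blast
    show "\<exists>T. \<forall>s. \<sigma>1 \<le> Re s \<and> Re s \<le> \<sigma>2 \<and> T \<le> \<bar>Im s\<bar> \<longrightarrow> norm (chi' s) < \<epsilon>"
      by (rule exI[of _ T]) (use T in \<open>auto simp: chi'_def\<close>)
  qed
  moreover have "\<exists>K. compact K \<and> chi' holomorphic_on (- K)"
  proof -
    from K obtain K where K: "compact K" "chi holomorphic_on (- K)" by blast
    let ?K = "(\<lambda>s. of_real r - s) ` K"
    have "compact ?K" by (intro compact_continuous_image continuous_intros K)
    moreover have "(chi \<circ> (\<lambda>s. of_real r - s)) holomorphic_on (- ?K)"
    proof (rule holomorphic_on_compose_gen[OF _ K(2)])
      show "(\<lambda>s. of_real r - s) ` (- ?K) \<subseteq> - K"
      proof safe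
        fix s assume "s \<notin> ?K" "of_real r - s \<in> K"
        then show False by (metis diff_diff_eq2 add_diff_cancel_left' image_eqI)
      qed
    qed (intro holomorphic_intros)
    ultimately show ?thesis by (auto simp: o_def chi'_def[abs_def])
  qed
  ultimately show ?thesis
    unfolding gamma_pair_def using r d by blast
qed

lemma class_B_sym: "class_B \<delta> lam a mu b \<Phi> \<Psi> \<Longrightarrow> class_B \<delta> mu b lam a \<Psi> \<Phi>"
  unfolding class_B_def bochner_pair_def using gamma_pair_sym by blast

subsection \<open>Bochner pairs and their theta relation\<close>

text \<open>The poles of the Gamma factor together with the point 1, the possible pole of
  \<open>\<Phi>\<close>; 1 is kept for both parities so that they can be treated alike.\<close>

definition bochner_poles :: "nat \<Rightarrow> complex set" where
  "bochner_poles \<delta> = insert 1 {s. (s + of_nat \<delta>) / 2 \<in> \<int>\<^sub>\<le>\<^sub>0}"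

lemma bochner_poles_cases:
  assumes "s \<in> bochner_poles \<delta>"
  shows "s = 1 \<or> (\<exists>n. s = - of_nat (2 * n + \<delta>))"
proof -
  have "s = - of_nat (2 * n + \<delta>)" if "(s + of_nat \<delta>) / 2 = - of_nat n" for n
    using that by (auto simp: complex_eq_iff)
  then show ?thesis using assms by (auto simp: bochner_poles_def elim!: nonpos_Ints_cases')
qed

lemma bochner_poles_countable: "countable (bochner_poles \<delta>)"
proof (rule countable_subset)
  show "bochner_poles \<delta> \<subseteq> insert 1 (range (\<lambda>n. - of_nat (2 * n + \<delta>)))"
    using bochner_poles_cases by blast
qed auto

lemma bochner_poles_closed: "closed (bochner_poles \<delta>)"
proof -
  have "closed (\<int>\<^sub>\<le>\<^sub>0 :: complex set)" by (intro closed_subset_Ints) (auto simp: nonpos_Ints_def)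
  then have "closed ((\<lambda>s. (s + of_nat \<delta>) / 2 :: complex) -` \<int>\<^sub>\<le>\<^sub>0)"
    by (rule closed_vimage) (intro continuous_intros, simp)
  then show ?thesis by (simp add: bochner_poles_def vimage_def)
qed

lemma bochner_poles_Im: "s \<in> bochner_poles \<delta> \<Longrightarrow> Im s = 0 \<and> Re s \<le> 1"
  using bochner_poles_cases by fastforce

text \<open>Both sides are holomorphic off a closed countable set, whose complement is connected,
  and agree far to the right. Neither the location of the exceptional points \<open>S\<close> of
  \<open>chi\<close> nor their number matters, as long as they are finite in number.\<close>

lemma gamma_pair_continuation:
  assumes gp: "gamma_pair \<Delta> r lam a mu b"
    and P: "closed P" "countable P" "\<And>s. s \<in> P \<Longrightarrow> Re s \<le> R"
    and \<Delta>: "\<Delta> holomorphic_on - P" and \<Phi>: "\<Phi> holomorphic_on - P"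
    and eq: "\<And>s. abs_abscissa lam a < ereal (Re s) \<Longrightarrow> s \<notin> P \<Longrightarrow> \<Phi> s = dirichlet_series lam a s"
    and S: "finite S" "chi holomorphic_on - S"
    and chi: "\<And>s. abs_abscissa lam a < ereal (Re s) \<Longrightarrow> chi s = \<Delta> s * dirichlet_series lam a s"
    and s: "s \<notin> P" "s \<notin> S"
  shows "chi s = \<Delta> s * \<Phi> s"
proof -
  obtain A where A: "abs_abscissa lam a = ereal A"
    using gp unfolding gamma_pair_def dirichlet_data_def by (cases "abs_abscissa lam a") auto
  have "bounded (Re ` S)" using S by (intro finite_imp_bounded) auto
  then obtain B where B: "\<And>p. p \<in> S \<Longrightarrow> \<bar>Re p\<bar> \<le> B"
    unfolding bounded_iff by auto
  define M where "M = max A (max B R)"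
  have op: "open (- (P \<union> S))" by (intro open_Compl closed_Un P(1) finite_imp_closed S(1))
  have con: "connected (- (P \<union> S))"
    using connected_open_diff_countable[of UNIV "P \<union> S"] P S connected_UNIV countable_finite
    by (auto simp: Compl_eq_Diff_UNIV)
  show ?thesis
  proof (rule analytic_continuation_open[where s = "{s. Re s > M}" and s' = "- (P \<union> S)"
        and f = chi and g = "\<lambda>s. \<Delta> s * \<Phi> s" and z = s])
    show "open {s. Re s > M}" by (rule open_halfspace_Re_gt)
    show "{s. Re s > M} \<noteq> {}" by (auto intro!: exI[of _ "of_real (M + 1)"])
    show "{s. Re s > M} \<subseteq> - (P \<union> S)" using P(3) B by (force simp: M_def)
    show "chi holomorphic_on - (P \<union> S)" using S(2) by (rule holomorphic_on_subset) auto
    show "(\<lambda>s. \<Delta> s * \<Phi> s) holomorphic_on - (P \<union> S)"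
      by (intro holomorphic_intros holomorphic_on_subset[OF \<Delta>] holomorphic_on_subset[OF \<Phi>]) auto
    show "chi z = \<Delta> z * \<Phi> z" if "z \<in> {s. Re s > M}" for z
    proof -
      have "z \<notin> P" using that P(3) by (force simp: M_def)
      then show ?thesis using that chi[of z] eq[of z] by (auto simp: A M_def)
    qed
  qed (use op con s in auto)
qed

section \<open>The completed function of a Bochner pair\<close>

lemma class_B_holomorphic:
  assumes "class_B \<delta> lam a mu b \<Phi> \<Psi>"
  shows "\<Phi> holomorphic_on - {1}" "\<delta> = 1 \<Longrightarrow> \<Phi> holomorphic_on UNIV"
    "\<And>s. abs_abscissa lam a < ereal (Re s) \<Longrightarrow> s \<noteq> 1 \<Longrightarrow> \<Phi> s = dirichlet_series lam a s"
    "\<delta> = 0 \<or> \<delta> = 1"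
  using assms
  by (auto simp: class_B_def bochner_pair_def continues_except_simple_pole_def continues_to_def
       intro: holomorphic_on_subset)

text \<open>A normal form of \<open>chi\<close>. A function that is \<open>meromorphic_on\<close> a
  set may have wrong values at removable singularities, and \<open>chi\<close> may have exceptional
  points anywhere in a compact set. \<open>X\<close> is the same function with these values
  corrected, so that only 0 and 1 remain as singularities.\<close>

definition bochner_completion ::
  "nat \<Rightarrow> (complex \<Rightarrow> complex) \<Rightarrow> (complex \<Rightarrow> complex) \<Rightarrow> (complex \<Rightarrow> complex) \<Rightarrow> bool" where
  "bochner_completion \<delta> \<Phi> \<Psi> X \<longleftrightarrow>
     X holomorphic_on - {0, 1} \<and>
     (\<forall>s. s \<notin> bochner_poles \<delta> \<longrightarrow> s \<noteq> 0 \<longrightarrow> X s = Gamma ((s + of_nat \<delta>) / 2) * \<Phi> s) \<and>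
     (\<forall>s. 1 - s \<notin> bochner_poles \<delta> \<longrightarrow> s \<noteq> 1 \<longrightarrow> X s = Gamma ((1 - s + of_nat \<delta>) / 2) * \<Psi> (1 - s)) \<and>
     (\<forall>\<sigma>1 \<sigma>2. \<forall>\<epsilon>>0. \<exists>T. \<forall>s. \<sigma>1 \<le> Re s \<and> Re s \<le> \<sigma>2 \<and> T \<le> \<bar>Im s\<bar> \<longrightarrow> norm (X s) < \<epsilon>)"

lemma bochner_completionD:
  assumes "bochner_completion \<delta> \<Phi> \<Psi> X"
  shows "X holomorphic_on - {0, 1}"
    "\<And>s. s \<notin> bochner_poles \<delta> \<Longrightarrow> s \<noteq> 0 \<Longrightarrow> X s = Gamma ((s + of_nat \<delta>) / 2) * \<Phi> s"
    "\<And>s. 1 - s \<notin> bochner_poles \<delta> \<Longrightarrow> s \<noteq> 1 \<Longrightarrow> X s = Gamma ((1 - s + of_nat \<delta>) / 2) * \<Psi> (1 - s)"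
    "\<And>\<sigma>1 \<sigma>2 \<epsilon>. \<epsilon> > 0 \<Longrightarrow> \<exists>T. \<forall>s. \<sigma>1 \<le> Re s \<and> Re s \<le> \<sigma>2 \<and> T \<le> \<bar>Im s\<bar> \<longrightarrow> norm (X s) < \<epsilon>"
  using assms unfolding bochner_completion_def by blast+

lemma bochner_completion_sym:
  assumes "bochner_completion \<delta> \<Phi> \<Psi> X"
  shows "bochner_completion \<delta> \<Psi> \<Phi> (\<lambda>s. X (1 - s))"
  unfolding bochner_completion_def
proof (intro conjI allI impI)
  note X = bochner_completionD[OF assms]
  show "(\<lambda>s. X (1 - s)) holomorphic_on - {0, 1}"
    by (rule holomorphic_on_compose_gen[OF _ X(1), of "\<lambda>u. 1 - u", unfolded o_def])
       (auto intro!: holomorphic_intros)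
  show "X (1 - s) = Gamma ((s + of_nat \<delta>) / 2) * \<Psi> s" if "s \<notin> bochner_poles \<delta>" "s \<noteq> 0" for s
    using X(3)[of "1 - s"] that by simp
  show "X (1 - s) = Gamma ((1 - s + of_nat \<delta>) / 2) * \<Phi> (1 - s)" if "1 - s \<notin> bochner_poles \<delta>" "s \<noteq> 1" for s
    using X(2)[of "1 - s"] that by simp
  fix \<sigma>1 \<sigma>2 \<epsilon> :: real assume "\<epsilon> > 0"
  then obtain T where T: "\<forall>s. 1 - \<sigma>2 \<le> Re s \<and> Re s \<le> 1 - \<sigma>1 \<and> T \<le> \<bar>Im s\<bar> \<longrightarrow> norm (X s) < \<epsilon>"
    using X(4) by blast
  show "\<exists>T. \<forall>s. \<sigma>1 \<le> Re s \<and> Re s \<le> \<sigma>2 \<and> T \<le> \<bar>Im s\<bar> \<longrightarrow> norm (X (1 - s)) < \<epsilon>"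
    by (rule exI[of _ T]) (use T in auto)
qed

text \<open>The two formulas for \<open>chi\<close> complement each other: the exceptional points of
  \<open>X1\<close> are 1 and points with \<open>Re s \<le> 0\<close>, those of \<open>X2\<close>
  are 0 and points with \<open>Re s \<ge> 1\<close>. Hence only 0 and 1 are not covered by one of
  them.\<close>

lemma bochner_completion_exists:
  assumes "class_B \<delta> lam a mu b \<Phi> \<Psi>"
  shows "\<exists>X. bochner_completion \<delta> \<Phi> \<Psi> X"
proof -
  let ?P = "bochner_poles \<delta>"
  define P2 where "P2 = {s. 1 - s \<in> ?P}"
  let ?D = "\<lambda>s::complex. Gamma ((s + of_nat \<delta>) / 2)"
  define X1 where "X1 s = ?D s * \<Phi> s" for s
  define X2 where "X2 s = ?D (1 - s) * \<Psi> (1 - s)" for s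
  have gp: "gamma_pair ?D 1 lam a mu b" using assms by (simp add: class_B_def bochner_pair_def)
  then obtain chi where chi: "chi meromorphic_on UNIV"
    "\<And>s. ereal (Re s) > abs_abscissa lam a \<Longrightarrow> chi s = ?D s * dirichlet_series lam a s"
    "\<And>s. ereal (Re s) < ereal 1 - abs_abscissa mu b \<Longrightarrow> chi s = ?D (1 - s) * dirichlet_series mu b (1 - s)"
    "\<And>\<sigma>1 \<sigma>2 \<epsilon>. \<epsilon> > 0 \<Longrightarrow> \<exists>T. \<forall>s. \<sigma>1 \<le> Re s \<and> Re s \<le> \<sigma>2 \<and> T \<le> \<bar>Im s\<bar> \<longrightarrow> norm (chi s) < \<epsilon>"
    "\<exists>K. compact K \<and> chi holomorphic_on (- K)"
    unfolding gamma_pair_def by auto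
  obtain B where B: "abs_abscissa mu b = ereal B"
    using gp unfolding gamma_pair_def dirichlet_data_def by (cases "abs_abscissa mu b") auto
  obtain K where K: "compact K" "chi holomorphic_on (- K)" using chi(5) by blast
  \<comment> \<open>Finite, since the singularities lie in a compact set and those of a meromorphic
    function do not accumulate.\<close>
  define S where "S = {w. \<not> chi analytic_on {w}}"
  have SK: "S \<subseteq> K"
  proof
    fix w assume "w \<in> S"
    show "w \<in> K"
    proof (rule ccontr)
      assume "w \<notin> K"
      moreover have "chi analytic_on (- K)"
        using K compact_imp_closed by (subst analytic_on_open) auto
      ultimately have "chi analytic_on {w}" by (auto intro: analytic_on_subset)
      with \<open>w \<in> S\<close> show False by (simp add: S_def)
    qed
  qed
  have finS: "finite S"
  proof (rule ccontr)
    assume "infinite S"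
    then obtain z where "z \<in> K" "z islimpt S"
      using K(1) SK by (auto simp: compact_eq_Bolzano_Weierstrass)
    then show False using meromorphic_on_imp_not_islimpt_singularities[OF chi(1), of z] by (auto simp: S_def)
  qed
  have holS: "chi holomorphic_on - S"
  proof (rule analytic_imp_holomorphic)
    show "chi analytic_on - S" by (subst analytic_on_analytic_at) (auto simp: S_def)
  qed
  have DholP: "?D holomorphic_on - ?P"
    by (rule holomorphic_on_compose_gen[of "\<lambda>s. (s + of_nat \<delta>) / 2" _ Gamma "- \<int>\<^sub>\<le>\<^sub>0", unfolded o_def])
       (auto intro!: holomorphic_intros simp: bochner_poles_def)
  have sub: "- ?P \<subseteq> - {1}" by (auto simp: bochner_poles_def)
  have e1: "chi s = X1 s" if "s \<notin> ?P" "s \<notin> S" for s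
    unfolding X1_def
  proof (rule gamma_pair_continuation[OF gp bochner_poles_closed bochner_poles_countable _ DholP _ _ finS holS chi(2) that])
    show "\<Phi> holomorphic_on - ?P" using class_B_holomorphic(1)[OF assms] sub by (rule holomorphic_on_subset)
    show "\<Phi> s = dirichlet_series lam a s" if "abs_abscissa lam a < ereal (Re s)" "s \<notin> ?P" for s
      using class_B_holomorphic(3)[OF assms that(1)] that(2) by (auto simp: bochner_poles_def)
    show "Re s \<le> 1" if "s \<in> ?P" for s using bochner_poles_Im[OF that] by simp
  qed
  have e2: "chi s = X2 s" if "1 - s \<notin> ?P" "s \<notin> S" for s
  proof -
    have "chi (1 - (1 - s)) = ?D (1 - s) * \<Psi> (1 - s)"
    proof (rule gamma_pair_continuation[where chi = "\<lambda>u. chi (1 - u)" and S = "(\<lambda>s. 1 - s) ` S",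
              OF gamma_pair_sym[OF gp] bochner_poles_closed bochner_poles_countable _ DholP])
      show "\<Psi> holomorphic_on - ?P" using class_B_holomorphic(1)[OF class_B_sym[OF assms]] sub by (rule holomorphic_on_subset)
      show "\<Psi> s = dirichlet_series mu b s" if "abs_abscissa mu b < ereal (Re s)" "s \<notin> ?P" for s
        using class_B_holomorphic(3)[OF class_B_sym[OF assms] that(1)] that(2) by (auto simp: bochner_poles_def)
      show "Re s \<le> 1" if "s \<in> ?P" for s using bochner_poles_Im[OF that] by simp
      show "(\<lambda>u. chi (1 - u)) holomorphic_on - (\<lambda>s. 1 - s) ` S"
        by (rule holomorphic_on_compose_gen[OF _ holS, of "\<lambda>u. 1 - u", unfolded o_def])
           (auto intro!: holomorphic_intros image_eqI[where x = "1 - _"])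
      show "chi (1 - s) = ?D s * dirichlet_series mu b s" if "abs_abscissa mu b < ereal (Re s)" for s
        using chi(3)[of "1 - s"] that by (simp add: B)
    qed (use finS that in auto)
    then show ?thesis by (simp add: X2_def)
  qed
  have op: "open (- ?P)" "open (- P2)"
  proof -
    show "open (- ?P)" using bochner_poles_closed by auto
    have "P2 = (\<lambda>s. 1 - s) -` ?P" by (auto simp: P2_def)
    moreover have "closed ((\<lambda>s. 1 - s) -` ?P)"
      by (rule closed_vimage[OF bochner_poles_closed]) (intro continuous_intros)
    ultimately show "open (- P2)" by auto
  qed
  have X1hol: "X1 holomorphic_on - ?P" unfolding X1_def
    by (intro holomorphic_intros DholP holomorphic_on_subset[OF class_B_holomorphic(1)[OF assms] sub])
  have X2hol: "X2 holomorphic_on - P2"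
  proof -
    have "((\<lambda>s. ?D s * \<Psi> s) \<circ> (\<lambda>s. 1 - s)) holomorphic_on - P2"
    proof (rule holomorphic_on_compose_gen[where t = "- ?P"])
      show "(\<lambda>s. ?D s * \<Psi> s) holomorphic_on - ?P"
        by (intro holomorphic_intros DholP holomorphic_on_subset[OF class_B_holomorphic(1)[OF class_B_sym[OF assms]] sub])
    qed (auto intro!: holomorphic_intros simp: P2_def)
    then show ?thesis by (simp add: X2_def[abs_def] o_def)
  qed
  have con: "connected (- (?P \<union> P2))"
  proof -
    have "P2 = (\<lambda>s. 1 - s) ` ?P" by (force simp: P2_def image_iff intro: exI[of _ "1 - _"])
    then have "countable (?P \<union> P2)" using bochner_poles_countable by auto
    then show ?thesis
      using connected_open_diff_countable[of UNIV "?P \<union> P2"] connected_UNIV by (auto simp: Compl_eq_Diff_UNIV)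
  qed
  have e12: "X1 s = X2 s" if "s \<notin> ?P" "s \<notin> P2" for s
  proof (rule analytic_continuation_open[where s = "- (?P \<union> P2 \<union> S)" and s' = "- (?P \<union> P2)"
        and f = X1 and g = X2 and z = s])
    show "open (- (?P \<union> P2 \<union> S))" "open (- (?P \<union> P2))"
      using op finS by (auto simp: closed_def[symmetric] intro!: closed_Un finite_imp_closed simp flip: open_closed)
    show "- (?P \<union> P2 \<union> S) \<noteq> {}"
    proof -
      have "bounded (Im ` S)" using finS by (intro finite_imp_bounded) auto
      then obtain M where M: "\<And>p. p \<in> S \<Longrightarrow> \<bar>Im p\<bar> \<le> M" unfolding bounded_iff by auto
      have "Complex 0 (\<bar>M\<bar> + 1) \<notin> ?P \<union> P2 \<union> S"
        using M[of "Complex 0 (\<bar>M\<bar> + 1)"] bochner_poles_Im[of "Complex 0 (\<bar>M\<bar> + 1)" \<delta>]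
          bochner_poles_Im[of "1 - Complex 0 (\<bar>M\<bar> + 1)" \<delta>] abs_ge_self[of M] abs_ge_zero[of M]
        by (auto simp: P2_def simp del: abs_ge_self abs_ge_zero)
      then show ?thesis by blast
    qed
    show "X1 holomorphic_on - (?P \<union> P2)" by (rule holomorphic_on_subset[OF X1hol]) auto
    show "X2 holomorphic_on - (?P \<union> P2)" by (rule holomorphic_on_subset[OF X2hol]) auto
    show "X1 z = X2 z" if "z \<in> - (?P \<union> P2 \<union> S)" for z
      using e1[of z] e2[of z] that by (auto simp: P2_def)
  qed (use con that in auto)
  have PP: "Re s \<le> 0 \<or> s = 1" if "s \<in> ?P" for s
    using bochner_poles_cases[OF that] by auto
  have P2P: "Re s \<ge> 1 \<or> s = 0" if "s \<in> P2" for s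
    using PP[of "1 - s"] that by (auto simp: P2_def)
  \<comment> \<open>Either formula is used where it can only fail at one point, the left one at 0
    and the right one at 1; on the common domain they agree by \<open>e12\<close>.\<close>
  define X where "X s = (if Re s < 1/2 then X2 s else X1 s)" for s
  have XX1: "X s = X1 s" if "s \<notin> ?P" "s \<noteq> 0" for s
    using e12[of s] that P2P[of s] by (cases "s \<in> P2") (auto simp: X_def)
  have XX2: "X s = X2 s" if "s \<notin> P2" "s \<noteq> 1" for s
    using e12[of s] that PP[of s] by (cases "s \<in> ?P") (auto simp: X_def)
  show ?thesis
    unfolding bochner_completion_def
  proof (intro exI[of _ X] conjI allI impI)
    have "X holomorphic_on (- ?P - {0}) \<union> (- P2 - {1})"
    proof (rule holomorphic_on_Un)
      have "X1 holomorphic_on (- ?P - {0})" by (rule holomorphic_on_subset[OF X1hol]) auto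
      then show "X holomorphic_on (- ?P - {0})"
        by (rule holomorphic_cong[THEN iffD1, rotated 2]) (auto simp: XX1)
      have "X2 holomorphic_on (- P2 - {1})" by (rule holomorphic_on_subset[OF X2hol]) auto
      then show "X holomorphic_on (- P2 - {1})"
        by (rule holomorphic_cong[THEN iffD1, rotated 2]) (auto simp: XX2)
    qed (use op in auto)
    then show "X holomorphic_on - {0, 1}"
    proof (rule holomorphic_on_subset)
      show "- {0, 1} \<subseteq> (- ?P - {0}) \<union> (- P2 - {1})"
        using PP P2P by force
    qed
    show "X s = Gamma ((s + of_nat \<delta>) / 2) * \<Phi> s" if "s \<notin> ?P" "s \<noteq> 0" for s
      using XX1[OF that] by (simp add: X1_def)
    show "X s = Gamma ((1 - s + of_nat \<delta>) / 2) * \<Psi> (1 - s)" if "1 - s \<notin> ?P" "s \<noteq> 1" for s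
      using XX2[of s] that by (simp add: X2_def P2_def)
    fix \<sigma>1 \<sigma>2 \<epsilon> :: real assume "\<epsilon> > 0"
    then obtain T where T: "\<forall>s. \<sigma>1 \<le> Re s \<and> Re s \<le> \<sigma>2 \<and> T \<le> \<bar>Im s\<bar> \<longrightarrow> norm (chi s) < \<epsilon>"
      using chi(4) by blast
    have "bounded (Im ` S)" using finS by (intro finite_imp_bounded) auto
    then obtain M where M: "\<And>p. p \<in> S \<Longrightarrow> \<bar>Im p\<bar> \<le> M" unfolding bounded_iff by auto
    show "\<exists>T. \<forall>s. \<sigma>1 \<le> Re s \<and> Re s \<le> \<sigma>2 \<and> T \<le> \<bar>Im s\<bar> \<longrightarrow> norm (X s) < \<epsilon>"
    proof (intro exI[of _ "max T (\<bar>M\<bar> + 1)"] allI impI)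
      fix s assume s: "\<sigma>1 \<le> Re s \<and> Re s \<le> \<sigma>2 \<and> max T (\<bar>M\<bar> + 1) \<le> \<bar>Im s\<bar>"
      have "s \<notin> S" using M[of s] s by auto
      moreover have "s \<notin> ?P" "s \<noteq> 0" using bochner_poles_Im[of s] s by auto
      ultimately have "X s = chi s" using XX1[of s] e1[of s] by simp
      then show "norm (X s) < \<epsilon>" using T s by simp
    qed
  qed
qed

text \<open>The Gamma factor has a pole at \<open>- of_nat \<delta>\<close>. For even parity this is
  the point 0 and gives the residue directly. For odd parity it is the point -1, where
  \<open>X\<close> is holomorphic, so \<open>\<Phi>\<close> must vanish there; and at 0 the dual
  formula is regular, as \<open>\<Psi>\<close> is entire, so the limit is 0 as well.\<close>

lemma bochner_limit_0:
  assumes B: "class_B \<delta> lam a mu b \<Phi> \<Psi>" and X: "bochner_completion \<delta> \<Phi> \<Psi> X"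
  shows "((\<lambda>s. X s * s) \<longlongrightarrow> 2 * \<Phi> (- of_nat \<delta>)) (at 0)" and "\<delta> = 1 \<Longrightarrow> \<Phi> (- of_nat \<delta>) = 0"
proof -
  note hol = bochner_completionD(1)[OF X] and X1 = bochner_completionD(2)[OF X]
    and X2 = bochner_completionD(3)[OF X]
  have res: "((\<lambda>s. Gamma ((s + of_nat \<delta>) / 2) * ((s + of_nat \<delta>) / 2)) \<longlongrightarrow> 1) (at (- of_nat \<delta> :: complex))"
  proof -
    have "filterlim (\<lambda>s::complex. (s + of_nat \<delta>) / 2) (at 0) (at (- of_nat \<delta>))"
      unfolding filterlim_at
    proof
      show "((\<lambda>s::complex. (s + of_nat \<delta>) / 2) \<longlongrightarrow> 0) (at (- of_nat \<delta>))"
        by (auto intro!: tendsto_eq_intros)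
      show "eventually (\<lambda>s::complex. (s + of_nat \<delta>) / 2 \<in> UNIV \<and> (s + of_nat \<delta>) / 2 \<noteq> 0) (at (- of_nat \<delta>))"
        by (rule eventually_mono[OF eventually_neq_at_within[of "- of_nat \<delta>"]]) (auto simp: add_eq_0_iff2)
    qed
    from filterlim_compose[OF Gamma_residues[of 0, simplified] this] show ?thesis by simp
  qed
  have cont: "(\<Phi> \<longlongrightarrow> \<Phi> (- of_nat \<delta>)) (at (- of_nat \<delta>))"
  proof -
    have "isCont \<Phi> (- of_nat \<delta>)"
      using class_B_holomorphic(1)[OF B]
      by (metis (no_types, lifting) ComplI continuous_on_interior holomorphic_on_imp_continuous_on
          interior_open open_Compl closed_singleton singletonD add_eq_0_iff2 of_nat_0 of_nat_Suc of_nat_eq_0_iff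
          Zero_not_Suc add.commute)
    then show ?thesis by (simp add: isCont_def)
  qed
  have lim: "((\<lambda>s. X s * ((s + of_nat \<delta>) / 2)) \<longlongrightarrow> \<Phi> (- of_nat \<delta>)) (at (- of_nat \<delta>))"
  proof (rule Lim_transform_eventually)
    show "((\<lambda>s. Gamma ((s + of_nat \<delta>) / 2) * ((s + of_nat \<delta>) / 2) * \<Phi> s) \<longlongrightarrow> \<Phi> (- of_nat \<delta>)) (at (- of_nat \<delta>))"
      using tendsto_mult[OF res cont] by simp
    have "eventually (\<lambda>s. s \<in> ball (- of_nat \<delta>) 1 - {- of_nat \<delta>}) (at (- of_nat \<delta> :: complex))"
      by (rule eventually_at_in_open) auto
    then show "eventually (\<lambda>s. Gamma ((s + of_nat \<delta>) / 2) * ((s + of_nat \<delta>) / 2) * \<Phi> s = X s * ((s + of_nat \<delta>) / 2)) (at (- of_nat \<delta>))"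
    proof eventually_elim
      case (elim s)
      have d: "\<bar>Re s + real \<delta>\<bar> < 1"
        using elim abs_Re_le_cmod[of "- of_nat \<delta> - s"] by (auto simp: dist_norm)
      have s1: "Re s < 1" using d by auto
      have "s \<noteq> 0"
      proof
        assume "s = 0"
        with d have "\<delta> = 0" by simp
        with elim \<open>s = 0\<close> show False by simp
      qed
      moreover have "s \<notin> bochner_poles \<delta>"
      proof
        assume "s \<in> bochner_poles \<delta>"
        then obtain n where n: "s = - of_nat (2 * n + \<delta>)" using bochner_poles_cases s1 by fastforce
        with d have "n = 0" by simp
        with n elim show False by simp
      qed
      ultimately show ?case using X1[of s] by simp
    qed
  qed
  show zero: "\<Phi> (- of_nat \<delta>) = 0" if "\<delta> = 1"
  proof -
    have "isCont X (- 1)"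
      using hol by (rule holomorphic_on_imp_continuous_on[THEN continuous_on_interior]) (auto simp: interior_open open_Compl)
    then have "((\<lambda>s. X s * ((s + of_nat \<delta>) / 2)) \<longlongrightarrow> X (-1) * ((- 1 + of_nat \<delta>) / 2)) (at (- of_nat \<delta>))"
      using that by (intro tendsto_intros) (auto simp: isCont_def)
    then have "((\<lambda>s. X s * ((s + of_nat \<delta>) / 2)) \<longlongrightarrow> 0) (at (- of_nat \<delta>))" using that by simp
    from tendsto_unique[OF _ lim this] show ?thesis by simp
  qed
  show "((\<lambda>s. X s * s) \<longlongrightarrow> 2 * \<Phi> (- of_nat \<delta>)) (at 0)"
  proof (cases "\<delta> = 1")
    case False
    then have "\<delta> = 0" using class_B_holomorphic(4)[OF B] by auto
    then show ?thesis using tendsto_mult[OF tendsto_const[of 2] lim] by simp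
  next
    case True
    have "isCont \<Psi> 1"
      using class_B_holomorphic(2)[OF class_B_sym[OF B] True]
      by (rule holomorphic_on_imp_continuous_on[THEN continuous_on_interior]) auto
    then have "isCont \<Psi> (1 - 0)" by simp
    then have iC: "isCont (\<lambda>s. \<Psi> (1 - s)) 0"
      by (rule isCont_o2[rotated]) (intro continuous_intros)
    have "((\<lambda>s. Gamma ((1 - s + of_nat \<delta>) / 2) * \<Psi> (1 - s) * s) \<longlongrightarrow> Gamma ((1 - 0 + of_nat \<delta>) / 2) * \<Psi> (1 - 0) * 0) (at 0)"
    proof (intro tendsto_intros)
      show "((\<lambda>s. \<Psi> (1 - s)) \<longlongrightarrow> \<Psi> (1 - 0)) (at 0)" using iC by (simp add: isCont_def)
      show "(1 - 0 + complex_of_nat \<delta>) / 2 \<notin> \<int>\<^sub>\<le>\<^sub>0" using True by simp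
    qed simp
    then have "((\<lambda>s. Gamma ((1 - s + of_nat \<delta>) / 2) * \<Psi> (1 - s) * s) \<longlongrightarrow> 0) (at 0)" by simp
    then have "((\<lambda>s. X s * s) \<longlongrightarrow> 0) (at 0)"
    proof (rule Lim_transform_eventually)
      have "eventually (\<lambda>s. s \<in> ball 0 1 - {0}) (at (0 :: complex))"
        by (rule eventually_at_in_open) auto
      then show "eventually (\<lambda>s. Gamma ((1 - s + of_nat \<delta>) / 2) * \<Psi> (1 - s) * s = X s * s) (at 0)"
      proof eventually_elim
        case (elim s)
        have d: "\<bar>Re s\<bar> < 1" using elim abs_Re_le_cmod[of s] by auto
        have "1 - s \<notin> bochner_poles \<delta>"
        proof
          assume "1 - s \<in> bochner_poles \<delta>"
          from bochner_poles_cases[OF this] show False using d elim by (auto simp: complex_eq_iff)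
        qed
        moreover have "s \<noteq> 1" using d by auto
        ultimately show ?case using X2[of s] by simp
      qed
    qed
    then show ?thesis using zero True by simp
  qed
qed

lemma tendsto_one_minus:
  fixes f :: "complex \<Rightarrow> complex"
  assumes "((\<lambda>s. f (1 - s)) \<longlongrightarrow> L) (at 0)"
  shows "(f \<longlongrightarrow> L) (at 1)"
proof -
  have "filterlim (\<lambda>s::complex. 1 - s) (at 0) (at 1)"
    unfolding filterlim_at
    by (auto intro!: tendsto_eq_intros eventually_mono[OF eventually_neq_at_within[of 1]])
  from filterlim_compose[OF assms this] show ?thesis by simp
qed

lemma bochner_limit_1:
  assumes B: "class_B \<delta> lam a mu b \<Phi> \<Psi>" and X: "bochner_completion \<delta> \<Phi> \<Psi> X"
  shows "((\<lambda>s. X s * (s - 1)) \<longlongrightarrow> - 2 * \<Psi> (- of_nat \<delta>)) (at 1)"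
proof (rule tendsto_one_minus)
  have "((\<lambda>s. X (1 - s) * s) \<longlongrightarrow> 2 * \<Psi> (- of_nat \<delta>)) (at 0)"
    by (rule bochner_limit_0[OF class_B_sym[OF B] bochner_completion_sym[OF X]])
  from tendsto_minus[OF this] show "((\<lambda>s. X (1 - s) * (1 - s - 1)) \<longlongrightarrow> - 2 * \<Psi> (- of_nat \<delta>)) (at 0)"
    by simp
qed

lemma class_B_odd_zero:
  assumes "class_B 1 lam a mu b \<Phi> \<Psi>"
  shows "\<Phi> (- 1) = 0"
  using bochner_completion_exists[OF assms] bochner_limit_0(2)[OF assms] by auto

text \<open>The residue of the completed function at 1 divided by \<open>Gamma (1 / 2)\<close>,
  which is \<open>sqrt pi\<close>. This converts the constants of index 0 in the dual theta
  functions into the residues named in the theorem.\<close>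

lemma class_B_residue:
  assumes B: "class_B 0 lam a mu b \<Phi> \<Psi>"
  shows "residue \<Phi> 1 = - 2 * \<Psi> 0 / of_real (sqrt pi)"
proof -
  obtain X where XX: "bochner_completion 0 \<Phi> \<Psi> X"
    using bochner_completion_exists[OF B] by blast
  note X = bochner_completionD(2)[OF XX] bochner_limit_1[OF B XX]
  show ?thesis
  proof (rule residue_simple'[of UNIV])
    show "\<Phi> holomorphic_on UNIV - {1}" using class_B_holomorphic(1)[OF B] by (simp add: Compl_eq_Diff_UNIV)
    have half: "Gamma (1 / 2 :: complex) = of_real (sqrt pi)" by (rule Gamma_one_half_complex)
    have "((\<lambda>s. X s * (s - 1) / Gamma (s / 2)) \<longlongrightarrow> - 2 * \<Psi> (- of_nat 0) / Gamma (1 / 2)) (at 1)"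
      by (intro tendsto_intros X(2)) (auto simp: half)
    then have "((\<lambda>s. X s * (s - 1) / Gamma (s / 2)) \<longlongrightarrow> - 2 * \<Psi> 0 / of_real (sqrt pi)) (at 1)"
      by (simp add: half)
    then show "((\<lambda>w. \<Phi> w * (w - 1)) \<longlongrightarrow> - 2 * \<Psi> 0 / of_real (sqrt pi)) (at 1)"
    proof (rule Lim_transform_eventually)
      have "eventually (\<lambda>s. s \<in> ball 1 1 - {1}) (at (1 :: complex))"
        by (rule eventually_at_in_open) auto
      then show "eventually (\<lambda>s. X s * (s - 1) / Gamma (s / 2) = \<Phi> s * (s - 1)) (at 1)"
      proof eventually_elim
        case (elim s)
        have d: "Re s > 0" using elim abs_Re_le_cmod[of "1 - s"] by (auto simp: dist_norm)
        have "s \<notin> bochner_poles 0"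
        proof
          assume "s \<in> bochner_poles 0"
          from bochner_poles_cases[OF this] show False using d elim by (auto simp: complex_eq_iff)
        qed
        moreover have "s \<noteq> 0" using d by auto
        moreover have "Gamma (s / 2) \<noteq> 0"
          using d by (auto simp: Gamma_eq_zero_iff elim!: nonpos_Ints_cases')
        ultimately show ?case using X(1)[of s] by simp
      qed
    qed
  qed auto
qed

text \<open>The Cahen-Mellin integral in the variable \<open>(s + \<delta>) / 2\<close> at the
  argument \<open>x\<^sup>2\<close>. Halving the variable doubles \<open>2 * pi\<close>, and the
  shift by \<delta> produces the power of \<open>x\<close>.\<close>

lemma Gamma_half_line:
  assumes x: "x > 0" and c: "c > 0"
  shows "integrable lborel (\<lambda>t. Gamma ((Complex c t + of_nat \<delta>) / 2) * complex_of_real x powr (- Complex c t))"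
    and "(LINT t|lborel. Gamma ((Complex c t + of_nat \<delta>) / 2) * complex_of_real x powr (- Complex c t))
           = complex_of_real (4 * pi * x ^ \<delta> * exp (- x\<^sup>2))"
proof -
  define c' where "c' = (c + real \<delta>) / 2"
  have c': "c' > 0" using c by (simp add: c'_def add_pos_nonneg)
  define G where "G u = Gamma (Complex c' u) * complex_of_real (x\<^sup>2) powr (- Complex c' u)" for u
  have intG: "integrable lborel G"
    unfolding G_def using c' x by (intro integrable_Gamma_powr) auto
  have valG: "integral\<^sup>L lborel G = complex_of_real (2 * pi * exp (- x\<^sup>2))"
    using Gamma_line_eq[of "x\<^sup>2" c'] x c' by (simp add: Gamma_line_def G_def[abs_def])
  have eq: "Gamma ((Complex c t + of_nat \<delta>) / 2) * complex_of_real x powr (- Complex c t)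
      = complex_of_real (x ^ \<delta>) * G (0 + (1/2) * t)" for t
  proof -
    have "(Complex c t + of_nat \<delta>) / 2 = Complex c' (t / 2)" by (simp add: complex_eq_iff c'_def)
    moreover have "complex_of_real x powr (- Complex c t) = complex_of_real (x ^ \<delta>) * complex_of_real (x\<^sup>2) powr (- Complex c' (t / 2))"
    proof -
      have "complex_of_real (x\<^sup>2) powr (- Complex c' (t / 2)) = (complex_of_real x * complex_of_real x) powr (- Complex c' (t / 2))"
        by (simp add: power2_eq_square)
      also have "\<dots> = complex_of_real x powr (- Complex c' (t / 2)) * complex_of_real x powr (- Complex c' (t / 2))"
        using x by (intro powr_times_real) auto
      also have "\<dots> = complex_of_real x powr (- Complex c' (t / 2) + - Complex c' (t / 2))"
        by (simp only: powr_add)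
      also have "- Complex c' (t / 2) + - Complex c' (t / 2) = - Complex c t - of_nat \<delta>"
        by (simp add: complex_eq_iff c'_def field_simps)
      finally have "complex_of_real (x ^ \<delta>) * complex_of_real (x\<^sup>2) powr (- Complex c' (t / 2))
          = complex_of_real x powr (of_nat \<delta>) * complex_of_real x powr (- Complex c t - of_nat \<delta>)"
        using x by (simp add: powr_nat')
      also have "\<dots> = complex_of_real x powr (- Complex c t)" by (simp only: powr_add[symmetric]) simp
      finally show ?thesis by simp
    qed
    ultimately show ?thesis by (simp add: G_def)
  qed
  have intG': "integrable lborel (\<lambda>t. G (0 + (1/2) * t))"
    by (rule lborel_integrable_real_affine[OF intG]) simp
  show "integrable lborel (\<lambda>t. Gamma ((Complex c t + of_nat \<delta>) / 2) * complex_of_real x powr (- Complex c t))"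
    unfolding eq by (rule integrable_mult_right[OF intG'])
  have "integral\<^sup>L lborel G = (1/2) *\<^sub>R (LINT t|lborel. G (0 + (1/2) * t))"
    using lborel_integral_real_affine[of "1/2" G 0] by simp
  then have "(LINT t|lborel. G (0 + (1/2) * t)) = complex_of_real (4 * pi * exp (- x\<^sup>2))"
    using valG by (simp add: scaleR_conv_of_real mult.assoc)
  then show "(LINT t|lborel. Gamma ((Complex c t + of_nat \<delta>) / 2) * complex_of_real x powr (- Complex c t))
           = complex_of_real (4 * pi * x ^ \<delta> * exp (- x\<^sup>2))"
    unfolding eq using integral_mult_right_zero[of lborel "complex_of_real (x ^ \<delta>)"] by simp
qed

text \<open>On a line of absolute convergence the n-th term is the previous integral at
  \<open>lam (Suc n) * y\<close>. The norms integrate to a multiple of the convergent majorant,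
  which justifies exchanging sum and integral.\<close>

lemma dirichlet_line_integral:
  fixes lam :: "nat \<Rightarrow> real" and a :: "nat \<Rightarrow> complex" and \<delta> :: nat
  assumes fr: "frequencies lam" and sm: "summable (\<lambda>n. norm (a (Suc n)) * lam (Suc n) powr (- c))"
    and c: "c > 0" and y: "y > 0"
  defines "F \<equiv> \<lambda>t. Gamma ((Complex c t + of_nat \<delta>) / 2) * dirichlet_series lam a (Complex c t) * complex_of_real y powr (- Complex c t)"
  shows "integrable lborel F"
    and "integral\<^sup>L lborel F = 4 * pi * y ^ \<delta> * (\<Sum>n. a (Suc n) * complex_of_real (lam (Suc n) ^ \<delta> * exp (- (lam (Suc n))\<^sup>2 * y\<^sup>2)))"
proof -
  let ?G = "\<lambda>t. Gamma ((Complex c t + of_nat \<delta>) / 2)"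
  define g where "g n t = a (Suc n) * (?G t * complex_of_real (lam (Suc n) * y) powr (- Complex c t))" for n t
  have pos: "lam (Suc n) > 0" for n using frequencies_pos[OF fr] .
  have int: "integrable lborel (g n)" for n
    unfolding g_def using Gamma_half_line(1)[of "lam (Suc n) * y" c \<delta>] pos y c by (intro integrable_mult_right) auto
  have val: "integral\<^sup>L lborel (g n) = 4 * pi * y ^ \<delta> * (a (Suc n) * complex_of_real (lam (Suc n) ^ \<delta> * exp (- (lam (Suc n))\<^sup>2 * y\<^sup>2)))" for n
    unfolding g_def integral_mult_right_zero
    using Gamma_half_line(2)[of "lam (Suc n) * y" c \<delta>] pos[of n] y c by (simp add: power_mult_distrib)
  have gt: "g n t = a (Suc n) * complex_of_real (lam (Suc n)) powr (- Complex c t) * (?G t * complex_of_real y powr (- Complex c t))" for n t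
    unfolding g_def using pos[of n] y by (simp add: powr_times_real)
  have "summable (\<lambda>n. norm (a (Suc n) * complex_of_real (lam (Suc n)) powr (- Complex c t)))" for t
    by (rule summable_dirichlet_series[OF fr sm]) simp
  then have sg: "summable (\<lambda>n. norm (g n t))" for t
    unfolding gt norm_mult[of _ "?G t * _"] by (rule summable_mult2)
  have "summable (\<lambda>n. a (Suc n) * complex_of_real (lam (Suc n)) powr (- Complex c t))" for t
    by (rule summable_norm_cancel[OF summable_dirichlet_series[OF fr sm]]) simp
  then have "(\<Sum>n. a (Suc n) * complex_of_real (lam (Suc n)) powr (- Complex c t)) * (?G t * complex_of_real y powr (- Complex c t)) = (\<Sum>n. g n t)" for t
    unfolding gt by (rule suminf_mult2)
  then have Fg: "F = (\<lambda>t. \<Sum>n. g n t)"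
    unfolding F_def dirichlet_series_def by (simp add: fun_eq_iff mult_ac)
  define K where "K = (LINT t|lborel. norm (?G t))"
  have nG: "norm (g n t) = norm (a (Suc n)) * lam (Suc n) powr (- c) * y powr (- c) * norm (?G t)" for n t
    unfolding gt norm_mult using pos[of n] y by (simp add: norm_powr_real_powr)
  have "summable (\<lambda>n. norm (a (Suc n)) * lam (Suc n) powr (- c) * (y powr (- c) * K))"
    by (intro summable_mult2 sm)
  then have sI: "summable (\<lambda>n. LINT t|lborel. norm (g n t))"
    unfolding nG K_def by (simp add: mult_ac)
  show "integrable lborel F" unfolding Fg by (rule integrable_suminf) (use int sg sI in auto)
  have "integral\<^sup>L lborel F = (\<Sum>n. integral\<^sup>L lborel (g n))"
    unfolding Fg by (rule integral_suminf) (use int sg sI in auto)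
  also have "\<dots> = 4 * pi * y ^ \<delta> * (\<Sum>n. a (Suc n) * complex_of_real (lam (Suc n) ^ \<delta> * exp (- (lam (Suc n))\<^sup>2 * y\<^sup>2)))"
    unfolding val
  proof (rule suminf_mult)
    have "summable (\<lambda>n. integral\<^sup>L lborel (g n))"
      by (rule summable_comparison_test'[OF sI]) (rule integral_norm_bound)
    moreover have "complex_of_real (4 * pi * y ^ \<delta>) \<noteq> 0" using y by simp
    ultimately show "summable (\<lambda>n. a (Suc n) * complex_of_real (lam (Suc n) ^ \<delta> * exp (- (lam (Suc n))\<^sup>2 * y\<^sup>2)))"
      unfolding val summable_cmult_iff by blast
  qed
  finally show "integral\<^sup>L lborel F = 4 * pi * y ^ \<delta> * (\<Sum>n. a (Suc n) * complex_of_real (lam (Suc n) ^ \<delta> * exp (- (lam (Suc n))\<^sup>2 * y\<^sup>2)))" .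
qed

section \<open>The one-dimensional theta relation\<close>

lemma powr_strip_bound:
  assumes "x > 0"
  shows "\<exists>D>0. \<forall>\<sigma>::real. \<sigma>1 \<le> \<sigma> \<and> \<sigma> \<le> \<sigma>2 \<longrightarrow> x powr (- \<sigma>) \<le> D"
proof (intro exI[of _ "x powr (-\<sigma>1) + x powr (-\<sigma>2)"] conjI allI impI)
  show "0 < x powr - \<sigma>1 + x powr - \<sigma>2" using assms by (simp add: add_pos_pos)
  fix \<sigma> assume that: "\<sigma>1 \<le> \<sigma> \<and> \<sigma> \<le> \<sigma>2"
  show "x powr (- \<sigma>) \<le> x powr (-\<sigma>1) + x powr (-\<sigma>2)"
  proof (cases "x \<ge> 1")
    case True
    then have "x powr (- \<sigma>) \<le> x powr (-\<sigma>1)" using that by (intro powr_mono) auto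
    then show ?thesis by (simp add: add_increasing2)
  next
    case False
    then have "x powr (- \<sigma>) \<le> x powr (-\<sigma>2)" using that assms by (intro powr_mono') auto
    then show ?thesis by (simp add: add_increasing)
  qed
qed

lemma class_B_dirichlet_data:
  assumes "class_B \<delta> lam a mu b \<Phi> \<Psi>"
  shows "dirichlet_data lam a" "frequencies lam"
  using assms by (auto simp: class_B_def bochner_pair_def gamma_pair_def dirichlet_data_def)

text \<open>Both lines of integration lie in half-planes of absolute convergence, the left one after
  reflection into that of the dual series. The residues at 0 and 1 between them supply the
  constants. The usual theta parameter is \<open>y\<^sup>2\<close>.\<close>

lemma class_B_theta:
  assumes B: "class_B \<delta> lam a mu b \<Phi> \<Psi>" and y: "y > 0"
  shows "- 2 * \<Phi> (- of_nat \<delta>) + 2 * y ^ \<delta> * (\<Sum>n. a (Suc n) * complex_of_real (lam (Suc n) ^ \<delta> * exp (- (lam (Suc n))\<^sup>2 * y\<^sup>2)))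
       = (- 2 * \<Psi> (- of_nat \<delta>) + 2 * (1 / y) ^ \<delta> * (\<Sum>n. b (Suc n) * complex_of_real (mu (Suc n) ^ \<delta> * exp (- (mu (Suc n))\<^sup>2 * (1 / y)\<^sup>2)))) / y"
    (is "?a0 + 2 * _ * ?A = (?b0 + 2 * _ * ?B) / _")
proof -
  obtain X where XX: "bochner_completion \<delta> \<Phi> \<Psi> X"
    using bochner_completion_exists[OF B] by blast
  note X = bochner_completionD[OF XX] bochner_limit_0(1)[OF B XX] bochner_limit_1[OF B XX]
  note Bs = class_B_sym[OF B]
  note fr = class_B_dirichlet_data(2)[OF B] class_B_dirichlet_data(2)[OF Bs]
  obtain A1 B1 where AB: "abs_abscissa lam a = ereal A1" "abs_abscissa mu b = ereal B1"
    using class_B_dirichlet_data(1)[OF B] class_B_dirichlet_data(1)[OF Bs] unfolding dirichlet_data_def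
    by (cases "abs_abscissa lam a"; cases "abs_abscissa mu b") auto
  \<comment> \<open>Beyond both abscissas, so that both line integrals can be evaluated termwise,
    and beyond 1, so that 0 and 1 lie strictly between the lines.\<close>
  define c where "c = max 1 (max A1 B1) + 1"
  have c: "c > 1" "c > A1" "c > B1" by (auto simp: c_def)
  have sa: "summable (\<lambda>n. norm (a (Suc n)) * lam (Suc n) powr (- c))"
    using fr c AB by (intro summable_of_abs_abscissa_less) auto
  have sb: "summable (\<lambda>n. norm (b (Suc n)) * mu (Suc n) powr (- c))"
    using fr c AB by (intro summable_of_abs_abscissa_less) auto
  define f where "f s = X s * complex_of_real y powr (- s)" for s
  have np: "Complex c t \<notin> bochner_poles \<delta>" "Complex c t \<noteq> 0" "Complex c t \<noteq> 1" for t
    using bochner_poles_Im[of "Complex c t"] c by (auto simp: complex_eq_iff)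
  have fR: "f (Complex c t) = Gamma ((Complex c t + of_nat \<delta>) / 2) * dirichlet_series lam a (Complex c t) * complex_of_real y powr (- Complex c t)" for t
    using X(2)[of "Complex c t"] np[of t] class_B_holomorphic(3)[OF B, of "Complex c t"] c by (simp add: f_def AB)
  \<comment> \<open>On the left line \<open>1 - s\<close> has real part \<open>c\<close>. The power
    of \<open>y\<close> splits off a factor \<open>1 / y\<close> and becomes one of
    \<open>1 / y\<close>, while the imaginary part changes sign.\<close>
  have fL: "f (Complex (1 - c) t) = complex_of_real (1 / y) *
      (Gamma ((Complex c (- t) + of_nat \<delta>) / 2) * dirichlet_series mu b (Complex c (- t)) * complex_of_real (1 / y) powr (- Complex c (- t)))" for t
  proof -
    have s: "1 - Complex (1 - c) t = Complex c (- t)" by (simp add: complex_eq_iff)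
    have "Complex (1 - c) t \<noteq> 1" using c by (simp add: complex_eq_iff)
    then have "X (Complex (1 - c) t) = Gamma ((Complex c (- t) + of_nat \<delta>) / 2) * dirichlet_series mu b (Complex c (- t))"
      using X(3)[of "Complex (1 - c) t"] np[of "- t"] class_B_holomorphic(3)[OF Bs, of "Complex c (- t)"] c
      unfolding s by (simp add: AB)
    moreover have "complex_of_real y powr (- Complex (1 - c) t) = complex_of_real (1 / y) * complex_of_real (1 / y) powr (- Complex c (- t))"
    proof -
      have "- Complex (1 - c) t = - 1 + Complex c (- t)" by (simp add: complex_eq_iff)
      then have "complex_of_real y powr (- Complex (1 - c) t) = complex_of_real y powr (-1) * complex_of_real y powr (Complex c (- t))"
        by (simp only: powr_add)
      also have "complex_of_real y powr (-1) = complex_of_real (1 / y)"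
        using y by (simp add: powr_minus inverse_eq_divide)
      also have "complex_of_real y powr (Complex c (- t)) = complex_of_real (1 / y) powr (- Complex c (- t))"
        using y Ln_of_real[of "1 / y"] Ln_of_real[of y] by (simp add: powr_def ln_div)
      finally show ?thesis .
    qed
    ultimately show ?thesis by (simp add: f_def)
  qed
  let ?FL = "\<lambda>t. Gamma ((Complex c t + of_nat \<delta>) / 2) * dirichlet_series mu b (Complex c t) * complex_of_real (1 / y) powr (- Complex c t)"
  have yi: "1 / y > 0" using y by simp
  have c0: "c > 0" using c by simp
  note DR = dirichlet_line_integral[OF fr(1) sa c0 y, of \<delta>]
  note DL = dirichlet_line_integral[OF fr(2) sb c0 yi, of \<delta>]
  have DL1: "integrable lborel (\<lambda>t. ?FL (0 + (- 1) * t))"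
    by (rule lborel_integrable_real_affine[OF DL(1)]) simp
  have "integral\<^sup>L lborel ?FL = (LINT t|lborel. ?FL (0 + (- 1) * t))"
    using lborel_integral_real_affine[of "-1" ?FL 0] by simp
  then have DL2: "(LINT t|lborel. f (Complex (1 - c) t)) = complex_of_real (1 / y) * (4 * pi * (1 / y) ^ \<delta> * ?B)"
    unfolding fL DL(2)[symmetric] by simp
  have intL: "integrable lborel (\<lambda>t. f (Complex (1 - c) t))"
    unfolding fL using DL1 by (intro integrable_mult_right) simp
  have "(LINT t|lborel. f (Complex c t)) - (LINT t|lborel. f (Complex (1 - c) t)) = 2 * pi * (\<Sum>p\<in>{0, 1}. residue f p)"
  proof (rule vertical_shift[where U = UNIV])
    have "f holomorphic_on - {0, 1}" unfolding f_def by (intro holomorphic_intros X(1)) (use y in auto)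
    then show "f holomorphic_on UNIV - {0, 1}" by (simp add: Compl_eq_Diff_UNIV)
    show "integrable lborel (\<lambda>t. f (Complex c t))" unfolding fR by (rule DR(1))
    fix e :: real assume e: "e > 0"
    obtain D where D: "D > 0" "\<And>\<sigma>. 1 - c \<le> \<sigma> \<Longrightarrow> \<sigma> \<le> c \<Longrightarrow> y powr (- \<sigma>) \<le> D"
      using powr_strip_bound[OF y] by meson
    obtain T where T: "\<forall>s. 1 - c \<le> Re s \<and> Re s \<le> c \<and> T \<le> \<bar>Im s\<bar> \<longrightarrow> norm (X s) < e / D"
      using X(4)[of "e / D" "1 - c" c] e D(1) by auto
    show "\<exists>T. \<forall>s. 1 - c \<le> Re s \<and> Re s \<le> c \<and> T \<le> \<bar>Im s\<bar> \<longrightarrow> norm (f s) < e"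
    proof (intro exI[of _ T] allI impI)
      fix s assume s: "1 - c \<le> Re s \<and> Re s \<le> c \<and> T \<le> \<bar>Im s\<bar>"
      have "norm (f s) = norm (X s) * y powr (- Re s)"
        using y by (simp add: f_def norm_mult norm_powr_real_powr)
      also have "\<dots> \<le> norm (X s) * D" using s by (intro mult_left_mono D) auto
      also have "\<dots> < e / D * D" using T s D by (intro mult_strict_right_mono) auto
      finally show "norm (f s) < e" using D by simp
    qed
  qed (use c intL connected_UNIV in auto)
  also have "(\<Sum>p\<in>{0, 1}. residue f p) = residue f 0 + residue f 1" by simp
  \<comment> \<open>The residue of \<open>X\<close> at 0 is
    \<open>2 * \<Phi> (- of_nat \<delta>)\<close>, which is minus the extended coefficient of index
    0.\<close>
  also have "residue f 0 = - ?a0"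
  proof (rule residue_simple')
    show "open (- {1} :: complex set)" by auto
    show "f holomorphic_on - {1} - {0}"
      unfolding f_def by (intro holomorphic_intros holomorphic_on_subset[OF X(1)]) (use y in auto)
    have "((\<lambda>s. X s * s * complex_of_real y powr (- s)) \<longlongrightarrow> 2 * \<Phi> (- of_nat \<delta>) * complex_of_real y powr (- 0)) (at 0)"
      using y by (intro tendsto_intros X(5)) auto
    then show "((\<lambda>w. f w * (w - 0)) \<longlongrightarrow> - ?a0) (at 0)" using y by (simp add: f_def mult_ac)
  qed auto
  also have "residue f 1 = ?b0 / y"
  proof (rule residue_simple')
    show "open (- {0} :: complex set)" by auto
    show "f holomorphic_on - {0} - {1}"
      unfolding f_def by (intro holomorphic_intros holomorphic_on_subset[OF X(1)]) (use y in auto)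
    have "((\<lambda>s. X s * (s - 1) * complex_of_real y powr (- s)) \<longlongrightarrow> ?b0 * complex_of_real y powr (- 1)) (at 1)"
      using y by (intro tendsto_intros X(6)) auto
    then show "((\<lambda>w. f w * (w - 1)) \<longlongrightarrow> ?b0 / y) (at 1)" using y by (simp add: f_def mult_ac powr_minus divide_inverse)
  qed auto
  finally have "4 * pi * y ^ \<delta> * ?A - complex_of_real (1 / y) * (4 * pi * (1 / y) ^ \<delta> * ?B) = 2 * pi * (- ?a0 + ?b0 / y)"
    unfolding DL2 fR DR(2) .
  then have eq: "(2 * complex_of_real pi) * (?a0 + 2 * y ^ \<delta> * ?A) = (2 * complex_of_real pi) * ((?b0 + 2 * (1 / y) ^ \<delta> * ?B) / y)"
    by (simp add: algebra_simps add_divide_distrib diff_divide_distrib)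
  have cancel: "U = V" if "(2 * complex_of_real pi) * U = (2 * complex_of_real pi) * V" for U V
    using that by simp
  show ?thesis by (rule cancel) (use eq in \<open>simp only: of_real_power of_real_divide of_real_1 of_real_mult of_real_numeral\<close>)
qed

subsection \<open>Poisson formulas with a linear term\<close>

text \<open>The two-variable Hermite polynomials of Kampe de Feriet, with exponential generating
  function \<open>exp (u * \<beta> + v * \<beta>\<^sup>2)\<close> in \<beta>. They are defined over
  semirings so that the same polynomials serve as complex derivatives and as real majorants.\<close>

fun hermite :: "'a::comm_semiring_1 \<Rightarrow> 'a \<Rightarrow> nat \<Rightarrow> 'a" where
  "hermite u v 0 = 1"
| "hermite u v (Suc 0) = u"
| "hermite u v (Suc (Suc j)) = u * hermite u v (Suc j) + 2 * v * of_nat (Suc j) * hermite u v j"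

lemma hermite_of_real:
  "of_real (hermite u v j) = (hermite (of_real u) (of_real v) j :: complex)"
  by (induction u v j rule: hermite.induct) auto

lemma hermite_nonneg: "0 \<le> u \<Longrightarrow> 0 \<le> v \<Longrightarrow> 0 \<le> hermite u (v::real) j"
  by (induction u v j rule: hermite.induct) auto

text \<open>The coefficients are nonnegative, so each polynomial is its own majorant.\<close>

lemma norm_hermite_le: "norm (hermite u v j) \<le> hermite (norm u) (norm (v::complex)) j"
proof (induction u v j rule: hermite.induct)
  case (3 u v j)
  have "norm (hermite u v (Suc (Suc j))) \<le> norm (u * hermite u v (Suc j)) + norm (2 * v * of_nat (Suc j) * hermite u v j)"
    unfolding hermite.simps by (rule norm_triangle_ineq)
  also have "\<dots> \<le> norm u * hermite (norm u) (norm v) (Suc j) + 2 * norm v * of_nat (Suc j) * hermite (norm u) (norm v) j"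
    unfolding norm_mult norm_of_nat norm_numeral by (intro add_mono mult_left_mono 3) auto
  finally show ?case by simp
qed auto

text \<open>The generating function satisfies \<open>F' = (u + 2 * v * \<beta>) * F\<close> with
  \<open>F 0 = 1\<close>; comparing coefficients gives the recurrence that defines
  \<open>hermite\<close>. It is entire, so the series converges for every \<beta>.\<close>

lemma hermite_sums: "(\<lambda>j. hermite u v j / fact j * \<beta> ^ j) sums exp (u * \<beta> + v * \<beta>\<^sup>2 :: complex)"
proof -
  define F where "F = fps_exp u * (fps_exp v oo fps_X ^ 2)"
  have exp: "(\<lambda>x. exp (u * x) * exp (v * x\<^sup>2)) has_fps_expansion F"
    unfolding F_def
  proof (rule has_fps_expansion_mult[OF has_fps_expansion_exp])
    have "((\<lambda>x. exp (v * x)) \<circ> (\<lambda>x. x ^ 2)) has_fps_expansion (fps_exp v oo fps_X ^ 2)"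
      by (rule has_fps_expansion_compose) (auto intro!: fps_expansion_intros)
    then show "(\<lambda>x. exp (v * x\<^sup>2)) has_fps_expansion (fps_exp v oo fps_X ^ 2)" by (simp add: o_def)
  qed
  have dF: "fps_deriv F = fps_const u * F + fps_const (2 * v) * (fps_X * F)"
  proof -
    have "fps_deriv (fps_exp v oo fps_X ^ 2) = (fps_const v * fps_exp v oo fps_X ^ 2) * (2 * fps_X)"
      by (subst fps_compose_deriv) (auto simp: fps_deriv_power)
    also have "fps_const v * fps_exp v oo fps_X ^ 2 = fps_const v * (fps_exp v oo fps_X ^ 2)"
      by (simp add: fps_compose_mult_distrib)
    finally show ?thesis by (simp add: F_def algebra_simps fps_const_mult[symmetric] numeral_fps_const del: fps_const_mult)
  qed
  have rec: "of_nat (Suc n) * F $ Suc n = u * F $ n + 2 * v * (if n = 0 then 0 else F $ (n - 1))" for n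
    using arg_cong[OF dF, of "\<lambda>G. G $ n"] by simp
  have F0: "F $ 0 = 1" by (simp add: F_def)
  have F1: "F $ Suc 0 = u" using rec[of 0] F0 by simp
  have nth: "F $ n = hermite u v n / fact n" for n
  proof (induction n rule: induct_nat_012)
    case (ge2 n)
    have "F $ Suc (Suc n) = (u * F $ Suc n + 2 * v * F $ n) / of_nat (Suc (Suc n))"
      using rec[of "Suc n"] by (simp add: field_simps del: of_nat_Suc)
    also have "\<dots> = (u * hermite u v (Suc n) + 2 * v * of_nat (Suc n) * hermite u v n) / (of_nat (Suc (Suc n)) * (of_nat (Suc n) * fact n))"
      unfolding ge2 by (simp add: divide_simps del: of_nat_Suc)
    finally show ?case by (simp add: fact_Suc del: of_nat_Suc)
  qed (use F0 F1 in auto)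
  have "(\<lambda>n. F $ n * \<beta> ^ n) sums (exp (u * \<beta>) * exp (v * \<beta>\<^sup>2))"
    by (rule has_fps_expansion_imp_sums_complex[OF exp, of \<infinity>]) (auto intro!: holomorphic_intros)
  then show ?thesis by (simp add: nth exp_add)
qed

lemma hermite_sums_real:
  "(\<lambda>j. hermite u v j / fact j * \<beta> ^ j) sums exp (u * \<beta> + v * \<beta>\<^sup>2 :: real)"
proof -
  have "(\<lambda>j. complex_of_real (hermite u v j / fact j * \<beta> ^ j)) sums complex_of_real (exp (u * \<beta> + v * \<beta>\<^sup>2))"
    using hermite_sums[of "of_real u" "of_real v" "of_real \<beta>"]
    by (simp add: hermite_of_real flip: exp_of_real)
  then show ?thesis by (simp only: sums_of_real_iff)
qed

text \<open>A single term of the generating series at \<beta> = 1, whose terms are nonnegative after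
  passing to absolute values, is at most the whole sum.\<close>

lemma norm_hermite_le_exp: "norm (hermite u v j) \<le> fact j * exp (norm u + norm (v::complex))"
proof -
  have s: "(\<lambda>j. hermite (norm u) (norm v) j / fact j) sums exp (norm u + norm v)"
    using hermite_sums_real[of "norm u" "norm v" 1] by simp
  have "(\<Sum>j\<in>{j}. hermite (norm u) (norm v) j / fact j) \<le> (\<Sum>j. hermite (norm u) (norm v) j / fact j)"
    by (rule sum_le_suminf) (use s in \<open>auto simp: sums_iff hermite_nonneg\<close>)
  then have "hermite (norm u) (norm v) j \<le> fact j * exp (norm u + norm v)"
    using s by (simp add: sums_iff field_simps)
  then show ?thesis using norm_hermite_le[of u v j] by linarith
qed

lemma power_le_fact_exp: "0 \<le> x \<Longrightarrow> x ^ n \<le> fact n * exp (x::real)"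
proof -
  assume x: "0 \<le> x"
  have s: "(\<lambda>n. x ^ n / fact n) sums exp x" using exp_converges[of x] by (simp add: divide_inverse mult_ac)
  have "(\<Sum>n\<in>{n}. x ^ n / fact n) \<le> (\<Sum>n. x ^ n / fact n)"
    by (rule sum_le_suminf) (use s x in \<open>auto simp: sums_iff\<close>)
  then show ?thesis using s by (simp add: sums_iff field_simps)
qed

text \<open>
  The \<open>j\<close>-th derivative at \<open>\<beta> = 0\<close> of \<open>z powr (-1/2) * exp ((\<beta> + 2 * \<i> * m)\<^sup>2 / (4 * z))\<close>.
\<close>
definition dual_gauss :: "complex \<Rightarrow> nat \<Rightarrow> complex \<Rightarrow> complex" where
  "dual_gauss m j z = z powr (-1/2) * exp (- m\<^sup>2 / z) * hermite (\<i> * m / z) (1 / (4 * z)) j"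

section \<open>Differentiation of Gaussian series in the scale parameter\<close>

lemma dual_gauss_rec:
  "z \<noteq> 0 \<Longrightarrow> dual_gauss m (Suc (Suc j)) z
     = \<i> * m / z * dual_gauss m (Suc j) z + of_nat (Suc j) / (2 * z) * dual_gauss m j z"
  by (simp add: dual_gauss_def algebra_simps)

lemma dual_gauss_deriv_0:
  assumes "Re z > 0"
  shows "(dual_gauss m 0 has_field_derivative - dual_gauss m 2 z) (at z)"
proof -
  have z: "z \<noteq> 0" "z \<notin> \<real>\<^sub>\<le>\<^sub>0" using assms by (auto simp: complex_nonpos_Reals_iff)
  have p: "z powr (-1/2 - 1) = z powr (-1/2) / z" using z powr_diff[of z "-1/2" 1] by simp
  have "((\<lambda>z. z powr (-1/2) * exp (- m\<^sup>2 / z)) has_field_derivative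
      ((-1/2) * z powr (-1/2 - 1)) * exp (- m\<^sup>2 / z) + exp (- m\<^sup>2 / z) * (m\<^sup>2 / z\<^sup>2) * z powr (-1/2)) (at z)"
    using z by (auto intro!: derivative_eq_intros simp: power2_eq_square)
  also have "((-1/2) * z powr (-1/2 - 1)) * exp (- m\<^sup>2 / z) + exp (- m\<^sup>2 / z) * (m\<^sup>2 / z\<^sup>2) * z powr (-1/2)
      = - dual_gauss m 2 z"
    unfolding p using z by (simp add: dual_gauss_def numeral_2_eq_2 field_simps power2_eq_square)
  finally show ?thesis by (simp add: dual_gauss_def[abs_def])
qed

text \<open>The function \<open>z powr (-1/2) * exp ((\<beta> + 2 * \<i> * m)\<^sup>2 / (4 *
  z))\<close> solves the same backward heat equation as
  \<open>exp (- z * l\<^sup>2 + \<beta> * l)\<close>: its derivative in \<open>z\<close> is minus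
  its second derivative in \<beta>. Thus differentiation in \<open>z\<close> raises the order
  \<open>j\<close> by two and changes the sign, on either side of the Poisson formula.\<close>

lemma dual_gauss_deriv:
  assumes z: "Re z > 0"
  shows "(dual_gauss m j has_field_derivative - dual_gauss m (j + 2) z) (at z)"
  using z
proof (induction j arbitrary: z rule: induct_nat_012)
  case (0 z)
  then show ?case using dual_gauss_deriv_0 by (simp add: numeral_2_eq_2)
next
  case (1 z)
  have z: "z \<noteq> 0" using 1 by auto
  have D0: "(dual_gauss m 0 has_field_derivative - dual_gauss m 2 z) (at z)"
    using dual_gauss_deriv_0[OF 1] .
  have "dual_gauss m (Suc 0) = (\<lambda>z. \<i> * m / z * dual_gauss m 0 z)"
    by (simp add: dual_gauss_def fun_eq_iff)
  moreover have "((\<lambda>z. \<i> * m / z * dual_gauss m 0 z) has_field_derivative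
      (- (\<i> * m) / z\<^sup>2) * dual_gauss m 0 z + - dual_gauss m 2 z * (\<i> * m / z)) (at z)"
    using z by (auto intro!: derivative_eq_intros D0 simp: power2_eq_square diff_divide_distrib)
  moreover have "(- (\<i> * m) / z\<^sup>2) * dual_gauss m 0 z + - dual_gauss m 2 z * (\<i> * m / z) = - dual_gauss m (Suc 0 + 2) z"
  proof -
    have "dual_gauss m (Suc 0 + 2) z = \<i> * m / z * dual_gauss m 2 z + 1 / z * dual_gauss m (Suc 0) z"
      using dual_gauss_rec[OF z, of m "Suc 0"] by (simp add: numeral_2_eq_2)
    moreover have "dual_gauss m (Suc 0) z = \<i> * m / z * dual_gauss m 0 z" by (simp add: dual_gauss_def)
    ultimately show ?thesis by (simp add: algebra_simps power2_eq_square)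
  qed
  ultimately show ?case by simp
next
  case (ge2 j z)
  have z: "z \<noteq> 0" using ge2 by auto
  have Dj: "(dual_gauss m j has_field_derivative - dual_gauss m (Suc (Suc j)) z) (at z)"
    "(dual_gauss m (Suc j) has_field_derivative - dual_gauss m (Suc (Suc (Suc j))) z) (at z)"
    using ge2 by auto
  have "((\<lambda>z. \<i> * m / z * dual_gauss m (Suc j) z + of_nat (Suc j) / (2 * z) * dual_gauss m j z) has_field_derivative
      ((- (\<i> * m) / z\<^sup>2) * dual_gauss m (Suc j) z + - dual_gauss m (Suc (Suc (Suc j))) z * (\<i> * m / z))
      + ((- of_nat (Suc j) / (2 * z\<^sup>2)) * dual_gauss m j z + - dual_gauss m (Suc (Suc j)) z * (of_nat (Suc j) / (2 * z)))) (at z)"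
    (is "(?f has_field_derivative ?D) _")
    using z by (auto intro!: derivative_eq_intros Dj simp: power2_eq_square diff_divide_distrib simp del: of_nat_Suc; simp add: divide_simps del: of_nat_Suc; simp add: algebra_simps)
  then have "(dual_gauss m (Suc (Suc j)) has_field_derivative ?D) (at z)"
  proof (rule has_field_derivative_transform_within_open)
    show "open {z. Re z > 0}" by (rule open_halfspace_Re_gt)
    show "z \<in> {z. Re z > 0}" using ge2 by simp
    show "?f w = dual_gauss m (Suc (Suc j)) w" if "w \<in> {z. Re z > 0}" for w
      by (rule dual_gauss_rec[symmetric]) (use that in auto)
  qed
  also have "?D = - dual_gauss m (Suc (Suc j) + 2) z"
  proof -
    have r4: "dual_gauss m (Suc (Suc j) + 2) z = \<i> * m / z * dual_gauss m (Suc (Suc (Suc j))) z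
        + of_nat (Suc (Suc (Suc j))) / (2 * z) * dual_gauss m (Suc (Suc j)) z"
      using dual_gauss_rec[OF z, of m "Suc (Suc j)"] by simp
    have r2: "1 / z * dual_gauss m (Suc (Suc j)) z
        = (\<i> * m / z\<^sup>2) * dual_gauss m (Suc j) z + of_nat (Suc j) / (2 * z\<^sup>2) * dual_gauss m j z"
      using z by (subst dual_gauss_rec[OF z]) (simp add: field_simps power2_eq_square del: of_nat_Suc)
    have n: "of_nat (Suc (Suc (Suc j))) / (2 * z) = 1 / z + of_nat (Suc j) / (2 * z)"
      using z by (simp add: field_simps)
    have "?D = - (1 / z * dual_gauss m (Suc (Suc j)) z) - dual_gauss m (Suc (Suc (Suc j))) z * (\<i> * m / z)
         - dual_gauss m (Suc (Suc j)) z * (of_nat (Suc j) / (2 * z))"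
      unfolding r2 by (simp add: field_simps del: of_nat_Suc)
    also have "\<dots> = - dual_gauss m (Suc (Suc j) + 2) z"
      unfolding r4 n by (simp add: ring_distribs mult_ac del: of_nat_Suc)
    finally show ?thesis .
  qed
  finally show ?case .
qed

lemma suminf_swap:
  fixes f :: "nat \<Rightarrow> nat \<Rightarrow> complex"
  assumes bd: "\<And>k j. norm (f k j) \<le> g k j" and g: "\<And>k. g k sums M k" and M: "summable M"
  shows "(\<Sum>k. \<Sum>j. f k j) = (\<Sum>j. \<Sum>k. f k j)"
proof -
  have g0: "0 \<le> g k j" for k j using order_trans[OF norm_ge_zero bd] .
  have hg: "(g k has_sum M k) UNIV" for k
    using g[of k] g0 by (intro norm_summable_imp_has_sum) (auto simp: sums_iff)
  have M0: "0 \<le> M k" for k using g[of k] g0 suminf_nonneg by (metis sums_iff)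
  have hM: "M summable_on UNIV" using M M0 by (simp add: norm_summable_imp_summable_on)
  have gs: "(\<lambda>(k, j). g k j) summable_on UNIV \<times> UNIV"
    by (rule summable_on_SigmaI[where g = M]) (use hg hM g0 in auto)
  have fs: "(\<lambda>x. norm ((\<lambda>(k, j). f k j) x)) summable_on UNIV \<times> UNIV"
    by (rule Infinite_Sum.abs_summable_on_comparison_test'[OF gs]) (use bd in auto)
  then have fs': "(\<lambda>(k, j). f k j) summable_on UNIV \<times> UNIV"
    by (rule abs_summable_summable)
  have sk: "summable (\<lambda>j. norm (f k j))" for k
    by (rule summable_comparison_test'[of "g k"]) (use g[of k] bd in \<open>auto simp: sums_iff\<close>)
  have rows: "((\<lambda>j. f k j) has_sum (\<Sum>j. f k j)) UNIV" for k
    by (rule norm_summable_imp_has_sum[OF sk summable_sums[OF summable_norm_cancel[OF sk]]])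
  have sj: "summable (\<lambda>k. norm (f k j))" for j
  proof (rule summable_comparison_test'[OF M])
    fix k
    have "g k j \<le> M k"
      using sum_le_suminf[of "g k" "{j}"] g[of k] g0 by (auto simp: sums_iff)
    then show "norm (norm (f k j)) \<le> M k" using bd[of k j] by simp
  qed
  have cols: "((\<lambda>k. f k j) has_sum (\<Sum>k. f k j)) UNIV" for j
    by (rule norm_summable_imp_has_sum[OF sj summable_sums[OF summable_norm_cancel[OF sj]]])
  obtain S where S: "((\<lambda>(k, j). f k j) has_sum S) (UNIV \<times> UNIV)"
    using fs' by (auto simp: summable_on_def)
  then have S': "((\<lambda>(j, k). f k j) has_sum S) (UNIV \<times> UNIV)"
    by (subst (asm) has_sum_swap) (simp add: case_prod_unfold)
  have "((\<lambda>k. \<Sum>j. f k j) has_sum S) UNIV"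
    by (rule has_sum_SigmaD[OF S]) (use rows in auto)
  moreover have "((\<lambda>j. \<Sum>k. f k j) has_sum S) UNIV"
    by (rule has_sum_SigmaD[OF S']) (use cols in auto)
  ultimately show ?thesis by (auto dest!: has_sum_imp_sums simp: sums_iff)
qed

text \<open>Termwise differentiation on the disc of radius \<open>\<alpha> / 2\<close> about
  \<alpha>. There the real part stays above \<open>\<alpha> / 2\<close>, which gives a common
  Gaussian majorant, and powers of \<open>l\<close> are absorbed by
  \<open>exp \<bar>l\<bar>\<close>.\<close>

lemma gauss_series_deriv:
  fixes a :: "nat \<Rightarrow> complex" and l :: "nat \<Rightarrow> real"
  assumes sa: "\<And>\<epsilon> K. \<epsilon> > 0 \<Longrightarrow> summable (\<lambda>k. norm (a k) * exp (K * \<bar>l k\<bar> - \<epsilon> * (l k)\<^sup>2))"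
    and al: "\<alpha> > 0"
  shows "((\<lambda>z. \<Sum>k. a k * (of_real (l k) ^ j * exp (- z * of_real ((l k)\<^sup>2)))) has_field_derivative
     - (\<Sum>k. a k * (of_real (l k) ^ (j + 2) * exp (- of_real \<alpha> * of_real ((l k)\<^sup>2))))) (at (of_real \<alpha>))"
proof -
  define S where "S = ball (complex_of_real \<alpha>) (\<alpha> / 2)"
  define f where "f k z = a k * (of_real (l k) ^ j * exp (- z * of_real ((l k)\<^sup>2)))" for k z
  define f' where "f' k z = - (a k * (of_real (l k) ^ (j + 2) * exp (- z * of_real ((l k)\<^sup>2))))" for k z
  have Re: "Re z \<ge> \<alpha> / 2" if "z \<in> S" for z
    using that abs_Re_le_cmod[of "of_real \<alpha> - z"] by (auto simp: S_def dist_norm abs_if split: if_splits)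
  have bound: "norm (a k * (of_real (l k) ^ i * exp (- z * of_real ((l k)\<^sup>2))))
      \<le> fact i * (norm (a k) * exp (1 * \<bar>l k\<bar> - (\<alpha> / 2) * (l k)\<^sup>2))" if "Re z \<ge> \<alpha> / 2" for i k z
  proof -
    have "norm (of_real (l k) ^ i * exp (- z * of_real ((l k)\<^sup>2)) :: complex) = \<bar>l k\<bar> ^ i * exp (- Re z * (l k)\<^sup>2)"
      by (simp add: norm_mult norm_power)
    also have "\<dots> \<le> (fact i * exp \<bar>l k\<bar>) * exp (- (\<alpha> / 2) * (l k)\<^sup>2)"
      using mult_right_mono[OF that, of "(l k)\<^sup>2"] by (intro mult_mono power_le_fact_exp) auto
    also have "\<dots> = fact i * exp (1 * \<bar>l k\<bar> - (\<alpha> / 2) * (l k)\<^sup>2)" by (simp flip: exp_add)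
    finally have le: "norm (of_real (l k) ^ i * exp (- z * of_real ((l k)\<^sup>2)) :: complex) \<le> fact i * exp (1 * \<bar>l k\<bar> - (\<alpha> / 2) * (l k)\<^sup>2)" .
    from mult_left_mono[OF this norm_ge_zero[of "a k"]] show ?thesis
      by (simp only: norm_mult mult.left_commute)
  qed
  have "((\<lambda>z. \<Sum>k. f k z) has_field_derivative (\<Sum>k. f' k (of_real \<alpha>))) (at (of_real \<alpha>))"
  proof (rule has_field_derivative_series'(2))
    show "convex S" by (simp add: S_def)
    show "(f k has_field_derivative f' k z) (at z within S)" for k z
      unfolding f_def f'_def by (auto intro!: derivative_eq_intros simp: power2_eq_square)
    show "uniformly_convergent_on S (\<lambda>n z. \<Sum>i<n. f' i z)"
    proof (rule Weierstrass_m_test')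
      show "norm (f' k z) \<le> fact (j + 2) * (norm (a k) * exp (1 * \<bar>l k\<bar> - (\<alpha> / 2) * (l k)\<^sup>2))" if "z \<in> S" for k z
        unfolding f'_def norm_minus_cancel by (rule bound[OF Re[OF that]])
      show "summable (\<lambda>k. fact (j + 2) * (norm (a k) * exp (1 * \<bar>l k\<bar> - (\<alpha> / 2) * (l k)\<^sup>2)))"
        using al by (intro summable_mult sa) auto
    qed
    show "of_real \<alpha> \<in> S" using al by (simp add: S_def)
    show "of_real \<alpha> \<in> interior S" using al by (simp add: S_def)
    show "summable (\<lambda>k. f k (of_real \<alpha>))"
    proof (rule summable_comparison_test')
      show "summable (\<lambda>k. fact j * (norm (a k) * exp (1 * \<bar>l k\<bar> - (\<alpha> / 2) * (l k)\<^sup>2)))"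
        using al by (intro summable_mult sa) auto
      show "norm (f k (of_real \<alpha>)) \<le> fact j * (norm (a k) * exp (1 * \<bar>l k\<bar> - (\<alpha> / 2) * (l k)\<^sup>2))" for k
        unfolding f_def using al by (intro bound) auto
    qed
  qed
  moreover have "(\<Sum>k. f' k (of_real \<alpha>)) = - (\<Sum>k. a k * (of_real (l k) ^ (j + 2) * exp (- of_real \<alpha> * of_real ((l k)\<^sup>2))))"
    unfolding f'_def
  proof (rule suminf_minus)
    show "summable (\<lambda>k. a k * (of_real (l k) ^ (j + 2) * exp (- of_real \<alpha> * of_real ((l k)\<^sup>2))))"
    proof (rule summable_comparison_test')
      show "summable (\<lambda>k. fact (j + 2) * (norm (a k) * exp (1 * \<bar>l k\<bar> - (\<alpha> / 2) * (l k)\<^sup>2)))"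
        using al by (intro summable_mult sa) auto
    qed (use al in \<open>intro bound, auto\<close>)
  qed
  ultimately show ?thesis by (simp add: f_def)
qed

text \<open>On this disc \<open>Re z \<ge> \<alpha> / 2\<close> and
  \<open>\<alpha> / 2 \<le> norm z \<le> 3 * \<alpha> / 2\<close>, hence
  \<open>Re (1 / z) = Re z / (norm z)\<^sup>2\<close> is at least \<open>2 / (9 * \<alpha>)\<close>.
  The Hermite factor grows only exponentially in \<open>m\<close> and leaves the Gaussian decay
  intact.\<close>

lemma norm_dual_gauss_le:
  assumes al: "\<alpha> > 0" and z: "z \<in> ball (of_real \<alpha>) (\<alpha> / 2)"
  shows "norm (dual_gauss (of_real m) j z) \<le> (\<alpha> / 2) powr (-1/2) * fact j * exp (1 / (2 * \<alpha>)) *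
            exp ((2 / \<alpha>) * \<bar>m\<bar> - (2 / (9 * \<alpha>)) * m\<^sup>2)"
proof -
  have Re: "Re z \<ge> \<alpha> / 2"
    using z abs_Re_le_cmod[of "of_real \<alpha> - z"] by (auto simp: dist_norm abs_if split: if_splits)
  have n1: "norm z \<ge> \<alpha> / 2" using Re complex_Re_le_cmod[of z] by linarith
  have n2: "norm z \<le> 3 * \<alpha> / 2"
    using z norm_triangle_ineq[of "of_real \<alpha>" "z - of_real \<alpha>"] al by (auto simp: dist_norm norm_minus_commute)
  have z0: "norm z > 0" using n1 al by linarith
  have R: "Re (1 / z) \<ge> 2 / (9 * \<alpha>)"
  proof -
    have "Re (1 / z) = Re z / (norm z)\<^sup>2" by (simp add: Re_divide cmod_power2)
    moreover have "(norm z)\<^sup>2 \<le> (3 * \<alpha> / 2)\<^sup>2" using n2 by (intro power_mono) auto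
    moreover have "(\<alpha> / 2) / (3 * \<alpha> / 2)\<^sup>2 = 2 / (9 * \<alpha>)" using al by (simp add: power2_eq_square field_simps)
    moreover have "(\<alpha> / 2) / (3 * \<alpha> / 2)\<^sup>2 \<le> Re z / (norm z)\<^sup>2"
      using Re z0 calculation(2) al by (intro frac_le) auto
    ultimately show ?thesis by linarith
  qed
  have e1: "norm (z powr (-1/2)) \<le> (\<alpha> / 2) powr (-1/2)"
  proof -
    have "norm (z powr (-1/2)) = norm z powr (-1/2)" by (subst norm_powr_real_powr') auto
    also have "\<dots> \<le> (\<alpha> / 2) powr (-1/2)" using n1 al by (intro powr_mono2') auto
    finally show ?thesis .
  qed
  have e2: "norm (exp (- (of_real m)\<^sup>2 / z)) \<le> exp (- (2 / (9 * \<alpha>)) * m\<^sup>2)"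
  proof -
    have "norm (exp (- (of_real m)\<^sup>2 / z)) = exp (- (m\<^sup>2 * Re (1 / z)))"
      by (simp add: Re_divide flip: of_real_power)
    also have "\<dots> \<le> exp (- (m\<^sup>2 * (2 / (9 * \<alpha>))))" using R by (simp add: mult_left_mono del: times_divide_eq_right)
    finally show ?thesis by (simp add: mult.commute)
  qed
  have e3: "norm (hermite (\<i> * of_real m / z) (1 / (4 * z)) j) \<le> fact j * exp ((2 / \<alpha>) * \<bar>m\<bar> + 1 / (2 * \<alpha>))"
  proof -
    have "norm (\<i> * of_real m / z) \<le> (2 / \<alpha>) * \<bar>m\<bar>"
    proof -
      have "\<bar>m\<bar> / norm z \<le> \<bar>m\<bar> / (\<alpha> / 2)" using n1 al z0 by (intro divide_left_mono) auto
      then show ?thesis by (simp add: norm_divide norm_mult mult.commute)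
    qed
    moreover have "norm (1 / (4 * z)) \<le> 1 / (2 * \<alpha>)"
    proof -
      have "1 / (4 * norm z) \<le> 1 / (4 * (\<alpha> / 2))" using n1 al z0 by (intro divide_left_mono) auto
      then show ?thesis by (simp add: norm_divide norm_mult)
    qed
    ultimately have "exp (norm (\<i> * of_real m / z) + norm (1 / (4 * z))) \<le> exp ((2 / \<alpha>) * \<bar>m\<bar> + 1 / (2 * \<alpha>))"
      by simp
    then have "fact j * exp (norm (\<i> * of_real m / z) + norm (1 / (4 * z))) \<le> fact j * exp ((2 / \<alpha>) * \<bar>m\<bar> + 1 / (2 * \<alpha>))"
      by (intro mult_left_mono) auto
    with norm_hermite_le_exp[of "\<i> * of_real m / z" "1 / (4 * z)" j] show ?thesis by linarith
  qed
  have "norm (dual_gauss (of_real m) j z) \<le> (\<alpha> / 2) powr (-1/2) * exp (- (2 / (9 * \<alpha>)) * m\<^sup>2) *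
      (fact j * exp ((2 / \<alpha>) * \<bar>m\<bar> + 1 / (2 * \<alpha>)))"
    unfolding dual_gauss_def norm_mult using e1 e2 e3 by (intro mult_mono) auto
  also have "\<dots> = (\<alpha> / 2) powr (-1/2) * fact j * (exp (1 / (2 * \<alpha>)) * exp ((2 / \<alpha>) * \<bar>m\<bar> - (2 / (9 * \<alpha>)) * m\<^sup>2))"
    unfolding mult_exp_exp by (simp add: mult_ac flip: exp_add)
  finally show ?thesis by (simp add: mult.assoc)
qed

lemma dual_gauss_series_deriv:
  fixes b :: "nat \<Rightarrow> complex" and m :: "nat \<Rightarrow> real"
  assumes sb: "\<And>\<epsilon> K. \<epsilon> > 0 \<Longrightarrow> summable (\<lambda>k. norm (b k) * exp (K * \<bar>m k\<bar> - \<epsilon> * (m k)\<^sup>2))"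
    and al: "\<alpha> > 0"
  shows "((\<lambda>z. \<Sum>k. b k * dual_gauss (of_real (m k)) j z) has_field_derivative
     - (\<Sum>k. b k * dual_gauss (of_real (m k)) (j + 2) (of_real \<alpha>))) (at (of_real \<alpha>))"
proof -
  define S where "S = ball (complex_of_real \<alpha>) (\<alpha> / 2)"
  define C where "C i = (\<alpha> / 2) powr (-1/2) * fact i * exp (1 / (2 * \<alpha>))" for i :: nat
  have bound: "norm (b k * dual_gauss (of_real (m k)) i z) \<le> C i * (norm (b k) * exp ((2 / \<alpha>) * \<bar>m k\<bar> - (2 / (9 * \<alpha>)) * (m k)\<^sup>2))"
    if "z \<in> S" for k i z
    using norm_dual_gauss_le[OF al that[unfolded S_def], of "m k" i]
    by (simp add: norm_mult C_def mult_left_mono mult.left_commute[of _ "norm (b k)"])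
  have sm: "summable (\<lambda>k. C i * (norm (b k) * exp ((2 / \<alpha>) * \<bar>m k\<bar> - (2 / (9 * \<alpha>)) * (m k)\<^sup>2)))" for i
    using al by (intro summable_mult sb) auto
  have aS: "of_real \<alpha> \<in> S" using al by (simp add: S_def)
  have Re: "Re z > 0" if "z \<in> S" for z
    using that abs_Re_le_cmod[of "of_real \<alpha> - z"] al by (auto simp: S_def dist_norm abs_if split: if_splits)
  have "((\<lambda>z. \<Sum>k. b k * dual_gauss (of_real (m k)) j z) has_field_derivative
     (\<Sum>k. - (b k * dual_gauss (of_real (m k)) (j + 2) (of_real \<alpha>)))) (at (of_real \<alpha>))"
  proof (rule has_field_derivative_series'(2)[where S = S])
    show "convex S" by (simp add: S_def)
    show "((\<lambda>z. b k * dual_gauss (of_real (m k)) j z) has_field_derivative - (b k * dual_gauss (of_real (m k)) (j + 2) z)) (at z within S)" if "z \<in> S" for k z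
      using DERIV_cmult[OF dual_gauss_deriv[OF Re[OF that]], of "b k" "of_real (m k)" j]
      by (auto intro: has_field_derivative_at_within)
    show "uniformly_convergent_on S (\<lambda>n z. \<Sum>i<n. - (b i * dual_gauss (of_real (m i)) (j + 2) z))"
      by (rule Weierstrass_m_test'[OF _ sm]) (unfold norm_minus_cancel, rule bound)
    show "of_real \<alpha> \<in> S" by (rule aS)
    show "of_real \<alpha> \<in> interior S" using al by (simp add: S_def)
    show "summable (\<lambda>k. b k * dual_gauss (of_real (m k)) j (of_real \<alpha>))"
      by (rule summable_comparison_test'[OF sm bound[OF aS]])
  qed
  moreover have "(\<Sum>k. - (b k * dual_gauss (of_real (m k)) (j + 2) (of_real \<alpha>))) = - (\<Sum>k. b k * dual_gauss (of_real (m k)) (j + 2) (of_real \<alpha>))"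
    by (rule suminf_minus, rule summable_comparison_test'[OF sm bound[OF aS]])
  ultimately show ?thesis by simp
qed

text \<open>The difference of both sides at order \<open>j - 2\<close> vanishes for all positive
  \<alpha>, so its derivative along the real axis vanishes too, and that derivative is minus the
  difference at order \<open>j\<close>. Induction in steps of two therefore starts from the orders 0
  and 1.\<close>

lemma gauss_moments_eq:
  fixes a b :: "nat \<Rightarrow> complex" and l m :: "nat \<Rightarrow> real"
  assumes sa: "\<And>\<epsilon> K. \<epsilon> > 0 \<Longrightarrow> summable (\<lambda>k. norm (a k) * exp (K * \<bar>l k\<bar> - \<epsilon> * (l k)\<^sup>2))"
    and sb: "\<And>\<epsilon> K. \<epsilon> > 0 \<Longrightarrow> summable (\<lambda>k. norm (b k) * exp (K * \<bar>m k\<bar> - \<epsilon> * (m k)\<^sup>2))"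
    and base: "\<And>\<alpha> j. \<alpha> > 0 \<Longrightarrow> j < 2 \<Longrightarrow> (\<Sum>k. a k * (of_real (l k) ^ j * exp (- of_real \<alpha> * of_real ((l k)\<^sup>2))))
          = \<kappa> * (\<Sum>k. b k * dual_gauss (of_real (m k)) j (of_real \<alpha>))"
    and "\<alpha> > 0"
  shows "(\<Sum>k. a k * (of_real (l k) ^ j * exp (- of_real \<alpha> * of_real ((l k)\<^sup>2))))
          = \<kappa> * (\<Sum>k. b k * dual_gauss (of_real (m k)) j (of_real \<alpha>))"
  using \<open>\<alpha> > 0\<close>
proof (induction j arbitrary: \<alpha> rule: less_induct)
  case (less j)
  show ?case
  proof (cases "j < 2")
    case True
    then show ?thesis using base less.prems by blast
  next
    case False
    define i where "i = j - 2"
    have j: "j = i + 2" "i < j" using False by (auto simp: i_def)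
    define F where "F z = (\<Sum>k. a k * (of_real (l k) ^ i * exp (- z * of_real ((l k)\<^sup>2))))" for z
    define G where "G z = (\<Sum>k. b k * dual_gauss (of_real (m k)) i z)" for z
    define A where "A = (\<Sum>k. a k * (of_real (l k) ^ j * exp (- of_real \<alpha> * of_real ((l k)\<^sup>2))))"
    define B where "B = (\<Sum>k. b k * dual_gauss (of_real (m k)) j (of_real \<alpha>))"
    have "((\<lambda>z. F z - \<kappa> * G z) has_field_derivative - A - \<kappa> * (- B)) (at (of_real \<alpha>))"
      unfolding F_def[abs_def] G_def[abs_def] A_def B_def j(1) using less.prems
      by (intro DERIV_diff DERIV_cmult gauss_series_deriv[OF sa] dual_gauss_series_deriv[OF sb])
    then have v1: "((\<lambda>x. F (of_real x) - \<kappa> * G (of_real x)) has_vector_derivative - A - \<kappa> * (- B)) (at \<alpha>)"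
      by (rule has_vector_derivative_real_field)
    have v2: "((\<lambda>x. F (of_real x) - \<kappa> * G (of_real x)) has_vector_derivative 0) (at \<alpha>)"
    proof (rule has_vector_derivative_transform_within_open[of "\<lambda>x. 0" _ _ "{0<..}"])
      show "0 = F (of_real x) - \<kappa> * G (of_real x)" if "x \<in> {0<..}" for x
        using less.IH[OF j(2), of x] that by (simp add: F_def G_def)
    qed (use less.prems in auto)
    have "- A - \<kappa> * (- B) = 0" by (rule vector_derivative_unique_at[OF v1 v2])
    then show ?thesis by (simp add: A_def B_def)
  qed
qed

lemma norm_exp_square_le:
  assumes al: "\<alpha> > 0"
  shows "norm (exp ((\<beta> + 2 * \<i> * of_real x)\<^sup>2 / (4 * of_real \<alpha>)))
     \<le> exp ((norm \<beta>)\<^sup>2 / (4 * \<alpha>)) * exp (norm \<beta> / \<alpha> * \<bar>x\<bar> - (1 / \<alpha>) * x\<^sup>2)"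
proof -
    have "Re ((\<beta> + 2 * \<i> * of_real x)\<^sup>2 / (4 * of_real \<alpha>)) = ((Re \<beta>)\<^sup>2 - (Im \<beta> + 2 * x)\<^sup>2) / (4 * \<alpha>)"
    proof -
      have "4 * complex_of_real \<alpha> = of_real (4 * \<alpha>)" by simp
      then show ?thesis by (simp only: Re_divide_of_real Re_power2) simp
    qed
    also have "\<dots> \<le> ((norm \<beta>)\<^sup>2 + 4 * norm \<beta> * \<bar>x\<bar> - 4 * x\<^sup>2) / (4 * \<alpha>)"
    proof (intro divide_right_mono)
      have "\<bar>Im \<beta> * x\<bar> \<le> norm \<beta> * \<bar>x\<bar>" unfolding abs_mult by (intro mult_right_mono abs_Im_le_cmod) auto
      then have "- (Im \<beta> * x) \<le> norm \<beta> * \<bar>x\<bar>" by linarith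
      moreover have "(norm \<beta>)\<^sup>2 = (Re \<beta>)\<^sup>2 + (Im \<beta>)\<^sup>2" by (simp add: cmod_power2)
      ultimately show "(Re \<beta>)\<^sup>2 - (Im \<beta> + 2 * x)\<^sup>2 \<le> (norm \<beta>)\<^sup>2 + 4 * norm \<beta> * \<bar>x\<bar> - 4 * x\<^sup>2"
        by (simp add: power2_sum power_mult_distrib) (use zero_le_power2[of "Im \<beta>"] in \<open>linarith\<close>)
    qed (use al in auto)
    also have "\<dots> = (norm \<beta>)\<^sup>2 / (4 * \<alpha>) + (norm \<beta> / \<alpha> * \<bar>x\<bar> - (1 / \<alpha>) * x\<^sup>2)"
      using al by (simp add: field_simps)
    finally show "norm (exp ((\<beta> + 2 * \<i> * of_real x)\<^sup>2 / (4 * of_real \<alpha>))) \<le> exp ((norm \<beta>)\<^sup>2 / (4 * \<alpha>)) * exp (norm \<beta> / \<alpha> * \<bar>x\<bar> - (1 / \<alpha>) * x\<^sup>2)"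
      by (simp flip: exp_add)
qed

text \<open>The moments are the Taylor coefficients of both sides in \<beta>. Absolute convergence
  of the double series, with \<open>exp (norm \<beta> * \<bar>l k\<bar>)\<close> and the Hermite
  generating function as majorants of the inner sums, allows resummation for every complex
  \<beta>.\<close>

lemma gauss_poisson:
  fixes a b :: "nat \<Rightarrow> complex" and l m :: "nat \<Rightarrow> real" and \<beta> :: complex
  assumes sa: "\<And>\<epsilon> K. \<epsilon> > 0 \<Longrightarrow> summable (\<lambda>k. norm (a k) * exp (K * \<bar>l k\<bar> - \<epsilon> * (l k)\<^sup>2))"
    and sb: "\<And>\<epsilon> K. \<epsilon> > 0 \<Longrightarrow> summable (\<lambda>k. norm (b k) * exp (K * \<bar>m k\<bar> - \<epsilon> * (m k)\<^sup>2))"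
    and base: "\<And>\<alpha> j. \<alpha> > 0 \<Longrightarrow> j < 2 \<Longrightarrow> (\<Sum>k. a k * (of_real (l k) ^ j * exp (- of_real \<alpha> * of_real ((l k)\<^sup>2))))
          = \<kappa> * (\<Sum>k. b k * dual_gauss (of_real (m k)) j (of_real \<alpha>))"
    and al: "\<alpha> > 0"
  shows "(\<Sum>k. a k * exp (- of_real \<alpha> * of_real ((l k)\<^sup>2) + \<beta> * of_real (l k)))
     = \<kappa> * of_real (\<alpha> powr (-1/2)) * (\<Sum>k. b k * exp ((\<beta> + 2 * \<i> * of_real (m k))\<^sup>2 / (4 * of_real \<alpha>)))"
proof -
  define T where "T j = (\<Sum>k. a k * (of_real (l k) ^ j * exp (- of_real \<alpha> * of_real ((l k)\<^sup>2))))" for j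
  define T' where "T' j = (\<Sum>k. b k * dual_gauss (of_real (m k)) j (of_real \<alpha>))" for j
  have TT: "T j = \<kappa> * T' j" for j
    unfolding T_def T'_def by (rule gauss_moments_eq[OF sa sb base al])
  have powr: "complex_of_real \<alpha> powr (-1/2) = of_real (\<alpha> powr (-1/2))"
    using al powr_of_real[of \<alpha> "-1/2"] by simp
  have sT: "summable (\<lambda>k. a k * (of_real (l k) ^ j * exp (- of_real \<alpha> * of_real ((l k)\<^sup>2))))" for j
  proof (rule summable_comparison_test')
    show "summable (\<lambda>k. fact j * (norm (a k) * exp (1 * \<bar>l k\<bar> - \<alpha> * (l k)\<^sup>2)))"
      using al by (intro summable_mult sa)
    fix k
    have "norm (of_real (l k) ^ j * exp (- of_real \<alpha> * of_real ((l k)\<^sup>2)) :: complex) = \<bar>l k\<bar> ^ j * exp (- \<alpha> * (l k)\<^sup>2)"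
      by (simp add: norm_mult norm_power)
    also have "\<dots> \<le> (fact j * exp \<bar>l k\<bar>) * exp (- \<alpha> * (l k)\<^sup>2)"
      by (intro mult_right_mono power_le_fact_exp) auto
    also have "\<dots> = fact j * exp (1 * \<bar>l k\<bar> - \<alpha> * (l k)\<^sup>2)" by (simp flip: exp_add)
    finally have "norm (of_real (l k) ^ j * exp (- of_real \<alpha> * of_real ((l k)\<^sup>2)) :: complex) \<le> fact j * exp (1 * \<bar>l k\<bar> - \<alpha> * (l k)\<^sup>2)" .
    from mult_left_mono[OF this norm_ge_zero[of "a k"]]
    show "norm (a k * (of_real (l k) ^ j * exp (- of_real \<alpha> * of_real ((l k)\<^sup>2))))
        \<le> fact j * (norm (a k) * exp (1 * \<bar>l k\<bar> - \<alpha> * (l k)\<^sup>2))"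
      by (simp only: norm_mult mult.left_commute)
  qed
  define c where "c = \<alpha> powr (-1/2) * exp ((norm \<beta>)\<^sup>2 / (4 * \<alpha>))"
  have nd: "norm (dual_gauss (of_real x) j (of_real \<alpha>)) \<le> \<alpha> powr (-1/2) * exp (- x\<^sup>2 / \<alpha>) * hermite (\<bar>x\<bar> / \<alpha>) (1 / (4 * \<alpha>)) j" for x j
  proof -
    have "norm (dual_gauss (of_real x) j (of_real \<alpha>)) = \<alpha> powr (-1/2) * exp (- x\<^sup>2 / \<alpha>) * norm (hermite (\<i> * of_real x / of_real \<alpha>) (1 / (4 * of_real \<alpha>)) j)"
      unfolding dual_gauss_def powr by (simp add: norm_mult flip: of_real_power of_real_divide of_real_minus)
    also have "norm (hermite (\<i> * of_real x / of_real \<alpha>) (1 / (4 * of_real \<alpha>)) j) \<le> hermite (\<bar>x\<bar> / \<alpha>) (1 / (4 * \<alpha>)) j"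
      using norm_hermite_le[of "\<i> * of_real x / of_real \<alpha>" "1 / (4 * of_real \<alpha>)" j] al by (simp add: norm_divide norm_mult)
    finally show ?thesis by (simp add: mult_left_mono)
  qed
  have sT': "summable (\<lambda>k. b k * dual_gauss (of_real (m k)) j (of_real \<alpha>))" for j
  proof (rule summable_comparison_test')
    let ?c = "\<alpha> powr (-1/2) * fact j * exp (1 / (4 * \<alpha>))"
    show "summable (\<lambda>k. ?c * (norm (b k) * exp (1 / \<alpha> * \<bar>m k\<bar> - (1 / \<alpha>) * (m k)\<^sup>2)))"
      using al by (intro summable_mult sb) auto
    fix k
    have "hermite (\<bar>m k\<bar> / \<alpha>) (1 / (4 * \<alpha>)) j \<le> fact j * exp (\<bar>m k\<bar> / \<alpha> + 1 / (4 * \<alpha>))"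
    proof -
      have "norm (hermite (of_real (\<bar>m k\<bar> / \<alpha>)) (of_real (1 / (4 * \<alpha>))) j :: complex) \<le> fact j * exp (\<bar>m k\<bar> / \<alpha> + 1 / (4 * \<alpha>))"
        using norm_hermite_le_exp[of "of_real (\<bar>m k\<bar> / \<alpha>)" "of_real (1 / (4 * \<alpha>))" j] al by (simp del: of_real_divide)
      then show ?thesis unfolding hermite_of_real[symmetric] by simp
    qed
    then have "\<alpha> powr (-1/2) * exp (- (m k)\<^sup>2 / \<alpha>) * hermite (\<bar>m k\<bar> / \<alpha>) (1 / (4 * \<alpha>)) j
        \<le> \<alpha> powr (-1/2) * exp (- (m k)\<^sup>2 / \<alpha>) * (fact j * exp (\<bar>m k\<bar> / \<alpha> + 1 / (4 * \<alpha>)))"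
      by (intro mult_left_mono) auto
    also have "\<dots> = ?c * exp (1 / \<alpha> * \<bar>m k\<bar> - (1 / \<alpha>) * (m k)\<^sup>2)"
      by (simp add: exp_add exp_diff exp_minus field_simps)
    finally have "norm (dual_gauss (of_real (m k)) j (of_real \<alpha>)) \<le> ?c * exp (1 / \<alpha> * \<bar>m k\<bar> - (1 / \<alpha>) * (m k)\<^sup>2)"
      using nd[of "m k" j] by linarith
    from mult_left_mono[OF this norm_ge_zero[of "b k"]]
    show "norm (b k * dual_gauss (of_real (m k)) j (of_real \<alpha>)) \<le> ?c * (norm (b k) * exp (1 / \<alpha> * \<bar>m k\<bar> - (1 / \<alpha>) * (m k)\<^sup>2))"
      by (simp only: norm_mult mult.left_commute)
  qed
  have "(\<Sum>k. a k * exp (- of_real \<alpha> * of_real ((l k)\<^sup>2) + \<beta> * of_real (l k)))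
     = (\<Sum>k. \<Sum>j. a k * (of_real (l k) ^ j * exp (- of_real \<alpha> * of_real ((l k)\<^sup>2))) * (\<beta> ^ j / fact j))"
  proof (rule suminf_cong)
    fix k
    have "(\<lambda>j. (\<beta> * of_real (l k)) ^ j / fact j) sums exp (\<beta> * of_real (l k))"
      using exp_converges[of "\<beta> * of_real (l k)"] by (simp add: scaleR_conv_of_real divide_inverse mult_ac)
    from sums_mult[OF this, of "a k * exp (- of_real \<alpha> * of_real ((l k)\<^sup>2))"]
    have "(\<lambda>j. a k * (of_real (l k) ^ j * exp (- of_real \<alpha> * of_real ((l k)\<^sup>2))) * (\<beta> ^ j / fact j))
        sums (a k * exp (- of_real \<alpha> * of_real ((l k)\<^sup>2)) * exp (\<beta> * of_real (l k)))"
      by (simp add: power_mult_distrib mult_ac)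
    from sums_unique[OF this] show "a k * exp (- of_real \<alpha> * of_real ((l k)\<^sup>2) + \<beta> * of_real (l k))
        = (\<Sum>j. a k * (of_real (l k) ^ j * exp (- of_real \<alpha> * of_real ((l k)\<^sup>2))) * (\<beta> ^ j / fact j))"
      by (simp only: exp_add mult.assoc)
  qed
  also have "\<dots> = (\<Sum>j. \<Sum>k. a k * (of_real (l k) ^ j * exp (- of_real \<alpha> * of_real ((l k)\<^sup>2))) * (\<beta> ^ j / fact j))"
  proof (rule suminf_swap)
    show "norm (a k * (of_real (l k) ^ j * exp (- of_real \<alpha> * of_real ((l k)\<^sup>2))) * (\<beta> ^ j / fact j))
       \<le> norm (a k) * exp (- \<alpha> * (l k)\<^sup>2) * ((norm \<beta> * \<bar>l k\<bar>) ^ j / fact j)" for k j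
      by (simp add: norm_mult norm_power norm_divide power_mult_distrib mult_ac)
    show "(\<lambda>j. norm (a k) * exp (- \<alpha> * (l k)\<^sup>2) * ((norm \<beta> * \<bar>l k\<bar>) ^ j / fact j)) sums
        (norm (a k) * exp (- \<alpha> * (l k)\<^sup>2) * exp (norm \<beta> * \<bar>l k\<bar>))" for k
      using exp_converges[of "norm \<beta> * \<bar>l k\<bar>"] by (intro sums_mult) (simp add: divide_inverse mult_ac)
    have "summable (\<lambda>k. norm (a k) * exp (norm \<beta> * \<bar>l k\<bar> - \<alpha> * (l k)\<^sup>2))" by (rule sa[OF al])
    then show "summable (\<lambda>k. norm (a k) * exp (- \<alpha> * (l k)\<^sup>2) * exp (norm \<beta> * \<bar>l k\<bar>))"
      by (simp add: mult.assoc flip: exp_add)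
  qed
  also have "\<dots> = (\<Sum>j. T j * (\<beta> ^ j / fact j))"
    unfolding T_def by (intro suminf_cong suminf_mult2[symmetric] sT)
  also have "\<dots> = (\<Sum>j. \<kappa> * (T' j * (\<beta> ^ j / fact j)))" by (simp add: TT mult.assoc)
  also have "(\<Sum>j. \<kappa> * (T' j * (\<beta> ^ j / fact j))) = (\<Sum>j. \<Sum>k. \<kappa> * (b k * dual_gauss (of_real (m k)) j (of_real \<alpha>) * (\<beta> ^ j / fact j)))"
    unfolding T'_def
    by (intro suminf_cong) (simp only: suminf_mult2[OF sT'] suminf_mult[OF summable_mult2[OF sT']])
  also have "\<dots> = (\<Sum>k. \<Sum>j. \<kappa> * (b k * dual_gauss (of_real (m k)) j (of_real \<alpha>) * (\<beta> ^ j / fact j)))"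
  proof (rule suminf_swap[symmetric])
    \<comment> \<open>The Hermite polynomial at absolute values; its generating function evaluates
      the inner sums in closed form, and they are again Gaussian in \<open>m k\<close>.\<close>
    define g where "g k j = norm \<kappa> * (norm (b k) * (\<alpha> powr (-1/2) * exp (- (m k)\<^sup>2 / \<alpha>))) * (hermite (\<bar>m k\<bar> / \<alpha>) (1 / (4 * \<alpha>)) j / fact j * norm \<beta> ^ j)" for k j
    show "norm (\<kappa> * (b k * dual_gauss (of_real (m k)) j (of_real \<alpha>) * (\<beta> ^ j / fact j))) \<le> g k j" for k j
    proof -
      have "norm (\<kappa> * (b k * dual_gauss (of_real (m k)) j (of_real \<alpha>) * (\<beta> ^ j / fact j)))
          = norm (dual_gauss (of_real (m k)) j (of_real \<alpha>)) * (norm \<kappa> * norm (b k) * norm \<beta> ^ j / fact j)"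
        by (simp add: norm_mult norm_divide norm_power)
      also have "\<dots> \<le> \<alpha> powr (-1/2) * exp (- (m k)\<^sup>2 / \<alpha>) * hermite (\<bar>m k\<bar> / \<alpha>) (1 / (4 * \<alpha>)) j * (norm \<kappa> * norm (b k) * norm \<beta> ^ j / fact j)"
        by (intro mult_right_mono nd) auto
      finally show ?thesis by (simp add: g_def mult_ac)
    qed
    show "g k sums (norm \<kappa> * (norm (b k) * (\<alpha> powr (-1/2) * exp (- (m k)\<^sup>2 / \<alpha>))) * exp (\<bar>m k\<bar> / \<alpha> * norm \<beta> + 1 / (4 * \<alpha>) * (norm \<beta>)\<^sup>2))" for k
      unfolding g_def by (intro sums_mult hermite_sums_real)
    have "summable (\<lambda>k. norm \<kappa> * c * (norm (b k) * exp (norm \<beta> / \<alpha> * \<bar>m k\<bar> - (1 / \<alpha>) * (m k)\<^sup>2)))"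
      using al by (intro summable_mult sb) auto
    then show "summable (\<lambda>k. norm \<kappa> * (norm (b k) * (\<alpha> powr (-1/2) * exp (- (m k)\<^sup>2 / \<alpha>))) * exp (\<bar>m k\<bar> / \<alpha> * norm \<beta> + 1 / (4 * \<alpha>) * (norm \<beta>)\<^sup>2))"
      by (simp add: c_def exp_add exp_diff exp_minus field_simps)
  qed
  also have "\<dots> = (\<Sum>k. \<kappa> * of_real (\<alpha> powr (-1/2)) * (b k * exp ((\<beta> + 2 * \<i> * of_real (m k))\<^sup>2 / (4 * of_real \<alpha>))))"
  proof (rule suminf_cong)
    fix k
    let ?m = "complex_of_real (m k)"
    let ?u = "\<i> * ?m / of_real \<alpha>" and ?v = "1 / (4 * complex_of_real \<alpha>)"
    have "(\<lambda>j. \<kappa> * (b k * (of_real (\<alpha> powr (-1/2)) * exp (- ?m\<^sup>2 / of_real \<alpha>))) * (hermite ?u ?v j / fact j * \<beta> ^ j))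
        sums (\<kappa> * (b k * (of_real (\<alpha> powr (-1/2)) * exp (- ?m\<^sup>2 / of_real \<alpha>))) * exp (?u * \<beta> + ?v * \<beta>\<^sup>2))"
      by (intro sums_mult hermite_sums)
    then have "(\<Sum>j. \<kappa> * (b k * dual_gauss ?m j (of_real \<alpha>) * (\<beta> ^ j / fact j)))
        = \<kappa> * (b k * (of_real (\<alpha> powr (-1/2)) * exp (- ?m\<^sup>2 / of_real \<alpha>))) * exp (?u * \<beta> + ?v * \<beta>\<^sup>2)"
      unfolding dual_gauss_def powr by (simp add: sums_iff mult_ac)
    also have "\<dots> = \<kappa> * of_real (\<alpha> powr (-1/2)) * (b k * (exp (- ?m\<^sup>2 / of_real \<alpha>) * exp (?u * \<beta> + ?v * \<beta>\<^sup>2)))"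
      by (simp only: mult_ac)
    also have "exp (- ?m\<^sup>2 / of_real \<alpha>) * exp (?u * \<beta> + ?v * \<beta>\<^sup>2) = exp ((\<beta> + 2 * \<i> * ?m)\<^sup>2 / (4 * of_real \<alpha>))"
      unfolding exp_add[symmetric]
      by (rule arg_cong[of _ _ exp]) (use al in \<open>simp add: field_simps power2_eq_square\<close>)
    finally show "(\<Sum>j. \<kappa> * (b k * dual_gauss ?m j (of_real \<alpha>) * (\<beta> ^ j / fact j)))
        = \<kappa> * of_real (\<alpha> powr (-1/2)) * (b k * exp ((\<beta> + 2 * \<i> * ?m)\<^sup>2 / (4 * of_real \<alpha>)))" .
  qed
  also have "\<dots> = \<kappa> * of_real (\<alpha> powr (-1/2)) * (\<Sum>k. b k * exp ((\<beta> + 2 * \<i> * of_real (m k))\<^sup>2 / (4 * of_real \<alpha>)))"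
  proof (rule suminf_mult)
    show "summable (\<lambda>k. b k * exp ((\<beta> + 2 * \<i> * of_real (m k))\<^sup>2 / (4 * of_real \<alpha>)))"
    proof (rule summable_comparison_test')
      show "summable (\<lambda>k. exp ((norm \<beta>)\<^sup>2 / (4 * \<alpha>)) * (norm (b k) * exp (norm \<beta> / \<alpha> * \<bar>m k\<bar> - (1 / \<alpha>) * (m k)\<^sup>2)))"
        using al by (intro summable_mult sb) auto
      fix k
      from mult_left_mono[OF norm_exp_square_le[OF al, of \<beta> "m k"] norm_ge_zero[of "b k"]]
      show "norm (b k * exp ((\<beta> + 2 * \<i> * of_real (m k))\<^sup>2 / (4 * of_real \<alpha>))) \<le> exp ((norm \<beta>)\<^sup>2 / (4 * \<alpha>)) * (norm (b k) * exp (norm \<beta> / \<alpha> * \<bar>m k\<bar> - (1 / \<alpha>) * (m k)\<^sup>2))"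
        by (simp only: norm_mult mult.left_commute)
    qed
  qed
  finally show ?thesis .
qed

section \<open>Sums over all integers\<close>

lemma has_sum_int_decompose:
  fixes f :: "int \<Rightarrow> 'a::banach"
  assumes p: "summable (\<lambda>n. norm (f (int (Suc n))))" and q: "summable (\<lambda>n. norm (f (- int (Suc n))))"
  shows "(f has_sum (f 0 + ((\<Sum>n. f (int (Suc n))) + (\<Sum>n. f (- int (Suc n)))))) UNIV"
    and "(\<lambda>n. norm (f n)) summable_on UNIV"
proof -
  have U: "(UNIV :: int set) = {0} \<union> (range (\<lambda>n. int (Suc n)) \<union> range (\<lambda>n. - int (Suc n)))"
  proof safe
    fix x :: int assume "x \<notin> range (\<lambda>n. - int (Suc n))" "x \<noteq> 0"
    then show "x \<in> range (\<lambda>n. int (Suc n))"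
      by (cases x rule: int_cases) (auto simp: image_iff intro!: exI[of _ "nat x - 1"])
  qed auto
  have gen: "(g has_sum (g 0 + ((\<Sum>n. g (int (Suc n))) + (\<Sum>n. g (- int (Suc n)))))) UNIV"
    if p: "summable (\<lambda>n. norm (g (int (Suc n))))" and q: "summable (\<lambda>n. norm (g (- int (Suc n))))"
    for g :: "int \<Rightarrow> 'b::banach"
  proof -
    have 1: "(g has_sum (\<Sum>n. g (int (Suc n)))) (range (\<lambda>n. int (Suc n)))"
      by (subst has_sum_reindex)
        (auto simp: inj_on_def o_def intro!: norm_summable_imp_has_sum[OF p] summable_sums summable_norm_cancel[OF p] simp del: of_nat_Suc)
    have 2: "(g has_sum (\<Sum>n. g (- int (Suc n)))) (range (\<lambda>n. - int (Suc n)))"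
      by (subst has_sum_reindex)
        (auto simp: inj_on_def o_def intro!: norm_summable_imp_has_sum[OF q] summable_sums summable_norm_cancel[OF q] simp del: of_nat_Suc)
    have 3: "(g has_sum g 0) {0}" using has_sum_finite[of "{0}" g] by simp
    show ?thesis
      unfolding U by (intro has_sum_Un_disjoint 1 2 3) (auto simp: image_iff)
  qed
  show "(f has_sum (f 0 + ((\<Sum>n. f (int (Suc n))) + (\<Sum>n. f (- int (Suc n)))))) UNIV"
    by (rule gen[OF p q])
  show "(\<lambda>n. norm (f n)) summable_on UNIV"
    using gen[of "\<lambda>n. norm (f n)"] p q by (auto simp: summable_on_def)
qed

text \<open>The Poisson formula is proved for series over the naturals, whereas the extended
  sequences are indexed by the integers; absolute convergence makes the enumeration
  immaterial.\<close>

lemma suminf_int_decode: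
  fixes f :: "int \<Rightarrow> complex"
  assumes "(\<lambda>n. norm (f n)) summable_on UNIV"
  shows "(\<Sum>k. f (int_decode k)) = infsum f UNIV"
proof -
  have "(f has_sum infsum f UNIV) UNIV"
    by (rule has_sum_infsum[OF abs_summable_summable[OF assms]])
  then have "((\<lambda>k. f (int_decode k)) has_sum infsum f UNIV) UNIV"
    by (subst has_sum_reindex_bij_betw[OF bij_int_decode])
  then show ?thesis by (auto dest!: has_sum_imp_sums simp: sums_iff)
qed

lemma summable_int_decode:
  fixes f :: "int \<Rightarrow> real"
  assumes "f summable_on UNIV"
  shows "summable (\<lambda>k. f (int_decode k))"
  using assms by (intro summable_on_imp_summable) (subst summable_on_reindex_bij_betw[OF bij_int_decode])

lemma ext_freq_simps [simp]:
  "ext_freq lam 0 = 0" "ext_freq lam (int (Suc n)) = lam (Suc n)" "ext_freq lam (- int (Suc n)) = - lam (Suc n)"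
  by (simp_all add: ext_freq_def del: of_nat_Suc)

lemma ext_coeff_simps [simp]:
  "ext_coeff \<delta> \<Phi> a 0 = - 2 * \<Phi> (- of_nat \<delta>)" "ext_coeff \<delta> \<Phi> a (int (Suc n)) = a (Suc n)"
  "ext_coeff \<delta> \<Phi> a (- int (Suc n)) = (- 1) ^ \<delta> * a (Suc n)"
  by (simp_all add: ext_coeff_def del: of_nat_Suc)

lemma class_B_abscissa_real:
  assumes "class_B \<delta> lam a mu b \<Phi> \<Psi>"
  obtains \<sigma> where "summable (\<lambda>n. norm (a (Suc n)) * lam (Suc n) powr (- \<sigma>))"
proof -
  obtain A where "abs_abscissa lam a = ereal A"
    using class_B_dirichlet_data(1)[OF assms] unfolding dirichlet_data_def by (cases "abs_abscissa lam a") auto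
  then have "abs_abscissa lam a < ereal (A + 1)" by simp
  from that[OF summable_of_abs_abscissa_less[OF class_B_dirichlet_data(2)[OF assms] this]] show ?thesis .
qed

lemma class_B_gauss_summable:
  assumes B: "class_B \<delta> lam a mu b \<Phi> \<Psi>" and e: "\<epsilon> > 0"
  shows "(\<lambda>n. norm (ext_coeff \<delta> \<Phi> a n) * exp (K * \<bar>ext_freq lam n\<bar> - \<epsilon> * (ext_freq lam n)\<^sup>2)) summable_on UNIV"
proof -
  obtain \<sigma> where s: "summable (\<lambda>n. norm (a (Suc n)) * lam (Suc n) powr (- \<sigma>))"
    using class_B_abscissa_real[OF B] .
  note fr = class_B_dirichlet_data(2)[OF B]
  have "lam (Suc n) > 0" for n by (rule frequencies_pos[OF fr])
  then have ab: "\<bar>lam (Suc n)\<bar> = lam (Suc n)" for n by (simp add: less_imp_le)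
  let ?f = "\<lambda>n. norm (ext_coeff \<delta> \<Phi> a n) * exp (K * \<bar>ext_freq lam n\<bar> - \<epsilon> * (ext_freq lam n)\<^sup>2)"
  have "(\<lambda>n. norm (?f n)) summable_on UNIV"
    by (rule has_sum_int_decompose(2))
       (use summable_dirichlet_gauss[OF fr s e, of K] in \<open>simp_all add: norm_mult norm_power ab del: of_nat_Suc\<close>)
  then show ?thesis by simp
qed

lemma dual_gauss_0_1:
  assumes "\<alpha> > 0"
  shows "dual_gauss m 0 (of_real \<alpha>) = of_real (\<alpha> powr (-1/2)) * exp (- m\<^sup>2 / of_real \<alpha>)"
    "dual_gauss m (Suc 0) (of_real \<alpha>) = of_real (\<alpha> powr (-1/2)) * exp (- m\<^sup>2 / of_real \<alpha>) * (\<i> * m / of_real \<alpha>)"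
  using powr_of_real[of \<alpha> "-1/2"] assms by (simp_all add: dual_gauss_def)

text \<open>For \<open>j \<noteq> \<delta>\<close> both sides vanish by antisymmetry.\<close>
lemma class_B_theta_int:
  assumes B: "class_B \<delta> lam a mu b \<Phi> \<Psi>" and al: "\<alpha> > 0" and j: "j < 2"
  defines "A \<equiv> ext_coeff \<delta> \<Phi> a" and "L \<equiv> ext_freq lam" and "C \<equiv> ext_coeff \<delta> \<Psi> b" and "M \<equiv> ext_freq mu"
  shows "(\<lambda>n. norm (A n * (of_real (L n) ^ j * exp (- of_real \<alpha> * of_real ((L n)\<^sup>2))))) summable_on UNIV" (is ?S1)
    and "(\<lambda>n. norm (C n * dual_gauss (of_real (M n)) j (of_real \<alpha>))) summable_on UNIV" (is ?S2)
    and "infsum (\<lambda>n. A n * (of_real (L n) ^ j * exp (- of_real \<alpha> * of_real ((L n)\<^sup>2)))) UNIV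
       = (- \<i>) ^ \<delta> * infsum (\<lambda>n. C n * dual_gauss (of_real (M n)) j (of_real \<alpha>)) UNIV" (is ?E)
proof -
  note Bs = class_B_sym[OF B]
  have d: "\<delta> = 0 \<or> \<delta> = 1" by (rule class_B_holomorphic(4)[OF B])
  have j01: "j = 0 \<or> j = 1" using j by auto
  define f where "f n = A n * (of_real (L n) ^ j * exp (- of_real \<alpha> * of_real ((L n)\<^sup>2)))" for n
  define g where "g n = C n * dual_gauss (of_real (M n)) j (of_real \<alpha>)" for n
  define fa where "fa n = a (Suc n) * complex_of_real (lam (Suc n) ^ j * exp (- (lam (Suc n))\<^sup>2 * \<alpha>))" for n
  define gb where "gb n = b (Suc n) * complex_of_real (mu (Suc n) ^ j * exp (- (mu (Suc n))\<^sup>2 * (1 / \<alpha>)))" for n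
  define k where "k = complex_of_real (\<alpha> powr (-1/2)) * (\<i> / of_real \<alpha>) ^ j"
  have f1: "f (int (Suc n)) = fa n" "f (- int (Suc n)) = (- 1) ^ \<delta> * (- 1) ^ j * fa n" for n
    using j01 by (auto simp: f_def fa_def A_def L_def exp_of_real[symmetric] mult_ac simp del: of_nat_Suc)
  have g1: "g (int (Suc n)) = k * gb n" "g (- int (Suc n)) = (- 1) ^ \<delta> * (- 1) ^ j * (k * gb n)" for n
    using j01 by (auto simp: g_def gb_def k_def C_def M_def dual_gauss_0_1[OF al] exp_of_real[symmetric] mult_ac simp del: of_nat_Suc)
  have f0: "f 0 = (if j = 0 then - 2 * \<Phi> (- of_nat \<delta>) else 0)"
    by (auto simp: f_def A_def L_def)
  have g0: "g 0 = (if j = 0 then k * (- 2 * \<Psi> (- of_nat \<delta>)) else 0)"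
    using j01 by (auto simp: g_def C_def M_def k_def dual_gauss_0_1[OF al])
  have sab: "summable (\<lambda>n. norm (c (Suc n) * complex_of_real (l (Suc n) ^ j * exp (- (l (Suc n))\<^sup>2 * x))))"
    if fr: "frequencies l" and s: "summable (\<lambda>n. norm (c (Suc n)) * l (Suc n) powr (- \<sigma>))" and x: "x > 0"
    for c :: "nat \<Rightarrow> complex" and l \<sigma> x
  proof (rule summable_comparison_test')
    show "summable (\<lambda>n. fact j * (norm (c (Suc n)) * exp (1 * l (Suc n) - x * (l (Suc n))\<^sup>2)))"
      by (intro summable_mult summable_dirichlet_gauss[OF fr s x])
    fix n
    have pos: "l (Suc n) > 0" by (rule frequencies_pos[OF fr])
    have "norm (complex_of_real (l (Suc n) ^ j * exp (- (l (Suc n))\<^sup>2 * x))) = l (Suc n) ^ j * exp (- (l (Suc n))\<^sup>2 * x)"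
      using pos by (simp only: norm_of_real) simp
    also have "\<dots> \<le> (fact j * exp (l (Suc n))) * exp (- (l (Suc n))\<^sup>2 * x)"
      using pos by (intro mult_right_mono power_le_fact_exp) auto
    also have "\<dots> = fact j * exp (1 * l (Suc n) - x * (l (Suc n))\<^sup>2)" by (simp add: mult_ac flip: exp_add)
    finally have "norm (complex_of_real (l (Suc n) ^ j * exp (- (l (Suc n))\<^sup>2 * x))) \<le> fact j * exp (1 * l (Suc n) - x * (l (Suc n))\<^sup>2)" .
    from mult_left_mono[OF this norm_ge_zero[of "c (Suc n)"]]
    show "norm (norm (c (Suc n) * complex_of_real (l (Suc n) ^ j * exp (- (l (Suc n))\<^sup>2 * x)))) \<le> fact j * (norm (c (Suc n)) * exp (1 * l (Suc n) - x * (l (Suc n))\<^sup>2))"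
      by (simp only: norm_mult mult.left_commute real_norm_def abs_mult abs_norm_cancel)
  qed
  obtain \<sigma>1 where s1: "summable (\<lambda>n. norm (a (Suc n)) * lam (Suc n) powr (- \<sigma>1))"
    using class_B_abscissa_real[OF B] .
  obtain \<sigma>2 where s2: "summable (\<lambda>n. norm (b (Suc n)) * mu (Suc n) powr (- \<sigma>2))"
    using class_B_abscissa_real[OF Bs] .
  have sfa: "summable (\<lambda>n. norm (fa n))"
    unfolding fa_def by (rule sab[OF class_B_dirichlet_data(2)[OF B] s1 al])
  have sgb: "summable (\<lambda>n. norm (gb n))"
    unfolding gb_def using al by (intro sab[OF class_B_dirichlet_data(2)[OF Bs] s2]) simp
  have sf: "summable (\<lambda>n. norm (f (int (Suc n))))" "summable (\<lambda>n. norm (f (- int (Suc n))))"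
    unfolding f1 using sfa by (simp_all add: norm_mult norm_power)
  have sg: "summable (\<lambda>n. norm (g (int (Suc n))))" "summable (\<lambda>n. norm (g (- int (Suc n))))"
    unfolding g1 using sgb by (simp_all add: norm_mult norm_power)
  show ?S1 using has_sum_int_decompose(2)[of f, OF sf] by (simp add: f_def)
  show ?S2 using has_sum_int_decompose(2)[of g, OF sg] by (simp add: g_def)
  \<comment> \<open>The sign of a term under \<open>n\<close> to \<open>- n\<close>: one factor from
    the coefficient, one from the j-th power of the frequency. So \<open>1 + e\<close> is 2 for
    \<open>j = \<delta>\<close> and 0 otherwise.\<close>
  define e where "e = (- 1) ^ \<delta> * (- 1 :: complex) ^ j"
  define F where "F = (\<Sum>n. fa n)"
  define G where "G = (\<Sum>n. gb n)"
  have eF: "(\<Sum>n. (- 1) ^ \<delta> * (- 1) ^ j * fa n) = e * F"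
    unfolding e_def F_def by (rule suminf_mult[OF summable_norm_cancel[OF sfa]])
  have kG: "(\<Sum>n. k * gb n) = k * G"
    unfolding G_def by (rule suminf_mult[OF summable_norm_cancel[OF sgb]])
  have ekG: "(\<Sum>n. (- 1) ^ \<delta> * (- 1) ^ j * (k * gb n)) = e * (k * G)"
    unfolding e_def kG[symmetric] by (rule suminf_mult[OF summable_mult[OF summable_norm_cancel[OF sgb]]])
  have If: "infsum f UNIV = f 0 + (1 + e) * F"
    using infsumI[OF has_sum_int_decompose(1)[of f, OF sf]] unfolding f1 eF F_def[symmetric]
    by (simp add: distrib_right)
  have Ig: "infsum g UNIV = g 0 + (1 + e) * (k * G)"
    using infsumI[OF has_sum_int_decompose(1)[of g, OF sg]] unfolding g1 ekG kG
    by (simp add: distrib_right)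
  have "infsum f UNIV = (- \<i>) ^ \<delta> * infsum g UNIV"
  proof (cases "j = \<delta>")
    case False
    then have "e = - 1" using d j01 by (auto simp: e_def)
    moreover have "f 0 = 0" "g 0 = 0"
    proof -
      have "\<Phi> (- of_nat \<delta>) = 0 \<and> \<Psi> (- of_nat \<delta>) = 0" if "j = 0"
      proof -
        have "\<delta> = 1" using that False d by auto
        then show ?thesis using class_B_odd_zero B Bs by auto
      qed
      then show "f 0 = 0" "g 0 = 0" unfolding f0 g0 by auto
    qed
    ultimately show ?thesis unfolding If Ig by simp
  next
    case True
    have e1: "e = 1" using d by (auto simp: e_def True)
    define y where "y = sqrt \<alpha>"
    have y: "y > 0" "y\<^sup>2 = \<alpha>" using al by (auto simp: y_def)
    have y2: "(1 / y)\<^sup>2 = 1 / \<alpha>" using y by (simp add: power_one_over)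
    have "\<alpha> powr (-1/2) = \<alpha> powr (- (1/2))" by simp
    also have "\<dots> = inverse (\<alpha> powr (1/2))" by (rule powr_minus)
    also have "\<alpha> powr (1/2) = y" unfolding y_def by (rule powr_half_sqrt[OF less_imp_le[OF al]])
    finally have yp: "\<alpha> powr (-1/2) = 1 / y" by (simp only: inverse_eq_divide)
    have th: "- 2 * \<Phi> (- of_nat \<delta>) + 2 * complex_of_real y ^ \<delta> * F = (- 2 * \<Psi> (- of_nat \<delta>) + 2 * (1 / complex_of_real y) ^ \<delta> * G) / y"
      using class_B_theta[OF B y(1)] by (simp only: y(2) y2 fa_def gb_def True F_def G_def)
    show ?thesis
    proof (cases "\<delta> = 0")
      case d0: True
      have "k = 1 / complex_of_real y" by (simp only: k_def yp True d0) simp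
      then show ?thesis unfolding If Ig f0 g0 e1 using th
        by (simp add: True d0 add_divide_distrib diff_divide_distrib)
    next
      case False
      then have d1: "\<delta> = 1" using d by auto
      have z: "\<Phi> (- of_nat \<delta>) = 0" "\<Psi> (- of_nat \<delta>) = 0"
        using class_B_odd_zero B Bs d1 by auto
      \<comment> \<open>The factor \<open>\<i>\<close> is the linear Hermite polynomial at order
        one; the constant \<open>(- \<i>) ^ \<delta>\<close> of the Poisson formula cancels
        it.\<close>
      have k: "k = (1 / complex_of_real y) * (\<i> / of_real \<alpha>)" by (simp only: k_def yp True d1) simp
      have "2 * complex_of_real y * F = 2 * G / (complex_of_real y * complex_of_real y)"
        using th unfolding z by (simp add: d1)
      then have "F = G / (complex_of_real y * complex_of_real (y\<^sup>2))"
        using y(1) by (simp add: field_simps power2_eq_square)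
      then have "F = (- \<i>) * (k * G)" unfolding y(2) k by simp
      then show ?thesis unfolding If Ig f0 g0 e1 using True d1 by simp
    qed
  qed
  then show ?E unfolding f_def[abs_def] g_def[abs_def] .
qed

text \<open>Poisson summation for the measure attached to a Bochner pair. The theta relation
  provides the moments of orders 0 and 1, from which all others follow.\<close>

lemma class_B_poisson:
  assumes B: "class_B \<delta> lam a mu b \<Phi> \<Psi>" and al: "\<alpha> > 0"
  shows "infsum (\<lambda>n. ext_coeff \<delta> \<Phi> a n * exp (- of_real \<alpha> * of_real ((ext_freq lam n)\<^sup>2) + \<beta> * of_real (ext_freq lam n))) UNIV
     = (- \<i>) ^ \<delta> * of_real (\<alpha> powr (-1/2)) *
         infsum (\<lambda>n. ext_coeff \<delta> \<Psi> b n * exp ((\<beta> + 2 * \<i> * of_real (ext_freq mu n))\<^sup>2 / (4 * of_real \<alpha>))) UNIV"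
proof -
  let ?A = "ext_coeff \<delta> \<Phi> a" and ?L = "ext_freq lam" and ?C = "ext_coeff \<delta> \<Psi> b" and ?M = "ext_freq mu"
  note Bs = class_B_sym[OF B]
  have main: "(\<Sum>k. ?A (int_decode k) * exp (- of_real \<alpha> * of_real ((?L (int_decode k))\<^sup>2) + \<beta> * of_real (?L (int_decode k))))
     = (- \<i>) ^ \<delta> * of_real (\<alpha> powr (-1/2)) * (\<Sum>k. ?C (int_decode k) * exp ((\<beta> + 2 * \<i> * of_real (?M (int_decode k)))\<^sup>2 / (4 * of_real \<alpha>)))"
  proof (rule gauss_poisson[OF _ _ _ al])
    show "summable (\<lambda>k. norm (?A (int_decode k)) * exp (K * \<bar>?L (int_decode k)\<bar> - \<epsilon> * (?L (int_decode k))\<^sup>2))" if "\<epsilon> > 0" for \<epsilon> K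
      by (rule summable_int_decode[OF class_B_gauss_summable[OF B that]])
    show "summable (\<lambda>k. norm (?C (int_decode k)) * exp (K * \<bar>?M (int_decode k)\<bar> - \<epsilon> * (?M (int_decode k))\<^sup>2))" if "\<epsilon> > 0" for \<epsilon> K
      by (rule summable_int_decode[OF class_B_gauss_summable[OF Bs that]])
    show "(\<Sum>k. ?A (int_decode k) * (of_real (?L (int_decode k)) ^ j * exp (- of_real \<gamma> * of_real ((?L (int_decode k))\<^sup>2))))
       = (- \<i>) ^ \<delta> * (\<Sum>k. ?C (int_decode k) * dual_gauss (of_real (?M (int_decode k))) j (of_real \<gamma>))" if "\<gamma> > 0" "j < 2" for \<gamma> j
      using class_B_theta_int(3)[OF B that] suminf_int_decode[OF class_B_theta_int(1)[OF B that]]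
        suminf_int_decode[OF class_B_theta_int(2)[OF B that]] by simp
  qed
  have sA: "(\<lambda>n. norm (?A n * exp (- of_real \<alpha> * of_real ((?L n)\<^sup>2) + \<beta> * of_real (?L n)))) summable_on UNIV"
  proof (rule Infinite_Sum.abs_summable_on_comparison_test'[OF class_B_gauss_summable[OF B al, of "norm \<beta>"]])
    fix n :: int
    have "Re \<beta> * ?L n \<le> norm \<beta> * \<bar>?L n\<bar>"
      using abs_Re_le_cmod[of \<beta>] by (metis abs_ge_self abs_mult abs_ge_zero mult_right_mono order_trans)
    then show "norm (?A n * exp (- of_real \<alpha> * of_real ((?L n)\<^sup>2) + \<beta> * of_real (?L n))) \<le> norm (?A n) * exp (norm \<beta> * \<bar>?L n\<bar> - \<alpha> * (?L n)\<^sup>2)"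
      unfolding norm_mult by (intro mult_left_mono) (auto simp flip: of_real_power)
  qed
  have sC: "(\<lambda>n. norm (?C n * exp ((\<beta> + 2 * \<i> * of_real (?M n))\<^sup>2 / (4 * of_real \<alpha>)))) summable_on UNIV"
  proof (rule Infinite_Sum.abs_summable_on_comparison_test')
    show "(\<lambda>n. exp ((norm \<beta>)\<^sup>2 / (4 * \<alpha>)) * (norm (?C n) * exp (norm \<beta> / \<alpha> * \<bar>?M n\<bar> - (1 / \<alpha>) * (?M n)\<^sup>2))) summable_on UNIV"
      using al by (intro summable_on_cmult_right class_B_gauss_summable[OF Bs]) auto
    fix n :: int
    from mult_left_mono[OF norm_exp_square_le[OF al, of \<beta> "?M n"] norm_ge_zero[of "?C n"]]
    show "norm (?C n * exp ((\<beta> + 2 * \<i> * of_real (?M n))\<^sup>2 / (4 * of_real \<alpha>))) \<le> exp ((norm \<beta>)\<^sup>2 / (4 * \<alpha>)) * (norm (?C n) * exp (norm \<beta> / \<alpha> * \<bar>?M n\<bar> - (1 / \<alpha>) * (?M n)\<^sup>2))"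
      by (simp only: norm_mult mult.left_commute)
  qed
  show ?thesis
    using main suminf_int_decode[OF sA] suminf_int_decode[OF sC] by simp
qed

subsection \<open>Positive definite binary forms\<close>

lemma qform_pos_def_coeffs:
  assumes "\<And>x y. (x, y) \<noteq> (0, 0) \<Longrightarrow> qform a b c x y > 0"
  shows "a > 0" "c > 0" "4 * a * c - b\<^sup>2 > 0"
proof -
  show a: "a > 0" using assms[of 1 0] by (simp add: qform_def)
  show "c > 0" using assms[of 0 1] by (simp add: qform_def)
  \<comment> \<open>A multiple of the vector at which the form is minimal for fixed
    \<open>y\<close>; the value there is \<open>a\<close> times minus the discriminant.\<close>
  have "qform a b c b (- 2 * a) > 0" using a by (intro assms) auto
  also have "qform a b c b (- 2 * a) = a * (4 * a * c - b\<^sup>2)" by (simp add: qform_def power2_eq_square algebra_simps)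
  finally show "4 * a * c - b\<^sup>2 > 0" using a by (simp add: zero_less_mult_iff)
qed

text \<open>The constant is the determinant divided by the trace of the symmetric matrix M of the
  form, a lower bound for its smaller eigenvalue. By Cayley-Hamilton, trace times form minus
  determinant times the squared norm equals the squared norm of Mv, the sum of two squares
  below.\<close>

lemma qform_lower_bound:
  assumes "a > 0" "c > 0"
  shows "(4 * a * c - b\<^sup>2) / (4 * (a + c)) * (x\<^sup>2 + y\<^sup>2) \<le> qform a b c x y"
proof -
  have "(a + c) * qform a b c x y - (4 * a * c - b\<^sup>2) / 4 * (x\<^sup>2 + y\<^sup>2) = (a * x + b * y / 2)\<^sup>2 + (c * y + b * x / 2)\<^sup>2"
    by (simp add: qform_def power2_eq_square field_simps)
  also have "\<dots> \<ge> 0" by simp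
  finally show ?thesis using assms by (simp add: field_simps)
qed

section \<open>The double theta function\<close>

lemma summable_on_product:
  fixes f :: "'a \<Rightarrow> real" and g :: "'b \<Rightarrow> real"
  assumes "f summable_on A" "g summable_on B" "\<And>x. f x \<ge> 0" "\<And>y. g y \<ge> 0"
  shows "(\<lambda>(x, y). f x * g y) summable_on A \<times> B"
proof (rule summable_on_SigmaI[where g = "\<lambda>x. f x * infsum g B"])
  show "((\<lambda>y. case (x, y) of (x, y) \<Rightarrow> f x * g y) has_sum f x * infsum g B) B" for x
    using assms(2) by (auto intro!: has_sum_cmult_right has_sum_infsum)
  show "(\<lambda>x. f x * infsum g B) summable_on A"
    by (intro summable_on_cmult_left assms)
qed (use assms in auto)

lemma class_B_gauss_summable':
  assumes "class_B \<delta> lam a mu b \<Phi> \<Psi>" "\<epsilon> > 0"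
  shows "(\<lambda>n. norm (ext_coeff \<delta> \<Phi> a n) * exp (- \<epsilon> * (ext_freq lam n)\<^sup>2)) summable_on UNIV"
  using class_B_gauss_summable[OF assms, of 0] by simp

lemma summable_double_theta:
  assumes B1: "class_B \<delta> lam1 a1 mu1 b1 \<Phi>1 \<Psi>1" and B2: "class_B \<delta> lam2 a2 mu2 b2 \<Phi>2 \<Psi>2"
    and pos: "a > 0" "c > 0" "4 * a * c - b\<^sup>2 > 0" and t: "t > 0"
  shows "(\<lambda>(m, n). norm (ext_coeff \<delta> \<Phi>1 a1 m * ext_coeff \<delta> \<Phi>2 a2 n * exp (- of_real (t * qform a b c (ext_freq lam1 m) (ext_freq lam2 n))) :: complex)) summable_on UNIV"
proof -
  define \<epsilon> where "\<epsilon> = t * ((4 * a * c - b\<^sup>2) / (4 * (a + c)))"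
  have e: "\<epsilon> > 0" using pos t by (simp add: \<epsilon>_def)
  let ?f = "\<lambda>m. norm (ext_coeff \<delta> \<Phi>1 a1 m) * exp (- \<epsilon> * (ext_freq lam1 m)\<^sup>2)"
  let ?g = "\<lambda>n. norm (ext_coeff \<delta> \<Phi>2 a2 n) * exp (- \<epsilon> * (ext_freq lam2 n)\<^sup>2)"
  have "(\<lambda>(m, n). ?f m * ?g n) summable_on UNIV \<times> UNIV"
    by (intro summable_on_product class_B_gauss_summable'[OF B1 e] class_B_gauss_summable'[OF B2 e]) auto
  then have "(\<lambda>p. norm ((\<lambda>(m, n). ext_coeff \<delta> \<Phi>1 a1 m * ext_coeff \<delta> \<Phi>2 a2 n * exp (- of_real (t * qform a b c (ext_freq lam1 m) (ext_freq lam2 n))) :: complex) p)) summable_on UNIV \<times> UNIV"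
  proof (rule Infinite_Sum.abs_summable_on_comparison_test')
    fix p :: "int \<times> int"
    obtain m n where p: "p = (m, n)" by (cases p)
    let ?x = "ext_freq lam1 m" and ?y = "ext_freq lam2 n"
    have "\<epsilon> * ?x\<^sup>2 + \<epsilon> * ?y\<^sup>2 \<le> t * qform a b c ?x ?y"
      using mult_left_mono[OF qform_lower_bound[OF pos(1,2), of b ?x ?y] less_imp_le[OF t]]
      by (simp only: \<epsilon>_def distrib_left mult.assoc)
    then have "exp (- (t * qform a b c ?x ?y)) \<le> exp (- \<epsilon> * ?x\<^sup>2) * exp (- \<epsilon> * ?y\<^sup>2)"
      unfolding exp_add[symmetric] by simp
    from mult_left_mono[OF this, of "norm (ext_coeff \<delta> \<Phi>1 a1 m) * norm (ext_coeff \<delta> \<Phi>2 a2 n)"]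
    show "norm ((\<lambda>(m, n). ext_coeff \<delta> \<Phi>1 a1 m * ext_coeff \<delta> \<Phi>2 a2 n * exp (- of_real (t * qform a b c (ext_freq lam1 m) (ext_freq lam2 n))) :: complex) p) \<le> (case p of (m, n) \<Rightarrow> ?f m * ?g n)"
      by (simp add: p norm_mult mult_ac)
  qed
  then show ?thesis by (simp add: case_prod_unfold)
qed

text \<open>Relates the exponent left by the Poisson formula in the first index to the shape
  required for the second one: a Gaussian in \<open>L\<close> with linear coefficient
  \<open>- \<i> * (b * M / a)\<close>, times a Gaussian in \<open>M\<close>.\<close>

lemma complete_square:
  fixes a t :: complex
  assumes "a \<noteq> 0" "t \<noteq> 0"
  shows "- (M\<^sup>2 / (a * t)) + (- ((4 * a * c - b\<^sup>2) * t / (4 * a)) * L\<^sup>2 + (- \<i> * (b * M / a)) * L)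
     = - (c * t) * L\<^sup>2 + (- (b * t * L) + 2 * \<i> * M)\<^sup>2 / (4 * (a * t))"
proof -
  have "(- (b * t * L) + 2 * \<i> * M)\<^sup>2 = (b * t * L)\<^sup>2 - 4 * \<i> * b * t * L * M - 4 * M\<^sup>2"
    by (simp add: power2_eq_square algebra_simps)
  then show ?thesis using assms by (simp add: field_simps power2_eq_square)
qed

text \<open>\<open>g\<close> is the intermediate sum, transformed in the first index only. The
  linear coefficient is real in the first Poisson formula and purely imaginary in the second. Each
  formula has weight 1/2, so that the weight of the result is one, and the two factors
  \<open>(- \<i>) ^ \<delta>\<close> multiply to \<open>(- 1) ^ \<delta>\<close>.\<close>

lemma double_theta:
  assumes B1: "class_B \<delta> lam1 a1 mu1 b1 \<Phi>1 \<Psi>1" and B2: "class_B \<delta> lam2 a2 mu2 b2 \<Phi>2 \<Psi>2"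
    and pos: "a > 0" "c > 0" "4 * a * c - b\<^sup>2 > 0" and t: "t > 0"
  defines "D \<equiv> 4 * a * c - b\<^sup>2"
  shows "infsum (\<lambda>(m, n). ext_coeff \<delta> \<Phi>1 a1 m * ext_coeff \<delta> \<Phi>2 a2 n * exp (- of_real (t * qform a b c (ext_freq lam1 m) (ext_freq lam2 n)))) UNIV
     = (- 1) ^ \<delta> * of_real (2 / (sqrt D * t)) *
       infsum (\<lambda>(m, n). ext_coeff \<delta> \<Psi>1 b1 m * ext_coeff \<delta> \<Psi>2 b2 n * exp (- of_real (4 / (D * t) * qform c (- b) a (ext_freq mu1 m) (ext_freq mu2 n)))) UNIV"
proof -
  define A1 L1 C1 M1 where d1: "A1 = ext_coeff \<delta> \<Phi>1 a1" "L1 = ext_freq lam1" "C1 = ext_coeff \<delta> \<Psi>1 b1" "M1 = ext_freq mu1"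
  define A2 L2 C2 M2 where d2: "A2 = ext_coeff \<delta> \<Phi>2 a2" "L2 = ext_freq lam2" "C2 = ext_coeff \<delta> \<Psi>2 b2" "M2 = ext_freq mu2"
  define k where "k = (- \<i>) ^ \<delta>"
  have D: "D > 0" using pos by (simp add: D_def)
  define f where "f m n = A1 m * A2 n * exp (- of_real (t * qform a b c (L1 m) (L2 n)))" for m n
  define h where "h m n = C1 m * C2 n * exp (- of_real (4 / (D * t) * qform c (- b) a (M1 m) (M2 n)))" for m n
  define g where "g m n = C1 m * (A2 n * exp (- of_real (c * t) * of_real ((L2 n)\<^sup>2)) * exp ((- of_real (b * t * L2 n) + 2 * \<i> * of_real (M1 m))\<^sup>2 / (4 * of_real (a * t))))" for m n
  \<comment> \<open>The coefficient of \<open>(L2 n)\<^sup>2\<close> after completing the square: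
    \<open>c * t - b\<^sup>2 * t / (4 * a)\<close>.\<close>
  define \<alpha> where "\<alpha> = D * t / (4 * a)"
  have at: "a * t > 0" and al: "\<alpha> > 0" using pos t D by (auto simp: \<alpha>_def)
  have sf: "(\<lambda>(m, n). f m n) summable_on UNIV \<times> UNIV"
    by (rule abs_summable_summable)
      (use summable_double_theta[OF B1 B2 pos t] in \<open>simp add: f_def d1 d2 case_prod_unfold\<close>)
  have sh: "(\<lambda>(m, n). h m n) summable_on UNIV \<times> UNIV"
  proof -
    have "(\<lambda>(m, n). norm (C1 m * C2 n * exp (- of_real (4 / (D * t) * qform c (- b) a (M1 m) (M2 n))))) summable_on UNIV"
      unfolding d1 d2
      by (rule summable_double_theta[OF class_B_sym[OF B1] class_B_sym[OF B2]]) (use pos t D in \<open>auto simp: mult_ac\<close>)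
    note * = this
    show ?thesis by (rule abs_summable_summable) (use * in \<open>simp add: h_def case_prod_unfold\<close>)
  qed
  have g_split: "C1 m * (exp (- of_real ((M1 m)\<^sup>2 / (a * t))) * (A2 n * exp (- of_real \<alpha> * of_real ((L2 n)\<^sup>2) + (- \<i> * of_real (b * M1 m / a)) * of_real (L2 n)))) = g m n" for m n
  proof -
    let ?E1 = "- complex_of_real ((M1 m)\<^sup>2 / (a * t))"
    let ?E2 = "- of_real \<alpha> * of_real ((L2 n)\<^sup>2) + (- \<i> * of_real (b * M1 m / a)) * of_real (L2 n)"
    let ?E3 = "- complex_of_real (c * t) * of_real ((L2 n)\<^sup>2)"
    let ?E4 = "(- of_real (b * t * L2 n) + 2 * \<i> * of_real (M1 m))\<^sup>2 / (4 * of_real (a * t))"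
    have nz: "complex_of_real a \<noteq> 0" "complex_of_real t \<noteq> 0" using pos t by auto
    have "?E1 + ?E2 = ?E3 + ?E4"
      using complete_square[OF nz, of "of_real (M1 m)" "of_real c" "of_real b" "of_real (L2 n)"]
      unfolding \<alpha>_def D_def
      by (simp only: of_real_mult of_real_divide of_real_power of_real_diff of_real_numeral)
    then have eq: "exp ?E1 * exp ?E2 = exp ?E3 * exp ?E4" by (simp only: exp_add[symmetric])
    have "C1 m * (exp ?E1 * (A2 n * exp ?E2)) = C1 m * (A2 n * (exp ?E1 * exp ?E2))" by (simp only: mult_ac)
    also have "\<dots> = g m n" unfolding eq g_def by (simp only: mult.assoc)
    finally show ?thesis .
  qed
  have sg: "(\<lambda>(m, n). g m n) summable_on UNIV \<times> UNIV"
  proof (rule abs_summable_summable, rule Infinite_Sum.abs_summable_on_comparison_test')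
    let ?F = "\<lambda>m. norm (C1 m) * exp (- (1 / (a * t)) * (M1 m)\<^sup>2)"
    let ?G = "\<lambda>n. norm (A2 n) * exp (- \<alpha> * (L2 n)\<^sup>2)"
    show "(\<lambda>(m, n). ?F m * ?G n) summable_on UNIV \<times> UNIV"
      unfolding d1 d2 using at al
      by (intro summable_on_product class_B_gauss_summable'[OF class_B_sym[OF B1]] class_B_gauss_summable'[OF B2]) auto
    fix p :: "int \<times> int"
    obtain m n where p: "p = (m, n)" by (cases p)
    show "norm (case p of (m, n) \<Rightarrow> g m n) \<le> (case p of (m, n) \<Rightarrow> ?F m * ?G n)"
    proof -
      have "norm (exp (- complex_of_real ((M1 m)\<^sup>2 / (a * t)))) = exp (- (1 / (a * t)) * (M1 m)\<^sup>2)"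
        by simp
      \<comment> \<open>The linear term is purely imaginary, so the modulus of \<open>g\<close>
        factors into two Gaussians and the order of summation can be exchanged.\<close>
      moreover have "norm (exp (- of_real \<alpha> * of_real ((L2 n)\<^sup>2) + (- \<i> * of_real (b * M1 m / a)) * of_real (L2 n))) = exp (- \<alpha> * (L2 n)\<^sup>2)"
        by (simp add: norm_exp_eq_Re flip: of_real_power)
      ultimately show ?thesis
        unfolding p prod.case g_split[symmetric] norm_mult by (simp only: mult_ac order_refl)
    qed
  qed
  have step1: "infsum (\<lambda>m. f m n) UNIV = k * of_real ((a * t) powr (-1/2)) * infsum (\<lambda>m. g m n) UNIV" for n
  proof -
    let ?w = "A2 n * exp (- of_real (c * t) * of_real ((L2 n)\<^sup>2))"
    have "f m n = ?w * (A1 m * exp (- of_real (a * t) * of_real ((L1 m)\<^sup>2) + (- of_real (b * t * L2 n)) * of_real (L1 m)))" for m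
    proof -
      have "- complex_of_real (t * qform a b c (L1 m) (L2 n)) = - of_real (c * t) * of_real ((L2 n)\<^sup>2) +
          (- of_real (a * t) * of_real ((L1 m)\<^sup>2) + (- of_real (b * t * L2 n)) * of_real (L1 m))"
        by (simp add: qform_def algebra_simps)
      then show ?thesis by (simp only: f_def exp_add mult_ac)
    qed
    then have "infsum (\<lambda>m. f m n) UNIV = ?w * infsum (\<lambda>m. A1 m * exp (- of_real (a * t) * of_real ((L1 m)\<^sup>2) + (- of_real (b * t * L2 n)) * of_real (L1 m))) UNIV"
      by (simp only: infsum_cmult_right')
    also have "infsum (\<lambda>m. A1 m * exp (- of_real (a * t) * of_real ((L1 m)\<^sup>2) + (- of_real (b * t * L2 n)) * of_real (L1 m))) UNIV
        = k * of_real ((a * t) powr (-1/2)) * infsum (\<lambda>m. C1 m * exp ((- of_real (b * t * L2 n) + 2 * \<i> * of_real (M1 m))\<^sup>2 / (4 * of_real (a * t)))) UNIV"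
      unfolding d1 k_def by (rule class_B_poisson[OF B1 at])
    also have "?w * (k * of_real ((a * t) powr (-1/2)) * infsum (\<lambda>m. C1 m * exp ((- of_real (b * t * L2 n) + 2 * \<i> * of_real (M1 m))\<^sup>2 / (4 * of_real (a * t)))) UNIV)
        = k * of_real ((a * t) powr (-1/2)) * (?w * infsum (\<lambda>m. C1 m * exp ((- of_real (b * t * L2 n) + 2 * \<i> * of_real (M1 m))\<^sup>2 / (4 * of_real (a * t)))) UNIV)"
      by (simp only: mult_ac)
    also have "?w * infsum (\<lambda>m. C1 m * exp ((- of_real (b * t * L2 n) + 2 * \<i> * of_real (M1 m))\<^sup>2 / (4 * of_real (a * t)))) UNIV = infsum (\<lambda>m. g m n) UNIV"
      unfolding infsum_cmult_right'[symmetric] g_def by (simp only: mult_ac)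
    finally show ?thesis .
  qed
  have step2: "infsum (\<lambda>n. g m n) UNIV = k * of_real (\<alpha> powr (-1/2)) * infsum (\<lambda>n. h m n) UNIV" for m
  proof -
    let ?w = "C1 m * exp (- of_real ((M1 m)\<^sup>2 / (a * t)))"
    let ?b = "- \<i> * complex_of_real (b * M1 m / a)"
    have "infsum (\<lambda>n. g m n) UNIV = ?w * infsum (\<lambda>n. A2 n * exp (- of_real \<alpha> * of_real ((L2 n)\<^sup>2) + ?b * of_real (L2 n))) UNIV"
      unfolding g_split[symmetric] infsum_cmult_right' by (simp only: mult.assoc)
    also have "infsum (\<lambda>n. A2 n * exp (- of_real \<alpha> * of_real ((L2 n)\<^sup>2) + ?b * of_real (L2 n))) UNIV
        = k * of_real (\<alpha> powr (-1/2)) * infsum (\<lambda>n. C2 n * exp ((?b + 2 * \<i> * of_real (M2 n))\<^sup>2 / (4 * of_real \<alpha>))) UNIV"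
      unfolding d2 k_def by (rule class_B_poisson[OF B2 al])
    also have "?w * (k * of_real (\<alpha> powr (-1/2)) * infsum (\<lambda>n. C2 n * exp ((?b + 2 * \<i> * of_real (M2 n))\<^sup>2 / (4 * of_real \<alpha>))) UNIV)
        = k * of_real (\<alpha> powr (-1/2)) * (?w * infsum (\<lambda>n. C2 n * exp ((?b + 2 * \<i> * of_real (M2 n))\<^sup>2 / (4 * of_real \<alpha>))) UNIV)"
      by (simp only: mult_ac)
    also have "?w * infsum (\<lambda>n. C2 n * exp ((?b + 2 * \<i> * of_real (M2 n))\<^sup>2 / (4 * of_real \<alpha>))) UNIV = infsum (\<lambda>n. h m n) UNIV"
      unfolding infsum_cmult_right'[symmetric]
    proof (rule infsum_cong)
      fix n
      have "- complex_of_real ((M1 m)\<^sup>2 / (a * t)) + (?b + 2 * \<i> * of_real (M2 n))\<^sup>2 / (4 * of_real \<alpha>)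
          = - of_real (4 / (D * t) * qform c (- b) a (M1 m) (M2 n))"
      proof -
        have "?b + 2 * \<i> * of_real (M2 n) = \<i> * of_real (2 * M2 n - b * M1 m / a)" by (simp add: algebra_simps)
        then have sq: "(?b + 2 * \<i> * of_real (M2 n))\<^sup>2 / (4 * of_real \<alpha>) = of_real (- ((2 * M2 n - b * M1 m / a)\<^sup>2) / (4 * \<alpha>))"
          by (simp add: power_mult_distrib)
        have "- ((M1 m)\<^sup>2 / (a * t)) + (- ((2 * M2 n - b * M1 m / a)\<^sup>2) / (4 * \<alpha>)) = - (4 / (D * t) * qform c (- b) a (M1 m) (M2 n))"
        proof -
          have "(M1 m)\<^sup>2 / (a * t) = D * (M1 m)\<^sup>2 / (a * D * t)" using D by simp
          moreover have "(2 * M2 n - b * M1 m / a)\<^sup>2 / (4 * \<alpha>) = (2 * a * M2 n - b * M1 m)\<^sup>2 / (a * D * t)"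
          proof -
            have "2 * M2 n - b * M1 m / a = (2 * a * M2 n - b * M1 m) / a" using pos by (simp add: field_simps)
            then show ?thesis using pos D t by (simp add: \<alpha>_def power_divide power2_eq_square)
          qed
          \<comment> \<open>Completing the square backwards; this is where the inverse form
            appears.\<close>
          moreover have "D * (M1 m)\<^sup>2 + (2 * a * M2 n - b * M1 m)\<^sup>2 = 4 * a * qform c (- b) a (M1 m) (M2 n)"
            by (simp add: D_def qform_def power2_eq_square algebra_simps)
          ultimately have "(M1 m)\<^sup>2 / (a * t) + (2 * M2 n - b * M1 m / a)\<^sup>2 / (4 * \<alpha>) = 4 * a * qform c (- b) a (M1 m) (M2 n) / (a * D * t)"
            by (simp only: add_divide_distrib[symmetric])
          also have "\<dots> = 4 / (D * t) * qform c (- b) a (M1 m) (M2 n)" using pos by simp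
          finally show ?thesis by (simp only: minus_divide_left[symmetric] minus_add_distrib[symmetric])
        qed
        then show ?thesis unfolding sq of_real_minus[symmetric] of_real_add[symmetric] by (simp only:)
      qed
      then show "?w * (C2 n * exp ((?b + 2 * \<i> * of_real (M2 n))\<^sup>2 / (4 * of_real \<alpha>))) = h m n"
        unfolding h_def by (metis (no_types, lifting) exp_add mult.assoc mult.left_commute)
    qed
    finally show ?thesis .
  qed
  have const: "(a * t) powr (-1/2) * \<alpha> powr (-1/2) = 2 / (sqrt D * t)"
  proof -
    have "(a * t) powr (-1/2) * \<alpha> powr (-1/2) = (a * t * \<alpha>) powr (-1/2)"
      using at al by (simp add: powr_mult)
    also have "a * t * \<alpha> = D * t\<^sup>2 / 4" using pos by (simp add: \<alpha>_def power2_eq_square)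
    also have "(D * t\<^sup>2 / 4) powr (-1/2) = inverse ((D * t\<^sup>2 / 4) powr (1/2))"
      using powr_minus[of "D * t\<^sup>2 / 4" "1/2"] by simp
    also have "(D * t\<^sup>2 / 4) powr (1/2) = sqrt (D * t\<^sup>2 / 4)"
      using D by (intro powr_half_sqrt) auto
    also have "sqrt (D * t\<^sup>2 / 4) = sqrt D * t / 2" using t by (simp add: real_sqrt_mult real_sqrt_divide)
    finally show ?thesis by (simp only: inverse_divide)
  qed
  have "infsum (\<lambda>(m, n). f m n) (UNIV \<times> UNIV) = infsum (\<lambda>m. infsum (\<lambda>n. f m n) UNIV) UNIV"
    by (rule infsum_Sigma'_banach[OF sf, symmetric])
  also have "\<dots> = infsum (\<lambda>n. infsum (\<lambda>m. f m n) UNIV) UNIV" by (rule infsum_swap_banach[OF sf])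
  also have "\<dots> = k * of_real ((a * t) powr (-1/2)) * infsum (\<lambda>n. infsum (\<lambda>m. g m n) UNIV) UNIV"
    unfolding step1 infsum_cmult_right' ..
  also have "infsum (\<lambda>n. infsum (\<lambda>m. g m n) UNIV) UNIV = infsum (\<lambda>m. infsum (\<lambda>n. g m n) UNIV) UNIV"
    by (rule infsum_swap_banach[OF sg, symmetric])
  also have "\<dots> = k * of_real (\<alpha> powr (-1/2)) * infsum (\<lambda>m. infsum (\<lambda>n. h m n) UNIV) UNIV"
    unfolding step2 infsum_cmult_right' ..
  also have "infsum (\<lambda>m. infsum (\<lambda>n. h m n) UNIV) UNIV = infsum (\<lambda>(m, n). h m n) (UNIV \<times> UNIV)"
    by (rule infsum_Sigma'_banach[OF sh])
  also have "k * of_real ((a * t) powr (-1/2)) * (k * of_real (\<alpha> powr (-1/2)) * infsum (\<lambda>(m, n). h m n) (UNIV \<times> UNIV))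
      = (k * k) * of_real ((a * t) powr (-1/2) * \<alpha> powr (-1/2)) * infsum (\<lambda>(m, n). h m n) (UNIV \<times> UNIV)"
    by (simp only: of_real_mult mult_ac)
  also have "k * k = (- 1) ^ \<delta>"
    by (simp add: k_def power_mult_distrib[symmetric])
  finally show ?thesis
    unfolding const f_def h_def d1 d2 UNIV_Times_UNIV .
qed

subsection \<open>Grouping by values of the form\<close>

text \<open>\<open>N\<close> counts the smaller elements. It is injective, its range is closed
  downwards and infinite, hence all of the naturals, and its inverse is the increasing
  enumeration.\<close>

lemma discrete_enumeration:
  fixes S :: "real set"
  assumes pos: "\<And>v. v \<in> S \<Longrightarrow> v > 0" and fin: "\<And>x. finite {v \<in> S. v \<le> x}" and inf: "infinite S"
  shows "\<exists>\<nu>. frequencies \<nu> \<and> \<nu> ` {1..} = S"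
proof -
  define N where "N v = card {w \<in> S. w < v}" for v
  have fin': "finite {w \<in> S. w < v}" for v by (rule finite_subset[OF _ fin[of v]]) auto
  have mono: "N v < N w" if "v \<in> S" "v < w" for v w
    unfolding N_def by (rule psubset_card_mono[OF fin']) (use that in auto)
  have inj: "inj_on N S" by (rule inj_onI) (metis mono less_irrefl linorder_less_linear)
  have down: "j \<in> N ` S" if "v \<in> S" "j < N v" for v j
  proof -
    let ?F = "{w \<in> S. w < v}"
    have sub: "N ` ?F \<subseteq> {..<N v}" using mono by auto
    have "card (N ` ?F) = card {..<N v}"
      using inj by (subst card_image) (auto simp: N_def intro: inj_on_subset)
    then have "N ` ?F = {..<N v}" using sub by (intro card_subset_eq) auto
    then show ?thesis using that by (metis (no_types, lifting) imageE image_eqI lessThan_iff mem_Collect_eq)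
  qed
  have surj: "n \<in> N ` S" for n
  proof -
    have "infinite (N ` S)" using inf inj by (simp add: finite_image_iff)
    then obtain v where "v \<in> S" "N v > n" by (auto simp: infinite_nat_iff_unbounded)
    then show ?thesis by (rule down)
  qed
  \<comment> \<open>Frequencies are numbered from 1, whereas the smallest element has count
    0.\<close>
  define \<nu> where "\<nu> n = inv_into S N (n - 1)" for n :: nat
  have nu: "\<nu> n \<in> S" "N (\<nu> n) = n - 1" for n
    using surj[of "n - 1"] by (auto simp: \<nu>_def inv_into_into f_inv_into_f)
  have smono: "\<nu> m < \<nu> n" if "1 \<le> m" "m < n" for m n
  proof (rule ccontr)
    assume "\<not> \<nu> m < \<nu> n"
    then have "N (\<nu> n) \<le> N (\<nu> m)" using mono[of "\<nu> n" "\<nu> m"] nu by (cases "\<nu> n = \<nu> m") auto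
    then show False using nu that by simp
  qed
  have img: "\<nu> ` {1..} = S"
  proof
    show "S \<subseteq> \<nu> ` {1..}"
    proof
      fix v assume v: "v \<in> S"
      have "\<nu> (Suc (N v)) = v" using v inj by (simp add: \<nu>_def)
      then show "v \<in> \<nu> ` {1..}" by (metis One_nat_def Suc_le_mono atLeast_iff image_eqI zero_le)
    qed
  qed (use nu in auto)
  have "filterlim \<nu> at_top sequentially"
    unfolding filterlim_at_top eventually_sequentially
  proof
    fix Z
    have "\<exists>v\<in>S. v > Z" using fin[of Z] inf by (metis (mono_tags, lifting) finite_subset mem_Collect_eq not_le subsetI)
    then obtain v where v: "v \<in> S" "v > Z" by blast
    then obtain k where k: "k \<ge> 1" "v = \<nu> k" using img by auto
    have "Z \<le> \<nu> n" if "n \<ge> k" for n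
      using smono[of k n] k v that by (cases "k = n") auto
    then show "\<exists>N. \<forall>n\<ge>N. Z \<le> \<nu> n" by blast
  qed
  then have "frequencies \<nu>" unfolding frequencies_def using nu pos smono by (auto simp: strict_mono_on_def)
  then show ?thesis using img by blast
qed

section \<open>Finiteness and positivity of the values of the form\<close>

lemma ext_freq_nonzero:
  assumes "frequencies lam" "n \<noteq> 0"
  shows "ext_freq lam n \<noteq> 0" "\<bar>ext_freq lam n\<bar> \<ge> lam (Suc 0)"
proof -
  obtain k where k: "\<bar>ext_freq lam n\<bar> = lam (Suc k)"
  proof (cases "n > 0")
    case True
    then have "n = int (Suc (nat n - 1))" by simp
    then have "\<bar>ext_freq lam n\<bar> = lam (Suc (nat n - 1))"
      using frequencies_pos[OF assms(1), of "nat n - 1"] ext_freq_simps(2)[of lam "nat n - 1"] by simp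
    then show ?thesis by (rule that)
  next
    case False
    then have "n = - int (Suc (nat (- n) - 1))" using assms by simp
    then have "\<bar>ext_freq lam n\<bar> = lam (Suc (nat (- n) - 1))"
      using frequencies_pos[OF assms(1), of "nat (- n) - 1"] ext_freq_simps(3)[of lam "nat (- n) - 1"] by simp
    then show ?thesis by (rule that)
  qed
  show "\<bar>ext_freq lam n\<bar> \<ge> lam (Suc 0)" unfolding k by (rule frequencies_ge_first[OF assms(1)])
  then show "ext_freq lam n \<noteq> 0" using frequencies_pos[OF assms(1), of 0] by auto
qed

lemma finite_ext_freq_le:
  assumes "frequencies lam"
  shows "finite {n. \<bar>ext_freq lam n\<bar> \<le> R}"
proof -
  have "eventually (\<lambda>n. R < lam (Suc n)) sequentially"
    using frequencies_filterlim_Suc[OF assms] by (simp add: filterlim_at_top_dense)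
  then obtain N where N: "\<And>n. n \<ge> N \<Longrightarrow> R < lam (Suc n)" by (auto simp: eventually_sequentially)
  have "{n. \<bar>ext_freq lam n\<bar> \<le> R} \<subseteq> {- int N..int N}"
  proof
    fix n assume "n \<in> {n. \<bar>ext_freq lam n\<bar> \<le> R}"
    then have n: "\<bar>ext_freq lam n\<bar> \<le> R" by simp
    show "n \<in> {- int N..int N}"
    proof (rule ccontr)
      assume "n \<notin> {- int N..int N}"
      then have "n > int N \<or> - n > int N" by auto
      then consider k where "n = int (Suc k)" "k \<ge> N" | k where "n = - int (Suc k)" "k \<ge> N"
      proof (elim disjE)
        assume "n > int N"
        then show thesis by (intro that(1)[of "nat n - 1"]) auto
      next
        assume "- n > int N"
        then show thesis by (intro that(2)[of "nat (- n) - 1"]) auto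
      qed
      then show False
      proof cases
        case 1
        then show False using n N[of k] by (simp del: of_nat_Suc)
      next
        case 2
        then show False using n N[of k] by (simp del: of_nat_Suc)
      qed
    qed
  qed
  then show ?thesis by (rule finite_subset) simp
qed

text \<open>The index set is the disjoint union of the fibres of \<open>q\<close>. An unconditional
  sum may be taken fibre by fibre, and here each inner sum is finite.\<close>

lemma has_sum_group:
  fixes f :: "'i \<Rightarrow> complex"
  assumes s: "(f has_sum s) I" and fin: "\<And>v. finite {i \<in> I. q i = v}"
  shows "((\<lambda>v. \<Sum>i\<in>{i \<in> I. q i = v}. f i) has_sum s) (q ` I)"
proof (rule has_sum_SigmaD)
  have "bij_betw snd (SIGMA v:q ` I. {i \<in> I. q i = v}) I"
    by (rule bij_betw_byWitness[where f' = "\<lambda>i. (q i, i)"]) auto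
  from has_sum_reindex_bij_betw[OF this, of f s]
  show "((\<lambda>x. f (snd x)) has_sum s) (SIGMA v:q ` I. {i \<in> I. q i = v})"
    using s by simp
  show "((\<lambda>y. f (snd (v, y))) has_sum (\<Sum>i\<in>{i \<in> I. q i = v}. f i)) {i \<in> I. q i = v}" for v
    using fin by (auto intro: has_sum_finite)
qed

context
  fixes a b c :: real and lam1 lam2 :: "nat \<Rightarrow> real"
  assumes pos: "a > 0" "c > 0" "4 * a * c - b\<^sup>2 > 0"
    and fr: "frequencies lam1" "frequencies lam2"
    and lower: "\<And>x y. (4 * a * c - b\<^sup>2) / (4 * (a + c)) * (x\<^sup>2 + y\<^sup>2) \<le> qform a b c x y"
begin

lemma epstein_value_pos:
  assumes "(m, n) \<noteq> (0, 0)"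
  shows "qform a b c (ext_freq lam1 m) (ext_freq lam2 n) > 0"
proof -
  have "ext_freq lam1 m \<noteq> 0 \<or> ext_freq lam2 n \<noteq> 0"
    using assms ext_freq_nonzero(1)[OF fr(1)] ext_freq_nonzero(1)[OF fr(2)] by auto
  then have "(ext_freq lam1 m)\<^sup>2 + (ext_freq lam2 n)\<^sup>2 > 0"
    by (simp add: sum_power2_gt_zero_iff)
  then have "0 < (4 * a * c - b\<^sup>2) / (4 * (a + c)) * ((ext_freq lam1 m)\<^sup>2 + (ext_freq lam2 n)\<^sup>2)"
    using pos by (intro mult_pos_pos) auto
  then show ?thesis using lower[of "ext_freq lam1 m" "ext_freq lam2 n"] by linarith
qed

lemma finite_epstein_value_le:
  "finite {(m, n). qform a b c (ext_freq lam1 m) (ext_freq lam2 n) \<le> x}"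
proof -
  define e where "e = (4 * a * c - b\<^sup>2) / (4 * (a + c))"
  have e: "e > 0" using pos by (simp add: e_def)
  define R where "R = sqrt (\<bar>x\<bar> / e)"
  have "{(m, n). qform a b c (ext_freq lam1 m) (ext_freq lam2 n) \<le> x}
      \<subseteq> {m. \<bar>ext_freq lam1 m\<bar> \<le> R} \<times> {n. \<bar>ext_freq lam2 n\<bar> \<le> R}"
  proof safe
    fix m n assume "qform a b c (ext_freq lam1 m) (ext_freq lam2 n) \<le> x"
    then have "e * ((ext_freq lam1 m)\<^sup>2 + (ext_freq lam2 n)\<^sup>2) \<le> \<bar>x\<bar>"
      using lower[of "ext_freq lam1 m" "ext_freq lam2 n"] unfolding e_def by linarith
    then have "(ext_freq lam1 m)\<^sup>2 + (ext_freq lam2 n)\<^sup>2 \<le> \<bar>x\<bar> / e" using e by (simp add: field_simps)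
    then have "(ext_freq lam1 m)\<^sup>2 \<le> \<bar>x\<bar> / e" "(ext_freq lam2 n)\<^sup>2 \<le> \<bar>x\<bar> / e"
      using zero_le_power2[of "ext_freq lam1 m"] zero_le_power2[of "ext_freq lam2 n"] by linarith+
    then show "\<bar>ext_freq lam1 m\<bar> \<le> R" "\<bar>ext_freq lam2 n\<bar> \<le> R"
      unfolding R_def by (auto intro: real_le_rsqrt)
  qed
  then show ?thesis by (rule finite_subset) (intro finite_cartesian_product finite_ext_freq_le fr)
qed

lemma epstein_values_enumeration:
  "\<exists>\<nu>. frequencies \<nu> \<and> \<nu> ` {1..} = epstein_values a b c (ext_freq lam1) (ext_freq lam2)"
proof (rule discrete_enumeration)
  let ?q = "\<lambda>(m, n). qform a b c (ext_freq lam1 m) (ext_freq lam2 n)"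
  let ?S = "epstein_values a b c (ext_freq lam1) (ext_freq lam2)"
  show "v > 0" if "v \<in> ?S" for v using that epstein_value_pos by (auto simp: epstein_values_def)
  have fin: "finite {p. ?q p \<le> x}" for x
    using finite_epstein_value_le[of x] by (simp add: case_prod_unfold)
  have "{v \<in> ?S. v \<le> x} \<subseteq> ?q ` {p. ?q p \<le> x}" for x
    unfolding epstein_values_def by auto
  then show "finite {v \<in> ?S. v \<le> x}" for x using fin[of x] by (meson finite_imageI finite_subset)
  show "infinite ?S"
  proof
    assume "finite ?S"
    then obtain x where x: "\<And>v. v \<in> ?S \<Longrightarrow> v \<le> x" by (meson bdd_above_finite bdd_above.E)
    have "UNIV - {(0, 0)} \<subseteq> {p. ?q p \<le> x}"
      using x by (auto simp: epstein_values_def)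
    then have "finite (UNIV - {(0 :: int, 0 :: int)})" using fin[of x] by (rule finite_subset)
    then show False by (simp add: infinite_UNIV_char_0 finite_prod)
  qed
qed

text \<open>The weight \<open>h\<close> is left general because the grouping is used twice: with an
  exponential for the theta function and with a power for the zeta function itself.\<close>

lemma epstein_grouping:
  fixes A1 A2 :: "int \<Rightarrow> complex" and h :: "real \<Rightarrow> complex"
  assumes nu: "frequencies \<nu>" "\<nu> ` {1..} = epstein_values a b c (ext_freq lam1) (ext_freq lam2)"
    and s: "(\<lambda>(m, n). norm (A1 m * A2 n * h (qform a b c (ext_freq lam1 m) (ext_freq lam2 n)))) summable_on (UNIV - {(0, 0)})"
  defines "C \<equiv> \<lambda>n. epstein_coeff a b c A1 A2 (ext_freq lam1) (ext_freq lam2) (\<nu> n)"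
  shows "(\<lambda>n. C (Suc n) * h (\<nu> (Suc n))) sums infsum (\<lambda>(m, n). A1 m * A2 n * h (qform a b c (ext_freq lam1 m) (ext_freq lam2 n))) (UNIV - {(0, 0)})"
    and "summable (\<lambda>n. norm (C (Suc n) * h (\<nu> (Suc n))))"
proof -
  let ?I = "UNIV - {(0 :: int, 0 :: int)}"
  define q where "q = (\<lambda>(m, n). qform a b c (ext_freq lam1 m) (ext_freq lam2 n))"
  define f where "f = (\<lambda>(m, n). A1 m * A2 n * h (qform a b c (ext_freq lam1 m) (ext_freq lam2 n)))"
  have "f summable_on ?I"
    by (rule abs_summable_summable) (use s in \<open>simp add: f_def case_prod_unfold\<close>)
  then have hs: "(f has_sum infsum f ?I) ?I" by (rule has_sum_infsum)
  have fin: "finite {i \<in> ?I. q i = v}" for v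
    by (rule finite_subset[OF _ finite_epstein_value_le[of v]]) (auto simp: q_def)
  have fibre: "(\<Sum>i\<in>{i \<in> ?I. q i = v}. f i) = epstein_coeff a b c A1 A2 (ext_freq lam1) (ext_freq lam2) v * h v" for v
  proof -
    have eq: "{i \<in> ?I. q i = v} = {(m, n). (m, n) \<noteq> (0, 0) \<and> qform a b c (ext_freq lam1 m) (ext_freq lam2 n) = v}"
      by (auto simp: q_def)
    show ?thesis
      unfolding epstein_coeff_def eq sum_distrib_right
      by (intro sum.cong) (auto simp: f_def)
  qed
  have img: "q ` ?I = \<nu> ` {1..}" unfolding nu(2) epstein_values_def q_def ..
  have bij: "bij_betw (\<lambda>n. \<nu> (Suc n)) UNIV (\<nu> ` {1..})"
  proof -
    have "inj_on \<nu> {1..}" using nu(1) by (auto simp: frequencies_def intro: strict_mono_on_imp_inj_on)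
    then have "bij_betw \<nu> {1..} (\<nu> ` {1..})" by (rule inj_on_imp_bij_betw)
    moreover have "bij_betw Suc UNIV {1..}"
      by (rule bij_betw_byWitness[where f' = "\<lambda>n. n - 1"]) auto
    ultimately show ?thesis using bij_betw_trans[of Suc UNIV "{1..}" \<nu>] by (simp add: o_def)
  qed
  have "((\<lambda>v. epstein_coeff a b c A1 A2 (ext_freq lam1) (ext_freq lam2) v * h v) has_sum infsum f ?I) (\<nu> ` {1..})"
    using has_sum_group[OF hs fin] unfolding fibre img .
  then have H: "((\<lambda>n. C (Suc n) * h (\<nu> (Suc n))) has_sum infsum f ?I) UNIV"
    unfolding C_def by (subst (asm) has_sum_reindex_bij_betw[OF bij, symmetric])
  show "(\<lambda>n. C (Suc n) * h (\<nu> (Suc n))) sums infsum (\<lambda>(m, n). A1 m * A2 n * h (qform a b c (ext_freq lam1 m) (ext_freq lam2 n))) ?I"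
    using has_sum_imp_sums[OF H] by (simp add: f_def)
  have "(\<lambda>n. C (Suc n) * h (\<nu> (Suc n))) summable_on UNIV" using H by (auto simp: summable_on_def)
  then have "(\<lambda>n. norm (C (Suc n) * h (\<nu> (Suc n)))) summable_on UNIV"
    by (rule summable_on_iff_abs_summable_on_complex[THEN iffD1])
  then show "summable (\<lambda>n. norm (C (Suc n) * h (\<nu> (Suc n))))" by (rule summable_on_imp_summable)
qed

text \<open>The form is at least \<open>e * (x\<^sup>2 + y\<^sup>2) \<ge> 2 * e * \<bar>x\<bar> *
  \<bar>y\<bar>\<close>. So for \<open>Re s \<ge> 0\<close> the double series is dominated by the
  product of the two Dirichlet series at the same exponent, which is why the maximum of the two
  abscissas suffices. On an axis, one of the two factors \<open>\<bar>y\<bar>\<close> in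
  \<open>y\<^sup>2\<close> is bounded below by the first frequency.\<close>

lemma epstein_term_summable:
  assumes s1: "summable (\<lambda>n. norm (a1 (Suc n)) * lam1 (Suc n) powr (- Re s))"
    and s2: "summable (\<lambda>n. norm (a2 (Suc n)) * lam2 (Suc n) powr (- Re s))" and s0: "Re s \<ge> 0"
  shows "(\<lambda>p. norm (epstein_term a b c (ext_coeff \<delta> \<Phi>1 a1) (ext_coeff \<delta> \<Phi>2 a2) (ext_freq lam1) (ext_freq lam2) s p)) summable_on (UNIV - {(0, 0)})"
proof -
  define e where "e = (4 * a * c - b\<^sup>2) / (4 * (a + c))"
  have e: "e > 0" using pos by (simp add: e_def)
  define \<sigma> where "\<sigma> = Re s"
  \<comment> \<open>Index 0 gets weight 1, so that the product of the weights also covers both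
    axes.\<close>
  define w where "w l A n = norm (A n :: complex) * (if n = 0 then 1 else \<bar>ext_freq l n\<bar> powr (- \<sigma>))" for l A n
  have sw: "w l (ext_coeff \<delta> \<Phi> x) summable_on UNIV"
    if "frequencies l" "summable (\<lambda>n. norm (x (Suc n)) * l (Suc n) powr (- Re s))" for l \<Phi> x
  proof -
    have "l (Suc n) > 0" for n using frequencies_pos[OF that(1)] .
    then have ab: "\<bar>l (Suc n)\<bar> = l (Suc n)" for n by (simp add: less_imp_le)
    have nz: "int (Suc n) \<noteq> 0" "- int (Suc n) \<noteq> 0" for n by auto
    have "(\<lambda>n. norm (w l (ext_coeff \<delta> \<Phi> x) n)) summable_on UNIV"
      by (rule has_sum_int_decompose(2))
         (use that(2) nz in \<open>simp_all add: w_def norm_mult norm_power ab \<sigma>_def del: of_nat_Suc\<close>)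
    then show ?thesis by (simp add: w_def[abs_def])
  qed
  let ?w1 = "w lam1 (ext_coeff \<delta> \<Phi>1 a1)" and ?w2 = "w lam2 (ext_coeff \<delta> \<Phi>2 a2)"
  \<comment> \<open>One summand for each case: both indices nonzero, second index 0, first index
    0.\<close>
  define C where "C = (2 * e) powr (- \<sigma>) + e powr (- \<sigma>) * lam1 (Suc 0) powr (- \<sigma>) + e powr (- \<sigma>) * lam2 (Suc 0) powr (- \<sigma>)"
  have prod: "(\<lambda>(m, n). ?w1 m * ?w2 n) summable_on UNIV \<times> UNIV"
  proof (rule summable_on_SigmaI[where g = "\<lambda>m. ?w1 m * infsum ?w2 UNIV"])
    show "((\<lambda>n. case (m, n) of (m, n) \<Rightarrow> ?w1 m * ?w2 n) has_sum ?w1 m * infsum ?w2 UNIV) UNIV" for m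
      using sw[OF fr(2) s2] by (auto intro!: has_sum_cmult_right has_sum_infsum)
    show "(\<lambda>m. ?w1 m * infsum ?w2 UNIV) summable_on UNIV"
      by (intro summable_on_cmult_left sw[OF fr(1) s1])
  qed (auto simp: w_def)
  have "(\<lambda>p. C * (case p of (m, n) \<Rightarrow> ?w1 m * ?w2 n)) summable_on UNIV"
    using prod by (intro summable_on_cmult_right) simp
  then have "(\<lambda>p. C * (case p of (m, n) \<Rightarrow> ?w1 m * ?w2 n)) summable_on (UNIV - {(0, 0)})"
    by (rule summable_on_subset_banach) auto
  then show ?thesis
  proof (rule Infinite_Sum.abs_summable_on_comparison_test')
    fix p :: "int \<times> int" assume "p \<in> UNIV - {(0, 0)}"
    then obtain m n where p: "p = (m, n)" "(m, n) \<noteq> (0, 0)" by (cases p) auto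
    let ?x = "ext_freq lam1 m" and ?y = "ext_freq lam2 n"
    define A where "A = norm (ext_coeff \<delta> \<Phi>1 a1 m) * norm (ext_coeff \<delta> \<Phi>2 a2 n)"
    have A0: "A \<ge> 0" by (simp add: A_def)
    have Q: "qform a b c ?x ?y > 0" by (rule epstein_value_pos[OF p(2)])
    have lb: "e * (?x\<^sup>2 + ?y\<^sup>2) \<le> qform a b c ?x ?y" using lower[of ?x ?y] by (simp add: e_def)
    have l0: "lam1 (Suc 0) > 0" "lam2 (Suc 0) > 0" using fr by (auto intro: frequencies_pos)
    have Cp: "(2 * e) powr (- \<sigma>) \<le> C" "e powr (- \<sigma>) * lam1 (Suc 0) powr (- \<sigma>) \<le> C" "e powr (- \<sigma>) * lam2 (Suc 0) powr (- \<sigma>) \<le> C"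
      by (simp_all add: C_def)
    have "norm (epstein_term a b c (ext_coeff \<delta> \<Phi>1 a1) (ext_coeff \<delta> \<Phi>2 a2) (ext_freq lam1) (ext_freq lam2) s p)
        = A * qform a b c ?x ?y powr (- \<sigma>)"
      using Q by (simp add: epstein_term_def p norm_divide norm_mult norm_powr_real_powr A_def \<sigma>_def powr_minus_divide)
    also have "\<dots> \<le> C * (?w1 m * ?w2 n)"
    proof -
      have sq1: "?x\<^sup>2 = \<bar>?x\<bar> * \<bar>?x\<bar>" "?y\<^sup>2 = \<bar>?y\<bar> * \<bar>?y\<bar>" by (simp_all add: power2_eq_square)
      consider "m \<noteq> 0" "n \<noteq> 0" | "m = 0" "n \<noteq> 0" | "m \<noteq> 0" "n = 0" using p by auto
      then show ?thesis
      proof cases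
        case 1
        note xy = ext_freq_nonzero(1)[OF fr(1) 1(1)] ext_freq_nonzero(1)[OF fr(2) 1(2)]
        have "2 * (\<bar>?x\<bar> * \<bar>?y\<bar>) \<le> ?x\<^sup>2 + ?y\<^sup>2"
          using zero_le_power2[of "\<bar>?x\<bar> - \<bar>?y\<bar>"] by (simp add: power2_diff)
        from mult_left_mono[OF this less_imp_le[OF e]]
        have "(2 * e) * (\<bar>?x\<bar> * \<bar>?y\<bar>) \<le> e * (?x\<^sup>2 + ?y\<^sup>2)" by (simp only: mult_ac)
        then have "(2 * e) * (\<bar>?x\<bar> * \<bar>?y\<bar>) \<le> qform a b c ?x ?y" using lb by (rule order_trans)
        then have "qform a b c ?x ?y powr (- \<sigma>) \<le> ((2 * e) * (\<bar>?x\<bar> * \<bar>?y\<bar>)) powr (- \<sigma>)"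
          using xy e s0 by (intro powr_mono2') (auto simp: \<sigma>_def)
        also have "\<dots> = (2 * e) powr (- \<sigma>) * (\<bar>?x\<bar> powr (- \<sigma>) * \<bar>?y\<bar> powr (- \<sigma>))"
          using e by (simp add: powr_mult)
        also have "\<dots> \<le> C * (\<bar>?x\<bar> powr (- \<sigma>) * \<bar>?y\<bar> powr (- \<sigma>))"
          by (intro mult_right_mono Cp) auto
        finally have "A * qform a b c ?x ?y powr (- \<sigma>) \<le> A * (C * (\<bar>?x\<bar> powr (- \<sigma>) * \<bar>?y\<bar> powr (- \<sigma>)))"
          by (intro mult_left_mono A0)
        then show ?thesis using 1 by (simp add: w_def A_def mult_ac)
      next
        case 2
        have y: "\<bar>?y\<bar> \<ge> lam2 (Suc 0)" "?y \<noteq> 0" using ext_freq_nonzero[OF fr(2) 2(2)] by auto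
        have x: "?x = 0" using 2 by simp
        from mult_left_mono[OF mult_right_mono[OF y(1) abs_ge_zero[of ?y]] less_imp_le[OF e]]
        have "(e * lam2 (Suc 0)) * \<bar>?y\<bar> \<le> e * (?x\<^sup>2 + ?y\<^sup>2)"
          unfolding sq1 x by (simp only: mult.assoc abs_zero mult_zero_right zero_power2 add_0)
        then have "(e * lam2 (Suc 0)) * \<bar>?y\<bar> \<le> qform a b c ?x ?y" using lb by linarith
        then have "qform a b c ?x ?y powr (- \<sigma>) \<le> ((e * lam2 (Suc 0)) * \<bar>?y\<bar>) powr (- \<sigma>)"
          using y e s0 l0 by (intro powr_mono2') (auto simp: \<sigma>_def)
        also have "\<dots> = e powr (- \<sigma>) * lam2 (Suc 0) powr (- \<sigma>) * \<bar>?y\<bar> powr (- \<sigma>)"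
          using e l0 by (simp add: powr_mult)
        also have "\<dots> \<le> C * \<bar>?y\<bar> powr (- \<sigma>)" by (intro mult_right_mono Cp) auto
        finally have "A * qform a b c ?x ?y powr (- \<sigma>) \<le> A * (C * \<bar>?y\<bar> powr (- \<sigma>))"
          by (intro mult_left_mono A0)
        then show ?thesis using 2 by (simp add: w_def A_def mult_ac)
      next
        case 3
        have x: "\<bar>?x\<bar> \<ge> lam1 (Suc 0)" "?x \<noteq> 0" using ext_freq_nonzero[OF fr(1) 3(1)] by auto
        have y: "?y = 0" using 3 by simp
        from mult_left_mono[OF mult_right_mono[OF x(1) abs_ge_zero[of ?x]] less_imp_le[OF e]]
        have "(e * lam1 (Suc 0)) * \<bar>?x\<bar> \<le> e * (?x\<^sup>2 + ?y\<^sup>2)"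
          unfolding sq1 y by (simp only: mult.assoc abs_zero mult_zero_right zero_power2 add_0_right)
        then have "(e * lam1 (Suc 0)) * \<bar>?x\<bar> \<le> qform a b c ?x ?y" using lb by linarith
        then have "qform a b c ?x ?y powr (- \<sigma>) \<le> ((e * lam1 (Suc 0)) * \<bar>?x\<bar>) powr (- \<sigma>)"
          using x e s0 l0 by (intro powr_mono2') (auto simp: \<sigma>_def)
        also have "\<dots> = e powr (- \<sigma>) * lam1 (Suc 0) powr (- \<sigma>) * \<bar>?x\<bar> powr (- \<sigma>)"
          using e l0 by (simp add: powr_mult)
        also have "\<dots> \<le> C * \<bar>?x\<bar> powr (- \<sigma>)" by (intro mult_right_mono Cp) auto
        finally have "A * qform a b c ?x ?y powr (- \<sigma>) \<le> A * (C * \<bar>?x\<bar> powr (- \<sigma>))"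
          by (intro mult_left_mono A0)
        then show ?thesis using 3 by (simp add: w_def A_def mult_ac)
      qed
    qed
    finally show "norm (epstein_term a b c (ext_coeff \<delta> \<Phi>1 a1) (ext_coeff \<delta> \<Phi>2 a2) (ext_freq lam1) (ext_freq lam2) s p) \<le> C * (case p of (m, n) \<Rightarrow> ?w1 m * ?w2 n)"
      by (simp add: p)
  qed
qed

end

subsection \<open>A lower bound for the abscissa of absolute convergence\<close>

text \<open>The first term that may be nonzero has constant modulus along a vertical line, where the
  whole sum tends to 0, so this modulus is at most the sum of the moduli of the later terms. These
  decay faster as the line moves to the right, which forces the coefficient to be 0.\<close>

lemma exp_sum_coeff_zero:
  fixes c :: "nat \<Rightarrow> complex" and g :: "nat \<Rightarrow> real"
  assumes g: "strict_mono g" and sm: "\<And>x. x > 0 \<Longrightarrow> summable (\<lambda>k. norm (c k) * exp (- g k * x))"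
    and lim: "\<And>x. x > 0 \<Longrightarrow> ((\<lambda>y. \<Sum>k. c k * exp (- of_real (g k) * Complex x y)) \<longlongrightarrow> 0) at_top"
  shows "c k = 0"
proof (induction k rule: less_induct)
  case (less k)
  let ?t = "\<lambda>x j. norm (c (j + Suc k)) * exp (- g (j + Suc k) * x)"
  have tail: "summable (?t x)" if "x > 0" for x
    using sm[OF that] by (rule summable_ignore_initial_segment)
  have le1: "norm (c k) * exp (- g k * x) \<le> (\<Sum>j. ?t x j)" if x: "x > 0" for x
  proof (rule tendsto_le[OF _ _ tendsto_const])
    show "((\<lambda>y. norm (\<Sum>k. c k * exp (- of_real (g k) * Complex x y)) + (\<Sum>j. ?t x j)) \<longlongrightarrow> (\<Sum>j. ?t x j)) at_top"
      using tendsto_add[OF tendsto_norm[OF lim[OF x]] tendsto_const] by simp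
    show "eventually (\<lambda>y. norm (c k) * exp (- g k * x) \<le> norm (\<Sum>k. c k * exp (- of_real (g k) * Complex x y)) + (\<Sum>j. ?t x j)) at_top"
    proof (intro always_eventually allI)
      fix y
      let ?f = "\<lambda>k. c k * exp (- of_real (g k) * Complex x y)"
      have nf: "norm (?f j) = norm (c j) * exp (- g j * x)" for j by (simp add: norm_mult)
      have sf: "summable ?f" by (rule summable_norm_cancel) (use sm[OF x] in \<open>simp only: nf\<close>)
      have "(\<Sum>j. ?f j) = (\<Sum>j. ?f (j + Suc k)) + (\<Sum>j<Suc k. ?f j)"
        by (rule suminf_split_initial_segment[OF sf])
      also have "(\<Sum>j<Suc k. ?f j) = ?f k" using less by simp
      finally have eq: "?f k = (\<Sum>j. ?f j) - (\<Sum>j. ?f (j + Suc k))" by simp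
      have "norm (?f k) \<le> norm (\<Sum>j. ?f j) + norm (\<Sum>j. ?f (j + Suc k))"
        by (rule norm_triangle_ineq4[of "\<Sum>j. ?f j" "\<Sum>j. ?f (j + Suc k)", folded eq])
      also have "norm (\<Sum>j. ?f (j + Suc k)) \<le> (\<Sum>j. norm (?f (j + Suc k)))"
        by (rule summable_norm) (use tail[OF x] in \<open>simp only: nf\<close>)
      finally show "norm (c k) * exp (- g k * x) \<le> norm (\<Sum>j. ?f j) + (\<Sum>j. ?t x j)"
        unfolding nf by simp
    qed
  qed simp
  define R where "R = (\<Sum>j. ?t 1 j)"
  have gk: "g (Suc k) \<le> g (j + Suc k)" for j using strict_mono_mono[OF g] by (auto simp: mono_def)
  \<comment> \<open>The tail at abscissa \<open>x\<close> is compared with that at abscissa 1; all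
    its exponents are at least \<open>g (Suc k)\<close>.\<close>
  have le2: "norm (c k) \<le> exp (g (Suc k)) * R * exp (- (g (Suc k) - g k) * x)" if x: "x \<ge> 1" for x
  proof -
    have "(\<Sum>j. ?t x j) \<le> (\<Sum>j. exp (- g (Suc k) * (x - 1)) * ?t 1 j)"
    proof (rule suminf_le)
      fix j
      have "g (Suc k) * (x - 1) \<le> g (j + Suc k) * (x - 1)" using x gk by (intro mult_right_mono) auto
      then have "exp (- g (j + Suc k) * x) \<le> exp (- g (Suc k) * (x - 1)) * exp (- g (j + Suc k) * 1)"
        unfolding exp_add[symmetric] by (simp add: algebra_simps)
      from mult_left_mono[OF this norm_ge_zero[of "c (j + Suc k)"]]
      show "?t x j \<le> exp (- g (Suc k) * (x - 1)) * ?t 1 j" by (simp only: mult_ac)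
    next
      show "summable (\<lambda>j. ?t x j)" by (rule tail) (use x in simp)
      show "summable (\<lambda>j. exp (- g (Suc k) * (x - 1)) * ?t 1 j)" by (rule summable_mult[OF tail]) simp
    qed
    also have "\<dots> = exp (- g (Suc k) * (x - 1)) * R"
      unfolding R_def by (rule suminf_mult[OF tail]) simp
    finally have "norm (c k) * exp (- g k * x) \<le> exp (- g (Suc k) * (x - 1)) * R"
      using le1[of x] x by linarith
    then have "norm (c k) * exp (- g k * x) * exp (g k * x) \<le> exp (- g (Suc k) * (x - 1)) * R * exp (g k * x)"
      by (intro mult_right_mono) auto
    also have "norm (c k) * exp (- g k * x) * exp (g k * x) = norm (c k)" by (simp add: mult.assoc flip: exp_add)
    also have "exp (- g (Suc k) * (x - 1)) * R * exp (g k * x) = R * exp (- g (Suc k) * (x - 1) + g k * x)"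
      by (simp only: exp_add mult_ac)
    also have "- g (Suc k) * (x - 1) + g k * x = g (Suc k) + - (g (Suc k) - g k) * x" by (simp add: algebra_simps)
    finally show ?thesis by (simp only: exp_add mult_ac)
  qed
  have d: "g (Suc k) - g k > 0" using strict_monoD[OF g, of k "Suc k"] by simp
  have "((\<lambda>x. exp (g (Suc k)) * R * exp (- (g (Suc k) - g k) * x)) \<longlongrightarrow> 0) at_top"
    using d by real_asymp
  then have "norm (c k) \<le> 0"
    by (rule tendsto_le[OF _ _ tendsto_const, rotated])
       (use le2 in \<open>auto intro: eventually_mono[OF eventually_ge_at_top[of 1]]\<close>)
  then show ?case by simp
qed

text \<open>Frequencies enter linearly and the argument is complex. Bochner pairs use it with
  squared frequencies, the Epstein zeta function with the values of the form.\<close>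

definition dirichlet_theta :: "(nat \<Rightarrow> real) \<Rightarrow> (nat \<Rightarrow> complex) \<Rightarrow> complex \<Rightarrow> complex" where
  "dirichlet_theta lam a w = (\<Sum>n. a (Suc n) * exp (- of_real (lam (Suc n)) * w))"

lemma norm_theta_term_le:
  assumes "frequencies lam" "r \<le> Re w"
  shows "norm (a (Suc n) * exp (- complex_of_real (lam (Suc n)) * w)) \<le> norm (a (Suc n)) * exp (- r * lam (Suc n))"
  using assms frequencies_pos[OF assms(1), of n] by (simp add: norm_mult mult_left_mono mult.commute)

lemma dirichlet_theta_holomorphic:
  assumes fr: "frequencies lam" and s: "summable (\<lambda>n. norm (a (Suc n)) * lam (Suc n) powr (- \<sigma>))"
  shows "dirichlet_theta lam a holomorphic_on {w. Re w > 0}"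
proof (rule holomorphic_uniform_sequence)
  let ?f = "\<lambda>n w. \<Sum>i<n. a (Suc i) * exp (- complex_of_real (lam (Suc i)) * w)"
  show "open {w. Re w > 0}" by (rule open_halfspace_Re_gt)
  show "?f n holomorphic_on {w. Re w > 0}" for n by (intro holomorphic_intros)
  fix x assume x: "x \<in> {w. Re w > 0}"
  define d where "d = Re x / 2"
  have d: "d > 0" using x by (simp add: d_def)
  have ball: "Re w \<ge> d" if "w \<in> cball x d" for w
    using that abs_Re_le_cmod[of "x - w"] by (auto simp: d_def dist_norm)
  have "uniform_limit (cball x d) ?f (dirichlet_theta lam a) sequentially"
    unfolding dirichlet_theta_def
  proof (rule Weierstrass_m_test)
    show "norm (a (Suc n) * exp (- complex_of_real (lam (Suc n)) * w)) \<le> norm (a (Suc n)) * exp (- d * lam (Suc n))"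
      if "w \<in> cball x d" for n w by (rule norm_theta_term_le[OF fr ball[OF that]])
  qed (rule summable_dirichlet_exp(1)[OF fr s d])
  moreover have "cball x d \<subseteq> {w. Re w > 0}" using ball d by force
  ultimately show "\<exists>d>0. cball x d \<subseteq> {w. Re w > 0} \<and> uniform_limit (cball x d) ?f (dirichlet_theta lam a) sequentially"
    using d by blast
qed

lemma powr_le_exp:
  assumes "q \<ge> 0"
  shows "\<exists>K\<ge>0. \<forall>u>0. u powr q \<le> K * exp (u::real)"
proof -
  obtain N :: nat where N: "real N \<ge> q" using real_arch_simple by blast
  show ?thesis
  proof (intro exI[of _ "1 + fact N"] conjI allI impI)
    fix u :: real assume u: "u > 0"
    show "u powr q \<le> (1 + fact N) * exp u"
    proof (cases "u \<le> 1")
      case True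
      have "u powr q \<le> 1" using u True assms by (intro powr_le1) auto
      also have "1 \<le> 1 * exp u" using u by simp
      also have "\<dots> \<le> (1 + fact N) * exp u" by (intro mult_right_mono) auto
      finally show ?thesis .
    next
      case False
      then have "u powr q \<le> u powr real N" using N by (intro powr_mono) auto
      also have "\<dots> = u ^ N" using u by (simp add: powr_realpow)
      also have "\<dots> \<le> fact N * exp u" using u by (intro power_le_fact_exp) auto
      also have "\<dots> \<le> (1 + fact N) * exp u" by (intro mult_right_mono) auto
      finally show ?thesis .
    qed
  qed auto
qed

text \<open>
  The relation extends to complex \<open>t\<close>. As \<open>w = 1 / t = x + \<i> * y\<close> runs up a vertical line,
  \<open>Re (1 / w)\<close> is of order \<open>x / y\<^sup>2\<close>, so the theta function of \<open>a\<close> at \<open>1 / w\<close> is \<open>O(y powr (2 * q))\<close>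
  and is beaten by the factor \<open>w powr (- p)\<close>.
\<close>
lemma theta_coeff_zero:
  assumes fa: "frequencies lam" and fb: "frequencies mu"
    and sa: "summable (\<lambda>n. norm (a (Suc n)) * lam (Suc n) powr (- q))"
    and sb: "summable (\<lambda>n. norm (b (Suc n)) * mu (Suc n) powr (- \<tau>))"
    and q: "0 \<le> q" "2 * q < p"
    and rel: "\<And>t. t > 0 \<Longrightarrow> a0 + dirichlet_theta lam a (of_real t) = of_real (t powr (- p)) * (b0 + dirichlet_theta mu b (of_real (1 / t)))"
  shows "b (Suc n) = 0"
proof -
  let ?H = "{w. Re w > 0}"
  have Hi: "Re (1 / w) > 0" if "Re w > 0" for w
  proof -
    have "w \<noteq> 0" using that by auto
    then show ?thesis using that by (simp add: Re_divide cmod_power2[symmetric])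
  qed
  have nz: "w \<notin> \<real>\<^sub>\<le>\<^sub>0" if "Re w > 0" for w using that by (auto simp: complex_nonpos_Reals_iff)
  have rel': "b0 + dirichlet_theta mu b w - w powr (- of_real p) * (a0 + dirichlet_theta lam a (1 / w)) = 0" if "Re w > 0" for w
  proof (rule analytic_continuation[where S = ?H and U = "of_real ` {0<..}" and \<xi> = 1 and w = w
        and f = "\<lambda>w. b0 + dirichlet_theta mu b w - w powr (- of_real p) * (a0 + dirichlet_theta lam a (1 / w))"])
    show "(\<lambda>w. b0 + dirichlet_theta mu b w - w powr (- of_real p) * (a0 + dirichlet_theta lam a (1 / w))) holomorphic_on ?H"
    proof -
      have "(dirichlet_theta lam a \<circ> (\<lambda>w. 1 / w)) holomorphic_on ?H"
      proof (rule holomorphic_on_compose_gen[OF _ dirichlet_theta_holomorphic[OF fa sa]])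
        show "(\<lambda>w. 1 / w) holomorphic_on ?H" by (intro holomorphic_intros) auto
        show "(\<lambda>w. 1 / w) ` ?H \<subseteq> ?H" using Hi by (simp only: image_subset_iff mem_Collect_eq) blast
      qed
      then have h1: "(\<lambda>w. dirichlet_theta lam a (1 / w)) holomorphic_on ?H" by (simp add: o_def)
      have h2: "(\<lambda>w. w powr (- of_real p)) holomorphic_on ?H"
        by (intro holomorphic_intros) (use nz in auto)
      show ?thesis
        by (intro holomorphic_on_diff holomorphic_on_add holomorphic_on_mult holomorphic_on_const h1 h2
            dirichlet_theta_holomorphic[OF fb sb])
    qed
    show "open ?H" by (rule open_halfspace_Re_gt)
    show "connected ?H" by (intro convex_connected convex_halfspace_Re_gt)
    show "(1 :: complex) islimpt of_real ` {0<..}"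
      unfolding islimpt_approachable
    proof (intro allI impI)
      fix e :: real assume e: "e > 0"
      have "complex_of_real (1 + e / 2) \<in> of_real ` {0<..}" using e by (intro imageI) simp
      moreover have "complex_of_real (1 + e / 2) \<noteq> 1" using e by simp
      moreover have "dist (complex_of_real (1 + e / 2)) 1 < e" using e by (simp add: dist_norm)
      ultimately show "\<exists>x'\<in>of_real ` {0<..}. x' \<noteq> 1 \<and> dist x' (1 :: complex) < e" by blast
    qed
    fix z :: complex assume "z \<in> of_real ` {0<..}"
    then obtain x where x: "z = of_real x" "x > 0" by auto
    have "a0 + dirichlet_theta lam a (of_real (1 / x)) = of_real ((1 / x) powr (- p)) * (b0 + dirichlet_theta mu b (of_real x))"
      using rel[of "1 / x"] x by simp
    moreover have "(1 / x) powr (- p) = x powr p" using x by (simp add: powr_minus powr_divide)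
    moreover have "z powr (- of_real p) = of_real (x powr (- p))" using x powr_of_real[of x "- p"] by simp
    moreover have "x powr (- p) * x powr p = 1" using x by (simp flip: powr_add)
    ultimately show "b0 + dirichlet_theta mu b z - z powr (- of_real p) * (a0 + dirichlet_theta lam a (1 / z)) = 0"
      using x by (simp add: mult.assoc[symmetric] flip: of_real_mult)
  qed (use that in auto)
  obtain K where K: "K \<ge> 0" "\<And>u. u > 0 \<Longrightarrow> u powr q \<le> K * exp u" using powr_le_exp[OF q(1)] by blast
  define S where "S = (\<Sum>n. norm (a (Suc n)) * lam (Suc n) powr (- q))"
  \<comment> \<open>Since \<open>u powr q\<close> is at most \<open>K * exp u\<close>, each
    exponential is bounded by a power of its exponent; summability at \<open>q\<close> turns this
    into a power of \<open>Re (1 / w)\<close>.\<close>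
  have bound: "norm (dirichlet_theta lam a (1 / w)) \<le> K * S * (Re (1 / w)) powr (- q)" if w: "Re w > 0" for w
  proof -
    let ?x = "Re (1 / w)"
    have x: "?x > 0" by (rule Hi[OF w])
    have tb: "norm (a (Suc n) * exp (- complex_of_real (lam (Suc n)) * (1 / w))) \<le> K * ?x powr (- q) * (norm (a (Suc n)) * lam (Suc n) powr (- q))" for n
    proof -
      have l: "lam (Suc n) > 0" by (rule frequencies_pos[OF fa])
      have "(?x * lam (Suc n)) powr q \<le> K * exp (?x * lam (Suc n))" using x l by (intro K) auto
      then have "exp (- ?x * lam (Suc n)) * (?x * lam (Suc n)) powr q \<le> exp (- ?x * lam (Suc n)) * (K * exp (?x * lam (Suc n)))"
        by (intro mult_left_mono) auto
      also have "exp (- ?x * lam (Suc n)) * (K * exp (?x * lam (Suc n))) = K" by (simp add: mult.left_commute flip: exp_add)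
      finally have "exp (- ?x * lam (Suc n)) \<le> K * (?x * lam (Suc n)) powr (- q)"
        using x l by (simp add: powr_minus field_simps)
      also have "(?x * lam (Suc n)) powr (- q) = ?x powr (- q) * lam (Suc n) powr (- q)"
        using x l by (intro powr_mult)
      finally have "norm (a (Suc n)) * exp (- ?x * lam (Suc n)) \<le> norm (a (Suc n)) * (K * (?x powr (- q) * lam (Suc n) powr (- q)))"
        by (intro mult_left_mono) auto
      with norm_theta_term_le[OF fa order_refl, of a n "1 / w"] show ?thesis by (simp add: mult_ac)
    qed
    have s1: "summable (\<lambda>n. K * ?x powr (- q) * (norm (a (Suc n)) * lam (Suc n) powr (- q)))"
      by (intro summable_mult sa)
    have "norm (dirichlet_theta lam a (1 / w)) \<le> (\<Sum>n. K * ?x powr (- q) * (norm (a (Suc n)) * lam (Suc n) powr (- q)))"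
      unfolding dirichlet_theta_def by (rule norm_suminf_le[OF tb s1])
    also have "\<dots> = K * ?x powr (- q) * S" unfolding S_def by (rule suminf_mult[OF sa])
    finally show ?thesis by (simp add: mult_ac)
  qed
  have lim0: "((\<lambda>y. b0 + dirichlet_theta mu b (Complex x y)) \<longlongrightarrow> 0) at_top" if x: "x > 0" for x
  proof (rule Lim_null_comparison)
    show "eventually (\<lambda>y. norm (b0 + dirichlet_theta mu b (Complex x y))
        \<le> (x\<^sup>2 + y\<^sup>2) powr (- p / 2) * (norm a0 + K * S * x powr (- q) * (x\<^sup>2 + y\<^sup>2) powr q)) at_top"
    proof (intro always_eventually allI)
      fix y
      let ?w = "Complex x y" and ?r = "x\<^sup>2 + y\<^sup>2"
      have r: "?r > 0" using x by (simp add: sum_power2_gt_zero_iff)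
      have w: "Re ?w > 0" using x by simp
      have "b0 + dirichlet_theta mu b ?w = ?w powr (- of_real p) * (a0 + dirichlet_theta lam a (1 / ?w))"
        using rel'[OF w] by simp
      then have "norm (b0 + dirichlet_theta mu b ?w) = norm (?w powr (- of_real p)) * norm (a0 + dirichlet_theta lam a (1 / ?w))"
        by (simp add: norm_mult)
      also have "norm (?w powr (- of_real p)) = norm ?w powr (- p)"
        using norm_powr_real_powr'[of "- of_real p" ?w] by simp
      also have "norm ?w powr (- p) = ?r powr (- p / 2)"
        using r by (simp add: cmod_def powr_half_sqrt[symmetric] powr_powr)
      also have "norm (a0 + dirichlet_theta lam a (1 / ?w)) \<le> norm a0 + K * S * (Re (1 / ?w)) powr (- q)"
        using norm_triangle_ineq[of a0 "dirichlet_theta lam a (1 / ?w)"] bound[OF w] by linarith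
      also have "Re (1 / ?w) = x / ?r" by (simp add: Re_divide)
      also have "(x / ?r) powr (- q) = x powr (- q) * ?r powr q"
        using x r by (simp add: powr_divide powr_minus field_simps)
      finally show "norm (b0 + dirichlet_theta mu b ?w) \<le> ?r powr (- p / 2) * (norm a0 + K * S * x powr (- q) * ?r powr q)"
        by (simp add: mult_left_mono mult.assoc)
    qed
    have "((\<lambda>y. (x\<^sup>2 + y\<^sup>2) powr (- p / 2) * norm a0 + K * S * x powr (- q) * (x\<^sup>2 + y\<^sup>2) powr (q - p / 2)) \<longlongrightarrow> 0) at_top"
    proof -
      have f: "filterlim (\<lambda>y::real. x\<^sup>2 + y\<^sup>2) at_top at_top" by real_asymp
      have 1: "((\<lambda>y. (x\<^sup>2 + y\<^sup>2) powr (- p / 2)) \<longlongrightarrow> 0) at_top"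
        using q by (intro tendsto_neg_powr f) auto
      have 2: "((\<lambda>y. (x\<^sup>2 + y\<^sup>2) powr (q - p / 2)) \<longlongrightarrow> 0) at_top"
        using q by (intro tendsto_neg_powr f) auto
      show ?thesis
        using tendsto_add[OF tendsto_mult_left_zero[OF 1] tendsto_mult_right_zero[OF 2]] by simp
    qed
    moreover have "(x\<^sup>2 + y\<^sup>2) powr (q - p / 2) = (x\<^sup>2 + y\<^sup>2) powr (- p / 2) * (x\<^sup>2 + y\<^sup>2) powr q" for y
      by (simp only: powr_add[symmetric]) simp
    ultimately show "((\<lambda>y. (x\<^sup>2 + y\<^sup>2) powr (- p / 2) * (norm a0 + K * S * x powr (- q) * (x\<^sup>2 + y\<^sup>2) powr q)) \<longlongrightarrow> 0) at_top"
      by (simp only: distrib_left mult_ac)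
  qed
  \<comment> \<open>The constant \<open>b0\<close> joins the series as the coefficient of frequency
    0, so that the uniqueness result applies to the whole sum.\<close>
  define c where "c k = (case k of 0 \<Rightarrow> b0 | Suc n \<Rightarrow> b (Suc n))" for k
  define g where "g k = (case k of 0 \<Rightarrow> 0 | Suc n \<Rightarrow> mu (Suc n))" for k
  have g: "strict_mono g"
  proof (rule strict_monoI_Suc)
    fix n
    have "mu (Suc n) < mu (Suc (Suc n))" for n
      using fb by (auto simp: frequencies_def strict_mono_on_def)
    then show "g n < g (Suc n)" using frequencies_pos[OF fb] by (cases n) (auto simp: g_def)
  qed
  have sc: "summable (\<lambda>k. norm (c k) * exp (- g k * x))" if "x > 0" for x
  proof -
    have "summable (\<lambda>k. norm (c (Suc k)) * exp (- g (Suc k) * x))"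
      using summable_dirichlet_exp(1)[OF fb sb that] by (simp add: c_def g_def mult.commute)
    then show ?thesis by (subst summable_Suc_iff[symmetric])
  qed
  have "c (Suc n) = 0"
  proof (rule exp_sum_coeff_zero[OF g sc])
    fix x :: real assume x: "x > 0"
    have "(\<Sum>k. c k * exp (- of_real (g k) * Complex x y)) = b0 + dirichlet_theta mu b (Complex x y)" for y
    proof -
      have "summable (\<lambda>k. c k * exp (- of_real (g k) * Complex x y))"
        by (rule summable_norm_cancel) (use sc[OF x] in \<open>simp add: norm_mult\<close>)
      from suminf_split_head[OF this] show ?thesis
        by (simp add: c_def g_def dirichlet_theta_def)
    qed
    then show "((\<lambda>y. \<Sum>k. c k * exp (- of_real (g k) * Complex x y)) \<longlongrightarrow> 0) at_top"
      using lim0[OF x] by simp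
  qed
  then show ?thesis by (simp add: c_def)
qed

subsection \<open>Mellin transforms of theta functions\<close>

text \<open>All frequencies are at least the first one, so the series at \<open>t\<close> is at most
  \<open>exp (- lam (Suc 0) * (t - 1))\<close> times the convergent majorant at 1.\<close>

lemma theta_exp_bound:
  assumes fr: "frequencies lam" and s: "summable (\<lambda>n. norm (a (Suc n)) * lam (Suc n) powr (- \<sigma>))"
  shows "\<exists>M\<ge>0. \<forall>t\<ge>1. norm (dirichlet_theta lam a (of_real t)) \<le> M * exp (- lam (Suc 0) * t)"
proof -
  let ?l = "lam (Suc 0)"
  define R where "R = (\<Sum>n. norm (a (Suc n)) * exp (- 1 * lam (Suc n)))"
  have s1: "summable (\<lambda>n. norm (a (Suc n)) * exp (- 1 * lam (Suc n)))"
    by (rule summable_dirichlet_exp(1)[OF fr s]) simp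
  have R: "R \<ge> 0" unfolding R_def by (rule suminf_nonneg[OF s1]) simp
  show ?thesis
  proof (intro exI[of _ "exp ?l * R"] conjI allI impI)
    fix t :: real assume t: "t \<ge> 1"
    have tb: "norm (a (Suc n) * exp (- complex_of_real (lam (Suc n)) * of_real t)) \<le> exp (- ?l * (t - 1)) * (norm (a (Suc n)) * exp (- 1 * lam (Suc n)))" for n
    proof -
      have "?l * (t - 1) \<le> lam (Suc n) * (t - 1)" using t frequencies_ge_first[OF fr] by (intro mult_right_mono) auto
      then have "exp (- t * lam (Suc n)) \<le> exp (- ?l * (t - 1)) * exp (- 1 * lam (Suc n))"
        unfolding exp_add[symmetric] by (simp add: algebra_simps)
      from mult_left_mono[OF this norm_ge_zero[of "a (Suc n)"]]
      have "norm (a (Suc n)) * exp (- t * lam (Suc n)) \<le> exp (- ?l * (t - 1)) * (norm (a (Suc n)) * exp (- 1 * lam (Suc n)))"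
        by (simp only: mult_ac)
      with norm_theta_term_le[OF fr, of t "of_real t" a n] show ?thesis by simp
    qed
    have "norm (dirichlet_theta lam a (of_real t)) \<le> (\<Sum>n. exp (- ?l * (t - 1)) * (norm (a (Suc n)) * exp (- 1 * lam (Suc n))))"
      unfolding dirichlet_theta_def by (rule norm_suminf_le[OF tb summable_mult[OF s1]])
    also have "\<dots> = exp (- ?l * (t - 1)) * R" unfolding R_def by (rule suminf_mult[OF s1])
    also have "exp (- ?l * (t - 1)) = exp ?l * exp (- ?l * t)" by (simp add: algebra_simps flip: exp_add)
    finally show "norm (dirichlet_theta lam a (of_real t)) \<le> exp ?l * R * exp (- ?l * t)" by (simp only: mult_ac)
  qed (use R in auto)
qed

lemma theta_continuous:
  assumes fr: "frequencies lam" and s: "summable (\<lambda>n. norm (a (Suc n)) * lam (Suc n) powr (- \<sigma>))"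
  shows "continuous_on {0<..} (\<lambda>t. dirichlet_theta lam a (of_real t))"
  by (rule continuous_on_compose2[OF holomorphic_on_imp_continuous_on[OF dirichlet_theta_holomorphic[OF fr s]]])
     (auto intro!: continuous_intros)

text \<open>The truncated upper Mellin transform; for \<open>N = 0\<close> the interval is empty.\<close>
definition upper_mellin :: "(real \<Rightarrow> complex) \<Rightarrow> nat \<Rightarrow> complex \<Rightarrow> complex" where
  "upper_mellin f N s = integral {1..real N} (\<lambda>t. of_real t powr (s - 1) * f t)"

lemma continuous_on_powr_mult:
  fixes f :: "real \<Rightarrow> complex"
  assumes "continuous_on A f" "A \<subseteq> {0<..}"
  shows "continuous_on A (\<lambda>t. of_real t powr s * f t)"
  using assms by (intro continuous_intros) (auto intro!: continuous_on_of_real continuous_on_id)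

lemma upper_mellin_holomorphic:
  fixes f :: "real \<Rightarrow> complex"
  assumes f: "continuous_on {0<..} f"
  shows "upper_mellin f N holomorphic_on UNIV"
proof -
  have c: "continuous_on {1..real N} f" by (rule continuous_on_subset[OF f]) auto
  have "(\<lambda>s. integral (cbox 1 (real N)) (\<lambda>t. of_real t powr (s - 1) * f t)) holomorphic_on UNIV"
  proof (rule leibniz_rule_holomorphic)
    show "((\<lambda>s. of_real t powr (s - 1) * f t) has_field_derivative (of_real t powr (x - 1) * Ln (of_real t) * f t)) (at x within UNIV)"
      if "t \<in> cbox 1 (real N)" for x t
      using that by (auto intro!: derivative_eq_intros simp: powr_def)
    show "(\<lambda>t. of_real t powr (x - 1) * f t) integrable_on cbox 1 (real N)" for x
      using c by (intro integrable_continuous continuous_on_powr_mult) auto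
    show "continuous_on (UNIV \<times> cbox 1 (real N)) (\<lambda>(x, t). of_real t powr (x - 1) * Ln (of_real t) * f t)"
      unfolding case_prod_unfold
    proof (intro continuous_intros)
      show "continuous_on (UNIV \<times> cbox 1 (real N)) (\<lambda>p. f (snd p))"
        by (rule continuous_on_compose2[OF c]) (auto intro!: continuous_intros)
    qed (auto simp: complex_nonpos_Reals_iff)
  qed auto
  then show ?thesis by (simp add: upper_mellin_def[abs_def])
qed

lemma upper_mellin_step:
  fixes f :: "real \<Rightarrow> complex"
  assumes f: "continuous_on {0<..} f" and bd: "\<And>t. t \<ge> 1 \<Longrightarrow> norm (f t) \<le> M * exp (- e * t)"
    and e: "e > 0" and M: "M \<ge> 0" and s: "\<bar>Re s\<bar> \<le> R" and R: "R \<ge> 0"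
  shows "norm (upper_mellin f (Suc i) s - upper_mellin f i s) \<le> M * (real (Suc i) powr (R + 1) * exp (- e * real i))"
\<comment> \<open>Here the intervals are \<open>{1..0}\<close> and \<open>{1..1}\<close>, and both
  integrals are 0.\<close>
proof (cases "i = 0")
  case True
  then show ?thesis using M by (simp add: upper_mellin_def)
next
  case False
  let ?g = "\<lambda>t. of_real t powr (s - 1) * f t"
  have c: "continuous_on {1..real (Suc i)} ?g" by (intro continuous_on_powr_mult continuous_on_subset[OF f]) auto
  then have int: "?g integrable_on {1..real (Suc i)}" by (rule integrable_continuous_interval)
  have c2: "continuous_on {real i..real (Suc i)} ?g" by (rule continuous_on_subset[OF c]) (use False in auto)
  have "integral {1..real i} ?g + integral {real i..real (Suc i)} ?g = integral {1..real (Suc i)} ?g"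
    by (rule Henstock_Kurzweil_Integration.integral_combine[OF _ _ int]) (use False in auto)
  then have "upper_mellin f (Suc i) s - upper_mellin f i s = integral {real i..real (Suc i)} ?g"
    unfolding upper_mellin_def by (simp add: algebra_simps)
  also have "norm \<dots> \<le> M * (real (Suc i) powr (R + 1) * exp (- e * real i)) * (real (Suc i) - real i)"
  proof (rule integral_bound[OF _ c2])
    fix t assume t: "t \<in> {real i..real (Suc i)}"
    have t1: "t \<ge> 1" using t False by auto
    have "norm (?g t) = t powr (Re s - 1) * norm (f t)" using t1 by (simp add: norm_mult norm_powr_real_powr)
    also have "\<dots> \<le> real (Suc i) powr (R + 1) * (M * exp (- e * real i))"
    proof (intro mult_mono)
      have "t powr (Re s - 1) \<le> t powr (R + 1)" using t1 s by (intro powr_mono) auto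
      also have "\<dots> \<le> real (Suc i) powr (R + 1)" using t t1 R by (intro powr_mono2) auto
      finally show "t powr (Re s - 1) \<le> real (Suc i) powr (R + 1)" .
      have "norm (f t) \<le> M * exp (- e * t)" by (rule bd[OF t1])
      also have "\<dots> \<le> M * exp (- e * real i)" using t e M by (intro mult_left_mono) auto
      finally show "norm (f t) \<le> M * exp (- e * real i)" .
    qed auto
    finally show "norm (?g t) \<le> M * (real (Suc i) powr (R + 1) * exp (- e * real i))" by (simp only: mult_ac)
  qed simp
  finally show ?thesis by simp
qed

text \<open>The integral over \<open>{1..}\<close> as a telescoping series of integrals over unit
  intervals, so that the Weierstrass test gives locally uniform convergence in \<open>s\<close>. The
  part of the Mellin transform below 1 is supplied later by the theta relation.\<close>

definition mellin :: "(real \<Rightarrow> complex) \<Rightarrow> complex \<Rightarrow> complex" where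
  "mellin f s = (\<Sum>i. upper_mellin f (Suc i) s - upper_mellin f i s)"

lemma summable_powr_exp:
  assumes e: "e > 0" and R: "R \<ge> 0"
  shows "summable (\<lambda>i. real (Suc i) powr (R + 1) * exp (- e * real i))"
proof -
  have "summable (\<lambda>i. exp (- e / 2) ^ i)" using e by (intro summable_geometric) simp
  then have "summable (\<lambda>i. exp (- e / 2 * real i))" by (simp add: exp_of_nat2_mult[symmetric])
  then show ?thesis
  proof (rule summable_comparison_test_ev[rotated])
    have "eventually (\<lambda>i. real (Suc i) powr (R + 1) * exp (- e * real i) \<le> exp (- e / 2 * real i)) sequentially"
      using e R by real_asymp
    then show "eventually (\<lambda>i. norm (real (Suc i) powr (R + 1) * exp (- e * real i)) \<le> exp (- e / 2 * real i)) sequentially"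
      by simp
  qed
qed

lemma upper_mellin_uniform_limit:
  fixes f :: "real \<Rightarrow> complex"
  assumes f: "continuous_on {0<..} f" and bd: "\<And>t. t \<ge> 1 \<Longrightarrow> norm (f t) \<le> M * exp (- e * t)"
    and e: "e > 0" and M: "M \<ge> 0" and R: "R \<ge> 0" and A: "\<And>s. s \<in> A \<Longrightarrow> \<bar>Re s\<bar> \<le> R"
  shows "uniform_limit A (upper_mellin f) (mellin f) sequentially"
proof -
  have tele: "(\<Sum>i<n. upper_mellin f (Suc i) s - upper_mellin f i s) = upper_mellin f n s" for n s
    by (induction n) (simp_all add: upper_mellin_def)
  have sm: "summable (\<lambda>i. M * (real (Suc i) powr (R + 1) * exp (- e * real i)))"
    by (rule summable_mult[OF summable_powr_exp[OF e R]])
  have "uniform_limit A (\<lambda>n s. \<Sum>i<n. upper_mellin f (Suc i) s - upper_mellin f i s) (mellin f) sequentially"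
    unfolding mellin_def
    by (rule Weierstrass_m_test[OF _ sm]) (rule upper_mellin_step[OF f bd e M A R])
  then show ?thesis unfolding tele by (simp add: eta_contract_eq)
qed

lemma mellin_lim:
  fixes f :: "real \<Rightarrow> complex"
  assumes f: "continuous_on {0<..} f" and bd: "\<And>t. t \<ge> 1 \<Longrightarrow> norm (f t) \<le> M * exp (- e * t)"
    and e: "e > 0" and M: "M \<ge> 0"
  shows "(\<lambda>n. upper_mellin f n s) \<longlonglongrightarrow> mellin f s"
proof -
  have "uniform_limit {s} (upper_mellin f) (mellin f) sequentially"
    by (rule upper_mellin_uniform_limit[OF f bd e M, of "\<bar>Re s\<bar>"]) auto
  then show ?thesis by (rule tendsto_uniform_limitI) simp
qed

lemma mellin_holomorphic:
  fixes f :: "real \<Rightarrow> complex"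
  assumes f: "continuous_on {0<..} f" and bd: "\<And>t. t \<ge> 1 \<Longrightarrow> norm (f t) \<le> M * exp (- e * t)"
    and e: "e > 0" and M: "M \<ge> 0"
  shows "mellin f holomorphic_on UNIV"
proof (rule holomorphic_uniform_sequence[where f = "upper_mellin f"])
  show "upper_mellin f n holomorphic_on UNIV" for n by (rule upper_mellin_holomorphic[OF f])
  fix x :: complex
  have "uniform_limit (cball x 1) (upper_mellin f) (mellin f) sequentially"
  proof (rule upper_mellin_uniform_limit[OF f bd e M, of "\<bar>Re x\<bar> + 1"])
    show "\<bar>Re s\<bar> \<le> \<bar>Re x\<bar> + 1" if "s \<in> cball x 1" for s
      using that abs_Re_le_cmod[of "x - s"] by (auto simp: dist_norm)
  qed auto
  then show "\<exists>d>0. cball x d \<subseteq> UNIV \<and> uniform_limit (cball x d) (upper_mellin f) (mellin f) sequentially"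
    by (intro exI[of _ 1]) auto
qed auto

lemma mellin_bounded:
  fixes f :: "real \<Rightarrow> complex"
  assumes f: "continuous_on {0<..} f" and bd: "\<And>t. t \<ge> 1 \<Longrightarrow> norm (f t) \<le> M * exp (- e * t)"
    and e: "e > 0" and M: "M \<ge> 0" and R: "R \<ge> 0"
  shows "\<exists>C. \<forall>s. \<bar>Re s\<bar> \<le> R \<longrightarrow> norm (mellin f s) \<le> C"
proof (intro exI allI impI)
  fix s assume "\<bar>Re s\<bar> \<le> R"
  then show "norm (mellin f s) \<le> (\<Sum>i. M * (real (Suc i) powr (R + 1) * exp (- e * real i)))"
    unfolding mellin_def
    by (intro norm_suminf_le summable_mult summable_powr_exp upper_mellin_step[OF f bd] e M R)
qed

text \<open>Integration by parts gains a factor \<open>1 / s\<close>. The remaining integral is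
  bounded in vertical strips, and this yields the decay demanded of \<open>chi\<close> in a Hecke
  pair.\<close>

lemma mellin_parts:
  fixes f f' :: "real \<Rightarrow> complex"
  assumes f: "continuous_on {0<..} f" and bd: "\<And>t. t \<ge> 1 \<Longrightarrow> norm (f t) \<le> M * exp (- e * t)"
    and f': "continuous_on {0<..} f'" and bd': "\<And>t. t \<ge> 1 \<Longrightarrow> norm (f' t) \<le> M' * exp (- e * t)"
    and deriv: "\<And>t. t > 0 \<Longrightarrow> (f has_vector_derivative f' t) (at t)"
    and e: "e > 0" and M: "M \<ge> 0" "M' \<ge> 0" and s: "s \<noteq> 0"
  shows "mellin f s = - (f 1 + mellin f' (s + 1)) / s"
proof -
  define H where "H t = of_real t powr s * f t" for t
  have id: "s * upper_mellin f n s = H (real n) - f 1 - upper_mellin f' n (s + 1)" if n: "n \<ge> 1" for n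
  proof -
    have powd: "((\<lambda>t. of_real t powr s) has_vector_derivative (s * of_real t powr (s - 1))) (at t within {1..real n})"
      if "t \<ge> 1" for t
    proof -
      have "((\<lambda>z. z powr s) has_field_derivative (s * of_real t powr (s - 1))) (at (of_real t))"
        using that by (intro has_field_derivative_powr) auto
      then show ?thesis by (rule has_vector_derivative_real_field)
    qed
    have "((\<lambda>t. of_real t powr s * f' t + s * of_real t powr (s - 1) * f t) has_integral (H (real n) - H 1)) {1..real n}"
    proof (rule fundamental_theorem_of_calculus)
      fix t assume t: "t \<in> {1..real n}"
      then have t1: "t \<ge> 1" by simp
      show "(H has_vector_derivative of_real t powr s * f' t + s * of_real t powr (s - 1) * f t) (at t within {1..real n})"
        unfolding H_def[abs_def]
        by (rule has_vector_derivative_mult[OF powd[OF t1] has_vector_derivative_at_within[OF deriv]]) (use t1 in simp)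
    qed (use n in simp)
    moreover have "(\<lambda>t. of_real t powr s * f' t) integrable_on {1..real n}"
      by (intro integrable_continuous_interval continuous_on_powr_mult continuous_on_subset[OF f']) auto
    moreover have "(\<lambda>t. of_real t powr (s - 1) * f t) integrable_on {1..real n}"
      by (intro integrable_continuous_interval continuous_on_powr_mult continuous_on_subset[OF f]) auto
    ultimately have "upper_mellin f' n (s + 1) + s * upper_mellin f n s = H (real n) - H 1"
      unfolding upper_mellin_def
      by (simp add: has_integral_iff mult.assoc Henstock_Kurzweil_Integration.integral_add integrable_on_mult_right)
    then show ?thesis by (simp add: H_def algebra_simps)
  qed
  have Hlim: "(\<lambda>n. H (real n)) \<longlonglongrightarrow> 0"
  proof (rule Lim_null_comparison)
    show "eventually (\<lambda>n. norm (H (real n)) \<le> M * (real n powr Re s * exp (- e * real n))) sequentially"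
      using eventually_ge_at_top[of 1]
    proof eventually_elim
      case (elim n)
      then have "norm (H (real n)) = real n powr Re s * norm (f (real n))"
        by (simp add: H_def norm_mult norm_powr_real_powr)
      also have "\<dots> \<le> real n powr Re s * (M * exp (- e * real n))"
        using elim by (intro mult_left_mono bd) auto
      finally show ?case by (simp only: mult_ac)
    qed
    show "(\<lambda>n. M * (real n powr Re s * exp (- e * real n))) \<longlonglongrightarrow> 0"
    proof (rule tendsto_mult_right_zero)
      show "(\<lambda>n. real n powr Re s * exp (- e * real n)) \<longlonglongrightarrow> 0" using e by real_asymp
    qed
  qed
  have l1: "(\<lambda>n. s * upper_mellin f n s) \<longlonglongrightarrow> s * mellin f s"
    by (intro tendsto_mult tendsto_const mellin_lim[OF f bd e M(1)])
  have l2: "(\<lambda>n. H (real n) - f 1 - upper_mellin f' n (s + 1)) \<longlonglongrightarrow> 0 - f 1 - mellin f' (s + 1)"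
    by (intro tendsto_diff tendsto_const Hlim mellin_lim[OF f' bd' e M(2)])
  have "eventually (\<lambda>n. H (real n) - f 1 - upper_mellin f' n (s + 1) = s * upper_mellin f n s) sequentially"
    using eventually_ge_at_top[of 1] by eventually_elim (simp add: id)
  then have "(\<lambda>n. s * upper_mellin f n s) \<longlonglongrightarrow> 0 - f 1 - mellin f' (s + 1)"
    by (rule Lim_transform_eventually[OF l2])
  then have "s * mellin f s = 0 - f 1 - mellin f' (s + 1)" using l1 by (rule LIMSEQ_unique[rotated])
  then show ?thesis using s by (simp add: field_simps)
qed

section \<open>The Mellin transform of a theta function\<close>

lemma Gamma_integral_scaled:
  assumes s: "Re s > 0" and \<nu>: "\<nu> > 0"
  defines "f \<equiv> \<lambda>t. indicator {0<..} t *\<^sub>R (complex_of_real t powr (s - 1) * exp (- of_real \<nu> * of_real t))"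
  shows "integrable lborel f" "integral\<^sup>L lborel f = Gamma s * of_real \<nu> powr (- s)"
proof -
  define g where "g = (\<lambda>t. indicator {0<..} t *\<^sub>R (complex_of_real t powr (s - 1) / of_real (exp t)))"
  have meas: "g \<in> borel_measurable lborel"
  proof -
    have "continuous_on {0<..} (\<lambda>t. complex_of_real t powr (s - 1) / of_real (exp t))"
      by (intro continuous_intros) auto
    then show ?thesis unfolding g_def
      using borel_measurable_continuous_on_indicator[of "{0<..}" "\<lambda>t. complex_of_real t powr (s - 1) / of_real (exp t)"] by simp
  qed
  have "integrable lebesgue g"
    using absolutely_integrable_Gamma_integral'[OF s] by (simp add: set_integrable_def g_def)
  then have intg: "integrable lborel g" using meas by (simp add: integrable_completion)
  then have si: "set_integrable lborel {0<..} (\<lambda>t. complex_of_real t powr (s - 1) / of_real (exp t))"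
    by (simp add: set_integrable_def g_def)
  have valg: "integral\<^sup>L lborel g = Gamma s"
    using set_borel_integral_eq_integral(2)[OF si] integral_unique[OF Gamma_integral_complex'[OF s]]
    by (simp add: set_lebesgue_integral_def g_def)
  have fg: "f t = of_real \<nu> powr (- (s - 1)) * g (0 + \<nu> * t)" for t
  proof (cases "t > 0")
    case True
    have "complex_of_real (\<nu> * t) powr (s - 1) = of_real \<nu> powr (s - 1) * of_real t powr (s - 1)"
      using True \<nu> by (simp add: powr_times_real)
    moreover have "complex_of_real \<nu> powr (- (s - 1)) * of_real \<nu> powr (s - 1) = 1"
      using \<nu> by (simp only: powr_add[symmetric]) simp
    moreover have "exp (- complex_of_real \<nu> * of_real t) = 1 / of_real (exp (\<nu> * t))"
      by (simp add: exp_minus divide_inverse flip: exp_of_real)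
    ultimately show ?thesis using True \<nu> by (simp add: f_def g_def mult.assoc[symmetric] zero_less_mult_iff)
  next
    case False
    then show ?thesis using \<nu> by (simp add: f_def g_def zero_less_mult_iff)
  qed
  have int': "integrable lborel (\<lambda>t. g (0 + \<nu> * t))"
    by (rule lborel_integrable_real_affine[OF intg]) (use \<nu> in simp)
  then show "integrable lborel f" unfolding fg[abs_def] by (rule integrable_mult_right)
  have "Gamma s = of_real \<nu> * (LINT t|lborel. g (0 + \<nu> * t))"
    using lborel_integral_real_affine[of \<nu> g 0] \<nu> valg by (simp add: scaleR_conv_of_real)
  moreover have "integral\<^sup>L lborel f = of_real \<nu> powr (- (s - 1)) * (LINT t|lborel. g (0 + \<nu> * t))"
    unfolding fg[abs_def] by simp
  moreover have "complex_of_real \<nu> powr (- (s - 1)) = of_real \<nu> powr (- s) * of_real \<nu>"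
    using powr_add[of "complex_of_real \<nu>" "- s" 1] \<nu> by (simp add: algebra_simps)
  ultimately show "integral\<^sup>L lborel f = Gamma s * of_real \<nu> powr (- s)" by simp
qed

text \<open>The exhausting intervals are invariant under \<open>t\<close> to \<open>1 / t\<close>,
  so that after inversion both halves are truncated at the same point.\<close>

lemma tendsto_integral_exhaust:
  fixes g :: "real \<Rightarrow> complex"
  assumes int: "integrable lborel (\<lambda>t. indicator {0<..} t *\<^sub>R g t)"
  shows "(\<lambda>n. integral {1 / real (Suc n)..real (Suc n)} g) \<longlonglongrightarrow> (LINT t|lborel. indicator {0<..} t *\<^sub>R g t)"
proof -
  let ?h = "\<lambda>t. indicator {0<..} t *\<^sub>R g t"
  have eq: "integral {1 / real (Suc n)..real (Suc n)} g = (LINT t|lborel. indicator {1 / real (Suc n)..real (Suc n)} t *\<^sub>R ?h t)" for n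
  proof -
    have "set_integrable lborel {1 / real (Suc n)..real (Suc n)} ?h"
      unfolding set_integrable_def by (intro integrable_mult_indicator int) auto
    from set_borel_integral_eq_integral(2)[OF this]
    have "(LINT t|lborel. indicator {1 / real (Suc n)..real (Suc n)} t *\<^sub>R ?h t) = integral {1 / real (Suc n)..real (Suc n)} ?h"
      by (simp add: set_lebesgue_integral_def)
    also have "\<dots> = integral {1 / real (Suc n)..real (Suc n)} g"
    proof (rule integral_cong)
      fix t assume "t \<in> {1 / real (Suc n)..real (Suc n)}"
      moreover have "1 / real (Suc n) > 0" by simp
      ultimately have "t > 0" by (simp only: atLeastAtMost_iff) linarith
      then show "?h t = g t" by simp
    qed
    finally show ?thesis by simp
  qed
  show ?thesis unfolding eq
  proof (rule integral_dominated_convergence[where w = "\<lambda>t. norm (?h t)"])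
    show "AE x in lborel. (\<lambda>n. indicator {1 / real (Suc n)..real (Suc n)} x *\<^sub>R ?h x) \<longlonglongrightarrow> ?h x"
    proof (intro always_eventually allI)
      fix x :: real
      show "(\<lambda>n. indicator {1 / real (Suc n)..real (Suc n)} x *\<^sub>R ?h x) \<longlonglongrightarrow> ?h x"
      proof (cases "x > 0")
        case True
        obtain N :: nat where N: "real N \<ge> max x (1 / x)" using real_arch_simple by blast
        have "indicator {1 / real (Suc n)..real (Suc n)} x *\<^sub>R ?h x = ?h x" if "n \<ge> N" for n
        proof -
          have n: "real (Suc n) \<ge> x" "real (Suc n) \<ge> 1 / x" using N that by auto
          then have "1 / real (Suc n) \<le> x" using True by (simp add: field_simps)
          then show ?thesis using n by simp
        qed
        then show ?thesis by (intro tendsto_eventually) (auto simp: eventually_at_top_linorder)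
      qed simp
    qed
    show "integrable lborel (\<lambda>t. norm (?h t))" by (rule integrable_norm[OF int])
    show hm: "?h \<in> borel_measurable lborel" using int by (rule borel_measurable_integrable)
    show "(\<lambda>x. indicator {1 / real (Suc n)..real (Suc n)} x *\<^sub>R ?h x) \<in> borel_measurable lborel" for n
      by (rule borel_measurable_scaleR[OF _ hm]) simp
    show "AE x in lborel. norm (indicator {1 / real (Suc n)..real (Suc n)} x *\<^sub>R ?h x) \<le> norm (?h x)" for n
      by (intro always_eventually allI) (auto simp: indicator_def)
  qed
qed

text \<open>Termwise this is Euler's integral for
  \<open>Gamma s * of_real (lam (Suc n)) powr (- s)\<close>. The integrals of the norms are the same
  expression at \<open>Re s\<close> with absolute coefficients, hence summable.\<close>

lemma theta_mellin:
  assumes fr: "frequencies lam" and sm: "summable (\<lambda>n. norm (a (Suc n)) * lam (Suc n) powr (- \<sigma>))"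
    and s: "Re s > 0" "Re s \<ge> \<sigma>"
  shows "(\<lambda>n. integral {1 / real (Suc n)..real (Suc n)} (\<lambda>t. of_real t powr (s - 1) * dirichlet_theta lam a (of_real t)))
     \<longlonglongrightarrow> Gamma s * dirichlet_series lam a s"
proof -
  let ?K = "\<lambda>s n t. indicator {0<..} t *\<^sub>R (complex_of_real t powr (s - 1) * exp (- of_real (lam (Suc n)) * of_real t))"
  define g where "g n t = a (Suc n) * ?K s n t" for n t
  define h where "h t = indicator {0<..} t *\<^sub>R (of_real t powr (s - 1) * dirichlet_theta lam a (of_real t))" for t
  have pos: "lam (Suc n) > 0" for n by (rule frequencies_pos[OF fr])
  have int: "integrable lborel (g n)" for n
    unfolding g_def by (rule integrable_mult_right[OF Gamma_integral_scaled(1)[OF s(1) pos]])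
  have val: "integral\<^sup>L lborel (g n) = Gamma s * (a (Suc n) * of_real (lam (Suc n)) powr (- s))" for n
    unfolding g_def integral_mult_right_zero Gamma_integral_scaled(2)[OF s(1) pos] by (simp only: mult_ac)
  have sR: "Re (of_real (Re s)) > 0" using s by simp
  have nval: "(LINT t|lborel. norm (g n t)) = Re (Gamma (of_real (Re s))) * (norm (a (Suc n)) * lam (Suc n) powr (- Re s))" for n
  proof -
    have "norm (g n t) = norm (a (Suc n)) * Re (?K (of_real (Re s)) n t)" for t
    proof (cases "t > 0")
      case True
      have "complex_of_real t powr (of_real (Re s) - 1) * exp (- of_real (lam (Suc n)) * of_real t)
          = of_real (t powr (Re s - 1) * exp (- lam (Suc n) * t))"
        using True powr_of_real[of t "Re s - 1"] by (simp flip: exp_of_real)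
      then show ?thesis using True by (simp add: g_def norm_mult norm_powr_real_powr)
    qed (simp add: g_def)
    then have "(LINT t|lborel. norm (g n t)) = norm (a (Suc n)) * (LINT t|lborel. Re (?K (of_real (Re s)) n t))"
      by simp
    also have "(LINT t|lborel. Re (?K (of_real (Re s)) n t)) = Re (LINT t|lborel. ?K (of_real (Re s)) n t)"
      by (rule integral_Re[OF Gamma_integral_scaled(1)[OF sR pos]])
    also have "\<dots> = Re (Gamma (of_real (Re s)) * of_real (lam (Suc n) powr (- Re s)))"
      unfolding Gamma_integral_scaled(2)[OF sR pos] using powr_of_real[of "lam (Suc n)" "- Re s"] pos[of n] by simp
    also have "\<dots> = Re (Gamma (of_real (Re s))) * lam (Suc n) powr (- Re s)" by simp
    finally show ?thesis by (simp only: mult_ac)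
  qed
  have sg: "summable (\<lambda>n. norm (g n t))" for t
  proof (cases "t > 0")
    case True
    have e: "norm (g n t) = t powr (Re s - 1) * (norm (a (Suc n)) * exp (- t * lam (Suc n)))" for n
      using True by (simp add: g_def norm_mult norm_powr_real_powr mult_ac)
    show ?thesis unfolding e by (intro summable_mult summable_dirichlet_exp(1)[OF fr sm True])
  qed (simp add: g_def)
  have sI: "summable (\<lambda>n. LINT t|lborel. norm (g n t))"
    unfolding nval by (intro summable_mult summable_dirichlet_mono[OF fr sm s(2)])
  have hg: "h = (\<lambda>t. \<Sum>n. g n t)"
  proof
    fix t
    show "h t = (\<Sum>n. g n t)"
    proof (cases "t > 0")
      case True
      have "summable (\<lambda>n. a (Suc n) * exp (- of_real (lam (Suc n)) * of_real t))"
      proof (rule summable_norm_cancel, rule summable_comparison_test'[OF summable_dirichlet_exp(1)[OF fr sm True]])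
        show "norm (norm (a (Suc n) * exp (- of_real (lam (Suc n)) * of_real t))) \<le> norm (a (Suc n)) * exp (- t * lam (Suc n))" for n
          using norm_theta_term_le[OF fr, of t "of_real t" a n] by simp
      qed
      from suminf_mult[OF this, of "of_real t powr (s - 1)"] show ?thesis
        using True by (simp add: h_def g_def dirichlet_theta_def mult_ac)
    qed (simp add: h_def g_def)
  qed
  have "integrable lborel h" unfolding hg by (rule integrable_suminf) (use int sg sI in auto)
  then have lim: "(\<lambda>n. integral {1 / real (Suc n)..real (Suc n)} (\<lambda>t. of_real t powr (s - 1) * dirichlet_theta lam a (of_real t))) \<longlonglongrightarrow> integral\<^sup>L lborel h"
    unfolding h_def[abs_def] by (rule tendsto_integral_exhaust)
  have "integral\<^sup>L lborel h = (\<Sum>n. integral\<^sup>L lborel (g n))"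
    unfolding hg by (rule integral_suminf) (use int sg sI in auto)
  also have "\<dots> = Gamma s * dirichlet_series lam a s"
    unfolding val dirichlet_series_def
    by (rule suminf_mult[OF summable_norm_cancel[OF summable_dirichlet_series[OF fr sm s(2)]]])
  finally show ?thesis using lim by simp
qed

lemma integral_powr_0_1:
  assumes "w \<noteq> 0" "0 < x" "x \<le> 1"
  shows "((\<lambda>t. complex_of_real t powr (w - 1)) has_integral ((1 - of_real x powr w) / w)) {x..1}"
proof -
  have "((\<lambda>t. complex_of_real t powr (w - 1)) has_integral (of_real 1 powr w / w - of_real x powr w / w)) {x..1}"
  proof (rule fundamental_theorem_of_calculus)
    fix t assume "t \<in> {x..1}"
    then have t: "t > 0" using assms by auto
    have "((\<lambda>z. z powr w / w) has_field_derivative (w * of_real t powr (w - 1) / w)) (at (of_real t))"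
      using t by (intro DERIV_cdivide has_field_derivative_powr) auto
    then have "((\<lambda>z. z powr w / w) has_field_derivative (of_real t powr (w - 1))) (at (of_real t))"
      using assms(1) by simp
    then show "((\<lambda>t. of_real t powr w / w) has_vector_derivative of_real t powr (w - 1)) (at t within {x..1})"
      by (rule has_vector_derivative_real_field)
  qed (use assms in auto)
  then show ?thesis by (simp add: diff_divide_distrib)
qed

text \<open>Substitution of \<open>1 / t\<close>, which reverses the orientation; it turns the part
  of a Mellin integral below 1 into an upper one for the dual theta function.\<close>

lemma integral_inversion:
  fixes f :: "real \<Rightarrow> complex"
  assumes f: "continuous_on {0<..} f" and n: "n \<ge> 1"
  shows "((\<lambda>t. of_real t powr (- w - 1) * f (1 / t)) has_integral upper_mellin f n w) {1 / real n..1}"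
proof -
  let ?F = "\<lambda>t. of_real t powr (- w - 1) * f (1 / t)"
  have n0: "real n \<ge> 1" using n by simp
  have ip: "1 / real n > 0" using n0 by simp
  have pos: "t > 0" if "t \<in> {1 / real n..1}" for t
    using that ip by (simp only: atLeastAtMost_iff) linarith
  have cF: "continuous_on {1 / real n..1} ?F"
  proof (rule continuous_on_powr_mult)
    show "continuous_on {1 / real n..1} (\<lambda>t. f (1 / t))"
    proof (rule continuous_on_compose2[OF f])
      show "continuous_on {1 / real n..1} (\<lambda>t. 1 / t)" by (intro continuous_intros) (use pos in blast)
      show "(\<lambda>t. 1 / t) ` {1 / real n..1} \<subseteq> {0<..}" using pos by fastforce
    qed
  qed (use pos in blast)
  have "((\<lambda>u. (- 1 / u\<^sup>2) *\<^sub>R ?F (1 / u)) has_integral (integral {1 / 1..1 / real n} ?F - integral {1 / real n..1 / 1} ?F)) {1..real n}"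
  proof (rule has_integral_substitution_general[where s = "{}"])
    show "(\<lambda>u. 1 / u) ` {1..real n} \<subseteq> {1 / real n..1}" using n0 by (auto simp: field_simps)
    show "continuous_on {1..real n} (\<lambda>u. 1 / u)" by (intro continuous_intros) auto
    show "((\<lambda>u. 1 / u) has_field_derivative - 1 / x\<^sup>2) (at x within {1..real n})" if "x \<in> {1..real n} - {}" for x
      using that by (auto intro!: derivative_eq_intros simp: power2_eq_square)
  qed (use n0 cF in auto)
  moreover have "integral {1 / 1..1 / real n} ?F = 0"
  proof (cases "n = 1")
    case False
    then have "1 / real n < 1" using n0 by simp
    then show ?thesis by simp
  qed simp
  ultimately have "((\<lambda>u. (- 1 / u\<^sup>2) *\<^sub>R ?F (1 / u)) has_integral (- integral {1 / real n..1} ?F)) {1..real n}"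
    by simp
  from has_integral_neg[OF this]
  have "((\<lambda>u. - ((- 1 / u\<^sup>2) *\<^sub>R ?F (1 / u))) has_integral integral {1 / real n..1} ?F) {1..real n}" by simp
  then have "((\<lambda>u. of_real u powr (w - 1) * f u) has_integral integral {1 / real n..1} ?F) {1..real n}"
  proof (rule has_integral_eq[rotated])
    fix u assume "u \<in> {1..real n}"
    then have u: "u > 0" by simp
    have "complex_of_real (1 / u) powr (- w - 1) = of_real u powr (w + 1)"
      using u Ln_of_real[of "1 / u"] Ln_of_real[of u] by (simp add: powr_def ln_div algebra_simps)
    moreover have "of_real u powr (w + 1) = of_real u powr (w - 1) * complex_of_real (u\<^sup>2)"
      using powr_add[of "complex_of_real u" "w - 1" 2] u by (simp add: powr_numeral add.commute)
    ultimately show "- ((- 1 / u\<^sup>2) *\<^sub>R ?F (1 / u)) = of_real u powr (w - 1) * f u"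
      using u by (simp add: scaleR_conv_of_real)
  qed
  then have "upper_mellin f n w = integral {1 / real n..1} ?F"
    unfolding upper_mellin_def by (rule integral_unique)
  moreover have "?F integrable_on {1 / real n..1}" using cF by (rule integrable_continuous_interval)
  ultimately show ?thesis by (simp add: integrable_integral)
qed

lemma theta_has_vector_derivative:
  assumes fr: "frequencies lam" and sm: "summable (\<lambda>n. norm (a (Suc n)) * lam (Suc n) powr (- \<sigma>))" and t: "t > 0"
  shows "((\<lambda>t. dirichlet_theta lam a (of_real t)) has_vector_derivative
     - dirichlet_theta lam (\<lambda>n. a n * of_real (lam n)) (of_real t)) (at t)"
proof -
  have pos: "lam (Suc n) > 0" for n by (rule frequencies_pos[OF fr])
  have sq: "(sqrt (lam (Suc n)))\<^sup>2 = lam (Suc n)" for n using pos[of n] by simp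
  \<comment> \<open>A theta series is a Gaussian series in the square roots of its frequencies, so
    the derivative of order 0 established there applies.\<close>
  have "((\<lambda>z. \<Sum>k. a (Suc k) * (of_real (sqrt (lam (Suc k))) ^ 0 * exp (- z * of_real ((sqrt (lam (Suc k)))\<^sup>2)))) has_field_derivative
     - (\<Sum>k. a (Suc k) * (of_real (sqrt (lam (Suc k))) ^ (0 + 2) * exp (- of_real t * of_real ((sqrt (lam (Suc k)))\<^sup>2))))) (at (of_real t))"
  proof (rule gauss_series_deriv[OF _ t])
    fix \<epsilon> K :: real assume e: "\<epsilon> > 0"
    have "summable (\<lambda>n. norm (a (Suc n)) * exp (K * sqrt (lam (Suc n)) - \<epsilon> * lam (Suc n)))"
    proof (rule summable_dirichlet_weight[OF fr sm])
      have "eventually (\<lambda>x::real. exp (K * sqrt x - \<epsilon> * x) \<le> x powr (- \<sigma>)) at_top"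
        using e by real_asymp
      then show "eventually (\<lambda>x::real. norm (exp (K * sqrt x - \<epsilon> * x)) \<le> x powr (- \<sigma>)) at_top" by simp
    qed
    then show "summable (\<lambda>k. norm (a (Suc k)) * exp (K * \<bar>sqrt (lam (Suc k))\<bar> - \<epsilon> * (sqrt (lam (Suc k)))\<^sup>2))"
      using pos by (simp add: less_imp_le)
  qed
  note D = this
  have pw: "complex_of_real (sqrt (lam (Suc k))) ^ (0 + 2) = of_real (lam (Suc k))" for k
    unfolding add_0 of_real_power[symmetric] sq ..
  have "(dirichlet_theta lam a has_field_derivative - dirichlet_theta lam (\<lambda>n. a n * of_real (lam n)) (of_real t)) (at (of_real t))"
    using D unfolding pw sq by (simp add: dirichlet_theta_def[abs_def] mult_ac)
  then show ?thesis by (rule has_vector_derivative_real_field)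
qed

subsection \<open>Hecke's correspondence\<close>

text \<open>The hypothesis of Hecke's correspondence for parameter 1: a theta relation of weight
  one, normalised to \<open>t\<close> and \<open>1 / t\<close>. The constants \<open>a0\<close> and
  \<open>b0\<close> are the terms of frequency 0; \<sigma> and \<tau> are exponents of absolute
  convergence.\<close>

locale hecke_theta =
  fixes lam mu :: "nat \<Rightarrow> real" and a b :: "nat \<Rightarrow> complex" and a0 b0 :: complex and \<sigma> \<tau> :: real
  assumes fa: "frequencies lam" and fb: "frequencies mu"
    and sa: "summable (\<lambda>n. norm (a (Suc n)) * lam (Suc n) powr (- \<sigma>))"
    and sb: "summable (\<lambda>n. norm (b (Suc n)) * mu (Suc n) powr (- \<tau>))"
    and rel: "\<And>t. t > 0 \<Longrightarrow> a0 + dirichlet_theta lam a (of_real t) = of_real (1 / t) * (b0 + dirichlet_theta mu b (of_real (1 / t)))"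
begin

lemma dual: "hecke_theta mu lam b a b0 a0 \<tau> \<sigma>"
proof
  fix t :: real assume t: "t > 0"
  have "of_real (1 / t) * (a0 + dirichlet_theta lam a (of_real (1 / t)))
      = of_real (1 / t) * (of_real t * (b0 + dirichlet_theta mu b (of_real t)))"
    using rel[of "1 / t"] t by simp
  also have "\<dots> = b0 + dirichlet_theta mu b (of_real t)" using t by simp
  finally show "b0 + dirichlet_theta mu b (of_real t) = of_real (1 / t) * (a0 + dirichlet_theta lam a (of_real (1 / t)))" ..
qed (rule fa fb sa sb)+

definition theta_a :: "real \<Rightarrow> complex" where "theta_a t = dirichlet_theta lam a (of_real t)"
definition theta_b :: "real \<Rightarrow> complex" where "theta_b t = dirichlet_theta mu b (of_real t)"
text \<open>The entire part of the completed function, made of both integrals over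
  \<open>{1..}\<close>; exchanging the two series together with \<open>s\<close> and
  \<open>1 - s\<close> leaves it unchanged.\<close>

definition E :: "complex \<Rightarrow> complex" where "E s = mellin theta_a s + mellin theta_b (1 - s)"
definition \<Lambda> :: "complex \<Rightarrow> complex" where "\<Lambda> s = E s - a0 / s + b0 / (s - 1)"
text \<open>\<open>\<Lambda>\<close> multiplied by \<open>rGamma\<close>, with
  \<open>rGamma s / s\<close> rewritten as \<open>rGamma (s + 1)\<close>. This removes the pole of
  \<open>\<Lambda>\<close> at 0 and gives \<open>Z 0 = - a0\<close>, the convention of class A for
  the coefficient of index 0.\<close>

definition Z :: "complex \<Rightarrow> complex" where
  "Z s = rGamma s * E s - a0 * rGamma (s + 1) + b0 * rGamma s / (s - 1)"

lemma theta_facts: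
  "continuous_on {0<..} theta_a" "continuous_on {0<..} theta_b"
  "\<exists>M\<ge>0. \<forall>t\<ge>1. norm (theta_a t) \<le> M * exp (- lam (Suc 0) * t)"
  "\<exists>M\<ge>0. \<forall>t\<ge>1. norm (theta_b t) \<le> M * exp (- mu (Suc 0) * t)"
  using theta_continuous[OF fa sa] theta_continuous[OF fb sb] theta_exp_bound[OF fa sa] theta_exp_bound[OF fb sb]
  by (simp_all add: theta_a_def[abs_def] theta_b_def[abs_def])

text \<open>The bound by \<open>1 / norm s\<close> comes from \<open>mellin_parts\<close>. The
  derivative of the theta function has coefficients \<open>a n * lam n\<close>, whose exponent of
  absolute convergence is larger by one.\<close>

lemma mellin_theta_a:
  "mellin theta_a holomorphic_on UNIV" "(\<lambda>n. upper_mellin theta_a n s) \<longlonglongrightarrow> mellin theta_a s"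
  "\<exists>C. \<forall>s. s \<noteq> 0 \<longrightarrow> \<bar>Re s\<bar> \<le> R \<longrightarrow> norm (mellin theta_a s) \<le> C / norm s"
proof -
  obtain M where M: "M \<ge> 0" "\<And>t. t \<ge> 1 \<Longrightarrow> norm (theta_a t) \<le> M * exp (- lam (Suc 0) * t)"
    using theta_facts(3) by blast
  have l0: "lam (Suc 0) > 0" by (rule frequencies_pos[OF fa])
  show "mellin theta_a holomorphic_on UNIV" by (rule mellin_holomorphic[OF theta_facts(1) M(2) l0 M(1)])
  show "(\<lambda>n. upper_mellin theta_a n s) \<longlonglongrightarrow> mellin theta_a s" by (rule mellin_lim[OF theta_facts(1) M(2) l0 M(1)])
  define f' where "f' t = - dirichlet_theta lam (\<lambda>n. a n * of_real (lam n)) (of_real t)" for t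
  have sa': "summable (\<lambda>n. norm (a (Suc n) * complex_of_real (lam (Suc n))) * lam (Suc n) powr (- (\<sigma> + 1)))"
  proof -
    have "norm (a (Suc n) * complex_of_real (lam (Suc n))) * lam (Suc n) powr (- (\<sigma> + 1)) = norm (a (Suc n)) * lam (Suc n) powr (- \<sigma>)" for n
      using frequencies_pos[OF fa, of n] powr_add[of "lam (Suc n)" "- (\<sigma> + 1)" 1]
      by (simp add: norm_mult mult.assoc mult.commute[of "lam (Suc n)"])
    then show ?thesis using sa by simp
  qed
  have c': "continuous_on {0<..} f'"
    unfolding f'_def by (intro continuous_intros theta_continuous[OF fa sa'])
  obtain M' where M': "M' \<ge> 0" "\<And>t. t \<ge> 1 \<Longrightarrow> norm (f' t) \<le> M' * exp (- lam (Suc 0) * t)"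
    using theta_exp_bound[OF fa sa'] unfolding f'_def norm_minus_cancel by blast
  have der: "(theta_a has_vector_derivative f' t) (at t)" if "t > 0" for t
    unfolding theta_a_def[abs_def] f'_def by (rule theta_has_vector_derivative[OF fa sa that])
  obtain C where C: "\<And>s. \<bar>Re s\<bar> \<le> \<bar>R\<bar> + 1 \<Longrightarrow> norm (mellin f' s) \<le> C"
    using mellin_bounded[OF c' M'(2) l0 M'(1), of "\<bar>R\<bar> + 1"] by auto
  show "\<exists>C. \<forall>s. s \<noteq> 0 \<longrightarrow> \<bar>Re s\<bar> \<le> R \<longrightarrow> norm (mellin theta_a s) \<le> C / norm s"
  proof (intro exI allI impI)
    fix s :: complex assume s: "s \<noteq> 0" "\<bar>Re s\<bar> \<le> R"
    have "mellin theta_a s = - (theta_a 1 + mellin f' (s + 1)) / s"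
      by (rule mellin_parts[OF theta_facts(1) M(2) c' M'(2) der l0 M(1) M'(1) s(1)])
    then have "norm (mellin theta_a s) = norm (theta_a 1 + mellin f' (s + 1)) / norm s"
      by (simp only: norm_divide norm_minus_cancel)
    also have "\<dots> \<le> (norm (theta_a 1) + C) / norm s"
    proof (rule divide_right_mono)
      have "\<bar>Re (s + 1)\<bar> \<le> \<bar>R\<bar> + 1" using s by auto
      from C[OF this] show "norm (theta_a 1 + mellin f' (s + 1)) \<le> norm (theta_a 1) + C"
        using norm_triangle_ineq[of "theta_a 1" "mellin f' (s + 1)"] by linarith
    qed simp
    finally show "norm (mellin theta_a s) \<le> (norm (theta_a 1) + C) / norm s" .
  qed
qed

end

context hecke_theta
begin

text \<open>The theta relation is symmetric, so each fact about \<open>a\<close> has a twin about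
  \<open>b\<close>.\<close>

interpretation d: hecke_theta mu lam b a b0 a0 \<tau> \<sigma> by (rule dual)

lemma dual_theta: "d.theta_a = theta_b" "d.theta_b = theta_a"
  by (simp_all add: fun_eq_iff d.theta_a_def d.theta_b_def theta_a_def theta_b_def)

lemmas mellin_theta_b = d.mellin_theta_a[unfolded dual_theta]

lemma E_dual: "d.E (1 - s) = E s"
  by (simp add: d.E_def E_def dual_theta)

lemma \<Lambda>_dual: "d.\<Lambda> (1 - s) = \<Lambda> s"
proof -
  have "b0 / (1 - s) = - (b0 / (s - 1))" by (metis minus_diff_eq minus_divide_right)
  then show ?thesis by (simp add: d.\<Lambda>_def \<Lambda>_def E_dual)
qed

lemma E_holomorphic: "E holomorphic_on UNIV"
proof -
  have "(mellin theta_b \<circ> (\<lambda>s. 1 - s)) holomorphic_on UNIV"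
    by (rule holomorphic_on_compose_gen[OF _ mellin_theta_b(1)]) (auto intro!: holomorphic_intros)
  then have "(\<lambda>s. mellin theta_b (1 - s)) holomorphic_on UNIV" by (simp add: o_def)
  then show ?thesis unfolding E_def[abs_def] by (intro holomorphic_on_add mellin_theta_a(1))
qed

lemma \<Lambda>_decay:
  assumes "\<epsilon> > 0"
  shows "\<exists>T. \<forall>s. \<sigma>1 \<le> Re s \<and> Re s \<le> \<sigma>2 \<and> T \<le> \<bar>Im s\<bar> \<longrightarrow> norm (\<Lambda> s) < \<epsilon>"
proof -
  define R where "R = \<bar>\<sigma>1\<bar> + \<bar>\<sigma>2\<bar> + 1"
  obtain C1 where C1: "\<And>s. s \<noteq> 0 \<Longrightarrow> \<bar>Re s\<bar> \<le> R \<Longrightarrow> norm (mellin theta_a s) \<le> C1 / norm s"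
    using mellin_theta_a(3) by blast
  obtain C2 where C2: "\<And>s. s \<noteq> 0 \<Longrightarrow> \<bar>Re s\<bar> \<le> R \<Longrightarrow> norm (mellin theta_b s) \<le> C2 / norm s"
    using mellin_theta_b(3) by blast
  define D where "D = \<bar>C1\<bar> + \<bar>C2\<bar> + norm a0 + norm b0 + 1"
  have D: "D > 0" unfolding D_def by (intro add_nonneg_pos add_nonneg_nonneg) auto
  show ?thesis
  proof (intro exI[of _ "max 1 (D / \<epsilon>)"] allI impI)
    fix s assume s: "\<sigma>1 \<le> Re s \<and> Re s \<le> \<sigma>2 \<and> max 1 (D / \<epsilon>) \<le> \<bar>Im s\<bar>"
    define y where "y = \<bar>Im s\<bar>"
    have y: "y \<ge> 1" "y \<ge> D / \<epsilon>" using s by (auto simp: y_def)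
    have nz: "s \<noteq> 0" "1 - s \<noteq> 0" using y by (auto simp: y_def)
    have n: "y \<le> norm s" "y \<le> norm (1 - s)" "y \<le> norm (s - 1)"
      using abs_Im_le_cmod[of s] abs_Im_le_cmod[of "1 - s"] abs_Im_le_cmod[of "s - 1"] by (auto simp: y_def)
    have fr: "c / norm w \<le> \<bar>c\<bar> / y" if "y \<le> norm w" for c and w :: complex
      using that y by (intro frac_le) auto
    have "norm (mellin theta_a s) \<le> \<bar>C1\<bar> / y"
      using C1[OF nz(1)] fr[OF n(1), of C1] s by (force simp: R_def)
    moreover have "norm (mellin theta_b (1 - s)) \<le> \<bar>C2\<bar> / y"
      using C2[OF nz(2)] fr[OF n(2), of C2] s by (force simp: R_def)
    moreover have "norm (a0 / s) \<le> norm a0 / y" using fr[OF n(1), of "norm a0"] by (simp add: norm_divide)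
    moreover have "norm (b0 / (s - 1)) \<le> norm b0 / y" using fr[OF n(3), of "norm b0"] by (simp add: norm_divide)
    moreover have "norm (\<Lambda> s) \<le> norm (mellin theta_a s) + norm (mellin theta_b (1 - s)) + norm (a0 / s) + norm (b0 / (s - 1))"
      unfolding \<Lambda>_def E_def
      by (meson norm_triangle_ineq norm_triangle_ineq4 order_trans add_mono order_refl)
    ultimately have "norm (\<Lambda> s) \<le> (\<bar>C1\<bar> + \<bar>C2\<bar> + norm a0 + norm b0) / y" by (simp add: add_divide_distrib)
    also have "\<dots> < D / y" using y by (intro divide_strict_right_mono) (auto simp: D_def)
    also have "\<dots> \<le> \<epsilon>" using y assms by (simp add: field_simps)
    finally show "norm (\<Lambda> s) < \<epsilon>" .
  qed
qed

text \<open>Riemann's argument: the Mellin integral is split at 1, and below 1 the theta relation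
  yields two elementary powers and an inverted integral of the dual. \<open>Re s > 1\<close> makes
  the boundary terms of both powers vanish in the limit.\<close>

lemma Gamma_series_eq:
  assumes s: "Re s > 1" "Re s \<ge> \<sigma>"
  shows "Gamma s * dirichlet_series lam a s = \<Lambda> s"
proof -
  have s0: "s \<noteq> 0" "s - 1 \<noteq> 0" using s by auto
  define L where "L n = integral {1 / real (Suc n)..real (Suc n)} (\<lambda>t. of_real t powr (s - 1) * theta_a t)" for n
  have L1: "L \<longlonglongrightarrow> Gamma s * dirichlet_series lam a s"
    using theta_mellin[OF fa sa, of s] s by (simp add: L_def[abs_def] theta_a_def)
  have L2: "L n = (- a0 * ((1 - of_real (1 / real (Suc n)) powr s) / s) + b0 * ((1 - of_real (1 / real (Suc n)) powr (s - 1)) / (s - 1))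
      + upper_mellin theta_b (Suc n) (1 - s)) + upper_mellin theta_a (Suc n) s" for n
  proof -
    let ?x = "1 / real (Suc n)"
    have x: "?x > 0" "?x \<le> 1" by simp_all
    have c: "continuous_on {?x..real (Suc n)} (\<lambda>t. of_real t powr (s - 1) * theta_a t)"
    proof -
      have "{?x..real (Suc n)} \<subseteq> {0<..}"
        using x(1) by (simp only: subset_iff atLeastAtMost_iff greaterThan_iff) (meson less_le_trans)
      then show ?thesis by (intro continuous_on_powr_mult continuous_on_subset[OF theta_facts(1)])
    qed
    have "integral {?x..1} (\<lambda>t. of_real t powr (s - 1) * theta_a t) + integral {1..real (Suc n)} (\<lambda>t. of_real t powr (s - 1) * theta_a t) = L n"
      unfolding L_def
      by (rule Henstock_Kurzweil_Integration.integral_combine[OF _ _ integrable_continuous_interval[OF c]]) (use x in auto)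
    moreover have "integral {?x..1} (\<lambda>t. of_real t powr (s - 1) * theta_a t)
        = - a0 * ((1 - of_real ?x powr s) / s) + b0 * ((1 - of_real ?x powr (s - 1)) / (s - 1)) + upper_mellin theta_b (Suc n) (1 - s)"
    proof (rule integral_unique, rule has_integral_eq[rotated])
      show "((\<lambda>t. - a0 * of_real t powr (s - 1) + b0 * of_real t powr ((s - 1) - 1) + of_real t powr (- (1 - s) - 1) * theta_b (1 / t)) has_integral
          (- a0 * ((1 - of_real ?x powr s) / s) + b0 * ((1 - of_real ?x powr (s - 1)) / (s - 1)) + upper_mellin theta_b (Suc n) (1 - s))) {?x..1}"
        by (intro has_integral_add has_integral_mult_right integral_powr_0_1 integral_inversion theta_facts(2) s0 x) simp
      fix t assume "t \<in> {?x..1}"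
      then have t: "t > 0" using x(1) by (simp only: atLeastAtMost_iff) linarith
      have "theta_a t = - a0 + of_real (1 / t) * (b0 + theta_b (1 / t))"
        using rel[OF t] by (simp add: theta_a_def theta_b_def algebra_simps)
      moreover have "of_real t powr (s - 1) * of_real (1 / t) = of_real t powr (s - 1 - 1)"
        using t powr_diff[of "complex_of_real t" "s - 1" 1] by simp
      moreover have "p * (- a0 + i * (b0 + y)) = - a0 * p + b0 * (p * i) + (p * i) * y" for p i y :: complex
        by (simp add: algebra_simps)
      moreover have "- (1 - s) - 1 = s - 1 - 1" by simp
      ultimately show "- a0 * of_real t powr (s - 1) + b0 * of_real t powr ((s - 1) - 1) + of_real t powr (- (1 - s) - 1) * theta_b (1 / t)
          = of_real t powr (s - 1) * theta_a t" by (simp only:)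
    qed
    ultimately show ?thesis unfolding upper_mellin_def by simp
  qed
  have powr0: "(\<lambda>n. complex_of_real (1 / real (Suc n)) powr w) \<longlonglongrightarrow> 0" if "Re w > 0" for w
  proof (rule Lim_null_comparison)
    show "eventually (\<lambda>n. norm (complex_of_real (1 / real (Suc n)) powr w) \<le> (1 / real (Suc n)) powr Re w) sequentially"
      by (intro always_eventually allI) (simp only: norm_powr_real_powr Reals_of_real Re_complex_of_real zero_le_divide_1_iff of_nat_0_le_iff order_refl)
    show "(\<lambda>n. (1 / real (Suc n)) powr Re w) \<longlonglongrightarrow> 0" using that by real_asymp
  qed
  have "L \<longlonglongrightarrow> (- a0 * ((1 - 0) / s) + b0 * ((1 - 0) / (s - 1)) + mellin theta_b (1 - s)) + mellin theta_a s"
    unfolding L2[abs_def]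
    by (intro tendsto_intros powr0 LIMSEQ_Suc[OF mellin_theta_a(2)] LIMSEQ_Suc[OF mellin_theta_b(2)]) (use s s0 in auto)
  with L1 have "Gamma s * dirichlet_series lam a s = (- a0 * ((1 - 0) / s) + b0 * ((1 - 0) / (s - 1)) + mellin theta_b (1 - s)) + mellin theta_a s"
    by (rule LIMSEQ_unique)
  then show ?thesis by (simp add: \<Lambda>_def E_def)
qed

lemma Gamma_Z: "s \<notin> \<int>\<^sub>\<le>\<^sub>0 \<Longrightarrow> Gamma s * Z s = \<Lambda> s"
proof -
  assume s: "s \<notin> \<int>\<^sub>\<le>\<^sub>0"
  then have s0: "s \<noteq> 0" by auto
  have g: "Gamma s * rGamma s = 1" using s by (simp add: Gamma_def rGamma_eq_zero_iff)
  have "rGamma s = s * rGamma (s + 1)" by (rule rGamma_plus1[symmetric])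
  then have g1: "Gamma s * rGamma (s + 1) = 1 / s" using g s0 by (simp add: field_simps)
  have "Gamma s * Z s = (Gamma s * rGamma s) * E s - a0 * (Gamma s * rGamma (s + 1)) + b0 * (Gamma s * rGamma s) / (s - 1)"
    by (simp add: Z_def algebra_simps)
  then show ?thesis unfolding g g1 by (simp add: \<Lambda>_def)
qed

lemma Z_holomorphic: "Z holomorphic_on - {1}"
  unfolding Z_def[abs_def] by (intro holomorphic_intros holomorphic_on_subset[OF E_holomorphic]) auto

lemma Z_entire: "b0 = 0 \<Longrightarrow> Z holomorphic_on UNIV"
  unfolding Z_def[abs_def] by (simp, intro holomorphic_intros holomorphic_on_subset[OF E_holomorphic]) auto

lemma Z_lim: "((\<lambda>s. Z s * (s - 1)) \<longlongrightarrow> b0) (at 1)"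
proof -
  have c: "isCont E 1" using E_holomorphic holomorphic_on_imp_continuous_on continuous_on_eq_continuous_at open_UNIV UNIV_I by blast
  have "isCont (\<lambda>s. (rGamma s * E s - a0 * rGamma (s + 1)) * (s - 1) + b0 * rGamma s) 1"
    using c by (intro continuous_intros) auto
  then have "((\<lambda>s. (rGamma s * E s - a0 * rGamma (s + 1)) * (s - 1) + b0 * rGamma s) \<longlongrightarrow> (rGamma 1 * E 1 - a0 * rGamma (1 + 1)) * (1 - 1) + b0 * rGamma 1) (at 1)"
    by (simp add: isCont_def)
  then have "((\<lambda>s. (rGamma s * E s - a0 * rGamma (s + 1)) * (s - 1) + b0 * rGamma s) \<longlongrightarrow> b0) (at 1)" by simp
  then show ?thesis
  proof (rule Lim_transform_eventually)
    show "eventually (\<lambda>s. (rGamma s * E s - a0 * rGamma (s + 1)) * (s - 1) + b0 * rGamma s = Z s * (s - 1)) (at 1)"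
      using eventually_neq_at_within[of 1] by eventually_elim (simp add: Z_def distrib_right)
  qed
qed

lemma Z_residue: "residue Z 1 = b0"
  by (rule residue_simple'[of UNIV]) (use Z_lim Z_holomorphic in \<open>auto simp: Compl_eq_Diff_UNIV\<close>)

lemma Z_pole:
  assumes "b0 \<noteq> 0"
  shows "is_pole Z 1" "zorder Z 1 = - 1"
proof -
  define H where "H s = (rGamma s * E s - a0 * rGamma (s + 1)) * (s - 1) + b0 * rGamma s" for s
  have holH: "H holomorphic_on UNIV"
    unfolding H_def[abs_def] by (intro holomorphic_intros holomorphic_on_subset[OF E_holomorphic]) auto
  have H1: "H 1 = b0" by (simp add: H_def)
  have ZH: "Z s = H s / (s - 1)" if "s \<noteq> 1" for s using that by (simp add: Z_def H_def field_simps)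
  show "zorder Z 1 = - 1"
    by (rule zorder_eqI[of UNIV _ H]) (use holH H1 assms ZH in \<open>auto simp: power_int_minus divide_inverse\<close>)
  have "isCont H 1" using holH holomorphic_on_imp_continuous_on continuous_on_eq_continuous_at open_UNIV UNIV_I by blast
  then have "is_pole (\<lambda>s. H s / (s - 1)) 1"
  proof (rule is_pole_divide)
    show "filterlim (\<lambda>s::complex. s - 1) (at 0) (at 1)"
      unfolding filterlim_at by (auto intro!: tendsto_eq_intros eventually_mono[OF eventually_neq_at_within[of 1]])
    show "H 1 \<noteq> 0" using H1 assms by simp
  qed
  moreover have "is_pole (\<lambda>s. H s / (s - 1)) 1 \<longleftrightarrow> is_pole Z 1"
    by (rule is_pole_cong[OF _ refl]) (rule eventually_mono[OF eventually_neq_at_within[of 1]], simp add: ZH)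
  ultimately show "is_pole Z 1" by simp
qed

lemma Z_eq_off_1:
  assumes s: "abs_abscissa lam a < ereal (Re s)" "s \<noteq> 1"
  shows "Z s = dirichlet_series lam a s"
proof (rule analytic_continuation_open[where s = "{s. Re s > max 1 (max \<sigma> 0)}" and s' = "{s. abs_abscissa lam a < ereal (Re s)} - {1}"
      and f = Z and g = "dirichlet_series lam a" and z = s])
  let ?U = "{s. abs_abscissa lam a < ereal (Re s)}"
  show "open {s. Re s > max 1 (max \<sigma> 0)}" by (rule open_halfspace_Re_gt)
  show "open (?U - {1})" by (intro open_delete abs_abscissa_less_half_plane)
  show "connected (?U - {1})"
    by (intro connected_open_delete abs_abscissa_less_half_plane convex_connected) auto
  show "{s. Re s > max 1 (max \<sigma> 0)} \<noteq> {}" by (auto intro!: exI[of _ "of_real (max 1 (max \<sigma> 0) + 1)"])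
  have "abs_abscissa lam a \<le> ereal \<sigma>" by (rule abs_abscissa_le[OF sa])
  then show "{s. Re s > max 1 (max \<sigma> 0)} \<subseteq> ?U - {1}" by (auto intro: le_less_trans)
  show "Z holomorphic_on ?U - {1}" by (rule holomorphic_on_subset[OF Z_holomorphic]) auto
  show "dirichlet_series lam a holomorphic_on ?U - {1}"
    by (rule holomorphic_on_subset[OF holomorphic_dirichlet_series[OF fa]]) auto
  show "Z z = dirichlet_series lam a z" if "z \<in> {s. Re s > max 1 (max \<sigma> 0)}" for z
  proof -
    have z: "Re z > 1" "Re z \<ge> \<sigma>" using that by auto
    then have np: "z \<notin> \<int>\<^sub>\<le>\<^sub>0" by (auto elim!: nonpos_Ints_cases')
    have "Gamma z * dirichlet_series lam a z = Gamma z * Z z"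
      using Gamma_series_eq[OF z] Gamma_Z[OF np] by simp
    moreover have "Gamma z \<noteq> 0" using np by (simp add: Gamma_eq_zero_iff)
    ultimately show ?thesis by simp
  qed
qed (use s in auto)

text \<open>If the series converges absolutely in a neighbourhood of 1, its product with
  \<open>s - 1\<close> tends to 0 there, whereas the same product for \<open>Z\<close> tends to
  \<open>b0\<close>.\<close>

lemma b0_eq_0:
  assumes "abs_abscissa lam a < 1"
  shows "b0 = 0"
proof -
  have op: "open {s. abs_abscissa lam a < ereal (Re s)}" by (rule abs_abscissa_less_half_plane)
  have "isCont (dirichlet_series lam a) 1"
    using holomorphic_on_imp_continuous_on[OF holomorphic_dirichlet_series[OF fa, of a]] op assms
    by (simp add: continuous_on_eq_continuous_at one_ereal_def)
  then have "((\<lambda>s. dirichlet_series lam a s * (s - 1)) \<longlongrightarrow> dirichlet_series lam a 1 * (1 - 1)) (at 1)"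
    by (intro tendsto_intros) (auto simp: isCont_def)
  then have "((\<lambda>s. dirichlet_series lam a s * (s - 1)) \<longlongrightarrow> 0) (at 1)" by simp
  moreover have "eventually (\<lambda>s. dirichlet_series lam a s * (s - 1) = Z s * (s - 1)) (at 1)"
  proof -
    have "eventually (\<lambda>s. s \<in> {s. abs_abscissa lam a < ereal (Re s)} - {1}) (at 1)"
      by (rule eventually_at_in_open[OF op]) (use assms in \<open>simp add: one_ereal_def\<close>)
    then show ?thesis by eventually_elim (use Z_eq_off_1 in auto)
  qed
  ultimately have "((\<lambda>s. Z s * (s - 1)) \<longlongrightarrow> 0) (at 1)" by (rule Lim_transform_eventually)
  from tendsto_unique[OF _ Z_lim this] show ?thesis by simp
qed

text \<open>At 1 the quotient in \<open>Z\<close> has denominator 0 and thus the value 0. That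
  agrees with the continuation because \<open>b0\<close> vanishes as soon as 1 lies to the right of
  the abscissa.\<close>

lemma Z_eq:
  assumes s: "abs_abscissa lam a < ereal (Re s)"
  shows "Z s = dirichlet_series lam a s"
proof (cases "s = 1")
  case False
  then show ?thesis using Z_eq_off_1 s by blast
next
  case True
  then have a1: "abs_abscissa lam a < 1" using s by (simp add: one_ereal_def)
  have op: "open {s. abs_abscissa lam a < ereal (Re s)}" by (rule abs_abscissa_less_half_plane)
  have "isCont (dirichlet_series lam a) 1"
    using holomorphic_on_imp_continuous_on[OF holomorphic_dirichlet_series[OF fa, of a]] op a1
    by (simp add: continuous_on_eq_continuous_at one_ereal_def)
  then have 1: "(dirichlet_series lam a \<longlongrightarrow> dirichlet_series lam a 1) (at 1)" by (simp add: isCont_def)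
  have "isCont Z 1" using Z_entire[OF b0_eq_0[OF a1]] holomorphic_on_imp_continuous_on continuous_on_eq_continuous_at open_UNIV UNIV_I by blast
  then have 2: "(Z \<longlongrightarrow> Z 1) (at 1)" by (simp add: isCont_def)
  have "eventually (\<lambda>s. s \<in> {s. abs_abscissa lam a < ereal (Re s)} - {1}) (at 1)"
    by (rule eventually_at_in_open[OF op]) (use a1 in \<open>simp add: one_ereal_def\<close>)
  then have "eventually (\<lambda>s. dirichlet_series lam a s = Z s) (at 1)" by eventually_elim (use Z_eq_off_1 in auto)
  then have "(Z \<longlongrightarrow> dirichlet_series lam a 1) (at 1)" by (rule Lim_transform_eventually[OF 1])
  from tendsto_unique[OF _ 2 this] show ?thesis using True by simp
qed

lemma Z_continues: "continues_except_simple_pole lam a 1 Z"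
proof -
  have "not_essential Z 1 \<and> (is_pole Z 1 \<longrightarrow> zorder Z 1 = - 1)"
  proof (cases "b0 = 0")
    case True
    have "Z analytic_on UNIV" using Z_entire[OF True] by (simp add: analytic_on_open)
    then have an: "Z analytic_on {1}" by (rule analytic_on_subset) simp
    then have "\<not> is_pole Z 1" using analytic_at_imp_no_pole by blast
    then show ?thesis using an by (simp add: not_essential_analytic)
  next
    case False
    then show ?thesis using Z_pole by (auto simp: not_essential_def)
  qed
  then show ?thesis
    unfolding continues_except_simple_pole_def continues_to_def using Z_holomorphic Z_eq by auto
qed

text \<open>The decay argument at weight 1: an exponent \<open>q\<close> with
  \<open>2 * q < 1\<close> makes all dual coefficients zero. A negative \<open>q\<close> is replaced
  by 0.\<close>

lemma coeff_zero_of_small_abscissa: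
  assumes "abs_abscissa lam a < ereal (1/2)"
  shows "b (Suc n) = 0"
proof -
  obtain q where q: "abs_abscissa lam a < ereal q" "ereal q < ereal (1/2)"
    using ereal_dense2[OF assms] by blast
  have "summable (\<lambda>n. norm (a (Suc n)) * lam (Suc n) powr (- max q 0))"
    by (rule summable_dirichlet_mono[OF fa summable_of_abs_abscissa_less[OF fa q(1)]]) simp
  then show ?thesis
  proof (rule theta_coeff_zero[OF fa fb _ sb, where p = 1])
    show "a0 + dirichlet_theta lam a (of_real t) = of_real (t powr - 1) * (b0 + dirichlet_theta mu b (of_real (1 / t)))" if "t > 0" for t
      using rel[OF that] that by (simp add: powr_minus divide_inverse)
  qed (use q in auto)
qed

end

section \<open>Finite abscissas and membership in class A\<close>

context hecke_theta
begin

interpretation d: hecke_theta mu lam b a b0 a0 \<tau> \<sigma> by (rule dual)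

text \<open>A dual series that vanishes identically has an abscissa of at most 0, below 1/2, so the
  decay argument in the opposite direction would make \<open>a\<close> vanish as well.\<close>

lemma dual_coeff_nonzero:
  assumes "a (Suc n) \<noteq> 0"
  shows "\<exists>m. b (Suc m) \<noteq> 0"
proof (rule ccontr)
  assume "\<nexists>m. b (Suc m) \<noteq> 0"
  then have z: "b (Suc m) = 0" for m by blast
  have "summable (\<lambda>n. norm (b (Suc n)) * mu (Suc n) powr (- 0))" by (simp add: z)
  then have "abs_abscissa mu b \<le> ereal 0" by (rule abs_abscissa_le)
  also have "\<dots> < ereal (1/2)" by simp
  finally have "a (Suc n) = 0" by (rule d.coeff_zero_of_small_abscissa)
  then show False using assms by simp
qed

text \<open>The lower bound excludes the abscissa minus infinity, and \<sigma> bounds it from above;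
  \<open>dirichlet_data\<close> requires it to be finite.\<close>

lemma abscissa_bounds:
  assumes "a (Suc n) \<noteq> 0"
  shows "abs_abscissa lam a \<ge> ereal (1/2)" "dirichlet_data lam a"
proof -
  show lb: "abs_abscissa lam a \<ge> ereal (1/2)"
    using coeff_zero_of_small_abscissa dual_coeff_nonzero[OF assms] by (meson not_le)
  have "abs_abscissa lam a \<le> ereal \<sigma>" by (rule abs_abscissa_le[OF sa])
  then have "\<bar>abs_abscissa lam a\<bar> \<noteq> \<infinity>" using lb by (cases "abs_abscissa lam a") auto
  then show "dirichlet_data lam a"
    unfolding dirichlet_data_def using fa assms by (auto intro!: exI[of _ "Suc n"])
qed

lemma \<Lambda>_series:
  assumes "a (Suc n) \<noteq> 0" "abs_abscissa lam a < ereal (Re s)"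
  shows "\<Lambda> s = Gamma s * dirichlet_series lam a s"
proof -
  have "ereal (1/2) < ereal (Re s)" using abscissa_bounds(1)[OF assms(1)] assms(2) by (rule le_less_trans)
  then have "s \<notin> \<int>\<^sub>\<le>\<^sub>0" by (auto elim!: nonpos_Ints_cases')
  then show ?thesis using Gamma_Z[of s] Z_eq[OF assms(2)] by simp
qed

end

context hecke_theta
begin

interpretation d: hecke_theta mu lam b a b0 a0 \<tau> \<sigma> by (rule dual)

lemma hecke_pair:
  assumes "a (Suc n) \<noteq> 0"
  shows "hecke_pair 1 lam a mu b"
proof -
  obtain m where m: "b (Suc m) \<noteq> 0" using dual_coeff_nonzero[OF assms] by blast
  obtain B where B: "abs_abscissa mu b = ereal B"
    using d.abscissa_bounds(2)[OF m] unfolding dirichlet_data_def by (cases "abs_abscissa mu b") auto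
  have "\<Lambda> meromorphic_on UNIV"
  proof -
    have "E meromorphic_on UNIV"
      using E_holomorphic by (intro analytic_on_imp_meromorphic_on) (simp add: analytic_on_open)
    then show ?thesis unfolding \<Lambda>_def[abs_def] by (intro meromorphic_intros)
  qed
  moreover have "\<Lambda> s = Gamma s * dirichlet_series lam a s" if "abs_abscissa lam a < ereal (Re s)" for s
    by (rule \<Lambda>_series[OF assms that])
  moreover have "\<Lambda> s = Gamma (1 - s) * dirichlet_series mu b (1 - s)" if "ereal (Re s) < ereal 1 - abs_abscissa mu b" for s
    using d.\<Lambda>_series[OF m, of "1 - s"] that \<Lambda>_dual[of s] by (simp add: B)
  moreover have "\<exists>K. compact K \<and> \<Lambda> holomorphic_on (- K)"
  proof (intro exI conjI)
    show "compact {0, 1 :: complex}" by simp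
    show "\<Lambda> holomorphic_on - {0, 1}"
      unfolding \<Lambda>_def[abs_def] by (intro holomorphic_intros holomorphic_on_subset[OF E_holomorphic]) auto
  qed
  ultimately show ?thesis
    unfolding hecke_pair_def gamma_pair_def
    using abscissa_bounds(2)[OF assms] d.abscissa_bounds(2)[OF m] \<Lambda>_decay by (auto intro!: exI[of _ \<Lambda>])
qed

lemma class_A:
  assumes "a (Suc n) \<noteq> 0"
  shows "class_A lam a"
  unfolding class_A_def
proof (intro exI conjI)
  show "hecke_pair 1 lam a mu b" by (rule hecke_pair[OF assms])
  show "continues_except_simple_pole lam a (of_real 1) Z" using Z_continues by simp
  show "continues_except_simple_pole mu b (of_real 1) d.Z" using d.Z_continues by simp
qed

lemma functional_equation:
  assumes "s \<notin> \<int>"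
  shows "Gamma s * Z s = Gamma (1 - s) * hecke_theta.Z mu lam b a b0 a0 (1 - s)"
proof -
  have "s \<notin> \<int>\<^sub>\<le>\<^sub>0" using assms nonpos_Ints_subset_Ints by blast
  moreover have "1 - s \<notin> \<int>\<^sub>\<le>\<^sub>0"
  proof
    assume "1 - s \<in> \<int>\<^sub>\<le>\<^sub>0"
    then have "1 - (1 - s) \<in> \<int>" using nonpos_Ints_subset_Ints by (intro Ints_diff) auto
    then show False using assms by simp
  qed
  ultimately show ?thesis using Gamma_Z[of s] d.Gamma_Z[of "1 - s"] \<Lambda>_dual[of s] by simp
qed

end

subsection \<open>The Epstein zeta function\<close>

lemma frequencies_square:
  assumes "frequencies lam"
  shows "frequencies (\<lambda>n. (lam n)\<^sup>2)"
proof -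
  have "strict_mono_on {1..} (\<lambda>n. (lam n)\<^sup>2)"
  proof (rule strict_mono_onI)
    fix m n :: nat assume "m \<in> {1..}" "n \<in> {1..}" "m < n"
    then have "0 < lam m" "lam m < lam n" using assms by (auto simp: frequencies_def strict_mono_on_def)
    then show "(lam m)\<^sup>2 < (lam n)\<^sup>2" by (intro power_strict_mono) auto
  qed
  moreover have "filterlim (\<lambda>n. (lam n)\<^sup>2) at_top sequentially"
    using assms by (intro filterlim_pow_at_top) (auto simp: frequencies_def)
  moreover have "\<forall>n\<ge>1. 0 < (lam n)\<^sup>2" using assms by (fastforce simp: frequencies_def)
  ultimately show ?thesis by (simp add: frequencies_def)
qed

lemma frequencies_scale:
  assumes "frequencies lam" "k > 0"
  shows "frequencies (\<lambda>n. k * lam n)"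
proof -
  have "filterlim (\<lambda>n. k * lam n) at_top sequentially"
    by (rule filterlim_tendsto_pos_mult_at_top[OF tendsto_const assms(2)]) (use assms(1) in \<open>simp add: frequencies_def\<close>)
  moreover have "strict_mono_on {1..} (\<lambda>n. k * lam n)"
    using assms by (auto simp: frequencies_def strict_mono_on_def)
  ultimately show ?thesis using assms by (simp add: frequencies_def)
qed

text \<open>Passing to squared frequencies halves the exponent, and the weight
  \<open>lam n ^ \<delta>\<close> shifts it by \<delta> beforehand.\<close>

lemma summable_square_weight:
  assumes fr: "frequencies lam" and sm: "summable (\<lambda>n. norm (a (Suc n)) * lam (Suc n) powr (- \<sigma>))"
  shows "summable (\<lambda>n. norm (a (Suc n) * complex_of_real (lam (Suc n) ^ \<delta>)) * ((lam (Suc n))\<^sup>2) powr (- ((\<sigma> + real \<delta>) / 2)))"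
proof -
  have "norm (a (Suc n) * complex_of_real (lam (Suc n) ^ \<delta>)) * ((lam (Suc n))\<^sup>2) powr (- ((\<sigma> + real \<delta>) / 2)) = norm (a (Suc n)) * lam (Suc n) powr (- \<sigma>)" for n
  proof -
    have l: "lam (Suc n) > 0" by (rule frequencies_pos[OF fr])
    have "(lam (Suc n))\<^sup>2 = lam (Suc n) powr 2" using l by (simp add: powr_numeral)
    moreover have "2 * (- (x / 2)) = - x" for x :: real by simp
    ultimately have "((lam (Suc n))\<^sup>2) powr (- ((\<sigma> + real \<delta>) / 2)) = lam (Suc n) powr (- (\<sigma> + real \<delta>))"
      by (simp only: powr_powr)
    moreover have "lam (Suc n) ^ \<delta> = lam (Suc n) powr real \<delta>" using l by (simp add: powr_realpow)
    moreover have "lam (Suc n) powr real \<delta> * lam (Suc n) powr (- (\<sigma> + real \<delta>)) = lam (Suc n) powr (- \<sigma>)"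
      unfolding powr_add[symmetric] by simp
    ultimately show ?thesis using l by (simp add: norm_mult mult.assoc)
  qed
  then show ?thesis using sm by simp
qed

text \<open>In \<open>t = y\<^sup>2\<close> the theta relation has weight
  \<open>1/2 + \<delta>\<close> and squared frequencies, and an exponent \<open>q\<close> of
  absolute convergence becomes \<open>(q + \<delta>) / 2\<close>. The condition of the decay
  argument, twice this exponent below the weight, reads \<open>q < 1/2\<close>.\<close>

lemma class_B_abscissa_ge:
  assumes B: "class_B \<delta> lam a mu b \<Phi> \<Psi>"
  shows "ereal (1/2) \<le> abs_abscissa lam a"
proof (rule ccontr)
  assume "\<not> ereal (1/2) \<le> abs_abscissa lam a"
  then have "abs_abscissa lam a < ereal (1/2)" by simp
  then obtain q0 where q0: "abs_abscissa lam a < ereal q0" "ereal q0 < ereal (1/2)"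
    using ereal_dense2 by blast
  define q where "q = max q0 0"
  have q: "0 \<le> q" "q < 1/2" using q0 by (auto simp: q_def)
  note Bs = class_B_sym[OF B]
  note fa = class_B_dirichlet_data(2)[OF B] and fb = class_B_dirichlet_data(2)[OF Bs]
  have sa: "summable (\<lambda>n. norm (a (Suc n)) * lam (Suc n) powr (- q))"
    by (rule summable_dirichlet_mono[OF fa summable_of_abs_abscissa_less[OF fa q0(1)]]) (simp add: q_def)
  obtain \<tau> where sb: "summable (\<lambda>n. norm (b (Suc n)) * mu (Suc n) powr (- \<tau>))"
    using class_B_abscissa_real[OF Bs] by blast
  define A where "A n = a n * complex_of_real (lam n ^ \<delta>)" for n
  define C where "C n = b n * complex_of_real (mu n ^ \<delta>)" for n
  define L where "L n = (lam n)\<^sup>2" for n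
  define M where "M n = (mu n)\<^sup>2" for n
  have "C (Suc n) = 0" for n
  proof (rule theta_coeff_zero[where p = "1/2 + real \<delta>" and lam = L and mu = M and a = A and b = C
        and q = "(q + real \<delta>) / 2" and \<tau> = "(\<tau> + real \<delta>) / 2" and ?a0.0 = "- \<Phi> (- of_nat \<delta>)" and ?b0.0 = "- \<Psi> (- of_nat \<delta>)"])
    show "frequencies L" "frequencies M" unfolding L_def M_def using fa fb by (auto intro: frequencies_square)
    show "summable (\<lambda>n. norm (A (Suc n)) * L (Suc n) powr (- ((q + real \<delta>) / 2)))"
      unfolding A_def L_def by (rule summable_square_weight[OF fa sa])
    show "summable (\<lambda>n. norm (C (Suc n)) * M (Suc n) powr (- ((\<tau> + real \<delta>) / 2)))"
      unfolding C_def M_def by (rule summable_square_weight[OF fb sb])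
    show "0 \<le> (q + real \<delta>) / 2" "2 * ((q + real \<delta>) / 2) < 1/2 + real \<delta>" using q by auto
    fix t :: real assume t: "t > 0"
    have st: "sqrt t > 0" "(sqrt t)\<^sup>2 = t" "(1 / sqrt t)\<^sup>2 = 1 / t" using t by (simp_all add: power_divide)
    have ta: "(\<Sum>n. a (Suc n) * complex_of_real (lam (Suc n) ^ \<delta> * exp (- (lam (Suc n))\<^sup>2 * t))) = dirichlet_theta L A (of_real t)"
      by (simp add: dirichlet_theta_def A_def L_def exp_of_real[symmetric] mult.assoc)
    have tb: "(\<Sum>n. b (Suc n) * complex_of_real (mu (Suc n) ^ \<delta> * exp (- (mu (Suc n))\<^sup>2 * (1 / t)))) = dirichlet_theta M C (of_real (1 / t))"
      by (simp add: dirichlet_theta_def C_def M_def exp_of_real[symmetric] mult.assoc)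
    note rel = class_B_theta[OF B st(1), unfolded st(2,3) ta tb]
    consider "\<delta> = 0" | "\<delta> = 1" using class_B_holomorphic(4)[OF B] by blast
    then show "- \<Phi> (- of_nat \<delta>) + dirichlet_theta L A (of_real t) = of_real (t powr (- (1/2 + real \<delta>))) * (- \<Psi> (- of_nat \<delta>) + dirichlet_theta M C (of_real (1 / t)))"
    proof cases
      case 1
      have pw: "t powr (- (1/2)) = 1 / sqrt t"
        unfolding powr_minus powr_half_sqrt[OF less_imp_le[OF t]] by (rule inverse_eq_divide)
      have *: "- P + X = (- Q + Y) / r" if "- 2 * P + 2 * X = (- 2 * Q + 2 * Y) / r" for P Q X Y r :: complex
      proof -
        have "2 * (- P + X) = 2 * ((- Q + Y) / r)"
          using that by (simp only: distrib_left mult_minus_left mult_minus_right times_divide_eq_right)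
        then show ?thesis unfolding mult_cancel_left by auto
      qed
      have pw': "t powr (- (1/2 + real \<delta>)) = 1 / sqrt t" using pw by (simp only: 1 of_nat_0 add_0_right)
      have "- \<Phi> (- of_nat \<delta>) + dirichlet_theta L A (of_real t) = (- \<Psi> (- of_nat \<delta>) + dirichlet_theta M C (of_real (1 / t))) / of_real (sqrt t)"
        by (rule *) (use rel 1 in simp)
      then show ?thesis unfolding pw' by (simp only: of_real_divide of_real_1 times_divide_eq_left mult_1_left)
    next
      case 2
      have z: "\<Phi> (- 1) = 0" "\<Psi> (- 1) = 0" using class_B_odd_zero B Bs 2 by blast+
      have "t powr (- (1/2 + 1)) = t powr - 1 * t powr (- (1/2))" unfolding powr_add[symmetric] by simp
      also have "\<dots> = 1 / (t * sqrt t)"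
        unfolding powr_minus powr_half_sqrt[OF less_imp_le[OF t]] powr_one[OF less_imp_le[OF t]]
        by (simp only: inverse_eq_divide times_divide_times_eq mult_1_left)
      finally have pw: "t powr (- (1/2 + 1)) = 1 / (t * sqrt t)" .
      let ?X = "dirichlet_theta L A (of_real t)" and ?Y = "dirichlet_theta M C (of_real (1 / t))" and ?r = "complex_of_real (sqrt t)"
      have r: "?r \<noteq> 0" "complex_of_real t = ?r * ?r" using t st(2) by (auto simp flip: of_real_mult)
      have "2 * ?r * ?X = 2 * (1 / ?r) * ?Y / ?r" using rel 2 z by simp
      then have "?X = ?Y / (?r * ?r * ?r)" using r(1) by (simp add: field_simps)
      moreover have "complex_of_real (1 / (t * sqrt t)) = 1 / (?r * ?r * ?r)"
        by (simp only: of_real_divide of_real_mult of_real_1 r(2))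
      moreover have "t powr (- (1/2 + real \<delta>)) = 1 / (t * sqrt t)" using pw by (simp only: 2 of_nat_1)
      moreover have "\<Phi> (- of_nat \<delta>) = 0" "\<Psi> (- of_nat \<delta>) = 0" using z 2 by simp_all
      ultimately show ?thesis by (simp only: minus_zero add_0_left times_divide_eq_left mult_1_left)
    qed
  qed
  note C_zero = this
  have "b (Suc n) = 0" for n using C_zero[of n] frequencies_pos[OF fb, of n] by (simp add: C_def)
  moreover obtain n where "n \<ge> 1" "b n \<noteq> 0"
    using class_B_dirichlet_data(1)[OF Bs] by (auto simp: dirichlet_data_def)
  ultimately show False by (cases n) auto
qed

text \<open>\<open>\<Phi>\<close> agrees with the entire continuation off 1, so its singularity
  there is removable. The value of \<open>\<Phi>\<close> at 1 is arbitrary for even parity, hence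
  the conclusion is about the residue.\<close>

lemma class_B_residue_0:
  assumes B: "class_B 0 lam a mu b \<Phi> \<Psi>" and G: "continues_to lam a UNIV G"
  shows "residue \<Phi> 1 = 0"
proof -
  obtain \<sigma> where sm: "summable (\<lambda>n. norm (a (Suc n)) * lam (Suc n) powr (- \<sigma>))"
    using class_B_abscissa_real[OF B] by blast
  have le: "abs_abscissa lam a \<le> ereal \<sigma>" by (rule abs_abscissa_le[OF sm])
  have holG: "G holomorphic_on UNIV" using G by (simp add: continues_to_def)
  have "\<Phi> z = G z" if "z \<noteq> 1" for z
  proof (rule analytic_continuation_open[where s = "{s. Re s > max 1 \<sigma>}" and s' = "- {1}" and f = \<Phi> and g = G and z = z])
    show "open {s. Re s > max 1 \<sigma>}" by (rule open_halfspace_Re_gt)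
    show "open (- {1 :: complex})" by auto
    show "connected (- {1 :: complex})" by (rule connected_punctured_universe) simp
    show "{s. Re s > max 1 \<sigma>} \<noteq> {}" by (auto intro!: exI[of _ "of_real (max 1 \<sigma> + 1)"])
    show "\<Phi> holomorphic_on - {1}" by (rule class_B_holomorphic(1)[OF B])
    show "G holomorphic_on - {1}" by (rule holomorphic_on_subset[OF holG]) simp
    show "\<Phi> w = G w" if "w \<in> {s. Re s > max 1 \<sigma>}" for w
    proof -
      have w: "abs_abscissa lam a < ereal (Re w)" "w \<noteq> 1" using that le by (auto intro: le_less_trans)
      have "G w = dirichlet_series lam a w" using G w(1) by (simp add: continues_to_def)
      then show ?thesis using class_B_holomorphic(3)[OF B w(1,2)] by simp
    qed
  qed (use that in auto)
  then have "residue \<Phi> 1 = residue G 1"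
    by (intro residue_cong) (auto intro!: eventually_mono[OF eventually_neq_at_within[of 1]])
  also have "\<dots> = 0" by (rule residue_holo[of UNIV]) (use holG in auto)
  finally show ?thesis .
qed

lemma (in hecke_theta) Z_meromorphic: "Z meromorphic_on UNIV"
proof -
  have "(\<lambda>s. rGamma s * E s - a0 * rGamma (s + 1)) holomorphic_on UNIV" "(\<lambda>s. b0 * rGamma s) holomorphic_on UNIV"
    by (intro holomorphic_intros holomorphic_on_subset[OF E_holomorphic]; simp)+
  then have m: "(\<lambda>s. rGamma s * E s - a0 * rGamma (s + 1)) meromorphic_on UNIV" "(\<lambda>s. b0 * rGamma s) meromorphic_on UNIV"
    by (auto intro!: analytic_on_imp_meromorphic_on simp: analytic_on_open)
  have "(\<lambda>s. s - 1) meromorphic_on UNIV" by (intro meromorphic_intros)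
  then show ?thesis unfolding Z_def[abs_def] by (intro meromorphic_on_add[OF m(1)] meromorphic_on_divide[OF m(2)])
qed

section \<open>The Epstein zeta function as a single Dirichlet series\<close>

lemma epstein_dirichlet_series:
  fixes \<delta> :: nat and \<Phi>1 \<Phi>2 :: "complex \<Rightarrow> complex"
  assumes pos: "a > 0" "c > 0" "4 * a * c - b\<^sup>2 > 0"
    and fr: "frequencies lam1" "frequencies lam2"
    and nu: "frequencies \<nu>" "\<nu> ` {1..} = epstein_values a b c (ext_freq lam1) (ext_freq lam2)"
    and s1: "summable (\<lambda>n. norm (a1 (Suc n)) * lam1 (Suc n) powr (- Re s))"
    and s2: "summable (\<lambda>n. norm (a2 (Suc n)) * lam2 (Suc n) powr (- Re s))" and s0: "Re s \<ge> 0"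
  defines "A \<equiv> \<lambda>n. epstein_coeff a b c (ext_coeff \<delta> \<Phi>1 a1) (ext_coeff \<delta> \<Phi>2 a2) (ext_freq lam1) (ext_freq lam2) (\<nu> n)"
  shows "summable (\<lambda>n. norm (A (Suc n)) * \<nu> (Suc n) powr (- Re s))"
    and "dirichlet_series \<nu> A s = epstein_zeta a b c (ext_coeff \<delta> \<Phi>1 a1) (ext_coeff \<delta> \<Phi>2 a2) (ext_freq lam1) (ext_freq lam2) s"
proof -
  let ?q = "\<lambda>m n. qform a b c (ext_freq lam1 m) (ext_freq lam2 n)"
  let ?A1 = "ext_coeff \<delta> \<Phi>1 a1" and ?A2 = "ext_coeff \<delta> \<Phi>2 a2"
  note low = qform_lower_bound[OF pos(1,2), of b]
  define h where "h v = complex_of_real v powr (- s)" for v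
  have et: "epstein_term a b c ?A1 ?A2 (ext_freq lam1) (ext_freq lam2) s = (\<lambda>(m, n). ?A1 m * ?A2 n * h (?q m n))"
    by (auto simp: epstein_term_def h_def fun_eq_iff powr_minus divide_inverse)
  have "(\<lambda>p. norm (epstein_term a b c ?A1 ?A2 (ext_freq lam1) (ext_freq lam2) s p)) summable_on (UNIV - {(0, 0)})"
    by (rule epstein_term_summable[OF pos fr low s1 s2 s0])
  then have sm: "(\<lambda>(m, n). norm (?A1 m * ?A2 n * h (?q m n))) summable_on (UNIV - {(0, 0)})"
    unfolding et by (simp add: case_prod_unfold)
  note g = epstein_grouping[OF pos fr low nu sm]
  have "norm (A (Suc n) * h (\<nu> (Suc n))) = norm (A (Suc n)) * \<nu> (Suc n) powr (- Re s)" for n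
    using frequencies_pos[OF nu(1), of n] by (simp add: h_def norm_mult norm_powr_real_powr)
  then show "summable (\<lambda>n. norm (A (Suc n)) * \<nu> (Suc n) powr (- Re s))"
    using g(2) by (simp add: A_def)
  show "dirichlet_series \<nu> A s = epstein_zeta a b c ?A1 ?A2 (ext_freq lam1) (ext_freq lam2) s"
    using sums_unique[OF g(1)] unfolding dirichlet_series_def epstein_zeta_def et A_def h_def by simp
qed

text \<open>The estimate of the terms requires a nonnegative real part, which holds to the right of
  the abscissas since these are at least 1/2. The room left by the strict inequality places the
  abscissa of the grouped series strictly below \<open>Re s\<close>.\<close>

lemma epstein_abscissa:
  assumes B1: "class_B \<delta> lam1 a1 mu1 b1 \<Phi>1 \<Psi>1" and B2: "class_B \<delta> lam2 a2 mu2 b2 \<Phi>2 \<Psi>2"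
    and pos: "a > 0" "c > 0" "4 * a * c - b\<^sup>2 > 0"
    and nu: "frequencies \<nu>" "\<nu> ` {1..} = epstein_values a b c (ext_freq lam1) (ext_freq lam2)"
    and s: "max (abs_abscissa lam1 a1) (abs_abscissa lam2 a2) < ereal (Re s)"
  defines "A \<equiv> \<lambda>n. epstein_coeff a b c (ext_coeff \<delta> \<Phi>1 a1) (ext_coeff \<delta> \<Phi>2 a2) (ext_freq lam1) (ext_freq lam2) (\<nu> n)"
  shows "\<exists>q<Re s. summable (\<lambda>n. norm (A (Suc n)) * \<nu> (Suc n) powr (- q))"
    and "dirichlet_series \<nu> A s = epstein_zeta a b c (ext_coeff \<delta> \<Phi>1 a1) (ext_coeff \<delta> \<Phi>2 a2) (ext_freq lam1) (ext_freq lam2) s"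
    and "(\<lambda>p. norm (epstein_term a b c (ext_coeff \<delta> \<Phi>1 a1) (ext_coeff \<delta> \<Phi>2 a2) (ext_freq lam1) (ext_freq lam2) s p)) summable_on (UNIV - {(0, 0)})"
proof -
  note fr = class_B_dirichlet_data(2)[OF B1] class_B_dirichlet_data(2)[OF B2]
  have ser: "summable (\<lambda>n. norm (a1 (Suc n)) * lam1 (Suc n) powr (- r))"
    "summable (\<lambda>n. norm (a2 (Suc n)) * lam2 (Suc n) powr (- r))" "r \<ge> 0"
    if "max (abs_abscissa lam1 a1) (abs_abscissa lam2 a2) < ereal r" for r
  proof -
    show "summable (\<lambda>n. norm (a1 (Suc n)) * lam1 (Suc n) powr (- r))"
      "summable (\<lambda>n. norm (a2 (Suc n)) * lam2 (Suc n) powr (- r))"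
      using that by (auto intro: summable_of_abs_abscissa_less fr)
    have "ereal (1/2) < ereal r" using le_less_trans[OF class_B_abscissa_ge[OF B1], of "ereal r"] that by simp
    then show "r \<ge> 0" by simp
  qed
  obtain q where q: "max (abs_abscissa lam1 a1) (abs_abscissa lam2 a2) < ereal q" "ereal q < ereal (Re s)"
    using ereal_dense2[OF s] by blast
  have "summable (\<lambda>n. norm (A (Suc n)) * \<nu> (Suc n) powr (- Re (of_real q)))"
    unfolding A_def by (rule epstein_dirichlet_series(1)[OF pos fr nu]) (use ser[OF q(1)] in simp_all)
  then show "\<exists>q<Re s. summable (\<lambda>n. norm (A (Suc n)) * \<nu> (Suc n) powr (- q))" using q(2) by auto
  show "dirichlet_series \<nu> A s = epstein_zeta a b c (ext_coeff \<delta> \<Phi>1 a1) (ext_coeff \<delta> \<Phi>2 a2) (ext_freq lam1) (ext_freq lam2) s"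
    unfolding A_def by (rule epstein_dirichlet_series(2)[OF pos fr nu ser[OF s]])
  show "(\<lambda>p. norm (epstein_term a b c (ext_coeff \<delta> \<Phi>1 a1) (ext_coeff \<delta> \<Phi>2 a2) (ext_freq lam1) (ext_freq lam2) s p)) summable_on (UNIV - {(0, 0)})"
    by (rule epstein_term_summable[OF pos fr qform_lower_bound[OF pos(1,2)] ser[OF s]])
qed

text \<open>The index \<open>(0, 0)\<close>, which is excluded from the zeta function, contributes
  the constant of the theta function.\<close>

lemma epstein_theta:
  assumes B1: "class_B \<delta> lam1 a1 mu1 b1 \<Phi>1 \<Psi>1" and B2: "class_B \<delta> lam2 a2 mu2 b2 \<Phi>2 \<Psi>2"
    and pos: "a > 0" "c > 0" "4 * a * c - b\<^sup>2 > 0"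
    and nu: "frequencies \<nu>" "\<nu> ` {1..} = epstein_values a b c (ext_freq lam1) (ext_freq lam2)" and t: "t > 0"
  defines "A1 \<equiv> ext_coeff \<delta> \<Phi>1 a1" and "A2 \<equiv> ext_coeff \<delta> \<Phi>2 a2"
  defines "A \<equiv> \<lambda>n. epstein_coeff a b c A1 A2 (ext_freq lam1) (ext_freq lam2) (\<nu> n)"
  shows "infsum (\<lambda>(m, n). A1 m * A2 n * exp (- of_real (t * qform a b c (ext_freq lam1 m) (ext_freq lam2 n)))) UNIV
     = A1 0 * A2 0 + dirichlet_theta \<nu> A (of_real t)"
proof -
  note fr = class_B_dirichlet_data(2)[OF B1] class_B_dirichlet_data(2)[OF B2]
  let ?q = "\<lambda>m n. qform a b c (ext_freq lam1 m) (ext_freq lam2 n)"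
  define h where "h v = exp (- complex_of_real (t * v))" for v
  let ?F = "\<lambda>(m, n). A1 m * A2 n * h (?q m n)"
  have sU: "(\<lambda>(m, n). norm (A1 m * A2 n * h (?q m n))) summable_on UNIV"
    unfolding A1_def A2_def h_def by (rule summable_double_theta[OF B1 B2 pos t])
  then have sm: "(\<lambda>(m, n). norm (A1 m * A2 n * h (?q m n))) summable_on (UNIV - {(0, 0)})"
    by (rule summable_on_subset_banach) simp
  have "(\<lambda>p. norm (?F p)) summable_on (UNIV - {(0, 0)})" using sm by (simp add: case_prod_unfold)
  then have sF: "?F summable_on (UNIV - {(0, 0)})" by (rule Infinite_Sum.abs_summable_summable)
  have "infsum ?F ({(0, 0)} \<union> (UNIV - {(0, 0)})) = infsum ?F {(0, 0)} + infsum ?F (UNIV - {(0, 0)})"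
    by (rule infsum_Un_disjoint[OF _ sF]) auto
  moreover have "infsum ?F {(0, 0)} = A1 0 * A2 0" by (simp add: h_def qform_def)
  moreover have "infsum ?F (UNIV - {(0, 0)}) = dirichlet_theta \<nu> A (of_real t)"
    using sums_unique[OF epstein_grouping(1)[OF pos fr qform_lower_bound[OF pos(1,2)] nu sm]]
    by (simp add: dirichlet_theta_def A_def h_def mult.commute)
  ultimately show ?thesis by (simp add: h_def insert_absorb)
qed

lemma dirichlet_series_scale:
  assumes fr: "frequencies \<nu>" and k: "k > 0"
    and sm: "summable (\<lambda>n. norm (B (Suc n)) * \<nu> (Suc n) powr (- \<sigma>))" and s: "\<sigma> \<le> Re s"
  shows "dirichlet_series (\<lambda>n. k * \<nu> n) (\<lambda>n. e * B n) s = e * of_real k powr (- s) * dirichlet_series \<nu> B s"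
proof -
  have "e * B (Suc n) * of_real (k * \<nu> (Suc n)) powr (- s) = (e * of_real k powr (- s)) * (B (Suc n) * of_real (\<nu> (Suc n)) powr (- s))" for n
    using k frequencies_pos[OF fr, of n] by (simp add: powr_times_real)
  then show ?thesis
    unfolding dirichlet_series_def
    by (simp only: suminf_mult[OF summable_norm_cancel[OF summable_dirichlet_series[OF fr sm s]]])
qed

lemma summable_dirichlet_scale:
  fixes e :: complex
  assumes fr: "frequencies \<nu>" and k: "k > 0"
    and sm: "summable (\<lambda>n. norm (B (Suc n)) * \<nu> (Suc n) powr (- \<sigma>))"
  shows "summable (\<lambda>n. norm (e * B (Suc n)) * (k * \<nu> (Suc n)) powr (- \<sigma>))"
proof -
  have "norm (e * B (Suc n)) * (k * \<nu> (Suc n)) powr (- \<sigma>) = (norm e * k powr (- \<sigma>)) * (norm (B (Suc n)) * \<nu> (Suc n) powr (- \<sigma>))" for n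
    by (simp add: norm_mult powr_mult)
  then show ?thesis using summable_mult[OF sm] by simp
qed

lemma dirichlet_theta_scale:
  assumes fr: "frequencies \<nu>" and k: "k > 0" and t: "t > 0"
    and sm: "summable (\<lambda>n. norm (B (Suc n)) * \<nu> (Suc n) powr (- \<sigma>))"
  shows "dirichlet_theta (\<lambda>n. k * \<nu> n) (\<lambda>n. e * B n) (of_real t) = e * dirichlet_theta \<nu> B (of_real (k * t))"
proof -
  have kt: "k * t > 0" using k t by simp
  have "summable (\<lambda>n. B (Suc n) * exp (- of_real (\<nu> (Suc n)) * of_real (k * t)))"
  proof (rule summable_norm_cancel, rule summable_comparison_test'[OF summable_dirichlet_exp(1)[OF fr sm kt]])
    show "norm (norm (B (Suc n) * exp (- of_real (\<nu> (Suc n)) * of_real (k * t)))) \<le> norm (B (Suc n)) * exp (- (k * t) * \<nu> (Suc n))" for n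
      using norm_theta_term_le[OF fr, of "k * t" "of_real (k * t)" B n] by simp
  qed
  from suminf_mult[OF this, of e] show ?thesis by (simp add: dirichlet_theta_def mult_ac)
qed

lemma class_B_right_of_abscissas:
  assumes B1: "class_B \<delta> lam1 a1 mu1 b1 \<Phi>1 \<Psi>1" and B2: "class_B \<delta> lam2 a2 mu2 b2 \<Phi>2 \<Psi>2"
  shows "\<exists>r. max (abs_abscissa lam1 a1) (abs_abscissa lam2 a2) < ereal r"
proof -
  obtain \<sigma> where 1: "summable (\<lambda>n. norm (a1 (Suc n)) * lam1 (Suc n) powr (- \<sigma>))"
    using class_B_abscissa_real[OF B1] by blast
  obtain \<tau> where 2: "summable (\<lambda>n. norm (a2 (Suc n)) * lam2 (Suc n) powr (- \<tau>))"
    using class_B_abscissa_real[OF B2] by blast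
  have "abs_abscissa lam1 a1 < ereal (max \<sigma> \<tau> + 1)" "abs_abscissa lam2 a2 < ereal (max \<sigma> \<tau> + 1)"
    by (rule le_less_trans[OF abs_abscissa_le[OF 1]], simp, rule le_less_trans[OF abs_abscissa_le[OF 2]], simp)
  then show ?thesis by (intro exI[of _ "max \<sigma> \<tau> + 1"]) simp
qed

text \<open>The double theta relation involves \<open>4 / (D * t)\<close> and the factor
  \<open>2 / (sqrt D * t)\<close>. Scaling the dual frequencies by \<open>4 / D\<close> and the dual
  coefficients by \<open>e\<close> brings it to the normalised form in \<open>t\<close> and
  \<open>1 / t\<close>.\<close>

lemma epstein_hecke_theta:
  assumes B1: "class_B \<delta> lam1 a1 mu1 b1 \<Phi>1 \<Psi>1" and B2: "class_B \<delta> lam2 a2 mu2 b2 \<Phi>2 \<Psi>2"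
    and pos: "a > 0" "c > 0" "4 * a * c - b\<^sup>2 > 0"
    and nu: "frequencies \<nu>" "\<nu> ` {1..} = epstein_values a b c (ext_freq lam1) (ext_freq lam2)"
    and nu': "frequencies \<nu>'" "\<nu>' ` {1..} = epstein_values c (- b) a (ext_freq mu1) (ext_freq mu2)"
  defines "D \<equiv> 4 * a * c - b\<^sup>2"
  defines "e \<equiv> (- 1) ^ \<delta> * complex_of_real (2 / sqrt D)"
  defines "A \<equiv> \<lambda>n. epstein_coeff a b c (ext_coeff \<delta> \<Phi>1 a1) (ext_coeff \<delta> \<Phi>2 a2) (ext_freq lam1) (ext_freq lam2) (\<nu> n)"
    and "B \<equiv> \<lambda>n. epstein_coeff c (- b) a (ext_coeff \<delta> \<Psi>1 b1) (ext_coeff \<delta> \<Psi>2 b2) (ext_freq mu1) (ext_freq mu2) (\<nu>' n)"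
  shows "\<exists>\<sigma> \<tau>. hecke_theta \<nu> (\<lambda>n. 4 / D * \<nu>' n) A (\<lambda>n. e * B n)
    (ext_coeff \<delta> \<Phi>1 a1 0 * ext_coeff \<delta> \<Phi>2 a2 0) (e * (ext_coeff \<delta> \<Psi>1 b1 0 * ext_coeff \<delta> \<Psi>2 b2 0)) \<sigma> \<tau>"
proof -
  note Bs = class_B_sym[OF B1] class_B_sym[OF B2]
  have D: "D > 0" using pos(3) by (simp add: D_def)
  have k: "4 / D > 0" using D by simp
  have pos': "c > 0" "a > 0" "4 * c * a - (- b)\<^sup>2 > 0" using pos by (simp_all add: mult.commute mult.left_commute)
  obtain r where r: "max (abs_abscissa lam1 a1) (abs_abscissa lam2 a2) < ereal (Re (of_real r))"
    using class_B_right_of_abscissas[OF B1 B2] by auto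
  obtain \<sigma> where sA: "summable (\<lambda>n. norm (A (Suc n)) * \<nu> (Suc n) powr (- \<sigma>))"
    using epstein_abscissa(1)[OF B1 B2 pos nu r] unfolding A_def by blast
  obtain r' where r': "max (abs_abscissa mu1 b1) (abs_abscissa mu2 b2) < ereal (Re (of_real r'))"
    using class_B_right_of_abscissas[OF Bs] by auto
  obtain \<tau> where sB: "summable (\<lambda>n. norm (B (Suc n)) * \<nu>' (Suc n) powr (- \<tau>))"
    using epstein_abscissa(1)[OF Bs pos' nu' r'] unfolding B_def by blast
  have "hecke_theta \<nu> (\<lambda>n. 4 / D * \<nu>' n) A (\<lambda>n. e * B n)
    (ext_coeff \<delta> \<Phi>1 a1 0 * ext_coeff \<delta> \<Phi>2 a2 0) (e * (ext_coeff \<delta> \<Psi>1 b1 0 * ext_coeff \<delta> \<Psi>2 b2 0)) \<sigma> \<tau>"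
  proof
    show "frequencies \<nu>" by (rule nu(1))
    show "frequencies (\<lambda>n. 4 / D * \<nu>' n)" by (rule frequencies_scale[OF nu'(1) k])
    show "summable (\<lambda>n. norm (A (Suc n)) * \<nu> (Suc n) powr (- \<sigma>))" by (rule sA)
    show "summable (\<lambda>n. norm (e * B (Suc n)) * (4 / D * \<nu>' (Suc n)) powr (- \<tau>))"
      by (rule summable_dirichlet_scale[OF nu'(1) k sB])
    fix t :: real assume t: "t > 0"
    have it: "1 / t > 0" "4 / (D * t) > 0" using t D by simp_all
    have "dirichlet_theta (\<lambda>n. 4 / D * \<nu>' n) (\<lambda>n. e * B n) (of_real (1 / t)) = e * dirichlet_theta \<nu>' B (of_real (4 / D * (1 / t)))"
      by (rule dirichlet_theta_scale[OF nu'(1) k it(1) sB])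
    also have "4 / D * (1 / t) = 4 / (D * t)" by simp
    finally have th: "dirichlet_theta (\<lambda>n. 4 / D * \<nu>' n) (\<lambda>n. e * B n) (of_real (1 / t)) = e * dirichlet_theta \<nu>' B (of_real (4 / (D * t)))" .
    have "ext_coeff \<delta> \<Phi>1 a1 0 * ext_coeff \<delta> \<Phi>2 a2 0 + dirichlet_theta \<nu> A (of_real t)
        = (- 1) ^ \<delta> * of_real (2 / (sqrt D * t)) * (ext_coeff \<delta> \<Psi>1 b1 0 * ext_coeff \<delta> \<Psi>2 b2 0 + dirichlet_theta \<nu>' B (of_real (4 / (D * t))))"
      unfolding A_def B_def D_def
      unfolding epstein_theta[OF B1 B2 pos nu t, symmetric] epstein_theta[OF Bs pos' nu' it(2)[unfolded D_def], symmetric]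
      by (rule double_theta[OF B1 B2 pos t])
    also have "(- 1) ^ \<delta> * complex_of_real (2 / (sqrt D * t)) = of_real (1 / t) * e" by (simp add: e_def mult_ac)
    finally show "ext_coeff \<delta> \<Phi>1 a1 0 * ext_coeff \<delta> \<Phi>2 a2 0 + dirichlet_theta \<nu> A (of_real t)
        = of_real (1 / t) * (e * (ext_coeff \<delta> \<Psi>1 b1 0 * ext_coeff \<delta> \<Psi>2 b2 0) + dirichlet_theta (\<lambda>n. 4 / D * \<nu>' n) (\<lambda>n. e * B n) (of_real (1 / t)))"
      unfolding th by (simp only: distrib_left mult.assoc)
  qed
  then show ?thesis by blast
qed

theorem corollary3p1:
  fixes a b c d :: real and \<delta> :: nat
    and lam1 lam2 mu1 mu2 :: "nat \<Rightarrow> real"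
    and a1 a2 b1 b2 :: "nat \<Rightarrow> complex"
    and \<Phi>1 \<Phi>2 \<Psi>1 \<Psi>2 :: "complex \<Rightarrow> complex"
  assumes pos_def: "\<And>x y. (x, y) \<noteq> (0, 0) \<Longrightarrow> qform a b c x y > 0"
    and discr: "d = b\<^sup>2 - 4 * a * c"
    and parity: "\<delta> \<in> {0, 1}"
    and B1: "class_B \<delta> lam1 a1 mu1 b1 \<Phi>1 \<Psi>1"
    and B2: "class_B \<delta> lam2 a2 mu2 b2 \<Phi>2 \<Psi>2"
  shows
    "\<exists>Z Z'.
       epstein_continuation a b c
         (ext_coeff \<delta> \<Phi>1 a1) (ext_coeff \<delta> \<Phi>2 a2) (ext_freq lam1) (ext_freq lam2)
         (max (abs_abscissa lam1 a1) (abs_abscissa lam2 a2)) Z \<and>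
       epstein_continuation c (- b) a
         (ext_coeff \<delta> \<Psi>1 b1) (ext_coeff \<delta> \<Psi>2 b2) (ext_freq mu1) (ext_freq mu2)
         (max (abs_abscissa mu1 b1) (abs_abscissa mu2 b2)) Z' \<and>
       (\<delta> = 0 \<longrightarrow>
          residue Z 1 = 2 * of_real pi * residue \<Phi>1 1 * residue \<Phi>2 1 / of_real (sqrt \<bar>d\<bar>) \<and>
          (residue \<Phi>1 1 * residue \<Phi>2 1 \<noteq> 0 \<longrightarrow> is_pole Z 1 \<and> zorder Z 1 = - 1) \<and>
          ((\<exists>G. continues_to lam1 a1 UNIV G) \<or> (\<exists>G. continues_to lam2 a2 UNIV G) \<longrightarrow>
             Z holomorphic_on UNIV)) \<and>
       (\<delta> = 1 \<longrightarrow> Z holomorphic_on UNIV) \<and>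
       (\<exists>\<nu> A. frequencies \<nu> \<and>
          \<nu> ` {1..} = epstein_values a b c (ext_freq lam1) (ext_freq lam2) \<and>
          (\<forall>n\<ge>1. A n = epstein_coeff a b c (ext_coeff \<delta> \<Phi>1 a1) (ext_coeff \<delta> \<Phi>2 a2)
                         (ext_freq lam1) (ext_freq lam2) (\<nu> n)) \<and>
          continues_to \<nu> A (- {1}) Z \<and>
          ((\<exists>n\<ge>1. A n \<noteq> 0) \<longrightarrow> class_A \<nu> A)) \<and>
       (\<forall>s. s \<notin> \<int> \<longrightarrow>
          of_real (2 / sqrt \<bar>d\<bar>) powr (- s) * Gamma s * Z s =
          (- 1) ^ \<delta> * of_real (2 / sqrt \<bar>d\<bar>) powr (s - 1) * Gamma (1 - s) * Z' (1 - s))"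
proof -
  note pos = qform_pos_def_coeffs[OF pos_def]
  have pos': "c > 0" "a > 0" "4 * c * a - (- b)\<^sup>2 > 0" using pos by (simp_all add: mult.commute mult.left_commute)
  note Bs = class_B_sym[OF B1] class_B_sym[OF B2]
  define D where "D = 4 * a * c - b\<^sup>2"
  have D: "D > 0" "\<bar>d\<bar> = D" using pos(3) by (auto simp: D_def discr)
  \<comment> \<open>The scale \<open>4 / D\<close> is the square of the base in the functional
    equation, so it can be shared equally between the two sides.\<close>
  define r where "r = 2 / sqrt D"
  have r: "r > 0" "4 / D = r * r" using D by (simp_all add: r_def)
  define e where "e = (- 1) ^ \<delta> * complex_of_real r"
  have e: "e \<noteq> 0" using r by (simp add: e_def)
  define k where "k = 4 / D"
  have k: "k > 0" using D by (simp add: k_def)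
  obtain \<nu> where nu: "frequencies \<nu>" "\<nu> ` {1..} = epstein_values a b c (ext_freq lam1) (ext_freq lam2)"
    using epstein_values_enumeration[OF pos class_B_dirichlet_data(2)[OF B1] class_B_dirichlet_data(2)[OF B2] qform_lower_bound[OF pos(1,2)]] by blast
  obtain \<nu>' where nu': "frequencies \<nu>'" "\<nu>' ` {1..} = epstein_values c (- b) a (ext_freq mu1) (ext_freq mu2)"
    using epstein_values_enumeration[OF pos' class_B_dirichlet_data(2)[OF Bs(1)] class_B_dirichlet_data(2)[OF Bs(2)] qform_lower_bound[OF pos'(1,2)]] by blast
  define A where "A = (\<lambda>n. epstein_coeff a b c (ext_coeff \<delta> \<Phi>1 a1) (ext_coeff \<delta> \<Phi>2 a2) (ext_freq lam1) (ext_freq lam2) (\<nu> n))"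
  define B where "B = (\<lambda>n. epstein_coeff c (- b) a (ext_coeff \<delta> \<Psi>1 b1) (ext_coeff \<delta> \<Psi>2 b2) (ext_freq mu1) (ext_freq mu2) (\<nu>' n))"
  define a0 where "a0 = ext_coeff \<delta> \<Phi>1 a1 0 * ext_coeff \<delta> \<Phi>2 a2 0"
  define b0 where "b0 = e * (ext_coeff \<delta> \<Psi>1 b1 0 * ext_coeff \<delta> \<Psi>2 b2 0)"
  obtain \<sigma> \<tau> where H: "hecke_theta \<nu> (\<lambda>n. k * \<nu>' n) A (\<lambda>n. e * B n) a0 b0 \<sigma> \<tau>"
    using epstein_hecke_theta[OF B1 B2 pos nu nu'] unfolding A_def B_def a0_def b0_def e_def r_def D_def k_def by blast
  interpret H: hecke_theta \<nu> "\<lambda>n. k * \<nu>' n" A "\<lambda>n. e * B n" a0 b0 \<sigma> \<tau> by (rule H)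
  interpret W: hecke_theta "\<lambda>n. k * \<nu>' n" \<nu> "\<lambda>n. e * B n" A b0 a0 \<tau> \<sigma> by (rule H.dual)
  \<comment> \<open>Removes the scaling of the dual series, whose continuation is
    \<open>e * of_real k powr (- s)\<close> times that of the unscaled one.\<close>
  define Z' where "Z' s = W.Z s * of_real k powr s / e" for s
  have contZ: "epstein_continuation a b c (ext_coeff \<delta> \<Phi>1 a1) (ext_coeff \<delta> \<Phi>2 a2) (ext_freq lam1) (ext_freq lam2)
      (max (abs_abscissa lam1 a1) (abs_abscissa lam2 a2)) H.Z"
    unfolding epstein_continuation_def
  proof (intro conjI allI impI)
    show "H.Z meromorphic_on UNIV" "H.Z holomorphic_on - {1}" by (rule H.Z_meromorphic H.Z_holomorphic)+
    fix s assume s: "max (abs_abscissa lam1 a1) (abs_abscissa lam2 a2) < ereal (Re s)"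
    note E = epstein_abscissa[OF B1 B2 pos nu s]
    show "(\<lambda>p. norm (epstein_term a b c (ext_coeff \<delta> \<Phi>1 a1) (ext_coeff \<delta> \<Phi>2 a2) (ext_freq lam1) (ext_freq lam2) s p)) summable_on UNIV - {(0, 0)}"
      by (rule E(3))
    obtain q where q: "q < Re s" "summable (\<lambda>n. norm (A (Suc n)) * \<nu> (Suc n) powr (- q))"
      using E(1) unfolding A_def by blast
    have "abs_abscissa \<nu> A < ereal (Re s)" using abs_abscissa_le[OF q(2)] q(1) by (auto intro: le_less_trans)
    then show "H.Z s = epstein_zeta a b c (ext_coeff \<delta> \<Phi>1 a1) (ext_coeff \<delta> \<Phi>2 a2) (ext_freq lam1) (ext_freq lam2) s"
      using H.Z_eq E(2)[folded A_def] by simp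
  qed
  have contZ': "epstein_continuation c (- b) a (ext_coeff \<delta> \<Psi>1 b1) (ext_coeff \<delta> \<Psi>2 b2) (ext_freq mu1) (ext_freq mu2)
      (max (abs_abscissa mu1 b1) (abs_abscissa mu2 b2)) Z'"
    unfolding epstein_continuation_def
  proof (intro conjI allI impI)
    have h: "(\<lambda>s. of_real k powr s) holomorphic_on X" for X using k by (intro holomorphic_intros) auto
    have "(\<lambda>s. of_real k powr s) meromorphic_on UNIV"
      using h[of UNIV] by (intro analytic_on_imp_meromorphic_on) (simp add: analytic_on_open)
    then show "Z' meromorphic_on UNIV"
      unfolding Z'_def[abs_def] by (intro meromorphic_intros W.Z_meromorphic)
    show "Z' holomorphic_on - {1}"
      unfolding Z'_def[abs_def] by (intro holomorphic_intros W.Z_holomorphic h) (use e in auto)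
    fix s assume s: "max (abs_abscissa mu1 b1) (abs_abscissa mu2 b2) < ereal (Re s)"
    note E = epstein_abscissa[OF Bs pos' nu' s]
    show "(\<lambda>p. norm (epstein_term c (- b) a (ext_coeff \<delta> \<Psi>1 b1) (ext_coeff \<delta> \<Psi>2 b2) (ext_freq mu1) (ext_freq mu2) s p)) summable_on UNIV - {(0, 0)}"
      by (rule E(3))
    obtain q where q: "q < Re s" "summable (\<lambda>n. norm (B (Suc n)) * \<nu>' (Suc n) powr (- q))"
      using E(1) unfolding B_def by blast
    have "abs_abscissa (\<lambda>n. k * \<nu>' n) (\<lambda>n. e * B n) < ereal (Re s)"
      using abs_abscissa_le[OF summable_dirichlet_scale[OF nu'(1) k q(2), of e]] q(1) by (auto intro: le_less_trans)
    then have "W.Z s = e * of_real k powr (- s) * dirichlet_series \<nu>' B s"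
      using W.Z_eq dirichlet_series_scale[OF nu'(1) k q(2), of s e] q(1) by simp
    moreover have "complex_of_real k powr (- s) * of_real k powr s = 1"
      using k by (simp only: powr_add[symmetric]) simp
    ultimately have "Z' s = dirichlet_series \<nu>' B s" using e by (simp add: Z'_def)
    then show "Z' s = epstein_zeta c (- b) a (ext_coeff \<delta> \<Psi>1 b1) (ext_coeff \<delta> \<Psi>2 b2) (ext_freq mu1) (ext_freq mu2) s"
      using E(2)[folded B_def] by simp
  qed
  have even: "residue H.Z 1 = 2 * of_real pi * residue \<Phi>1 1 * residue \<Phi>2 1 / of_real (sqrt \<bar>d\<bar>) \<and>
      (residue \<Phi>1 1 * residue \<Phi>2 1 \<noteq> 0 \<longrightarrow> is_pole H.Z 1 \<and> zorder H.Z 1 = - 1) \<and>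
      ((\<exists>G. continues_to lam1 a1 UNIV G) \<or> (\<exists>G. continues_to lam2 a2 UNIV G) \<longrightarrow> H.Z holomorphic_on UNIV)" if "\<delta> = 0"
  proof -
    note B1' = B1[unfolded that] and B2' = B2[unfolded that]
    have sp: "complex_of_real (sqrt pi) \<noteq> 0" "complex_of_real (sqrt pi) * of_real (sqrt pi) = of_real pi"
      by (simp_all flip: of_real_mult)
    \<comment> \<open>Each dual constant contributes \<open>sqrt pi\<close> times a residue; the
      product, multiplied by \<open>2 / sqrt \<bar>d\<bar>\<close> from \<open>e\<close>, is the
      asserted residue.\<close>
    have "ext_coeff \<delta> \<Psi>1 b1 0 = of_real (sqrt pi) * residue \<Phi>1 1" "ext_coeff \<delta> \<Psi>2 b2 0 = of_real (sqrt pi) * residue \<Phi>2 1"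
      using class_B_residue[OF B1'] class_B_residue[OF B2'] sp(1) that by simp_all
    then have "b0 = of_real r * (of_real (sqrt pi) * of_real (sqrt pi)) * (residue \<Phi>1 1 * residue \<Phi>2 1)"
      using that by (simp add: b0_def e_def)
    then have b0: "b0 = 2 * of_real pi * residue \<Phi>1 1 * residue \<Phi>2 1 / of_real (sqrt \<bar>d\<bar>)"
      unfolding sp(2) D(2) r_def by simp
    have "residue \<Phi>1 1 * residue \<Phi>2 1 \<noteq> 0 \<Longrightarrow> b0 \<noteq> 0" using D by (auto simp: b0)
    moreover have "b0 = 0" if "(\<exists>G. continues_to lam1 a1 UNIV G) \<or> (\<exists>G. continues_to lam2 a2 UNIV G)"
      using that class_B_residue_0[OF B1'] class_B_residue_0[OF B2'] unfolding b0 by auto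
    ultimately show ?thesis using H.Z_residue H.Z_pole H.Z_entire b0 by metis
  qed
  have odd: "H.Z holomorphic_on UNIV" if "\<delta> = 1"
  proof (rule H.Z_entire)
    show "b0 = 0" using class_B_odd_zero[OF Bs(1)[unfolded that]] that by (simp add: b0_def)
  qed
  have grouped: "\<exists>\<nu> A. frequencies \<nu> \<and>
          \<nu> ` {1..} = epstein_values a b c (ext_freq lam1) (ext_freq lam2) \<and>
          (\<forall>n\<ge>1. A n = epstein_coeff a b c (ext_coeff \<delta> \<Phi>1 a1) (ext_coeff \<delta> \<Phi>2 a2)
                         (ext_freq lam1) (ext_freq lam2) (\<nu> n)) \<and>
          continues_to \<nu> A (- {1}) H.Z \<and>
          ((\<exists>n\<ge>1. A n \<noteq> 0) \<longrightarrow> class_A \<nu> A)"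
  proof (intro exI conjI impI)
    show "continues_to \<nu> A (- {1}) H.Z" using H.Z_continues by (simp add: continues_except_simple_pole_def)
    assume "\<exists>n\<ge>1. A n \<noteq> 0"
    then obtain n where "A (Suc n) \<noteq> 0" by (auto dest!: Suc_le_D)
    then show "class_A \<nu> A" by (rule H.class_A)
  qed (use nu in \<open>auto simp: A_def\<close>)
  have fe: "of_real (2 / sqrt \<bar>d\<bar>) powr (- s) * Gamma s * H.Z s =
          (- 1) ^ \<delta> * of_real (2 / sqrt \<bar>d\<bar>) powr (s - 1) * Gamma (1 - s) * Z' (1 - s)" if "s \<notin> \<int>" for s
  proof -
    have r2: "2 / sqrt \<bar>d\<bar> = r" by (simp add: D(2) r_def)
    let ?R = "complex_of_real r"
    \<comment> \<open>One of the two equal powers cancels against \<open>?R powr (s - 1)\<close>;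
      the other loses one factor \<open>?R\<close> to \<open>e\<close> and becomes
      \<open>?R powr (- s)\<close>.\<close>
    have k1: "of_real k powr (1 - s) = ?R powr (1 - s) * ?R powr (1 - s)"
      using r by (simp add: k_def powr_times_real)
    have inv: "?R powr (s - 1) * ?R powr (1 - s) = 1"
      using r by (simp only: powr_add[symmetric]) simp
    have rr: "?R powr (1 - s) = ?R * ?R powr (- s)"
      using powr_add[of ?R 1 "- s"] r by simp
    have ee: "(- 1) ^ \<delta> * ?R = e" by (simp add: e_def)
    have "(- 1) ^ \<delta> * ?R powr (s - 1) * Gamma (1 - s) * Z' (1 - s)
        = (- 1) ^ \<delta> * (?R powr (s - 1) * ?R powr (1 - s)) * ?R powr (1 - s) * (Gamma (1 - s) * W.Z (1 - s)) / e"
      unfolding Z'_def k1 by simp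
    also have "\<dots> = ((- 1) ^ \<delta> * ?R) * (?R powr (- s) * (Gamma s * H.Z s)) / e"
      by (simp only: inv, simp only: rr H.functional_equation[OF that], simp)
    also have "\<dots> = ?R powr (- s) * Gamma s * H.Z s" unfolding ee using e by simp
    finally show ?thesis unfolding r2 by simp
  qed
  show ?thesis
    by (rule exI[of _ H.Z], rule exI[of _ Z'], intro conjI)
      (rule contZ contZ' grouped | (rule impI, erule even odd) | (intro allI impI, erule fe))+
qed

end
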